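(* Let $\Sigma$ be a compact hyperbolic surface with non-empty (geodesic) boundary and let $X$ be a hyperbolic structure on $S=\Sigma\setminus\partial\Sigma$. There is no geodesic current $L_X\in\mathcal C(\Sigma)$ on $\Sigma$ which satisfies $i(L_X,\gamma)=\ell_X(\gamma)$ for every essential closed curve $\gamma\in\mathfrak C(\Sigma)$.
   Context: A hyperbolic structure $X$ on $S$ is a complete, finite area Riemannian metric of constant curvature $-1$ (so the ends of $S$ are cusps of $X$). A closed curve is essential if it is neither null-homotopic nor peripheral (freely homotopic into the boundary, respectively into a cusp). $\mathfrak C(\Sigma)$ is the set of free homotopy classes of essential closed curves in $\Sigma$; the inclusion $S=\Sigma\setminus\partial\Sigma\subset\Sigma$ identifies it with the set $\mathfrak C(S)$ of free homotopy classes of essential closed curves in $S$. For $\gamma\in\mathfrak C(S)=\mathfrak C(\Sigma)$, $\ell_X(\gamma)$ is the length of the unique closed $X$-geodesic freely homotopic to $\gamma$. A geodesic current on $\Sigma$ is a $\pi_1(\Sigma)$-invariant Radon measure on the set of bi-infinite geodesics of the universal cover $\tilde\Sigma$ of $\Sigma$; the space $\mathcal C(\Sigma)$ of geodesic currents carries the weak-$*$ topology. A closed geodesic of $\Sigma$ is regarded as a current via the counting measure on the set of its lifts (with multiplicity for powers). The intersection form $i:\mathcal C(\Sigma)\times\mathcal C(\Sigma)\to\mathbb R_+$ is the continuous bilinear map extending the geometric intersection number of closed curves; explicitly $i(\mu,\nu)$ is the total mass of the measure induced by $\mu\times\nu$ on the quotient by $\pi_1(\Sigma)$ of the set of pairs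 of bi-infinite geodesics of $\tilde\Sigma$ that intersect transversely. *)

theory Defs
  imports "HOL-Analysis.Analysis"
begin

section \<open>The hyperbolic plane\<close>

definition uhp :: "complex set" where
  "uhp = {z. Im z > 0}"

definition hdist :: "complex \<Rightarrow> complex \<Rightarrow> real" where
  "hdist z w = arcosh (1 + (cmod (z - w))\<^sup>2 / (2 * Im z * Im w))"

definition hyp_area :: "complex set \<Rightarrow> ennreal" where
  "hyp_area A = emeasure (density lborel (\<lambda>z. ennreal (1 / (Im z)\<^sup>2))) A"

text \<open>A point lies on the geodesic segment between two others iff the triangle inequality is
  an equality.\<close>

definition hyp_convex :: "complex set \<Rightarrow> bool" where
  "hyp_convex C \<longleftrightarrow> C \<subseteq> uhp \<and>
     (\<forall>u\<in>C. \<forall>v\<in>C. \<forall>z\<in>uhp. hdist u z + hdist z v = hdist u v \<longrightarrow> z \<in> C)"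


section \<open>Hyperbolic surfaces\<close>

text \<open>A Riemannian metric on a surface is encoded by its distance function. Being the distance of a
  metric of constant curvature -1 then means: distances are infima of lengths of paths, and small
  discs are isometric to discs of the hyperbolic plane or, at points of a geodesic boundary, to
  half-discs. A length metric in the sense below is finite-valued, so the space is path connected.\<close>

definition curve_length :: "('a \<Rightarrow> 'a \<Rightarrow> real) \<Rightarrow> (real \<Rightarrow> 'a) \<Rightarrow> ennreal" where
  "curve_length d c =
     (SUP ts\<in>{ts. sorted ts \<and> set ts \<subseteq> {0..1}}.
        \<Sum>i<length ts - 1. ennreal (d (c (ts ! i)) (c (ts ! Suc i))))"

definition length_metric :: "'a::topological_space set \<Rightarrow> ('a \<Rightarrow> 'a \<Rightarrow> real) \<Rightarrow> bool" where
  "length_metric M d \<longleftrightarrow>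
     (\<forall>x\<in>M. \<forall>y\<in>M. ennreal (d x y) =
        (INF c\<in>{c. path c \<and> path_image c \<subseteq> M \<and> pathstart c = x \<and> pathfinish c = y}.
           curve_length d c))"

definition isometric_onto ::
  "('a \<Rightarrow> 'a \<Rightarrow> real) \<Rightarrow> 'a set \<Rightarrow> (complex \<Rightarrow> complex \<Rightarrow> real) \<Rightarrow> complex set \<Rightarrow> ('a \<Rightarrow> complex) \<Rightarrow> bool"
  where
  "isometric_onto d U d' V \<phi> \<longleftrightarrow> bij_betw \<phi> U V \<and> (\<forall>y\<in>U. \<forall>z\<in>U. d' (\<phi> y) (\<phi> z) = d y z)"

text \<open>As the hyperbolic plane is homogeneous and isotropic, all charts can be centred at
  \<open>\<i>\<close>, and the half-plane modelling the boundary can be taken to be \<open>Re z \<ge> 0\<close>.\<close>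

definition disc_chart ::
  "'a set \<Rightarrow> ('a \<Rightarrow> 'a \<Rightarrow> real) \<Rightarrow> 'a \<Rightarrow> real \<Rightarrow> ('a \<Rightarrow> complex) \<Rightarrow> bool" where
  "disc_chart M d x r \<phi> \<longleftrightarrow> r > 0 \<and> \<phi> x = \<i> \<and>
     isometric_onto d {y\<in>M. d x y < r} hdist {z\<in>uhp. hdist \<i> z < r} \<phi>"

definition half_disc_chart ::
  "'a set \<Rightarrow> ('a \<Rightarrow> 'a \<Rightarrow> real) \<Rightarrow> 'a \<Rightarrow> real \<Rightarrow> ('a \<Rightarrow> complex) \<Rightarrow> bool" where
  "half_disc_chart M d x r \<phi> \<longleftrightarrow> r > 0 \<and> \<phi> x = \<i> \<and>
     isometric_onto d {y\<in>M. d x y < r} hdist {z\<in>uhp. hdist \<i> z < r \<and> 0 \<le> Re z} \<phi>"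

definition hyperbolic_surface :: "'a::metric_space set \<Rightarrow> bool" where
  "hyperbolic_surface M \<longleftrightarrow> M \<noteq> {} \<and> length_metric M dist \<and>
     (\<forall>x\<in>M. (\<exists>r \<phi>. disc_chart M dist x r \<phi>) \<or> (\<exists>r \<phi>. half_disc_chart M dist x r \<phi>))"

definition surface_boundary :: "'a::metric_space set \<Rightarrow> 'a set" where
  "surface_boundary M = {x\<in>M. \<exists>r \<phi>. half_disc_chart M dist x r \<phi>}"

definition surface_interior :: "'a::metric_space set \<Rightarrow> 'a set" where
  "surface_interior M = M - surface_boundary M"

definition area_measure ::
  "'a::topological_space set \<Rightarrow> ('a \<Rightarrow> 'a \<Rightarrow> real) \<Rightarrow> 'a measure \<Rightarrow> bool" where
  "area_measure S d \<alpha> \<longleftrightarrow> sets \<alpha> = sets (restrict_space borel S) \<and>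
     (\<forall>x\<in>S. \<forall>r \<phi>. disc_chart S d x r \<phi> \<longrightarrow>
        (\<forall>A\<in>sets \<alpha>. A \<subseteq> {y\<in>S. d x y < r} \<longrightarrow> emeasure \<alpha> A = hyp_area (\<phi> ` A)))"

text \<open>The area measure exists and is unique, since countably many discs cover the surface.\<close>

definition hyperbolic_structure :: "'a::topological_space set \<Rightarrow> ('a \<Rightarrow> 'a \<Rightarrow> real) \<Rightarrow> bool" where
  "hyperbolic_structure S d \<longleftrightarrow>
     Metric_space S d \<and>
     Metric_space.mtopology S d = top_of_set S \<and>
     Metric_space.mcomplete S d \<and>
     length_metric S d \<and>
     (\<forall>x\<in>S. \<exists>r \<phi>. disc_chart S d x r \<phi>) \<and>
     (\<exists>\<alpha>. area_measure S d \<alpha> \<and> emeasure \<alpha> S < \<infinity>)"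


section \<open>Closed curves and closed geodesics\<close>

text \<open>Closed curves are loops parametrised by \<open>[0,1]\<close>; free homotopy is \<open>homotopic_loops\<close>.\<close>

definition essential_loop :: "'a::metric_space set \<Rightarrow> (real \<Rightarrow> 'a) \<Rightarrow> bool" where
  "essential_loop M \<gamma> \<longleftrightarrow>
     path \<gamma> \<and> path_image \<gamma> \<subseteq> M \<and> pathfinish \<gamma> = pathstart \<gamma> \<and>
     \<not> (\<exists>a. homotopic_loops M \<gamma> (\<lambda>_. a)) \<and>
     \<not> (\<exists>\<delta>. path_image \<delta> \<subseteq> surface_boundary M \<and> homotopic_loops M \<gamma> \<delta>)"

text \<open>A closed geodesic is a periodic unit speed geodesic \<open>c\<close> together with a period \<open>l\<close>, which is
  its length and need not be the minimal period.\<close>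

definition closed_geodesic ::
  "'a set \<Rightarrow> ('a \<Rightarrow> 'a \<Rightarrow> real) \<Rightarrow> (real \<Rightarrow> 'a) \<Rightarrow> real \<Rightarrow> bool" where
  "closed_geodesic S d c l \<longleftrightarrow> l > 0 \<and> (\<forall>t. c t \<in> S \<and> c (t + l) = c t) \<and>
     (\<forall>t. \<exists>e>0. \<forall>s\<in>{t-e<..<t+e}. \<forall>s'\<in>{t-e<..<t+e}. d (c s) (c s') = \<bar>s - s'\<bar>)"

definition closed_geodesic_in_class ::
  "'a::topological_space set \<Rightarrow> 'a set \<Rightarrow> ('a \<Rightarrow> 'a \<Rightarrow> real) \<Rightarrow> (real \<Rightarrow> 'a) \<Rightarrow> (real \<Rightarrow> 'a) \<Rightarrow> real \<Rightarrow> bool"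
  where
  "closed_geodesic_in_class M S d \<gamma> c l \<longleftrightarrow>
     closed_geodesic S d c l \<and> homotopic_loops M (\<lambda>t. c (l * t)) \<gamma>"

text \<open>Below, \<open>d\<close> is a hyperbolic structure on the interior of the compact surface \<open>M\<close>. The homotopy
  to \<open>\<gamma>\<close> is taken in \<open>M\<close>: this is the identification of free homotopy classes in the interior with
  those in \<open>M\<close>. The choice operator is immaterial, the closed geodesic in an essential class being
  unique up to reparametrisation.\<close>

definition geodesic_length :: "'a::metric_space set \<Rightarrow> ('a \<Rightarrow> 'a \<Rightarrow> real) \<Rightarrow> (real \<Rightarrow> 'a) \<Rightarrow> real" where
  "geodesic_length M d \<gamma> =
     (SOME l. \<exists>c. closed_geodesic_in_class M (surface_interior M) d \<gamma> c l)"


section \<open>The universal cover and its space of geodesics\<close>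

text \<open>The universal cover of a complete hyperbolic surface with geodesic boundary is, up to isometry,
  a closed convex subset of the hyperbolic plane; it is always taken in this form.\<close>

definition universal_cover :: "complex set \<Rightarrow> (complex \<Rightarrow> 'a) \<Rightarrow> 'a::metric_space set \<Rightarrow> bool" where
  "universal_cover C p M \<longleftrightarrow>
     closedin (top_of_set uhp) C \<and> hyp_convex C \<and> simply_connected C \<and> covering_space C p M \<and>
     (\<forall>z\<in>C. \<exists>r>0. \<forall>u\<in>C. \<forall>v\<in>C. hdist z u < r \<longrightarrow> hdist z v < r \<longrightarrow> dist (p u) (p v) = hdist u v)"

text \<open>The fundamental group, acting on the universal cover as the group of deck transformations.
  Values of a deck transformation outside \<open>C\<close> are irrelevant.\<close>

definition deck_transformations :: "complex set \<Rightarrow> (complex \<Rightarrow> 'a) \<Rightarrow> (complex \<Rightarrow> complex) set" where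
  "deck_transformations C p =
     {\<tau>. (\<exists>\<tau>'. homeomorphism C C \<tau> \<tau>') \<and> (\<forall>z\<in>C. p (\<tau> z) = p z)}"

definition unit_geodesics :: "complex set \<Rightarrow> (real \<Rightarrow> complex) set" where
  "unit_geodesics C = {k. (\<forall>t. k t \<in> C) \<and> (\<forall>s t. hdist (k s) (k t) = \<bar>s - t\<bar>)}"

definition geodesics :: "complex set \<Rightarrow> complex set set" where
  "geodesics C = range ` unit_geodesics C"

text \<open>The quotient topology from unit speed parametrisations. The latter carry the topology of
  pointwise convergence, which for isometric maps is that of locally uniform convergence.\<close>

definition geodesic_topology :: "complex set \<Rightarrow> complex set topology" where
  "geodesic_topology C = topology (\<lambda>U. U \<subseteq> geodesics C \<and>
     openin (top_of_set (unit_geodesics C)) {k \<in> unit_geodesics C. range k \<in> U})"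

lemma openin_geodesic_topology:
  "openin (geodesic_topology C) U \<longleftrightarrow> U \<subseteq> geodesics C \<and>
     openin (top_of_set (unit_geodesics C)) {k \<in> unit_geodesics C. range k \<in> U}"
proof -
  let ?P = "\<lambda>U. U \<subseteq> geodesics C \<and>
     openin (top_of_set (unit_geodesics C)) {k \<in> unit_geodesics C. range k \<in> U}"
  have "istopology ?P"
    unfolding istopology_def
  proof (intro conjI allI impI)
    fix S T assume S: "?P S" and T: "?P T"
    then show "S \<inter> T \<subseteq> geodesics C" by blast
    have "{k \<in> unit_geodesics C. range k \<in> S \<inter> T} =
      {k \<in> unit_geodesics C. range k \<in> S} \<inter> {k \<in> unit_geodesics C. range k \<in> T}" by blast
    then show "openin (top_of_set (unit_geodesics C)) {k \<in> unit_geodesics C. range k \<in> S \<inter> T}"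
      using S T by (auto intro!: openin_Int)
  next
    fix \<K> assume K: "\<forall>K\<in>\<K>. ?P K"
    then show "\<Union>\<K> \<subseteq> geodesics C" by blast
    have "{k \<in> unit_geodesics C. range k \<in> \<Union>\<K>} =
      (\<Union>K\<in>\<K>. {k \<in> unit_geodesics C. range k \<in> K})" by blast
    then show "openin (top_of_set (unit_geodesics C)) {k \<in> unit_geodesics C. range k \<in> \<Union>\<K>}"
      using K by (auto intro!: openin_Union)
  qed
  then show ?thesis
    unfolding geodesic_topology_def by (subst topology_inverse') (assumption, rule refl)
qed

definition geodesic_borel :: "complex set \<Rightarrow> complex set measure" where
  "geodesic_borel C = sigma (geodesics C) {U. openin (geodesic_topology C) U}"


section \<open>Geodesic currents and the intersection form\<close>

text \<open>Inner regularity of a Radon measure is automatic here, the space of geodesics being locally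
  compact and second countable.\<close>

definition geodesic_current :: "complex set \<Rightarrow> (complex \<Rightarrow> 'a) \<Rightarrow> complex set measure \<Rightarrow> bool" where
  "geodesic_current C p \<mu> \<longleftrightarrow>
     sets \<mu> = sets (geodesic_borel C) \<and>
     (\<forall>K. compactin (geodesic_topology C) K \<longrightarrow> emeasure \<mu> K < \<infinity>) \<and>
     (\<forall>\<tau>\<in>deck_transformations C p. \<forall>A\<in>sets \<mu>. emeasure \<mu> ((`) \<tau> ` A) = emeasure \<mu> A)"

definition lifts :: "complex set \<Rightarrow> (complex \<Rightarrow> 'a) \<Rightarrow> (real \<Rightarrow> 'a) \<Rightarrow> complex set set" where
  "lifts C p c = {range k | k. k \<in> unit_geodesics C \<and> (\<forall>t. p (k t) = c t)}"

text \<open>If the period \<open>l\<close> is \<open>m\<close> times the minimal period of \<open>c\<close>, the closed geodesic is an \<open>m\<close>-th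
  power, and \<open>m\<close> is the number of periods of \<open>c\<close> in \<open>(0,l]\<close>.\<close>

definition multiplicity_of :: "(real \<Rightarrow> 'a) \<Rightarrow> real \<Rightarrow> nat" where
  "multiplicity_of c l = card {s. 0 < s \<and> s \<le> l \<and> (\<forall>t. c (t + s) = c t)}"

definition closed_geodesic_current ::
  "complex set \<Rightarrow> (complex \<Rightarrow> 'a) \<Rightarrow> (real \<Rightarrow> 'a) \<Rightarrow> real \<Rightarrow> complex set measure" where
  "closed_geodesic_current C p c l =
     scale_measure (of_nat (multiplicity_of c l))
       (distr (count_space (lifts C p c)) (geodesic_borel C) (\<lambda>g. g))"

text \<open>As for \<open>geodesic_length\<close>, the choice is immaterial for an essential \<open>\<gamma>\<close>: the closed geodesic in
  its class is unique up to reparametrisation, which does not affect the current.\<close>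

definition curve_current ::
  "complex set \<Rightarrow> (complex \<Rightarrow> 'a) \<Rightarrow> 'a::metric_space set \<Rightarrow> (real \<Rightarrow> 'a) \<Rightarrow> complex set measure" where
  "curve_current C p M \<gamma> =
     (SOME \<nu>. \<exists>c l. closed_geodesic_in_class M M dist \<gamma> c l \<and> \<nu> = closed_geodesic_current C p c l)"

text \<open>Distinct geodesics of the hyperbolic plane that meet do so transversely.\<close>

definition transverse_pairs :: "complex set \<Rightarrow> (complex set \<times> complex set) set" where
  "transverse_pairs C = {(g, h). g \<in> geodesics C \<and> h \<in> geodesics C \<and> g \<noteq> h \<and> g \<inter> h \<noteq> {}}"

definition orbit_injective ::
  "complex set \<Rightarrow> (complex \<Rightarrow> 'a) \<Rightarrow> (complex set \<times> complex set) set \<Rightarrow> bool" where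
  "orbit_injective C p B \<longleftrightarrow>
     (\<forall>x\<in>B. \<forall>y\<in>B. \<forall>\<tau>\<in>deck_transformations C p. y = (\<tau> ` fst x, \<tau> ` snd x) \<longrightarrow> y = x)"

text \<open>The fundamental group acts freely and properly discontinuously on transverse pairs. The measure
  induced on the quotient is the one for which the image of a Borel set \<open>B\<close> on which the projection
  is injective has mass \<open>(\<mu> \<times> \<nu>)(B)\<close>. Its total mass is the supremum of these masses, and is
  attained at any Borel fundamental domain.\<close>

definition intersection_form ::
  "complex set \<Rightarrow> (complex \<Rightarrow> 'a) \<Rightarrow> complex set measure \<Rightarrow> complex set measure \<Rightarrow> ennreal" where
  "intersection_form C p \<mu> \<nu> =
     (SUP B\<in>{B \<in> sets (\<mu> \<Otimes>\<^sub>M \<nu>). B \<subseteq> transverse_pairs C \<and> orbit_injective C p B}.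
        emeasure (\<mu> \<Otimes>\<^sub>M \<nu>) B)"

end

theory Submission
  imports Defs
begin

text \<open>Let \<open>z\<close> and \<open>w\<close> be the end points of a shortest arc between two boundary lines of the universal
  cover, and let \<open>\<gamma>\<^sub>n\<close> be represented by the product of the \<open>n\<close>-th power of a translation along the
  line through \<open>z\<close> with a translation along the line through \<open>w\<close>. Up to homotopy, one period of
  \<open>\<gamma>\<^sub>n\<close> runs along the arc, along the boundary, back along the arc, and along the boundary. As
  geodesics of the cover do not cross boundary lines, every geodesic that crosses a lift of \<open>\<gamma>\<^sub>n\<close>
  meets a translate of the arc, so that \<open>i(L, \<gamma>\<^sub>n)\<close> is at most twice the mass that \<open>L\<close> gives to the
  compact set of geodesics meeting the arc, for every \<open>n\<close>. On the other hand, \<open>\<ell>\<^sub>X(\<gamma>\<^sub>n)\<close> tends to infinity.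
  Indeed, a loop that is not homotopic into the boundary leaves a fixed collar of it, so by the
  Hopf--Rinow theorem all such loops of bounded \<open>X\<close>-length lie in a fixed compact subset of the interior.
  There \<open>X\<close> and the metric of the surface are uniformly equivalent, but the displacement of \<open>\<gamma>\<^sub>n\<close>
  in the universal cover tends to infinity.\<close>

section \<open>Hyperboloid coordinates\<close>

text \<open>Hyperboloid coordinates turn the geometry into linear algebra: half-planes are given by
  signs of linear functionals, and along a unit speed geodesic such a functional has the form
  \<open>A * exp t + B * exp (- t)\<close>. Zeros and signs of these functions take the place of the
  circle at infinity. The arc is taken shortest because it is then perpendicular to both lines, so
  that both translations become explicit matrices in one frame: the trace of their product shows the
  growth of the displacement, and the action on linear functionals shows that no boundary line is
  preserved. Invariance of a boundary line of the cover is the test for being peripheral, since it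
  makes sense without reference to \<open>X\<close>. The current and the length of a class are
  defined by choice. Hence a closed geodesic has to be found in the class first, by minimising
  displacement for the metric of the surface and by a shortest loop for \<open>X\<close>; both
  estimates then hold for every closed geodesic of the class.\<close>

text \<open>The points of the half-plane are the positive definite symmetric matrices with entries
  \<open>hW\<close>, \<open>hV\<close>, \<open>hU\<close> and determinant 1, and \<open>hB\<close> is the polar form of the determinant, that is, the
  hyperbolic cosine of the distance.\<close>

definition hU :: "complex \<Rightarrow> real" where "hU z = 1 / Im z"
definition hV :: "complex \<Rightarrow> real" where "hV z = Re z / Im z"
definition hW :: "complex \<Rightarrow> real" where "hW z = (cmod z)\<^sup>2 / Im z"

definition hB :: "complex \<Rightarrow> complex \<Rightarrow> real" where
  "hB z w = (hU z * hW w + hW z * hU w) / 2 - hV z * hV w"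

lemma hU_pos: "z \<in> uhp \<Longrightarrow> hU z > 0"
  by (simp add: hU_def uhp_def)

lemma hUW: "z \<in> uhp \<Longrightarrow> hU z * hW z = 1 + (hV z)\<^sup>2"
  unfolding hU_def hV_def hW_def uhp_def cmod_power2 by (simp add: field_simps power2_eq_square)

lemma hW_pos: "z \<in> uhp \<Longrightarrow> hW z > 0"
  by (metis hU_pos hUW add_pos_nonneg zero_le_power2 zero_less_mult_pos zero_less_one)

lemma hB_eq: "z \<in> uhp \<Longrightarrow> w \<in> uhp \<Longrightarrow> hB z w = 1 + (cmod (z - w))\<^sup>2 / (2 * Im z * Im w)"
  unfolding hB_def hU_def hV_def hW_def uhp_def cmod_power2
  by (simp add: field_simps power2_eq_square)

lemma hB_ge_1: "z \<in> uhp \<Longrightarrow> w \<in> uhp \<Longrightarrow> hB z w \<ge> 1"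
  by (simp add: hB_eq uhp_def)

lemma hB_commute: "hB z w = hB w z"
  by (simp add: hB_def algebra_simps)

lemma hB_self: "z \<in> uhp \<Longrightarrow> hB z z = 1"
  by (simp add: hB_eq)

lemma hdist_arcosh: "z \<in> uhp \<Longrightarrow> w \<in> uhp \<Longrightarrow> hdist z w = arcosh (hB z w)"
  by (simp add: hdist_def hB_eq)

lemma cosh_hdist: "z \<in> uhp \<Longrightarrow> w \<in> uhp \<Longrightarrow> cosh (hdist z w) = hB z w"
  by (simp add: hdist_arcosh hB_ge_1)

lemma hdist_nonneg: "z \<in> uhp \<Longrightarrow> w \<in> uhp \<Longrightarrow> hdist z w \<ge> 0"
  by (simp add: hdist_arcosh hB_ge_1 arcosh_nonneg_real)

lemma hdist_commute: "z \<in> uhp \<Longrightarrow> w \<in> uhp \<Longrightarrow> hdist z w = hdist w z"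
  by (simp add: hdist_arcosh hB_commute)

lemma hdist_self [simp]: "z \<in> uhp \<Longrightarrow> hdist z z = 0"
  by (simp add: hdist_arcosh hB_self)

lemma hdist_eq_0_iff: "z \<in> uhp \<Longrightarrow> w \<in> uhp \<Longrightarrow> hdist z w = 0 \<longleftrightarrow> z = w"
proof -
  assume zw: "z \<in> uhp" "w \<in> uhp"
  have "z = w" if "hdist z w = 0"
  proof -
    have "hB z w = 1" using cosh_hdist[OF zw] that by simp
    then show ?thesis using zw by (simp add: hB_eq uhp_def)
  qed
  then show ?thesis using zw by auto
qed

lemma hdist_eq_iff:
  assumes "z \<in> uhp" "w \<in> uhp" "z' \<in> uhp" "w' \<in> uhp"
  shows "hdist z w = hdist z' w' \<longleftrightarrow> hB z w = hB z' w'"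
  by (metis assms cosh_hdist hdist_arcosh)

lemma hdist_le_iff:
  assumes "z \<in> uhp" "w \<in> uhp" "d \<ge> 0"
  shows "hdist z w \<le> d \<longleftrightarrow> hB z w \<le> cosh d"
  by (metis assms cosh_hdist cosh_real_nonneg_le_iff hdist_nonneg)

lemma hdist_eqI:
  assumes "z \<in> uhp" "w \<in> uhp" "d \<ge> 0" "hB z w = cosh d"
  shows "hdist z w = d"
  using assms by (simp add: hdist_arcosh arcosh_cosh_real)

lemma uhp_eqI: "z \<in> uhp \<Longrightarrow> w \<in> uhp \<Longrightarrow> hU z = hU w \<Longrightarrow> hV z = hV w \<Longrightarrow> z = w"
  by (auto simp: hU_def hV_def uhp_def complex_eq_iff)

text \<open>The determinant condition leaves no freedom for \<open>hW\<close>, so two coordinates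
  describe a point. Maps into the half-plane are built this way, with positivity of \<open>u\<close>
  as the only thing to check.\<close>

definition hpt :: "real \<Rightarrow> real \<Rightarrow> complex" where "hpt u v = Complex (v / u) (1 / u)"

lemma hpt:
  assumes "u > 0"
  shows "hpt u v \<in> uhp" "hU (hpt u v) = u" "hV (hpt u v) = v" "hW (hpt u v) = (1 + v\<^sup>2) / u"
  using assms unfolding hpt_def hU_def hV_def hW_def uhp_def cmod_power2
  by (auto simp: field_simps power2_eq_square)

lemma hpt_coords: "z \<in> uhp \<Longrightarrow> hpt (hU z) (hV z) = z"
  by (simp add: hpt_def hU_def hV_def uhp_def complex_eq_iff)

text \<open>By the inequality of arithmetic and geometric means for \<open>U * w\<close> and
  \<open>W * u\<close>, whose sum is prescribed by orthogonality: the form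
  \<open>u * w - v^2\<close> has signature (1,2), so it is nonpositive on the complement of a
  timelike vector.\<close>

lemma lorentz_spacelike:
  fixes U V W u v w :: real
  assumes "U * W = 1 + V\<^sup>2" "U * w + W * u = 2 * V * v"
  shows "u * w \<le> v\<^sup>2"
proof -
  have "(U * w + W * u)\<^sup>2 = (U * w - W * u)\<^sup>2 + 4 * (U * W) * (u * w)"
    by (simp add: power2_eq_square algebra_simps)
  then have "4 * V\<^sup>2 * v\<^sup>2 = (U * w - W * u)\<^sup>2 + 4 * (1 + V\<^sup>2) * (u * w)"
    using assms by (simp add: power_mult_distrib)
  then have "(1 + V\<^sup>2) * (u * w) \<le> V\<^sup>2 * v\<^sup>2" 
    using zero_le_power2[of "U * w - W * u"] by linarith
  also have "\<dots> \<le> (1 + V\<^sup>2) * v\<^sup>2" by (simp add: algebra_simps)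
  finally show ?thesis
    by (simp add: add_pos_nonneg)
qed

lemma quadratic_nonpos_discriminant:
  fixes a b c :: real
  assumes "\<And>s t. a * s\<^sup>2 + 2 * b * s * t + c * t\<^sup>2 \<le> 0"
  shows "b\<^sup>2 \<le> a * c"
proof (cases "a = 0")
  case True
  have "2 * b * s + c \<le> 0" for s using assms[of s 1] True by simp
  \<comment> \<open>For \<open>b \<noteq> 0\<close> the affine function \<open>2 * b * s + c\<close>
    would equal 1 at this \<open>s\<close>.\<close>
  from this[of "(1 - c) / (2 * b)"] show ?thesis using True by (cases "b = 0") auto
next
  case False
  have "a \<le> 0" using assms[of 1 0] by simp
  then have a: "a < 0" using False by simp
  \<comment> \<open>For \<open>t = a\<close> the form is largest at \<open>s = - b\<close>.\<close>
  have "a * (a * c - b\<^sup>2) \<le> 0" using assms[of "- b" a]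
    by (simp add: power2_eq_square algebra_simps)
  then show ?thesis using a by (simp add: mult_le_0_iff)
qed

text \<open>The vectors \<open>a\<close> and \<open>c\<close>, projected orthogonally to
  \<open>b\<close>, lie in a negative definite plane; the Cauchy-Schwarz inequality in this plane is
  the claim.\<close>

lemma hB_triangle:
  assumes "a \<in> uhp" "b \<in> uhp" "c \<in> uhp"
  shows "(hB a c - hB a b * hB b c)\<^sup>2 \<le> ((hB a b)\<^sup>2 - 1) * ((hB b c)\<^sup>2 - 1)"
proof -
  define x y where xy: "x = hB a b" "y = hB b c"
  have "(1 - x\<^sup>2) * s\<^sup>2 + 2 * (hB a c - x * y) * s * t + (1 - y\<^sup>2) * t\<^sup>2 \<le> 0" for s t
  proof -
    \<comment> \<open>This coefficient of \<open>b\<close> makes the combination of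
      \<open>a\<close>, \<open>b\<close>, \<open>c\<close> orthogonal to \<open>b\<close>.\<close>
    define m where "m = - (s * x + t * y)"
    define u where "u = s * hU a + t * hU c + m * hU b"
    define v where "v = s * hV a + t * hV c + m * hV b"
    define w where "w = s * hW a + t * hW c + m * hW b"
    have "hU b * w + hW b * u - 2 * hV b * v = 2 * (s * x + t * y + m * (hU b * hW b - (hV b)\<^sup>2))"
      by (simp add: u_def v_def w_def xy hB_def power2_eq_square field_simps)
    then have o: "hU b * w + hW b * u = 2 * hV b * v" using hUW[OF assms(2)] by (simp add: m_def)
    have "u * w - v\<^sup>2 = s\<^sup>2 * (hU a * hW a - (hV a)\<^sup>2) + t\<^sup>2 * (hU c * hW c - (hV c)\<^sup>2)
       + m\<^sup>2 * (hU b * hW b - (hV b)\<^sup>2) + 2 * s * t * hB a c + 2 * s * m * x + 2 * t * m * y"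
      by (simp add: u_def v_def w_def xy hB_def power2_eq_square field_simps)
    also have "\<dots> = s\<^sup>2 + t\<^sup>2 + m\<^sup>2 + 2 * s * t * hB a c + 2 * m * (s * x + t * y)"
      using assms by (simp add: hUW algebra_simps)
    also have "\<dots> = (1 - x\<^sup>2) * s\<^sup>2 + 2 * (hB a c - x * y) * s * t + (1 - y\<^sup>2) * t\<^sup>2"
      by (simp add: m_def power2_eq_square algebra_simps)
    finally show ?thesis using lorentz_spacelike[OF hUW[OF assms(2)] o] by simp
  qed
  from quadratic_nonpos_discriminant[OF this] show ?thesis
    by (simp add: xy algebra_simps)
qed

lemma hdist_triangle:
  assumes "a \<in> uhp" "b \<in> uhp" "c \<in> uhp"
  shows "hdist a c \<le> hdist a b + hdist b c"
proof -
  define x where "x = hdist a b"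
  define y where "y = hdist b c"
  have xy: "x \<ge> 0" "y \<ge> 0" using assms hdist_nonneg by (auto simp: x_def y_def)
  have ch: "hB a b = cosh x" "hB b c = cosh y" using assms cosh_hdist by (auto simp: x_def y_def)
  have "(hB a c - cosh x * cosh y)\<^sup>2 \<le> ((cosh x)\<^sup>2 - 1) * ((cosh y)\<^sup>2 - 1)"
    using hB_triangle[OF assms] by (simp add: ch)
  also have "\<dots> = (sinh x * sinh y)\<^sup>2"
    by (simp add: cosh_square_eq power_mult_distrib)
  finally have "hB a c - cosh x * cosh y \<le> sinh x * sinh y"
    using xy by (intro power2_le_imp_le[of "hB a c - cosh x * cosh y"]) auto
  then have "hB a c \<le> cosh (x + y)" by (simp add: cosh_add)
  then show ?thesis using assms xy by (simp add: hdist_le_iff x_def y_def)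
qed

text \<open>The equality case of \<open>lorentz_spacelike\<close>: the form is definite on the
  complement of a timelike vector. It turns equalities between distances into equalities between
  vectors.\<close>

lemma lorentz_null:
  fixes U V W u v w :: real
  assumes "U > 0" "U * W = 1 + V\<^sup>2" "u * w = v\<^sup>2" "U * w + W * u = 2 * V * v"
  shows "u = 0 \<and> v = 0 \<and> w = 0"
proof -
  have W: "W > 0" using assms(1,2) by (metis add_pos_nonneg zero_le_power2 zero_less_mult_pos zero_less_one)
  have "(U * w + W * u)\<^sup>2 = (U * w - W * u)\<^sup>2 + 4 * (U * W) * (u * w)"
    by (simp add: power2_eq_square algebra_simps)
  then have "4 * V\<^sup>2 * v\<^sup>2 = (U * w - W * u)\<^sup>2 + 4 * (1 + V\<^sup>2) * v\<^sup>2"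
    using assms by (simp add: power_mult_distrib)
  then have "(U * w - W * u)\<^sup>2 + 4 * v\<^sup>2 = 0" by (simp add: algebra_simps)
  then have v: "v = 0" and e: "U * w - W * u = 0"
    by (auto simp: sum_power2_eq_zero_iff add_nonneg_eq_0_iff)
  then have "2 * (U * w) = 0" "2 * (W * u) = 0" using assms(4) by auto
  then show ?thesis using v assms(1) W by auto
qed

text \<open>If the triangle inequality is an equality, the difference of the two sides is a null
  vector; it is also orthogonal to \<open>b\<close> and therefore vanishes. Geodesics thus become
  linear interpolations with weights given by \<open>sinh\<close>.\<close>

lemma hB_collinear:
  assumes "a \<in> uhp" "b \<in> uhp" "c \<in> uhp" and add: "hdist a b + hdist b c = hdist a c"
  defines "x \<equiv> hdist a b" and "y \<equiv> hdist b c"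
  shows "sinh (x + y) * hU b = sinh y * hU a + sinh x * hU c"
    and "sinh (x + y) * hV b = sinh y * hV a + sinh x * hV c"
    and "sinh (x + y) * hW b = sinh y * hW a + sinh x * hW c"
proof -
  define S where "S = sinh (x + y)"
  have ch: "hB a b = cosh x" "hB b c = cosh y" "hB a c = cosh (x + y)"
    using assms cosh_hdist by (auto simp: x_def y_def)
  let ?u = "S * hU b - sinh y * hU a - sinh x * hU c"
  let ?v = "S * hV b - sinh y * hV a - sinh x * hV c"
  let ?w = "S * hW b - sinh y * hW a - sinh x * hW c"
  have q: "?u * ?w - ?v\<^sup>2 = S\<^sup>2 * (hU b * hW b - (hV b)\<^sup>2) + (sinh y)\<^sup>2 * (hU a * hW a - (hV a)\<^sup>2)
     + (sinh x)\<^sup>2 * (hU c * hW c - (hV c)\<^sup>2)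
     - 2 * S * sinh y * hB a b - 2 * S * sinh x * hB b c + 2 * sinh x * sinh y * hB a c"
    by (simp add: hB_def field_simps power2_eq_square)
  also have "\<dots> = S\<^sup>2 + (sinh y)\<^sup>2 + (sinh x)\<^sup>2 - 2 * S * (sinh y * cosh x + sinh x * cosh y)
      + 2 * sinh x * sinh y * cosh (x + y)"
    using assms(1-3) by (simp add: hUW ch algebra_simps)
  also have "\<dots> = - (S\<^sup>2) + (sinh y)\<^sup>2 + (sinh x)\<^sup>2 + 2 * sinh x * sinh y * cosh (x + y)"
    by (simp add: S_def sinh_add power2_eq_square algebra_simps)
  also have "\<dots> = (sinh x)\<^sup>2 * (1 - (cosh y)\<^sup>2) + (sinh y)\<^sup>2 * (1 - (cosh x)\<^sup>2) + 2 * (sinh x)\<^sup>2 * (sinh y)\<^sup>2"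
    by (simp add: S_def sinh_add cosh_add power2_eq_square algebra_simps)
  also have "\<dots> = 0" by (simp add: cosh_square_eq algebra_simps)
  finally have n: "?u * ?w = ?v\<^sup>2" by simp
  have "hU b * ?w + hW b * ?u - 2 * hV b * ?v = 2 * (S * (hU b * hW b - (hV b)\<^sup>2) - sinh y * hB a b - sinh x * hB b c)"
    by (simp add: hB_def field_simps power2_eq_square)
  also have "\<dots> = 0" using assms(1-3) by (simp add: hUW ch S_def sinh_add)
  finally have o: "hU b * ?w + hW b * ?u = 2 * hV b * ?v" by simp
  have "?u = 0 \<and> ?v = 0 \<and> ?w = 0"
    using lorentz_null[OF hU_pos[OF assms(2)] hUW[OF assms(2)] n o] .
  then show "sinh (x + y) * hU b = sinh y * hU a + sinh x * hU c"
    and "sinh (x + y) * hV b = sinh y * hV a + sinh x * hV c"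
    and "sinh (x + y) * hW b = sinh y * hW a + sinh x * hW c"
    by (auto simp: S_def)
qed


section \<open>Topology of the hyperbolic plane\<close>

lemma hball_subset_ball:
  assumes "z \<in> uhp" "e > 0"
  shows "\<exists>r>0. \<forall>w\<in>uhp. hdist z w < r \<longrightarrow> dist z w < e"
proof -
  \<comment> \<open>At distance \<open>r\<close> one has
    \<open>(cmod (z - w))^2 = 2 * Im z * Im w * (cosh r - 1)\<close> and
    \<open>Im w \<le> 2 * Im z * cosh r\<close>; together they give this bound.\<close>
  define g where "g r = 4 * (Im z)\<^sup>2 * cosh r * (cosh r - 1)" for r :: real
  have y: "Im z > 0" using assms by (simp add: uhp_def)
  have "isCont g 0" unfolding g_def by (intro continuous_intros)
  moreover have "g 0 < e\<^sup>2" using assms by (simp add: g_def)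
  ultimately have "\<forall>\<^sub>F r in at 0. g r < e\<^sup>2"
    by (simp add: isCont_def order_tendsto_iff)
  then obtain r where r: "r > 0" "\<And>x. x \<noteq> 0 \<Longrightarrow> \<bar>x\<bar> < r \<Longrightarrow> g x < e\<^sup>2"
    by (auto simp: eventually_at dist_real_def)
  have "dist z w < e" if w: "w \<in> uhp" "hdist z w < r" for w
  proof (cases "z = w")
    case False
    define d where "d = hdist z w"
    have d: "d > 0" using False w assms hdist_nonneg hdist_eq_0_iff by (metis d_def order_le_less)
    have B: "hB z w = cosh d" using cosh_hdist assms w d_def by simp
    have yw: "Im w > 0" using w by (simp add: uhp_def)
    have 1: "(cmod (z - w))\<^sup>2 = 2 * Im z * Im w * (cosh d - 1)"
      using B hB_eq[OF assms(1) w(1)] y yw by (simp add: field_simps)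
    have "(Im z - Im w)\<^sup>2 \<le> (cmod (z - w))\<^sup>2" by (simp add: cmod_power2)
    then have "(Im z)\<^sup>2 + (Im w)\<^sup>2 \<le> 2 * Im z * Im w * cosh d"
      unfolding 1 by (simp add: power2_eq_square algebra_simps)
    then have "(Im w)\<^sup>2 \<le> 2 * Im z * Im w * cosh d"
      using zero_le_power2[of "Im z"] by linarith
    then have "Im w \<le> 2 * Im z * cosh d" using yw by (simp add: power2_eq_square algebra_simps)
    then have "2 * Im z * Im w * (cosh d - 1) \<le> 2 * Im z * (2 * Im z * cosh d) * (cosh d - 1)"
      using y cosh_real_ge_1[of d] by (intro mult_right_mono mult_left_mono) auto
    then have "(cmod (z - w))\<^sup>2 \<le> g d" unfolding 1 g_def by (simp add: power2_eq_square algebra_simps)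
    also have "\<dots> < e\<^sup>2" using r(2)[of d] d w by (simp add: d_def)
    finally show ?thesis using assms(2) by (simp add: dist_norm power_less_imp_less_base)
  qed (use assms in simp)
  then show ?thesis using r(1) by blast
qed

lemma continuous_on_hdist: "continuous_on (uhp \<times> uhp) (\<lambda>(z, w). hdist z w)"
proof -
  have "continuous_on (uhp \<times> uhp) (\<lambda>q. arcosh (1 + (cmod (fst q - snd q))\<^sup>2 / (2 * Im (fst q) * Im (snd q))))"
    by (rule continuous_on_compose2[OF continuous_on_arcosh[OF order.refl]])
      (auto intro!: continuous_intros simp: uhp_def)
  then show ?thesis by (simp add: hdist_def case_prod_unfold)
qed

lemma continuous_on_hdist_compose [continuous_intros]:
  assumes "continuous_on S f" "continuous_on S g" "f ` S \<subseteq> uhp" "g ` S \<subseteq> uhp"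
  shows "continuous_on S (\<lambda>x. hdist (f x) (g x))"
proof -
  have "continuous_on S (\<lambda>x. (case (f x, g x) of (z, w) \<Rightarrow> hdist z w))"
    by (rule continuous_on_compose2[OF continuous_on_hdist]) (use assms in \<open>auto intro!: continuous_intros\<close>)
  then show ?thesis by simp
qed

lemma ball_subset_hball:
  assumes "z \<in> uhp" "e > 0"
  shows "\<exists>r>0. \<forall>w\<in>uhp. dist z w < r \<longrightarrow> hdist z w < e"
proof -
  have "continuous_on uhp (\<lambda>w. hdist z w)"
    using assms by (intro continuous_intros) auto
  then obtain r where "r > 0" "\<And>w. w \<in> uhp \<Longrightarrow> dist w z < r \<Longrightarrow> dist (hdist z w) (hdist z z) < e"
    using assms by (metis continuous_on_iff)
  then have "\<forall>w\<in>uhp. dist z w < r \<longrightarrow> hdist z w < e"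
    using assms by (fastforce simp: dist_real_def dist_commute[of z])
  with \<open>r > 0\<close> show ?thesis by blast
qed

lemma continuous_on_uhp_iff:
  fixes f :: "complex \<Rightarrow> 'b::metric_space"
  assumes "S \<subseteq> uhp"
  shows "continuous_on S f \<longleftrightarrow>
    (\<forall>z\<in>S. \<forall>e>0. \<exists>r>0. \<forall>w\<in>S. hdist z w < r \<longrightarrow> dist (f z) (f w) < e)"
proof
  assume c: "continuous_on S f"
  show "\<forall>z\<in>S. \<forall>e>0. \<exists>r>0. \<forall>w\<in>S. hdist z w < r \<longrightarrow> dist (f z) (f w) < e"
  proof (intro ballI allI impI)
    fix z and e :: real assume "z \<in> S" "e > 0"
    then obtain d where d: "d > 0" "\<And>w. w \<in> S \<Longrightarrow> dist w z < d \<Longrightarrow> dist (f w) (f z) < e"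
      using c by (metis continuous_on_iff)
    obtain r where "r > 0" "\<forall>w\<in>uhp. hdist z w < r \<longrightarrow> dist z w < d"
      using hball_subset_ball d \<open>z \<in> S\<close> assms by blast
    then show "\<exists>r>0. \<forall>w\<in>S. hdist z w < r \<longrightarrow> dist (f z) (f w) < e"
      using d assms by (metis dist_commute subsetD)
  qed
next
  assume h: "\<forall>z\<in>S. \<forall>e>0. \<exists>r>0. \<forall>w\<in>S. hdist z w < r \<longrightarrow> dist (f z) (f w) < e"
  show "continuous_on S f"
    unfolding continuous_on_iff
  proof (intro ballI allI impI)
    fix z and e :: real assume "z \<in> S" "e > 0"
    then obtain r where r: "r > 0" "\<And>w. w \<in> S \<Longrightarrow> hdist z w < r \<Longrightarrow> dist (f z) (f w) < e"
      using h by metis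
    obtain d where "d > 0" "\<forall>w\<in>uhp. dist z w < d \<longrightarrow> hdist z w < r"
      using ball_subset_hball r \<open>z \<in> S\<close> assms by blast
    then show "\<exists>d>0. \<forall>w\<in>S. dist w z < d \<longrightarrow> dist (f w) (f z) < e"
      using r assms by (metis dist_commute subsetD)
  qed
qed

lemma continuous_into_uhp_iff:
  fixes f :: "'b::metric_space \<Rightarrow> complex"
  assumes "f ` S \<subseteq> uhp"
  shows "continuous_on S f \<longleftrightarrow>
    (\<forall>x\<in>S. \<forall>e>0. \<exists>r>0. \<forall>y\<in>S. dist x y < r \<longrightarrow> hdist (f x) (f y) < e)"
proof
  assume c: "continuous_on S f"
  show "\<forall>z\<in>S. \<forall>e>0. \<exists>r>0. \<forall>w\<in>S. dist z w < r \<longrightarrow> hdist (f z) (f w) < e"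
  proof (intro ballI allI impI)
    fix z and e :: real assume z: "z \<in> S" "e > 0"
    then have "f z \<in> uhp" using assms by auto
    then obtain d where d: "d > 0" "\<forall>w\<in>uhp. dist (f z) w < d \<longrightarrow> hdist (f z) w < e"
      using ball_subset_hball z by blast
    then obtain r where "r > 0" "\<And>w. w \<in> S \<Longrightarrow> dist w z < r \<Longrightarrow> dist (f w) (f z) < d"
      using c z by (metis continuous_on_iff)
    then show "\<exists>r>0. \<forall>w\<in>S. dist z w < r \<longrightarrow> hdist (f z) (f w) < e"
      using d assms by (metis dist_commute image_subset_iff)
  qed
next
  assume h: "\<forall>z\<in>S. \<forall>e>0. \<exists>r>0. \<forall>w\<in>S. dist z w < r \<longrightarrow> hdist (f z) (f w) < e"
  show "continuous_on S f"
    unfolding continuous_on_iff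
  proof (intro ballI allI impI)
    fix z and e :: real assume z: "z \<in> S" "e > 0"
    then have "f z \<in> uhp" using assms by auto
    then obtain r where r: "r > 0" "\<forall>w\<in>uhp. hdist (f z) w < r \<longrightarrow> dist (f z) w < e"
      using hball_subset_ball z by blast
    then obtain d where "d > 0" "\<And>w. w \<in> S \<Longrightarrow> dist z w < d \<Longrightarrow> hdist (f z) (f w) < r"
      using h z by metis
    then show "\<exists>d>0. \<forall>w\<in>S. dist w z < d \<longrightarrow> dist (f w) (f z) < e"
      using r assms by (metis dist_commute image_subset_iff)
  qed
qed

lemma compact_hcball:
  assumes "z \<in> uhp"
  shows "compact {w\<in>uhp. hdist z w \<le> r}"
proof (cases "r \<ge> 0")
  case r: True
  define m where "m = Im z / (2 * cosh r)"
  have m: "m > 0" using assms by (simp add: m_def uhp_def)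
  have y: "Im z > 0" using assms by (simp add: uhp_def)
  have Im_low: "Im w \<ge> m" and nrm: "(cmod (z - w))\<^sup>2 \<le> 4 * (Im z)\<^sup>2 * cosh r * cosh r" if w: "w \<in> uhp" "hdist z w \<le> r" for w
  proof -
    have B: "hB z w \<le> cosh r" using w assms r hdist_le_iff by blast
    have yw: "Im w > 0" using w by (simp add: uhp_def)
    have 1: "(cmod (z - w))\<^sup>2 \<le> 2 * Im z * Im w * (cosh r - 1)"
      using B hB_eq[OF assms(1) w(1)] y yw by (simp add: field_simps)
    have 2: "(Im z - Im w)\<^sup>2 \<le> 2 * Im z * Im w * (cosh r - 1)"
      using 1 zero_le_power2[of "Re z - Re w"] unfolding cmod_power2 minus_complex.simps by linarith
    then have 3: "(Im z)\<^sup>2 + (Im w)\<^sup>2 \<le> 2 * Im z * Im w * cosh r"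
      by (simp add: power2_eq_square algebra_simps)
    have "(Im z)\<^sup>2 \<le> 2 * Im z * Im w * cosh r"
      using 3 zero_le_power2[of "Im w"] by linarith
    then have "Im z * Im z \<le> Im z * (2 * Im w * cosh r)"
      by (simp add: power2_eq_square algebra_simps)
    then have "Im z \<le> 2 * Im w * cosh r" using y by (simp only: mult_le_cancel_left_pos)
    then show "Im w \<ge> m" by (simp add: m_def field_simps)
    have "(Im w)\<^sup>2 \<le> 2 * Im z * Im w * cosh r"
      using 3 zero_le_power2[of "Im z"] by linarith
    then have "Im w * Im w \<le> Im w * (2 * Im z * cosh r)"
      by (simp add: power2_eq_square algebra_simps)
    then have "Im w \<le> 2 * Im z * cosh r" using yw by (simp only: mult_le_cancel_left_pos)
    then have "2 * Im z * Im w * (cosh r - 1) \<le> 2 * Im z * (2 * Im z * cosh r) * cosh r"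
      using y yw cosh_real_ge_1[of r] by (intro mult_mono) auto
    then show "(cmod (z - w))\<^sup>2 \<le> 4 * (Im z)\<^sup>2 * cosh r * cosh r"
      using 1 by (simp add: power2_eq_square algebra_simps)
  qed
  \<comment> \<open>Unlike \<open>uhp\<close>, this half-plane is closed in the complex plane, so
    closedness can be checked inside it.\<close>
  let ?A = "{w. Im w \<ge> m}"
  have eq: "{w\<in>uhp. hdist z w \<le> r} = {w\<in>?A. hdist z w \<le> r}"
    using Im_low m by (auto simp: uhp_def)
  have "closed ?A" by (simp add: closed_halfspace_Im_ge)
  moreover have "continuous_on ?A (\<lambda>w. hdist z w)"
    using assms m by (intro continuous_intros) (auto simp: uhp_def)
  ultimately have "closed {w\<in>?A. hdist z w \<le> r}"
    by (intro continuous_on_closed_Collect_le) (auto intro: continuous_intros)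
  moreover have "bounded {w\<in>?A. hdist z w \<le> r}"
  proof (rule boundedI[of _ "cmod z + sqrt (4 * (Im z)\<^sup>2 * cosh r * cosh r)"])
    fix w assume "w \<in> {w\<in>?A. hdist z w \<le> r}"
    then have "w \<in> uhp" "hdist z w \<le> r" using m by (auto simp: uhp_def)
    then have "cmod (z - w) \<le> sqrt (4 * (Im z)\<^sup>2 * cosh r * cosh r)"
      using nrm by (simp add: real_le_rsqrt)
    then show "cmod w \<le> cmod z + sqrt (4 * (Im z)\<^sup>2 * cosh r * cosh r)"
      using norm_triangle_sub[of w z] by (simp add: norm_minus_commute)
  qed
  ultimately show ?thesis unfolding eq by (simp add: compact_eq_bounded_closed)
next
  case False
  then have "{w\<in>uhp. hdist z w \<le> r} = {}" using assms hdist_nonneg by fastforce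
  then show ?thesis by (simp only: compact_empty)
qed

lemma continuous_on_hcoords [continuous_intros]:
  assumes "continuous_on S f" "f ` S \<subseteq> uhp"
  shows "continuous_on S (\<lambda>x. hU (f x))" "continuous_on S (\<lambda>x. hV (f x))" "continuous_on S (\<lambda>x. hW (f x))"
  unfolding hU_def hV_def hW_def using assms
  by (auto intro!: continuous_intros simp: uhp_def image_subset_iff)

section \<open>Geodesics and isometries of the hyperbolic plane\<close>

definition iax :: "real \<Rightarrow> complex" where "iax t = Complex 0 (exp t)"

lemma iax: "iax t \<in> uhp" "hU (iax t) = exp (- t)" "hV (iax t) = 0" "hW (iax t) = exp t"
  by (auto simp: iax_def uhp_def hU_def hV_def hW_def cmod_def exp_minus field_simps power2_eq_square)

lemma iax_0: "iax 0 = \<i>"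
  by (simp add: iax_def complex_eq_iff)

lemma i_uhp [simp]: "\<i> \<in> uhp"
  by (simp add: uhp_def)

lemma hcoords_i [simp]: "hU \<i> = 1" "hV \<i> = 0" "hW \<i> = 1"
  by (simp_all add: hU_def hV_def hW_def)

lemma hB_iax: "hB z (iax t) = (hU z * exp t + hW z * exp (- t)) / 2"
  by (simp add: hB_def iax)

lemma hdist_iax: "hdist (iax s) (iax t) = \<bar>s - t\<bar>"
proof (rule hdist_eqI)
  show "hB (iax s) (iax t) = cosh \<bar>s - t\<bar>"
    by (simp add: hB_iax iax abs_if cosh_def mult_exp_exp)
qed (auto simp: iax)

lemma iax_eqI:
  assumes "z \<in> uhp" "hV z = 0"
  shows "z = iax (ln (hW z))"
proof (rule uhp_eqI)
  have "hU z * hW z = 1" using hUW[OF assms(1)] assms(2) by simp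
  then have "hU z = 1 / hW z" using hW_pos[OF assms(1)] by (simp add: field_simps)
  then show "hU z = hU (iax (ln (hW z)))"
    using hW_pos[OF assms(1)] by (simp add: iax exp_minus inverse_eq_divide)
qed (use assms in \<open>auto simp: iax\<close>)

lemma iax_unit_geodesic: "iax \<in> unit_geodesics uhp"
  by (simp add: unit_geodesics_def iax hdist_iax)

lemma unit_geodesics_uhp:
  assumes "k \<in> unit_geodesics D" "D \<subseteq> uhp"
  shows "k \<in> unit_geodesics uhp"
  using assms by (auto simp: unit_geodesics_def)

lemma geodesic_coords:
  assumes "k \<in> unit_geodesics uhp"
  shows "sinh 1 * hU (k t) = sinh (1 - t) * hU (k 0) + sinh t * hU (k 1)"
    and "sinh 1 * hV (k t) = sinh (1 - t) * hV (k 0) + sinh t * hV (k 1)"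
    and "sinh 1 * hW (k t) = sinh (1 - t) * hW (k 0) + sinh t * hW (k 1)"
proof -
  have k: "k s \<in> uhp" "hdist (k s) (k r) = \<bar>s - r\<bar>" for s r
    using assms by (auto simp: unit_geodesics_def)
  have m: "sinh (1 - t) = - sinh (t - 1)" by (metis minus_diff_eq sinh_minus)
  consider "t < 0" | "0 \<le> t" "t \<le> 1" | "t > 1" by linarith
  then have "sinh 1 * hU (k t) = sinh (1 - t) * hU (k 0) + sinh t * hU (k 1)
    \<and> sinh 1 * hV (k t) = sinh (1 - t) * hV (k 0) + sinh t * hV (k 1)
    \<and> sinh 1 * hW (k t) = sinh (1 - t) * hW (k 0) + sinh t * hW (k 1)"
  proof cases
    case 1
    then show ?thesis using hB_collinear[OF k(1) k(1) k(1), of t 0 1] by (simp add: k)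
  next
    case 2
    then show ?thesis using hB_collinear[OF k(1) k(1) k(1), of 0 t 1] by (simp add: k)
  next
    case 3
    then show ?thesis using hB_collinear[OF k(1) k(1) k(1), of 0 1 t] by (simp add: k m)
  qed
  then show "sinh 1 * hU (k t) = sinh (1 - t) * hU (k 0) + sinh t * hU (k 1)"
    and "sinh 1 * hV (k t) = sinh (1 - t) * hV (k 0) + sinh t * hV (k 1)"
    and "sinh 1 * hW (k t) = sinh (1 - t) * hW (k 0) + sinh t * hW (k 1)" by auto
qed

text \<open>Restrictions of linear functionals of Minkowski space. Lying on a line, the side of a
  line and invariance of a line are all expressed by their zeros and signs. The class is stable
  under isometries.\<close>

definition hlin :: "(complex \<Rightarrow> real) \<Rightarrow> bool" where
  "hlin f \<longleftrightarrow> (\<exists>a b c. \<forall>z\<in>uhp. f z = a * hU z + b * hV z + c * hW z)"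

lemma hlin_coords: "hlin hU" "hlin hV" "hlin hW"
  unfolding hlin_def
  by (rule exI[of _ 1], rule exI[of _ 0], rule exI[of _ 0], simp)
     (rule exI[of _ 0], rule exI[of _ 1], rule exI[of _ 0], simp,
      rule exI[of _ 0], rule exI[of _ 0], rule exI[of _ 1], simp)

lemma hlin_lincomb:
  assumes "hlin f" "hlin g"
  shows "hlin (\<lambda>z. r * f z + s * g z)"
proof -
  obtain a b c a' b' c' where
    "\<forall>z\<in>uhp. f z = a * hU z + b * hV z + c * hW z" "\<forall>z\<in>uhp. g z = a' * hU z + b' * hV z + c' * hW z"
    using assms unfolding hlin_def by blast
  then have "\<forall>z\<in>uhp. r * f z + s * g z =
      (r * a + s * a') * hU z + (r * b + s * b') * hV z + (r * c + s * c') * hW z"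
    by (simp add: algebra_simps)
  then show ?thesis unfolding hlin_def by blast
qed

lemma hlin_cong: "hlin f \<Longrightarrow> (\<And>z. z \<in> uhp \<Longrightarrow> g z = f z) \<Longrightarrow> hlin g"
  unfolding hlin_def by simp

lemma hlin_hB: "hlin (\<lambda>z. hB z w)"
  unfolding hlin_def hB_def
  by (rule exI[of _ "hW w / 2"], rule exI[of _ "- hV w"], rule exI[of _ "hU w / 2"]) (simp add: field_simps)

lemma hlin_geodesic:
  assumes "hlin f" "k \<in> unit_geodesics uhp"
  obtains A B where "\<And>t. f (k t) = A * exp t + B * exp (- t)"
proof -
  obtain a b c where f: "\<And>z. z \<in> uhp \<Longrightarrow> f z = a * hU z + b * hV z + c * hW z"
    using assms(1) unfolding hlin_def by blast
  have k: "k s \<in> uhp" for s using assms(2) by (auto simp: unit_geodesics_def)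
  have *: "sinh 1 * f (k t) = sinh (1 - t) * f (k 0) + sinh t * f (k 1)" for t
  proof -
    have "sinh 1 * f (k t) = a * (sinh 1 * hU (k t)) + b * (sinh 1 * hV (k t)) + c * (sinh 1 * hW (k t))"
      by (simp add: f k algebra_simps)
    then show ?thesis unfolding geodesic_coords[OF assms(2), of t] by (simp add: f k algebra_simps)
  qed
  have s1: "sinh (1::real) > 0" by simp
  define A where "A = (f (k 1) - exp (-1) * f (k 0)) / (2 * sinh 1)"
  define B where "B = (exp 1 * f (k 0) - f (k 1)) / (2 * sinh 1)"
  have "f (k t) = A * exp t + B * exp (- t)" for t
  proof -
    have "2 * (sinh 1 * f (k t)) = (exp (1 - t) - exp (t - 1)) * f (k 0) + (exp t - exp (- t)) * f (k 1)"
      unfolding * by (simp add: sinh_def algebra_simps)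
    moreover have "exp (1 - t) = exp 1 * exp (- t)" "exp (t - 1) = exp (-1) * exp t"
      by (simp_all add: mult_exp_exp)
    moreover have A: "2 * sinh 1 * A = f (k 1) - exp (-1) * f (k 0)"
      and B: "2 * sinh 1 * B = exp 1 * f (k 0) - f (k 1)"
      using s1 by (simp_all add: A_def B_def)
    have "2 * sinh 1 * (A * exp t + B * exp (- t)) = (2 * sinh 1 * A) * exp t + (2 * sinh 1 * B) * exp (- t)"
      by (simp add: algebra_simps)
    then have "2 * sinh 1 * (A * exp t + B * exp (- t)) =
        (f (k 1) - exp (-1) * f (k 0)) * exp t + (exp 1 * f (k 0) - f (k 1)) * exp (- t)"
      unfolding A B .
    ultimately have "2 * sinh 1 * f (k t) = 2 * sinh 1 * (A * exp t + B * exp (- t))"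
      by (simp add: algebra_simps)
    then show ?thesis using s1 by simp
  qed
  then show ?thesis using that by blast
qed

lemma hlin_geodesic_midpoint:
  assumes "hlin f" "k \<in> unit_geodesics uhp"
  shows "f (k (s + t)) + f (k (s - t)) = 2 * cosh t * f (k s)"
proof -
  obtain A B where f: "\<And>t. f (k t) = A * exp t + B * exp (- t)"
    using hlin_geodesic[OF assms] by blast
  show ?thesis unfolding f cosh_def by (simp add: exp_add exp_diff exp_minus field_simps)
qed

lemma hlin_geodesic_zero:
  assumes "hlin f" "k \<in> unit_geodesics uhp" "f (k s) = 0" "f (k r) = 0" "s \<noteq> r"
  shows "f (k t) = 0"
proof -
  obtain A B where f: "\<And>t. f (k t) = A * exp t + B * exp (- t)"
    using hlin_geodesic[OF assms(1,2)] by blast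
  have g: "f (k t) * exp t = A * exp (2 * t) + B" for t
    by (simp add: f algebra_simps mult_exp_exp flip: exp_add)
  have "A * exp (2 * s) + B = 0" "A * exp (2 * r) + B = 0"
    using g[of s] g[of r] assms by auto
  moreover have "A * (exp (2 * s) - exp (2 * r)) = (A * exp (2 * s) + B) - (A * exp (2 * r) + B)"
    by (simp add: algebra_simps)
  ultimately have "A * (exp (2 * s) - exp (2 * r)) = 0" by simp
  then have "A = 0" using assms(5) by simp
  then show ?thesis using \<open>A * exp (2 * s) + B = 0\<close> f by simp
qed

text \<open>The values at equal distances on both sides of \<open>s\<close> add up to a multiple of
  the value at \<open>s\<close>, that is, to 0; being nonnegative they vanish, and two zeros
  suffice. Touching the edge of a half-plane from inside therefore means running along the
  edge.\<close>

lemma hlin_geodesic_nonneg_zero: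
  assumes "hlin f" "k \<in> unit_geodesics uhp" "f (k s) = 0"
    and "e > 0" "\<And>r. \<bar>r - s\<bar> < e \<Longrightarrow> f (k r) \<ge> 0"
  shows "f (k t) = 0"
proof -
  have "f (k (s + e/2)) + f (k (s - e/2)) = 0"
    using hlin_geodesic_midpoint[OF assms(1,2), of s "e/2"] assms(3) by simp
  moreover have "f (k (s + e/2)) \<ge> 0" "f (k (s - e/2)) \<ge> 0" using assms(4,5) by auto
  ultimately have "f (k (s + e/2)) = 0" by linarith
  then show ?thesis using hlin_geodesic_zero[OF assms(1,2,3), of "s + e/2" t] assms(4) by simp
qed

section \<open>Isometries of the half-plane and normal forms\<close>

definition hiso :: "(complex \<Rightarrow> complex) \<Rightarrow> (complex \<Rightarrow> complex) \<Rightarrow> bool" where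
  "hiso M M' \<longleftrightarrow> (\<forall>z\<in>uhp. M z \<in> uhp \<and> M' z \<in> uhp \<and> M' (M z) = z \<and> M (M' z) = z) \<and>
     (\<forall>z\<in>uhp. \<forall>w\<in>uhp. hdist (M z) (M w) = hdist z w)"

lemma hisoD:
  assumes "hiso M M'"
  shows "z \<in> uhp \<Longrightarrow> M z \<in> uhp" "z \<in> uhp \<Longrightarrow> M' z \<in> uhp" "z \<in> uhp \<Longrightarrow> M' (M z) = z"
    "z \<in> uhp \<Longrightarrow> M (M' z) = z" "z \<in> uhp \<Longrightarrow> w \<in> uhp \<Longrightarrow> hdist (M z) (M w) = hdist z w"
    "z \<in> uhp \<Longrightarrow> w \<in> uhp \<Longrightarrow> hdist (M' z) (M' w) = hdist z w"
  using assms unfolding hiso_def by (auto, metis)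

lemma hiso_sym: "hiso M M' \<Longrightarrow> hiso M' M"
  unfolding hiso_def by metis

lemma hiso_comp:
  assumes "hiso M M'" "hiso N N'"
  shows "hiso (N \<circ> M) (M' \<circ> N')"
  using assms unfolding hiso_def by simp

lemma hiso_hB: "hiso M M' \<Longrightarrow> z \<in> uhp \<Longrightarrow> w \<in> uhp \<Longrightarrow> hB (M z) (M w) = hB z w"
  by (metis cosh_hdist hisoD(1,5))

text \<open>Isometries preserve \<open>hB\<close>, so \<open>hB (M z) w = hB z (M' w)\<close>; and
  the functionals \<open>hB z w\<close> with \<open>w\<close> equal to \<open>\<i>\<close>,
  \<open>Complex 0 2\<close> and \<open>Complex 1 1\<close> span all linear functionals.\<close>

lemma hlin_comp:
  assumes "hiso M M'" "hlin f"
  shows "hlin (\<lambda>z. f (M z))"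
proof -
  have B: "hlin (\<lambda>z. hB (M z) w)" if "w \<in> uhp" for w
  proof (rule hlin_cong[OF hlin_hB[of "M' w"]])
    fix z assume "z \<in> uhp"
    then show "hB (M z) w = hB z (M' w)"
      using hiso_hB[OF assms(1), of z "M' w"] hisoD[OF assms(1)] that by simp
  qed
  have w: "Complex 0 2 \<in> uhp" "Complex 1 1 \<in> uhp" by (auto simp: uhp_def)
  have c: "hU (Complex 0 2) = 1/2" "hV (Complex 0 2) = 0" "hW (Complex 0 2) = 2"
    "hU (Complex 1 1) = 1" "hV (Complex 1 1) = 1" "hW (Complex 1 1) = 2"
    by (auto simp: hU_def hV_def hW_def cmod_def)
  have U: "hlin (\<lambda>z. hU (M z))"
    by (rule hlin_cong[OF hlin_lincomb[OF B[OF w(1)] B[OF i_uhp], of "4/3" "-2/3"]])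
       (simp add: hB_def c field_simps)
  have W: "hlin (\<lambda>z. hW (M z))"
    by (rule hlin_cong[OF hlin_lincomb[OF B[OF i_uhp] U, of 2 "-1"]]) (simp add: hB_def field_simps)
  have V: "hlin (\<lambda>z. hV (M z))"
    by (rule hlin_cong[OF hlin_lincomb[OF hlin_lincomb[OF U W, of 1 "1/2"] B[OF w(2)], of 1 "-1"]])
       (simp add: hB_def c field_simps)
  obtain a b c where f: "\<And>z. z \<in> uhp \<Longrightarrow> f z = a * hU z + b * hV z + c * hW z"
    using assms(2) unfolding hlin_def by blast
  show ?thesis
    by (rule hlin_cong[OF hlin_lincomb[OF hlin_lincomb[OF U V, of a b] W, of 1 c]])
       (simp add: f hisoD[OF assms(1)])
qed

lemma unit_geodesics_hiso:
  assumes "hiso M M'" "k \<in> unit_geodesics uhp"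
  shows "(\<lambda>t. M (k t)) \<in> unit_geodesics uhp"
  using assms by (auto simp: unit_geodesics_def hisoD)

lemma continuous_on_hiso:
  assumes "hiso M M'"
  shows "continuous_on uhp M"
  using assms by (auto simp: continuous_into_uhp_iff image_subset_iff hisoD)
    (metis ball_subset_hball)

text \<open>The fractional linear action of SL(2,R), written as the congruence of a symmetric matrix
  with entries \<open>hW\<close>, \<open>hV\<close>, \<open>hU\<close> by the matrix with rows
  \<open>a b\<close> and \<open>c d\<close>. In this form the action is polynomial.\<close>

definition mob :: "real \<Rightarrow> real \<Rightarrow> real \<Rightarrow> real \<Rightarrow> complex \<Rightarrow> complex" where
  "mob a b c d z = hpt (c\<^sup>2 * hW z + 2 * c * d * hV z + d\<^sup>2 * hU z)
     (a * c * hW z + (a * d + b * c) * hV z + b * d * hU z)"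

lemma mob:
  assumes "z \<in> uhp" "a * d - b * c = 1"
  shows "mob a b c d z \<in> uhp"
    "hU (mob a b c d z) = c\<^sup>2 * hW z + 2 * c * d * hV z + d\<^sup>2 * hU z"
    "hV (mob a b c d z) = a * c * hW z + (a * d + b * c) * hV z + b * d * hU z"
    "hW (mob a b c d z) = a\<^sup>2 * hW z + 2 * a * b * hV z + b\<^sup>2 * hU z"
proof -
  define U V W where UVW: "U = hU z" "V = hV z" "W = hW z"
  have U: "U > 0" and q: "U * W = 1 + V\<^sup>2" using assms hU_pos hUW by (auto simp: UVW)
  let ?U = "c\<^sup>2 * W + 2 * c * d * V + d\<^sup>2 * U"
  let ?V = "a * c * W + (a * d + b * c) * V + b * d * U"
  let ?W = "a\<^sup>2 * W + 2 * a * b * V + b\<^sup>2 * U"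
  have "?U * U = c\<^sup>2 * (U * W) + 2 * c * d * V * U + (d * U)\<^sup>2"
    by (simp add: power2_eq_square algebra_simps)
  also have "\<dots> = c\<^sup>2 + (c * V + d * U)\<^sup>2" unfolding q by (simp add: power2_eq_square algebra_simps)
  also have "\<dots> > 0"
  proof (cases "c = 0")
    case True
    then have "d \<noteq> 0" using assms by auto
    then show ?thesis using True U by simp
  qed (simp add: add_pos_nonneg)
  finally have p: "?U > 0" using U zero_less_mult_pos2 by blast
  have "?U * ?W - ?V\<^sup>2 = (a * d - b * c)\<^sup>2 * (U * W - V\<^sup>2)"
    by (simp add: power2_eq_square algebra_simps)
  then have "?U * ?W = 1 + ?V\<^sup>2" using assms q by simp
  then have w: "(1 + ?V\<^sup>2) / ?U = ?W" using p by (simp add: field_simps)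
  show "mob a b c d z \<in> uhp"
    "hU (mob a b c d z) = c\<^sup>2 * hW z + 2 * c * d * hV z + d\<^sup>2 * hU z"
    "hV (mob a b c d z) = a * c * hW z + (a * d + b * c) * hV z + b * d * hU z"
    "hW (mob a b c d z) = a\<^sup>2 * hW z + 2 * a * b * hV z + b\<^sup>2 * hU z"
    using hpt[OF p, of ?V] w by (auto simp: mob_def UVW)
qed

lemma hB_mob:
  assumes "z \<in> uhp" "w \<in> uhp" "a * d - b * c = 1"
  shows "hB (mob a b c d z) (mob a b c d w) = hB z w"
proof -
  have "hB (mob a b c d z) (mob a b c d w) = (a * d - b * c)\<^sup>2 * hB z w"
    unfolding hB_def mob(2-4)[OF assms(1,3)] mob(2-4)[OF assms(2,3)]
    by (simp add: power2_eq_square field_simps)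
  then show ?thesis using assms by simp
qed

lemma mob_inverse:
  assumes "z \<in> uhp" "a * d - b * c = 1"
  shows "mob d (- b) (- c) a (mob a b c d z) = z"
proof -
  have D: "d * a - (- b) * (- c) = 1" using assms by (simp add: algebra_simps)
  note m = mob[OF assms] and m' = mob[OF mob(1)[OF assms] D]
  have "hU (mob d (- b) (- c) a (mob a b c d z)) = (a * d - b * c)\<^sup>2 * hU z"
    unfolding m' m by (simp add: power2_eq_square algebra_simps)
  moreover have "hV (mob d (- b) (- c) a (mob a b c d z)) = (a * d - b * c)\<^sup>2 * hV z"
    unfolding m' m by (simp add: power2_eq_square algebra_simps)
  ultimately show ?thesis using assms m'(1) by (intro uhp_eqI) auto
qed

lemma hiso_mob:
  assumes "a * d - b * c = 1"
  shows "hiso (mob a b c d) (mob d (- b) (- c) a)"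
proof -
  have D: "d * a - (- b) * (- c) = 1" using assms by (simp add: algebra_simps)
  have "mob a b c d (mob d (- b) (- c) a z) = z" if "z \<in> uhp" for z
    using mob_inverse[OF that D] by simp
  then show ?thesis
    unfolding hiso_def using assms D
    by (auto simp: mob mob_inverse hdist_arcosh hB_mob)
qed

definition hrefl :: "complex \<Rightarrow> complex" where "hrefl z = hpt (hU z) (- hV z)"

lemma hrefl:
  assumes "z \<in> uhp"
  shows "hrefl z \<in> uhp" "hU (hrefl z) = hU z" "hV (hrefl z) = - hV z" "hW (hrefl z) = hW z"
  using hpt[OF hU_pos[OF assms], of "- hV z"] hUW[OF assms, symmetric] hU_pos[OF assms]
  by (auto simp: hrefl_def)

lemma hiso_hrefl: "hiso hrefl hrefl"
  unfolding hiso_def by (auto simp: hrefl hdist_arcosh hB_def intro!: uhp_eqI)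

lemma hiso_id: "hiso (\<lambda>z. z) (\<lambda>z. z)"
  by (simp add: hiso_def)

text \<open>The hyperbolic cosine of the displacement is exactly the right-hand side plus half the
  square of a linear functional \<open>S\<close>, which for a hyperbolic element vanishes on the
  axis. A large trace thus moves every point far.\<close>

lemma cosh_displacement_mob:
  assumes "z \<in> uhp" "a * d - b * c = 1"
  shows "cosh (hdist z (mob a b c d z)) \<ge> (a + d)\<^sup>2 / 2 - 1"
proof -
  define S where "S = b * hU z + (a - d) * hV z - c * hW z"
  have "hB z (mob a b c d z) - S\<^sup>2 / 2 = (a\<^sup>2 + d\<^sup>2 + 2 * b * c) / 2 * (hU z * hW z - (hV z)\<^sup>2)"
    unfolding hB_def mob[OF assms] S_def by (simp add: power2_eq_square field_simps)
  also have "\<dots> = (a\<^sup>2 + d\<^sup>2 + 2 * b * c) / 2" using hUW[OF assms(1)] by simp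
  also have "\<dots> = (a + d)\<^sup>2 / 2 - (a * d - b * c)" by (simp add: power2_eq_square field_simps)
  finally have "hB z (mob a b c d z) \<ge> (a + d)\<^sup>2 / 2 - 1"
    using assms(2) zero_le_power2[of S] by linarith
  then show ?thesis
    using cosh_hdist[OF assms(1) mob(1)[OF assms]] by simp
qed

lemma hiso_to_i:
  assumes "u \<in> uhp"
  obtains M M' where "hiso M M'" "M u = \<i>"
proof -
  define s where "s = sqrt (Im u)"
  have y: "Im u > 0" using assms by (simp add: uhp_def)
  have s: "s > 0" "s\<^sup>2 = Im u" using y by (auto simp: s_def)
  have D: "(1 / s) * s - (- Re u / s) * 0 = 1" using s by simp
  note m = mob[OF assms D]
  have "mob (1 / s) (- Re u / s) 0 s u = \<i>"
  proof (rule uhp_eqI[OF m(1) i_uhp])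
    show "hU (mob (1 / s) (- Re u / s) 0 s u) = hU \<i>"
      unfolding m using s y by (simp add: hU_def)
    show "hV (mob (1 / s) (- Re u / s) 0 s u) = hV \<i>"
      unfolding m using s y by (simp add: hU_def hV_def)
  qed
  then show ?thesis using hiso_mob[OF D] that by blast
qed

lemma hiso_rotate:
  assumes "v \<in> uhp"
  obtains M M' where "hiso M M'" "M \<i> = \<i>" "M v = iax (hdist \<i> v)"
proof -
  \<comment> \<open>\<open>(q, p)\<close> are the coordinates of \<open>v\<close> in the plane
    orthogonal to \<open>\<i>\<close>, on which rotations about \<open>\<i>\<close> act as plane
    rotations.\<close>
  define p q where pq: "p = hV v" "q = (hW v - hU v) / 2"
  obtain r \<phi> where r: "r \<ge> 0" "p = r * sin \<phi>" "q = r * cos \<phi>"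
  proof -
    obtain r a where "Complex q p = rcis r a" "r \<ge> 0" by (metis rcis_Ex rcis_cmod_Arg norm_ge_zero)
    then show ?thesis using that[of r a] by (simp add: rcis_def cis.ctr complex_eq_iff)
  qed
  \<comment> \<open>Half the angle, because a matrix of SO(2) acts by congruence with twice its
    angle.\<close>
  define c s where cs: "c = cos (\<phi>/2)" "s = sin (\<phi>/2)"
  have cs1: "c * c - s * (- s) = 1" using sin_cos_squared_add[of "\<phi>/2"] by (simp add: cs power2_eq_square)
  have c2: "cos \<phi> = c\<^sup>2 - s\<^sup>2" "sin \<phi> = 2 * s * c"
    using cos_double[of "\<phi>/2"] sin_double[of "\<phi>/2"] by (auto simp: cs)
  note m = mob[OF assms cs1] and mi = mob[OF i_uhp cs1]
  have i: "mob c s (- s) c \<i> = \<i>"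
    by (rule uhp_eqI[OF mi(1) i_uhp]) (use cs1 in \<open>auto simp: mi power2_eq_square algebra_simps\<close>)
  define w where "w = mob c s (- s) c v"
  have w: "w \<in> uhp" using m by (simp add: w_def)
  have "hV w = (c\<^sup>2 - s\<^sup>2) * p - 2 * s * c * q"
    unfolding w_def m pq by (simp add: power2_eq_square field_simps)
  then have V0: "hV w = 0" by (simp add: r c2[symmetric])
  have "(hW w - hU w) / 2 = (c\<^sup>2 - s\<^sup>2) * q + 2 * s * c * p"
    unfolding w_def m pq by (simp add: power2_eq_square field_simps)
  also have "\<dots> = r * ((c\<^sup>2 - s\<^sup>2)\<^sup>2 + (2 * s * c)\<^sup>2)"
  proof -
    have e: "p = r * (2 * s * c)" "q = r * (c\<^sup>2 - s\<^sup>2)" using r(2,3) unfolding c2 .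
    show ?thesis by (simp only: e) (simp add: power2_eq_square algebra_simps)
  qed
  finally have "(hW w - hU w) / 2 = r * ((cos \<phi>)\<^sup>2 + (sin \<phi>)\<^sup>2)"
    by (simp only: c2)
  then have "(hW w - hU w) / 2 = r" by (simp only: sin_cos_squared_add2 mult_1_right)
  then have WU: "hW w \<ge> hU w" using r(1) by simp
  define t where "t = ln (hW w)"
  have wt: "w = iax t" unfolding t_def by (rule iax_eqI[OF w V0])
  have "t \<ge> 0" using WU unfolding wt by (simp add: iax)
  have "hdist \<i> v = hdist (mob c s (- s) c \<i>) (mob c s (- s) c v)"
    using hisoD(5)[OF hiso_mob[OF cs1] i_uhp assms] by simp
  also have "\<dots> = hdist (iax 0) (iax t)" by (simp add: i iax_0 flip: w_def wt)
  also have "\<dots> = t" using \<open>t \<ge> 0\<close> by (simp add: hdist_iax)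
  finally show ?thesis using that[OF hiso_mob[OF cs1] i] wt w_def by simp
qed

lemma hiso_homogeneous:
  assumes "u \<in> uhp" "v \<in> uhp"
  obtains M M' where "hiso M M'" "M u = \<i>" "M v = iax (hdist u v)"
proof -
  obtain A A' where A: "hiso A A'" "A u = \<i>" using hiso_to_i[OF assms(1)] .
  obtain B B' where B: "hiso B B'" "B \<i> = \<i>" "B (A v) = iax (hdist \<i> (A v))"
    using hiso_rotate hisoD(1)[OF A(1) assms(2)] by blast
  have "hdist \<i> (A v) = hdist u v" using hisoD(5)[OF A(1) assms] A(2) by simp
  then show ?thesis using that[OF hiso_comp[OF A(1) B(1)]] A B by simp
qed

lemma geodesic_normal_form:
  assumes "k \<in> unit_geodesics uhp"
  obtains M M' where "hiso M M'" "\<And>t. M (k t) = iax t"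
proof -
  have k: "k t \<in> uhp" for t using assms by (auto simp: unit_geodesics_def)
  obtain M M' where M: "hiso M M'" "M (k 0) = \<i>" "M (k 1) = iax (hdist (k 0) (k 1))"
    using hiso_homogeneous[OF k k] .
  have M1: "M (k 1) = iax 1" proof -
    have "hdist (k 0) (k 1) = \<bar>0 - 1\<bar>" using assms unfolding unit_geodesics_def by blast
    then show ?thesis using M(3) by simp
  qed
  have g: "(\<lambda>t. M (k t)) \<in> unit_geodesics uhp" using unit_geodesics_hiso[OF M(1) assms] .
  have "M (k t) = iax t" for t
  proof (rule uhp_eqI)
    have "sinh 1 * hV (M (k t)) = 0" unfolding geodesic_coords(2)[OF g, of t] by (simp add: M(2) M1 iax)
    then show "hV (M (k t)) = hV (iax t)" by (simp add: iax)
    have "sinh 1 * hU (M (k t)) = sinh (1 - t) + sinh t * exp (- 1)"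
      unfolding geodesic_coords(1)[OF g, of t] by (simp add: M(2) M1 iax)
    also have "\<dots> = sinh 1 * exp (- t)"
      by (simp add: sinh_def field_simps mult_exp_exp)
    finally show "hU (M (k t)) = hU (iax t)" by (simp add: iax)
  qed (auto simp: iax hisoD[OF M(1)] k)
  then show ?thesis using that M(1) by blast
qed

lemma hiso_iax_unit_geodesic: "hiso M M' \<Longrightarrow> (\<lambda>t. M' (iax t)) \<in> unit_geodesics uhp"
  using unit_geodesics_hiso[OF hiso_sym iax_unit_geodesic] .

lemma geodesic_through:
  assumes "u \<in> uhp" "v \<in> uhp"
  obtains k where "k \<in> unit_geodesics uhp" "k 0 = u" "k (hdist u v) = v"
proof -
  obtain M M' where M: "hiso M M'" "M u = \<i>" "M v = iax (hdist u v)"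
    using hiso_homogeneous[OF assms] .
  have "M' (iax 0) = u" "M' (iax (hdist u v)) = v"
    using M hisoD(3)[OF M(1)] assms by (metis iax_0, metis)
  then show ?thesis using that[of "\<lambda>t. M' (iax t)"] hiso_iax_unit_geodesic[OF M(1)] by simp
qed

text \<open>\<open>hB z (iax t)\<close> is the mean of two terms with constant product
  \<open>1 + (hV z)^2\<close>, so it is smallest when they agree. Hence \<open>hV\<close> is the
  hyperbolic sine of the signed distance to the imaginary axis.\<close>

lemma cosh_hdist_iax_ge:
  assumes "z \<in> uhp"
  shows "cosh (hdist z (iax t)) \<ge> sqrt (1 + (hV z)\<^sup>2)"
proof (rule real_le_lsqrt)
  let ?a = "hU z * exp t" and ?b = "hW z * exp (- t)"
  have "?a * ?b = hU z * hW z" by (simp add: exp_minus field_simps)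
  then have "?a * ?b = 1 + (hV z)\<^sup>2" using hUW[OF assms] by simp
  moreover have "((?a + ?b) / 2)\<^sup>2 - ?a * ?b = ((?a - ?b) / 2)\<^sup>2" by (simp add: power2_eq_square field_simps)
  ultimately show "1 + (hV z)\<^sup>2 \<le> (cosh (hdist z (iax t)))\<^sup>2"
    using zero_le_power2[of "(?a - ?b) / 2"]
    unfolding cosh_hdist[OF assms iax(1)] hB_iax by linarith
qed (auto intro: order_trans[OF _ cosh_real_ge_1])

lemma cosh_hdist_iax_attained:
  assumes "z \<in> uhp"
  obtains t where "cosh (hdist z (iax t)) = sqrt (1 + (hV z)\<^sup>2)"
proof -
  \<comment> \<open>The foot of the perpendicular, where
    \<open>hU z * exp t = hW z * exp (- t)\<close>.\<close>
  define t where "t = ln (hW z / hU z) / 2"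
  have p: "hU z > 0" "hW z > 0" using hU_pos hW_pos assms by auto
  have "(exp t)\<^sup>2 = hW z / hU z" using p by (simp add: t_def exp_double[symmetric])
  have "(hU z * exp t)\<^sup>2 = hU z * hW z"
    unfolding power_mult_distrib \<open>(exp t)\<^sup>2 = _\<close> using p by (simp add: power2_eq_square)
  then have 1: "hU z * exp t = sqrt (hU z * hW z)"
    using p by (intro real_sqrt_unique[symmetric]) auto
  have "(hW z * exp (- t))\<^sup>2 = (hW z)\<^sup>2 / (exp t)\<^sup>2"
    by (simp add: exp_minus power_mult_distrib field_simps)
  also have "\<dots> = hU z * hW z"
    unfolding \<open>(exp t)\<^sup>2 = _\<close> using p by (simp add: power2_eq_square field_simps)
  finally have 2: "hW z * exp (- t) = sqrt (hU z * hW z)"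
    using p by (intro real_sqrt_unique[symmetric]) auto
  have "hB z (iax t) = sqrt (1 + (hV z)\<^sup>2)"
    using hUW[OF assms] by (simp add: hB_iax 1 2)
  then show ?thesis using that cosh_hdist[OF assms iax(1)] by simp
qed

text \<open>The signed distance \<open>arsinh (hV z)\<close> from the imaginary axis is 1-Lipschitz,
  so a point further than \<open>D\<close> from the axis cannot change sides by moving at most
  \<open>D\<close>.\<close>

lemma hV_sign_preserved:
  assumes "z \<in> uhp" "w \<in> uhp" "hdist z w \<le> D" "\<bar>hV z\<bar> > sinh D"
  shows "sgn (hV w) = sgn (hV z)"
proof -
  define x y where "x = arsinh (hV z)" and "y = arsinh (hV w)"
  have V: "hV z = sinh x" "hV w = sinh y" by (simp_all add: x_def y_def)
  have D: "D \<ge> 0" using assms hdist_nonneg by force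
  have UW: "hU z * hW z = (cosh x)\<^sup>2" "hU w * hW w = (cosh y)\<^sup>2"
    using hUW assms by (simp_all add: V cosh_square_eq)
  let ?a = "hU z * hW w" and ?b = "hW z * hU w"
  have ab: "?a > 0" "?b > 0" using assms hU_pos hW_pos by auto
  have "?a * ?b = (hU z * hW z) * (hU w * hW w)" by simp
  also have "\<dots> = (cosh x * cosh y)\<^sup>2" by (simp add: UW power_mult_distrib)
  finally have "((?a + ?b) / 2)\<^sup>2 - (cosh x * cosh y)\<^sup>2 = ((?a - ?b) / 2)\<^sup>2"
    by (simp add: power2_eq_square field_simps)
  then have "(cosh x * cosh y)\<^sup>2 \<le> ((?a + ?b) / 2)\<^sup>2"
    using zero_le_power2[of "(?a - ?b) / 2"] by linarith
  then have "cosh x * cosh y \<le> (?a + ?b) / 2" by (rule power2_le_imp_le) (use ab in auto)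
  then have "cosh (x - y) \<le> hB z w" by (simp add: hB_def V cosh_diff)
  also have "\<dots> \<le> cosh D" using assms D hdist_le_iff by blast
  finally have "\<bar>x - y\<bar> \<le> D" using D by (metis abs_ge_zero cosh_real_abs cosh_real_nonneg_le_iff)
  moreover have "\<bar>x\<bar> > D"
    using assms(4) by (simp add: V flip: sinh_real_abs)
  ultimately have "(x > 0 \<and> y > 0) \<or> (x < 0 \<and> y < 0)" using D by linarith
  then show ?thesis unfolding V by (elim disjE) simp_all
qed

text \<open>Distances to two points of the axis determine \<open>hU\<close> and \<open>hW\<close>,
  hence \<open>hV\<close> up to the reflection in the axis; a third point off the axis decides the
  sign.\<close>

lemma isometry_fixing_frame:
  assumes "A \<in> uhp" "B \<in> uhp" "e \<noteq> 0" "f \<in> uhp" "hV f > 0"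
    and "hdist A \<i> = hdist B \<i>" "hdist A (iax e) = hdist B (iax e)"
  shows "hU A = hU B" "hW A = hW B" "(hV A)\<^sup>2 = (hV B)\<^sup>2" "hdist A f = hdist B f \<Longrightarrow> A = B"
proof -
  have 1: "hU A + hW A = hU B + hW B" using assms by (simp add: hdist_eq_iff hB_def)
  have 2: "hU A * exp e + hW A * exp (- e) = hU B * exp e + hW B * exp (- e)"
    using assms by (simp add: hdist_eq_iff iax hB_iax)
  have "(hU A - hU B) * (exp e - exp (- e)) = (hU A * exp e + hW A * exp (- e)) - (hU A + hW A) * exp (- e)
     - (hU B * exp e + hW B * exp (- e)) + (hU B + hW B) * exp (- e)" by (simp add: algebra_simps)
  also have "\<dots> = 0" unfolding 1 2 by simp
  finally show U: "hU A = hU B" using assms(3) by auto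
  then show W: "hW A = hW B" using 1 by simp
  show "(hV A)\<^sup>2 = (hV B)\<^sup>2" using hUW[OF assms(1)] hUW[OF assms(2)] U W by simp
  assume "hdist A f = hdist B f"
  then have "hV A * hV f = hV B * hV f" using assms U W by (simp add: hdist_eq_iff hB_def)
  then show "A = B" using assms U by (intro uhp_eqI) auto
qed

text \<open>Needed for chart domains: a map known to preserve distances only on \<open>D\<close> is
  matched with a global isometry by normalising the images of the frame \<open>\<i>\<close>,
  \<open>iax e\<close>, \<open>f\<close>, which then determines all other points.\<close>

lemma isometry_extends:
  assumes "D \<subseteq> uhp" "\<i> \<in> D" "iax e \<in> D" "e \<noteq> 0" "f \<in> D" "hV f > 0"
    and \<psi>: "\<And>z. z \<in> D \<Longrightarrow> \<psi> z \<in> uhp" "\<And>z w. z \<in> D \<Longrightarrow> w \<in> D \<Longrightarrow> hdist (\<psi> z) (\<psi> w) = hdist z w"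
  obtains M M' where "hiso M M'" "\<And>z. z \<in> D \<Longrightarrow> M (\<psi> z) = z"
proof -
  obtain N N' where N: "hiso N N'" "N (\<psi> \<i>) = \<i>" "N (\<psi> (iax e)) = iax (hdist (\<psi> \<i>) (\<psi> (iax e)))"
    using hiso_homogeneous \<psi>(1) assms by metis
  have "hdist (\<psi> \<i>) (\<psi> (iax e)) = \<bar>e\<bar>"
    using \<psi>(2)[OF assms(2,3)] hdist_iax[of 0 e] by (simp add: iax_0)
  obtain A A' where A: "hiso A A'" "A (\<psi> \<i>) = \<i>" "A (\<psi> (iax e)) = iax e"
  proof (cases "e > 0")
    case True
    then show ?thesis using that N \<open>hdist (\<psi> \<i>) (\<psi> (iax e)) = \<bar>e\<bar>\<close> by simp
  next
    case False
    \<comment> \<open>The half-turn about \<open>\<i>\<close> exchanges the two halves of the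
      axis.\<close>
    have d: "(0::real) * 0 - 1 * (-1) = 1" by simp
    have "mob 0 1 (-1) 0 \<i> = \<i>" by (rule uhp_eqI) (auto simp: mob[OF _ d])
    moreover have "mob 0 1 (-1) 0 (iax (- e)) = iax e" by (rule uhp_eqI) (auto simp: mob[OF _ d] iax)
    ultimately show ?thesis using that[OF hiso_comp[OF N(1) hiso_mob[OF d]]] N False
        \<open>hdist (\<psi> \<i>) (\<psi> (iax e)) = \<bar>e\<bar>\<close> by simp
  qed
  define xx where "xx z = A (\<psi> z)" for z
  have xx: "xx z \<in> uhp" "xx \<i> = \<i>" "xx (iax e) = iax e" if "z \<in> D" for z
    using A \<psi> that hisoD(1)[OF A(1)] by (auto simp: xx_def)
  have xxd: "hdist (xx z) (xx w) = hdist z w" if "z \<in> D" "w \<in> D" for z w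
    using hisoD(5)[OF A(1)] \<psi> that by (simp add: xx_def)
  have fu: "f \<in> uhp" using assms by auto
  have fr: "hdist (xx z) \<i> = hdist z \<i>" "hdist (xx z) (iax e) = hdist z (iax e)" if "z \<in> D" for z
    using xxd[OF that assms(2)] xxd[OF that assms(3)] xx[OF that] by auto
  have "(hV (xx f))\<^sup>2 = (hV f)\<^sup>2"
    using isometry_fixing_frame(3)[OF xx(1) fu _ fu] assms fr by auto
  then have "hV (xx f) = hV f \<or> hV (xx f) = - hV f" by (simp add: power2_eq_iff)
  then obtain R where R: "hiso R R" "R (xx f) = f" "R \<i> = \<i>" "R (iax e) = iax e"
  proof
    assume "hV (xx f) = hV f"
    moreover have "hU (xx f) = hU f"
      using isometry_fixing_frame(1)[OF xx(1) fu _ fu] assms fr by auto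
    ultimately have "xx f = f" using xx(1) assms(5) fu by (intro uhp_eqI) auto
    then show thesis using that[OF hiso_id] by simp
  next
    assume V: "hV (xx f) = - hV f"
    have U: "hU (xx f) = hU f"
      using isometry_fixing_frame(1)[OF xx(1) fu _ fu] assms fr by auto
    have "hrefl (xx f) = f" using hrefl[OF xx(1)[OF assms(5)]] U V fu by (intro uhp_eqI) auto
    moreover have "hrefl \<i> = \<i>" "hrefl (iax e) = iax e"
      by (auto simp: hrefl iax intro!: uhp_eqI)
    ultimately show thesis using that[OF hiso_hrefl] by simp
  qed
  have "R (xx z) = z" if z: "z \<in> D" for z
  proof (rule isometry_fixing_frame(4)[OF _ _ assms(4) fu assms(6)])
    have e: "hdist (R (xx z)) (R (xx w)) = hdist z w" if "w \<in> D" for w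
      using hisoD(5)[OF R(1)] xx(1) xxd that z by simp
    show "hdist (R (xx z)) f = hdist z f" using e[OF assms(5)] R by simp
    show "hdist (R (xx z)) \<i> = hdist z \<i>" using e[OF assms(2)] R xx(2)[OF z] by simp
    show "hdist (R (xx z)) (iax e) = hdist z (iax e)" using e[OF assms(3)] R xx(3)[OF z] by simp
    show "R (xx z) \<in> uhp" "z \<in> uhp" using hisoD(1)[OF R(1)] xx(1) z assms by auto
  qed
  then show ?thesis using that[OF hiso_comp[OF A(1) R(1)]] by (simp add: xx_def)
qed

section \<open>Interpolation along geodesic segments\<close>

definition hmixN :: "real \<Rightarrow> complex \<Rightarrow> complex \<Rightarrow> real" where
  "hmixN s z w = sqrt ((1 - s)\<^sup>2 + s\<^sup>2 + 2 * s * (1 - s) * hB z w)"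

text \<open>The linear interpolation in hyperboloid coordinates, renormalised. It commutes with isometries
  and runs through the geodesic segment from \<open>z\<close> to \<open>w\<close>.\<close>

definition hmix :: "real \<Rightarrow> complex \<Rightarrow> complex \<Rightarrow> complex" where
  "hmix s z w = hpt (((1 - s) * hU z + s * hU w) / hmixN s z w) (((1 - s) * hV z + s * hV w) / hmixN s z w)"

lemma hmixN_sq:
  assumes "z \<in> uhp" "w \<in> uhp" "s \<in> {0..1}"
  shows "(hmixN s z w)\<^sup>2 = (1 - s)\<^sup>2 + s\<^sup>2 + 2 * s * (1 - s) * hB z w" "hmixN s z w \<ge> 1"
proof -
  have "(1 - s)\<^sup>2 + s\<^sup>2 + 2 * s * (1 - s) * 1 \<le> (1 - s)\<^sup>2 + s\<^sup>2 + 2 * s * (1 - s) * hB z w"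
    using assms hB_ge_1[of z w] by (intro add_left_mono mult_left_mono) auto
  moreover have "(1 - s)\<^sup>2 + s\<^sup>2 + 2 * s * (1 - s) * 1 = 1" by (simp add: power2_eq_square algebra_simps)
  ultimately have 1: "1 \<le> (1 - s)\<^sup>2 + s\<^sup>2 + 2 * s * (1 - s) * hB z w" by simp
  then show "(hmixN s z w)\<^sup>2 = (1 - s)\<^sup>2 + s\<^sup>2 + 2 * s * (1 - s) * hB z w"
    unfolding hmixN_def by (intro real_sqrt_pow2) linarith
  show "hmixN s z w \<ge> 1" unfolding hmixN_def using 1 by simp
qed

lemma hmix:
  assumes "z \<in> uhp" "w \<in> uhp" "s \<in> {0..1}"
  shows "hmix s z w \<in> uhp"
    "hU (hmix s z w) = ((1 - s) * hU z + s * hU w) / hmixN s z w"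
    "hV (hmix s z w) = ((1 - s) * hV z + s * hV w) / hmixN s z w"
    "hW (hmix s z w) = ((1 - s) * hW z + s * hW w) / hmixN s z w"
proof -
  define N where "N = hmixN s z w"
  have N: "N > 0" "N\<^sup>2 = (1 - s)\<^sup>2 + s\<^sup>2 + 2 * s * (1 - s) * hB z w"
    using hmixN_sq[OF assms] by (auto simp: N_def)
  define u v x where "u = (1 - s) * hU z + s * hU w" and "v = (1 - s) * hV z + s * hV w"
    and "x = (1 - s) * hW z + s * hW w"
  have u: "u > 0"
  proof (cases "s = 1")
    case True
    then show ?thesis using hU_pos[OF assms(2)] by (simp add: u_def)
  next
    case False
    then show ?thesis using hU_pos[OF assms(1)] hU_pos[OF assms(2)] assms(3)
      by (auto simp: u_def intro!: add_pos_nonneg)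
  qed
  have "u * x - v\<^sup>2 = (1 - s)\<^sup>2 * (hU z * hW z - (hV z)\<^sup>2) + s\<^sup>2 * (hU w * hW w - (hV w)\<^sup>2) + 2 * s * (1 - s) * hB z w"
    by (simp add: u_def v_def x_def hB_def power2_eq_square field_simps)
  also have "\<dots> = N\<^sup>2" using hUW assms N by simp
  finally have "u * x = N\<^sup>2 + v\<^sup>2" by simp
  then have w: "(1 + (v / N)\<^sup>2) / (u / N) = x / N"
    using N(1) u by (simp add: field_simps power2_eq_square)
  have "u / N > 0" using u N by simp
  from hpt[OF this, of "v / N"] w
  show "hmix s z w \<in> uhp"
    "hU (hmix s z w) = ((1 - s) * hU z + s * hU w) / hmixN s z w"
    "hV (hmix s z w) = ((1 - s) * hV z + s * hV w) / hmixN s z w"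
    "hW (hmix s z w) = ((1 - s) * hW z + s * hW w) / hmixN s z w"
    by (auto simp: hmix_def u_def v_def x_def N_def)
qed

lemma hB_hmix:
  assumes "z \<in> uhp" "w \<in> uhp" "s \<in> {0..1}"
  shows "hB x (hmix s z w) = ((1 - s) * hB x z + s * hB x w) / hmixN s z w"
  using hmixN_sq(2)[OF assms] unfolding hB_def hmix[OF assms] by (simp add: field_simps)

lemma hmix_0: "z \<in> uhp \<Longrightarrow> w \<in> uhp \<Longrightarrow> hmix 0 z w = z"
  and hmix_1: "z \<in> uhp \<Longrightarrow> w \<in> uhp \<Longrightarrow> hmix 1 z w = w"
  by (simp_all add: hmix_def hmixN_def hpt_coords)

text \<open>The partial distances have hyperbolic sines \<open>s * sinh d / N\<close> and
  \<open>(1 - s) * sinh d / N\<close>; the addition theorem then yields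
  \<open>cosh (x + y) = cosh d\<close>.\<close>

lemma hmix_between:
  assumes "z \<in> uhp" "w \<in> uhp" "s \<in> {0..1}"
  shows "hdist z (hmix s z w) + hdist (hmix s z w) w = hdist z w"
proof -
  define N where "N = hmixN s z w"
  define B where "B = hB z w"
  define m where "m = hmix s z w"
  define x y d where "x = hdist z m" and "y = hdist m w" and "d = hdist z w"
  have N: "N > 0" "N\<^sup>2 = (1 - s)\<^sup>2 + s\<^sup>2 + 2 * s * (1 - s) * B"
    using hmixN_sq[OF assms] by (auto simp: N_def B_def)
  have m: "m \<in> uhp" using hmix[OF assms] by (simp add: m_def)
  have nn: "x \<ge> 0" "y \<ge> 0" "d \<ge> 0" using assms m by (auto simp: x_def y_def d_def hdist_nonneg)
  have d: "cosh d = B" using assms by (simp add: d_def B_def cosh_hdist)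
  have x: "cosh x = ((1 - s) + s * B) / N"
    using assms m hB_hmix[OF assms, of z] by (simp add: x_def cosh_hdist hB_self m_def N_def B_def)
  have y: "cosh y = ((1 - s) * B + s) / N"
    using assms m hB_hmix[OF assms, of w]
    by (simp add: y_def cosh_hdist hB_self m_def N_def B_def hB_commute[of m w] hB_commute[of w z]
        hB_commute[of "hmix s z w" w])
  have sx: "sinh x = s * sinh d / N"
  proof (rule power2_eq_imp_eq)
    have "N\<^sup>2 * (sinh x)\<^sup>2 = (N * cosh x)\<^sup>2 - N\<^sup>2"
      using cosh_square_eq[of x] by (simp add: power_mult_distrib algebra_simps)
    also have "\<dots> = ((1 - s) + s * B)\<^sup>2 - N\<^sup>2" using N(1) by (simp add: x)
    also have "\<dots> = s\<^sup>2 * (B\<^sup>2 - 1)" unfolding N(2) by (simp add: power2_eq_square algebra_simps)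
    also have "\<dots> = s\<^sup>2 * (sinh d)\<^sup>2" using cosh_square_eq[of d] by (simp add: d)
    finally show "(sinh x)\<^sup>2 = (s * sinh d / N)\<^sup>2"
      using N(1) by (simp add: power_mult_distrib power_divide field_simps)
  qed (use nn N assms in auto)
  have sy: "sinh y = (1 - s) * sinh d / N"
  proof (rule power2_eq_imp_eq)
    have "N\<^sup>2 * (sinh y)\<^sup>2 = (N * cosh y)\<^sup>2 - N\<^sup>2"
      using cosh_square_eq[of y] by (simp add: power_mult_distrib algebra_simps)
    also have "\<dots> = ((1 - s) * B + s)\<^sup>2 - N\<^sup>2" using N(1) by (simp add: y)
    also have "\<dots> = (1 - s)\<^sup>2 * (B\<^sup>2 - 1)" unfolding N(2) by (simp add: power2_eq_square algebra_simps)
    also have "\<dots> = (1 - s)\<^sup>2 * (sinh d)\<^sup>2" using cosh_square_eq[of d] by (simp add: d)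
    finally show "(sinh y)\<^sup>2 = ((1 - s) * sinh d / N)\<^sup>2"
      unfolding power_mult_distrib power_divide using N(1) by (simp add: eq_divide_eq mult_ac)
  qed (use nn N assms in auto)
  have "N\<^sup>2 * cosh (x + y) = (N * cosh x) * (N * cosh y) + (N * sinh x) * (N * sinh y)"
    by (simp add: cosh_add power2_eq_square algebra_simps)
  also have "\<dots> = ((1 - s) + s * B) * ((1 - s) * B + s) + s * (1 - s) * (sinh d)\<^sup>2"
    using N(1) by (simp add: x y sx sy power2_eq_square)
  also have "\<dots> = N\<^sup>2 * B"
  proof -
    have "(sinh d)\<^sup>2 = B\<^sup>2 - 1" using cosh_square_eq[of d] by (simp add: d)
    then show ?thesis unfolding N(2) by (simp only:) (simp add: power2_eq_square algebra_simps)
  qed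
  finally have "cosh (x + y) = cosh d" using N(1) by (simp add: d)
  then have "x + y = d" using nn by (metis add_nonneg_nonneg arcosh_cosh_real)
  then show ?thesis by (simp add: x_def y_def d_def m_def)
qed

lemma between_unique:
  assumes "a \<in> uhp" "b \<in> uhp" "b' \<in> uhp" "c \<in> uhp"
    and "hdist a b + hdist b c = hdist a c" "hdist a b' = hdist a b" "hdist b' c = hdist b c"
  shows "b' = b"
proof (cases "a = c")
  case True
  then have "hdist a b = 0" using assms hdist_nonneg[of a b] hdist_nonneg[of b c] by simp
  then show ?thesis using assms hdist_eq_0_iff by metis
next
  case False
  then have "hdist a c > 0" using assms hdist_nonneg[of a c] hdist_eq_0_iff[of a c] by linarith
  then have p: "sinh (hdist a c) \<noteq> 0" by simp
  have U: "sinh (hdist a c) * hU b' = sinh (hdist a c) * hU b"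
    using hB_collinear(1)[OF assms(1,2,4,5)] hB_collinear(1)[OF assms(1,3,4)] assms(5-7) by simp
  have V: "sinh (hdist a c) * hV b' = sinh (hdist a c) * hV b"
    using hB_collinear(2)[OF assms(1,2,4,5)] hB_collinear(2)[OF assms(1,3,4)] assms(5-7) by simp
  show ?thesis using U V p assms(2,3) by (intro uhp_eqI) simp_all
qed

lemma continuous_on_hmix [continuous_intros]:
  assumes "continuous_on A a" "continuous_on A f" "continuous_on A g"
    and "a ` A \<subseteq> {0..1}" "f ` A \<subseteq> uhp" "g ` A \<subseteq> uhp"
  shows "continuous_on A (\<lambda>x. hmix (a x) (f x) (g x))"
proof -
  have N: "hmixN (a x) (f x) (g x) \<noteq> 0" if "x \<in> A" for x
    using hmixN_sq(2)[of "f x" "g x" "a x"] that assms by (auto simp: image_subset_iff)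
  have U: "((1 - a x) * hU (f x) + a x * hU (g x)) \<noteq> 0" if "x \<in> A" for x
    using hmix(1,2)[of "f x" "g x" "a x"] that assms hU_pos
    by (metis divide_eq_0_iff image_subset_iff less_irrefl)
  have c: "continuous_on A (\<lambda>x. hmixN (a x) (f x) (g x))"
    unfolding hmixN_def hB_def by (intro continuous_intros assms) auto
  show ?thesis
    unfolding hmix_def hpt_def Complex_eq
    by (intro continuous_intros assms c) (use N U in auto)
qed


section \<open>Convex subsets of the hyperbolic plane\<close>

lemma hyp_convexD:
  assumes "hyp_convex C"
  shows "C \<subseteq> uhp" "u \<in> C \<Longrightarrow> v \<in> C \<Longrightarrow> z \<in> uhp \<Longrightarrow> hdist u z + hdist z v = hdist u v \<Longrightarrow> z \<in> C"
  using assms unfolding hyp_convex_def by blast+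

lemma hyp_convex_hmix:
  assumes "hyp_convex C" "z \<in> C" "w \<in> C" "s \<in> {0..1}"
  shows "hmix s z w \<in> C"
proof -
  have zw: "z \<in> uhp" "w \<in> uhp" using assms(2,3) hyp_convexD(1)[OF assms(1)] by auto
  show ?thesis
    using hyp_convexD(2)[OF assms(1-3) hmix(1)[OF zw assms(4)] hmix_between[OF zw assms(4)]] .
qed

lemma hyp_convex_geodesic:
  assumes "hyp_convex C" "k \<in> unit_geodesics uhp" "k a \<in> C" "k b \<in> C" "a \<le> t" "t \<le> b"
  shows "k t \<in> C"
proof -
  have "k t \<in> uhp" "hdist (k a) (k t) + hdist (k t) (k b) = hdist (k a) (k b)"
    using assms by (auto simp: unit_geodesics_def)
  then show ?thesis using hyp_convexD(2)[OF assms(1,3,4)] by blast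
qed

lemma openin_hball:
  assumes "D \<subseteq> uhp" "z \<in> uhp"
  shows "openin (top_of_set D) {w\<in>D. hdist z w < r}"
proof -
  have "continuous_on D (\<lambda>w. hdist z w)" using assms by (intro continuous_intros) auto
  then have "openin (top_of_set D) (D \<inter> (\<lambda>w. hdist z w) -` {..<r})"
    by (rule continuous_openin_preimage_gen) simp
  moreover have "D \<inter> (\<lambda>w. hdist z w) -` {..<r} = {w\<in>D. hdist z w < r}" by auto
  ultimately show ?thesis by simp
qed

text \<open>\<open>hB x\<close> is affine in the unnormalised combination, and the normalising
  factor is at least 1. Balls are therefore convex.\<close>

lemma hdist_hmix_less:
  assumes "x \<in> uhp" "z \<in> uhp" "w \<in> uhp" "s \<in> {0..1}" "hdist x z \<le> r" "hdist x w \<le> r"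
  shows "hdist x (hmix s z w) \<le> r"
proof -
  have r: "r \<ge> 0" using assms hdist_nonneg by (meson order_trans)
  have b: "hB x z \<le> cosh r" "hB x w \<le> cosh r" using assms r hdist_le_iff by auto
  have "(1 - s) * hB x z + s * hB x w \<le> (1 - s) * cosh r + s * cosh r"
    using assms b by (intro add_mono mult_left_mono) auto
  then have 1: "(1 - s) * hB x z + s * hB x w \<le> cosh r" by (simp add: algebra_simps)
  have "hB x (hmix s z w) \<le> cosh r / hmixN s z w"
    unfolding hB_hmix[OF assms(2-4)] using 1 hmixN_sq(2)[OF assms(2-4)] by (intro divide_right_mono) auto
  also have "\<dots> \<le> cosh r" using hmixN_sq(2)[OF assms(2-4)] by (simp add: divide_le_eq)
  finally show ?thesis using assms r hmix(1)[OF assms(2-4)] by (simp add: hdist_le_iff)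
qed

text \<open>Small balls of \<open>C\<close> are convex, hence path connected through
  \<open>hmix\<close>. This is a requirement for lifting \<open>p\<close> through itself.\<close>

lemma hyp_convex_locally_path_connected:
  assumes "hyp_convex C"
  shows "locally path_connected C"
proof (rule locallyI)
  fix w x assume w: "openin (top_of_set C) w" "x \<in> w"
  note C = hyp_convexD(1)[OF assms]
  obtain e where e: "e > 0" "ball x e \<inter> C \<subseteq> w" using w by (metis openin_contains_ball)
  have x: "x \<in> C" using w by (meson openin_subset subsetD topspace_euclidean_subtopology openin_imp_subset)
  then obtain r where r: "r > 0" "\<forall>v\<in>uhp. hdist x v < r \<longrightarrow> dist x v < e"
    using hball_subset_ball[of x e] e C by blast
  let ?u = "{v\<in>C. hdist x v < r}"
  have "path_connected ?u"
    unfolding path_connected_def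
  proof (intro ballI)
    fix a b assume ab: "a \<in> ?u" "b \<in> ?u"
    then have abu: "a \<in> uhp" "b \<in> uhp" "x \<in> uhp" using C x by auto
    define g where "g = (\<lambda>s. hmix s a b)"
    have "path g" unfolding path_def g_def using abu by (intro continuous_intros) auto
    moreover have "path_image g \<subseteq> ?u"
    proof -
      have "g s \<in> ?u" if s: "s \<in> {0..1}" for s
      proof -
        have "hdist x (g s) \<le> max (hdist x a) (hdist x b)"
          unfolding g_def using abu s by (intro hdist_hmix_less) auto
        moreover have "max (hdist x a) (hdist x b) < r" using ab by simp
        ultimately show ?thesis using hyp_convex_hmix[OF assms _ _ s] ab by (auto simp: g_def)
      qed
      then show ?thesis by (auto simp: path_image_def)
    qed
    moreover have "pathstart g = a" "pathfinish g = b"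
      using abu by (auto simp: g_def pathstart_def pathfinish_def hmix_0 hmix_1)
    ultimately show "\<exists>g. path g \<and> path_image g \<subseteq> ?u \<and> pathstart g = a \<and> pathfinish g = b" by blast
  qed
  moreover have "openin (top_of_set C) ?u" using openin_hball[OF C] x C by blast
  moreover have "x \<in> ?u" using x C r by auto
  moreover have "?u \<subseteq> w" using r e C by (auto simp: subset_iff)
  ultimately show "\<exists>u v. openin (top_of_set C) u \<and> path_connected v \<and> x \<in> u \<and> u \<subseteq> v \<and> v \<subseteq> w"
    by blast
qed


section \<open>Lifting to covering spaces of metric spaces\<close>

text \<open>The library proves its lifting theorems for subsets of normed spaces. The Kuratowski embedding
  transports them to subsets of arbitrary metric spaces.\<close>

definition kuratowski :: "'a::metric_space \<Rightarrow> ('a \<Rightarrow>\<^sub>C real)" where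
  "kuratowski x = Bcontfun (\<lambda>y. dist x y - dist undefined y)"

lemma apply_kuratowski: "apply_bcontfun (kuratowski x) y = dist x y - dist undefined y"
proof -
  have "(\<lambda>y. dist x y - dist undefined y) \<in> bcontfun"
  proof (rule bcontfun_normI)
    show "continuous_on UNIV (\<lambda>y. dist x y - dist undefined y)" by (intro continuous_intros)
    show "norm (dist x y - dist undefined y) \<le> dist x undefined" for y
      by (metis abs_dist_diff_le dist_commute real_norm_def)
  qed
  then show ?thesis by (simp add: kuratowski_def Bcontfun_inverse)
qed

lemma dist_kuratowski: "dist (kuratowski x) (kuratowski y) = dist x y"
proof (rule antisym)
  show "dist (kuratowski x) (kuratowski y) \<le> dist x y"
    by (rule dist_bound) (simp add: apply_kuratowski dist_real_def, metis abs_dist_diff_le dist_commute)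
  show "dist x y \<le> dist (kuratowski x) (kuratowski y)"
    using dist_bounded[of "kuratowski x" y "kuratowski y"] by (simp add: apply_kuratowski dist_real_def)
qed

lemma kuratowski_eq_iff [simp]: "kuratowski x = kuratowski y \<longleftrightarrow> x = y"
  by (metis dist_kuratowski dist_eq_0_iff)

lemma continuous_on_kuratowski: "continuous_on S kuratowski"
  by (auto simp: continuous_on_iff dist_kuratowski)

lemma homeomorphism_kuratowski: "homeomorphism S (kuratowski ` S) kuratowski (inv kuratowski)"
proof -
  have i: "inv kuratowski (kuratowski x) = x" for x :: 'a
    by (rule inv_f_f) (simp add: inj_def)
  show ?thesis
    by (auto simp: homeomorphism_def continuous_on_kuratowski continuous_on_iff dist_kuratowski image_image i)
qed

lemma covering_space_kuratowski:
  assumes "covering_space C p S"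
  shows "covering_space C (\<lambda>z. kuratowski (p z)) (kuratowski ` S)"
proof
  note c = assms[unfolded covering_space_def]
  show "continuous_on C (\<lambda>z. kuratowski (p z))"
    by (rule continuous_on_compose2[OF continuous_on_kuratowski]) (use c in auto)
  show "(\<lambda>z. kuratowski (p z)) ` C = kuratowski ` S" using c by force
next
  note c = assms[unfolded covering_space_def]
  fix y assume "y \<in> kuratowski ` S"
  then obtain x where x: "x \<in> S" "y = kuratowski x" by auto
  from bspec[OF conjunct2[OF conjunct2[OF c]] x(1)] obtain T v where T: "x \<in> T" "openin (top_of_set S) T" "\<Union>v = C \<inter> p -` T"
    "\<forall>u\<in>v. openin (top_of_set C) u" "pairwise disjnt v" "\<forall>u\<in>v. \<exists>q. homeomorphism u T p q"
    by (elim exE conjE)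
  let ?T = "kuratowski ` T"
  have "openin (top_of_set (kuratowski ` S)) ?T"
    using homeomorphism_kuratowski T(2) by (rule homeomorphism_imp_open_map)
  moreover have "\<Union>v = C \<inter> (\<lambda>z. kuratowski (p z)) -` ?T" using T(3) by auto
  moreover have "\<exists>q. homeomorphism u ?T (\<lambda>z. kuratowski (p z)) q" if "u \<in> v" for u
  proof -
    obtain q where "homeomorphism u T p q" using T(6) \<open>u \<in> v\<close> by blast
    then have "homeomorphism u ?T (kuratowski \<circ> p) (q \<circ> inv kuratowski)"
      using homeomorphism_compose homeomorphism_kuratowski by blast
    then show ?thesis by (auto simp: o_def)
  qed
  ultimately show "\<exists>T. y \<in> T \<and> openin (top_of_set (kuratowski ` S)) T \<and>
      (\<exists>v. \<Union>v = C \<inter> (\<lambda>z. kuratowski (p z)) -` T \<and> (\<forall>u\<in>v. openin (top_of_set C) u) \<and>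
      pairwise disjnt v \<and> (\<forall>u\<in>v. \<exists>q. homeomorphism u T (\<lambda>z. kuratowski (p z)) q))"
  proof (rule_tac exI[of _ ?T], intro conjI exI[of _ v] ballI)
    show "y \<in> ?T" using T(1) x(2) by (rule_tac image_eqI)
  qed (use T(4,5) in \<open>simp_all only:\<close>)
qed

lemma metric_covering_lift_path:
  fixes p :: "'c::real_normed_vector \<Rightarrow> 'a::metric_space"
  assumes "covering_space C p S" "a \<in> C" "path g" "path_image g \<subseteq> S" "g 0 = p a"
  obtains h where "path h" "path_image h \<subseteq> C" "h 0 = a" "\<And>t. t \<in> {0..1} \<Longrightarrow> p (h t) = g t"
proof -
  have 1: "path (\<lambda>t. kuratowski (g t))"
    using assms(3) unfolding path_def
    by (intro continuous_on_compose2[OF continuous_on_kuratowski[of UNIV]]) auto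
  obtain h where "path h" "path_image h \<subseteq> C" "pathstart h = a"
    "\<And>t. t \<in> {0..1} \<Longrightarrow> kuratowski (p (h t)) = kuratowski (g t)"
    by (rule covering_space_lift_path_strong[OF covering_space_kuratowski[OF assms(1)] assms(2) 1])
       (use assms in \<open>auto simp: path_image_def pathstart_def\<close>)
  then show ?thesis using that[of h] by (simp add: pathstart_def)
qed

lemma metric_covering_lift_homotopy:
  fixes p :: "'c::real_normed_vector \<Rightarrow> 'a::metric_space" and h :: "real \<times> real \<Rightarrow> 'a"
  assumes "covering_space C p S" "continuous_on ({0..1} \<times> U) h" "h \<in> ({0..1} \<times> U) \<rightarrow> S"
    and "\<And>y. y \<in> U \<Longrightarrow> h (0, y) = p (f y)" "continuous_on U f" "f \<in> U \<rightarrow> C"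
  obtains k where "continuous_on ({0..1} \<times> U) k" "k \<in> ({0..1} \<times> U) \<rightarrow> C"
    "\<And>y. y \<in> U \<Longrightarrow> k (0, y) = f y" "\<And>z. z \<in> {0..1} \<times> U \<Longrightarrow> h z = p (k z)"
proof -
  have 1: "continuous_on ({0..1} \<times> U) (\<lambda>z. kuratowski (h z))"
    by (intro continuous_on_compose2[OF continuous_on_kuratowski[of UNIV] assms(2)]) auto
  obtain k where "continuous_on ({0..1} \<times> U) k" "k \<in> ({0..1} \<times> U) \<rightarrow> C"
    "\<And>y. y \<in> U \<Longrightarrow> k (0, y) = f y" "\<And>z. z \<in> {0..1} \<times> U \<Longrightarrow> kuratowski (h z) = kuratowski (p (k z))"
    by (rule covering_space_lift_homotopy[OF covering_space_kuratowski[OF assms(1)] 1])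
       (use assms in auto)
  then show ?thesis using that[of k] by simp
qed

lemma metric_covering_lift:
  fixes p :: "'c::real_normed_vector \<Rightarrow> 'a::metric_space" and f :: "'d::real_normed_vector \<Rightarrow> 'a"
  assumes "covering_space C p S" "a \<in> C" "z \<in> U" "simply_connected U" "locally path_connected U"
    and "continuous_on U f" "f \<in> U \<rightarrow> S" "f z = p a"
  obtains g where "continuous_on U g" "g \<in> U \<rightarrow> C" "g z = a" "\<And>y. y \<in> U \<Longrightarrow> p (g y) = f y"
proof -
  have 1: "continuous_on U (\<lambda>z. kuratowski (f z))"
    by (intro continuous_on_compose2[OF continuous_on_kuratowski[of UNIV] assms(6)]) auto
  obtain g where "continuous_on U g" "g \<in> U \<rightarrow> C" "g z = a" 
    "\<And>y. y \<in> U \<Longrightarrow> kuratowski (p (g y)) = kuratowski (f y)"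
    by (rule covering_space_lift_strong[OF covering_space_kuratowski[OF assms(1)] assms(2-5) 1])
       (use assms in auto)
  then show ?thesis using that[of g] by simp
qed

lemma tendsto_hdist:
  assumes "u \<in> uhp" "\<And>n. x n \<in> uhp" "x \<longlonglongrightarrow> u"
  shows "(\<lambda>n. hdist u (x n)) \<longlonglongrightarrow> 0"
proof (rule LIMSEQ_I)
  fix e :: real assume "e > 0"
  then obtain r where r: "r > 0" "\<forall>w\<in>uhp. dist u w < r \<longrightarrow> hdist u w < e"
    using ball_subset_hball assms(1) by blast
  then obtain N where "\<forall>n\<ge>N. dist (x n) u < r" using assms(3) by (meson lim_sequentially)
  then show "\<exists>N. \<forall>n\<ge>N. norm (hdist u (x n) - 0) < e"
    using r assms(1,2) hdist_nonneg by (intro exI[of _ N]) (auto simp: dist_commute)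
qed

lemma curve_length_ge:
  assumes "t \<in> {0..1}"
  shows "ennreal (d (c 0) (c t)) \<le> curve_length d c"
proof -
  have "[0, t] \<in> {ts. sorted ts \<and> set ts \<subseteq> {0..1}}" using assms by auto
  then have "(\<Sum>i<length [0, t] - 1. ennreal (d (c ([0, t] ! i)) (c ([0, t] ! Suc i)))) \<le> curve_length d c"
    unfolding curve_length_def by (rule SUP_upper)
  then show ?thesis by simp
qed

section \<open>The universal cover of a compact hyperbolic surface and its deck group\<close>

locale surface_cover =
  fixes Sg :: "'a::metric_space set" and C :: "complex set" and p :: "complex \<Rightarrow> 'a"
  assumes surf: "hyperbolic_surface Sg" and comp: "compact Sg" and ucov: "universal_cover C p Sg"
begin

lemma conv: "hyp_convex C" and simply: "simply_connected C" and cov: "covering_space C p Sg"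
  and C_closed: "closedin (top_of_set uhp) C"
  using ucov by (auto simp: universal_cover_def)

lemma C_uhp: "C \<subseteq> uhp" using hyp_convexD(1)[OF conv] .

lemma C_uhpD: "z \<in> C \<Longrightarrow> z \<in> uhp" using C_uhp by blast

lemma pC: "p ` C = Sg" using covering_space_imp_surjective[OF cov] .

lemma p_Sg: "z \<in> C \<Longrightarrow> p z \<in> Sg" using pC by blast

lemma cont_p: "continuous_on C p" using covering_space_imp_continuous[OF cov] .

lemma local_iso: "z \<in> C \<Longrightarrow> \<exists>r>0. \<forall>u\<in>C. \<forall>v\<in>C. hdist z u < r \<longrightarrow> hdist z v < r \<longrightarrow> dist (p u) (p v) = hdist u v"
  using ucov unfolding universal_cover_def by blast

lemma Sg_nonempty: "Sg \<noteq> {}" using surf by (simp add: hyperbolic_surface_def)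

lemma compact_C_hcball:
  assumes "z \<in> uhp"
  shows "compact {w\<in>C. hdist z w \<le> r}"
proof -
  obtain T where T: "closed T" "C = uhp \<inter> T" using C_closed by (auto simp: closedin_closed)
  have "{w\<in>C. hdist z w \<le> r} = {w\<in>uhp. hdist z w \<le> r} \<inter> T" using T by auto
  then show ?thesis using compact_Int_closed[OF compact_hcball[OF assms] T(1)] by simp
qed

abbreviation "Deck \<equiv> deck_transformations C p"

lemma deck_cont: "\<tau> \<in> Deck \<Longrightarrow> continuous_on C \<tau>"
  and deck_C: "\<tau> \<in> Deck \<Longrightarrow> z \<in> C \<Longrightarrow> \<tau> z \<in> C"
  and deck_p: "\<tau> \<in> Deck \<Longrightarrow> z \<in> C \<Longrightarrow> p (\<tau> z) = p z"
  by (auto simp: deck_transformations_def homeomorphism_def)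

lemma lift_unique:
  assumes "connected T" "a \<in> T" "x \<in> T" "continuous_on T f" "continuous_on T g"
    and "f \<in> T \<rightarrow> C" "g \<in> T \<rightarrow> C" "\<And>y. y \<in> T \<Longrightarrow> p (f y) = p (g y)" "f a = g a"
  shows "f x = g x"
proof (rule covering_space_lift_unique[OF cov, of f a g T "\<lambda>y. p (f y)"])
  show "continuous_on T (\<lambda>y. p (f y))"
    by (rule continuous_on_compose2[OF cont_p assms(4)]) (use assms in auto)
  show "(\<lambda>y. p (f y)) \<in> T \<rightarrow> Sg" using assms p_Sg by auto
qed (use assms in auto)

lemma C_connected: "connected C"
  using simply simply_connected_imp_connected by blast

text \<open>As \<open>C\<close> is simply connected, \<open>p\<close> lifts through itself with a
  prescribed value at one point; the lifts in the two directions are inverse to each other by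
  uniqueness of lifts.\<close>

lemma deck_exists:
  assumes "u \<in> C" "v \<in> C" "p u = p v"
  obtains \<tau> where "\<tau> \<in> Deck" "\<tau> u = v"
proof -
  have lift: "\<exists>g. continuous_on C g \<and> g \<in> C \<rightarrow> C \<and> g u = v \<and> (\<forall>y\<in>C. p (g y) = p y)"
    if "u \<in> C" "v \<in> C" "p u = p v" for u v
    using metric_covering_lift[OF cov that(2) that(1) simply hyp_convex_locally_path_connected[OF conv] cont_p _ that(3)]
      p_Sg by (metis Pi_I)
  obtain g where g: "continuous_on C g" "g \<in> C \<rightarrow> C" "g u = v" "\<forall>y\<in>C. p (g y) = p y"
    using lift assms by blast
  obtain h where h: "continuous_on C h" "h \<in> C \<rightarrow> C" "h v = u" "\<forall>y\<in>C. p (h y) = p y"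
    using lift[of v u] assms by auto
  have hg: "h (g z) = z" if "z \<in> C" for z
  proof (rule lift_unique[OF C_connected assms(1) that])
    show "continuous_on C (\<lambda>z. h (g z))"
      by (rule continuous_on_compose2[OF h(1) g(1)]) (use g in auto)
  qed (use g h in \<open>auto simp: Pi_iff\<close>)
  have gh: "g (h z) = z" if "z \<in> C" for z
  proof (rule lift_unique[OF C_connected assms(2) that])
    show "continuous_on C (\<lambda>z. g (h z))"
      by (rule continuous_on_compose2[OF g(1) h(1)]) (use h in auto)
  qed (use g h in \<open>auto simp: Pi_iff\<close>)
  have "homeomorphism C C g h"
    unfolding homeomorphism_def
  proof (intro conjI)
    show "g ` C = C" using g(2) h(2) gh by (force simp: Pi_iff)
    show "h ` C = C" using g(2) h(2) hg by (force simp: Pi_iff)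
  qed (use g h hg gh in auto)
  then have "g \<in> Deck" using g(4) by (auto simp: deck_transformations_def)
  then show ?thesis using that g(3) by blast
qed

lemma deck_unique:
  assumes "\<tau> \<in> Deck" "\<tau>' \<in> Deck" "z \<in> C" "\<tau> z = \<tau>' z" "w \<in> C"
  shows "\<tau> w = \<tau>' w"
  by (rule lift_unique[OF C_connected assms(3,5)])
     (use assms deck_cont deck_C deck_p in auto)

lemma deck_id: "(\<lambda>z. z) \<in> Deck"
  unfolding deck_transformations_def using homeomorphism_ident by blast

lemma deck_free: "\<tau> \<in> Deck \<Longrightarrow> z \<in> C \<Longrightarrow> \<tau> z = z \<Longrightarrow> w \<in> C \<Longrightarrow> \<tau> w = w"
  using deck_unique[OF _ deck_id] by metis

lemma deck_comp: "\<sigma> \<in> Deck \<Longrightarrow> \<tau> \<in> Deck \<Longrightarrow> (\<lambda>z. \<sigma> (\<tau> z)) \<in> Deck"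
proof -
  assume a: "\<sigma> \<in> Deck" "\<tau> \<in> Deck"
  then obtain s t where "homeomorphism C C \<sigma> s" "homeomorphism C C \<tau> t"
    by (auto simp: deck_transformations_def)
  then have "homeomorphism C C (\<sigma> \<circ> \<tau>) (t \<circ> s)" using homeomorphism_compose by blast
  then have "\<exists>t'. homeomorphism C C (\<lambda>z. \<sigma> (\<tau> z)) t'" by (auto simp: o_def)
  moreover have "\<forall>z\<in>C. p (\<sigma> (\<tau> z)) = p z" using a deck_C deck_p by simp
  ultimately show ?thesis unfolding deck_transformations_def by blast
qed

lemma deck_inv:
  assumes "\<tau> \<in> Deck"
  obtains \<tau>' where "\<tau>' \<in> Deck" "\<And>z. z \<in> C \<Longrightarrow> \<tau>' (\<tau> z) = z" "\<And>z. z \<in> C \<Longrightarrow> \<tau> (\<tau>' z) = z"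
proof -
  obtain t where t: "homeomorphism C C \<tau> t" using assms by (auto simp: deck_transformations_def)
  then have "homeomorphism C C t \<tau>" by (rule homeomorphism_symD)
  moreover have "p (t z) = p z" if "z \<in> C" for z
  proof -
    have "t z \<in> C" "\<tau> (t z) = z" using t that unfolding homeomorphism_def by blast+
    then show ?thesis using deck_p[OF assms, of "t z"] by simp
  qed
  ultimately have "t \<in> Deck" by (auto simp: deck_transformations_def)
  then show ?thesis using that t by (auto simp: homeomorphism_def)
qed

text \<open>The segment from \<open>u\<close> to \<open>v\<close> lies in \<open>C\<close> by
  convexity. Near each of its points, distances before and after applying \<open>\<tau>\<close> can
  both be read off in \<open>Sg\<close> through \<open>p\<close>; the triangle inequality adds up
  the pieces.\<close>

lemma deck_isometry_le:
  assumes \<tau>: "\<tau> \<in> Deck" and uv: "u \<in> C" "v \<in> C"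
  shows "hdist (\<tau> u) (\<tau> v) \<le> hdist u v"
proof -
  obtain k where k: "k \<in> unit_geodesics uhp" "k 0 = u" "k (hdist u v) = v"
    using geodesic_through uv C_uhpD by metis
  define d where "d = hdist u v"
  have d0: "d \<ge> 0" using uv C_uhpD hdist_nonneg by (simp add: d_def)
  have kC: "k t \<in> C" if "0 \<le> t" "t \<le> d" for t
    using hyp_convex_geodesic[OF conv k(1), of 0 d t] k uv that by (simp add: d_def)
  have kd: "hdist (k s) (k t) = \<bar>s - t\<bar>" for s t using k(1) by (auto simp: unit_geodesics_def)
  define P where "P a b \<longleftrightarrow> (0 \<le> a \<and> b \<le> d \<longrightarrow> hdist (\<tau> (k a)) (\<tau> (k b)) \<le> b - a)" for a b
  have "P 0 d"
  proof (rule Bolzano[OF d0])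
    fix a b c assume h: "P a b" "P b c" "a \<le> b" "b \<le> c"
    show "P a c"
      unfolding P_def
    proof
      assume ac: "0 \<le> a \<and> c \<le> d"
      have "hdist (\<tau> (k a)) (\<tau> (k c)) \<le> hdist (\<tau> (k a)) (\<tau> (k b)) + hdist (\<tau> (k b)) (\<tau> (k c))"
        using ac h kC \<tau> deck_C C_uhpD by (intro hdist_triangle) auto
      also have "\<dots> \<le> (b - a) + (c - b)" using ac h unfolding P_def by (intro add_mono) auto
      finally show "hdist (\<tau> (k a)) (\<tau> (k c)) \<le> c - a" by simp
    qed
  next
    fix x assume x: "0 \<le> x" "x \<le> d"
    define z where "z = k x"
    have z: "z \<in> C" "\<tau> z \<in> C" using kC x \<tau> deck_C by (auto simp: z_def)
    obtain r where r: "r > 0" "\<forall>u\<in>C. \<forall>v\<in>C. hdist z u < r \<longrightarrow> hdist z v < r \<longrightarrow> dist (p u) (p v) = hdist u v"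
      using local_iso z by blast
    obtain r' where r': "r' > 0"
      "\<forall>u\<in>C. \<forall>v\<in>C. hdist (\<tau> z) u < r' \<longrightarrow> hdist (\<tau> z) v < r' \<longrightarrow> dist (p u) (p v) = hdist u v"
      using local_iso z by blast
    obtain e where e: "e > 0" "\<forall>w\<in>uhp. dist (\<tau> z) w < e \<longrightarrow> hdist (\<tau> z) w < r'"
      using ball_subset_hball r' z C_uhpD by blast
    obtain r'' where r'': "r'' > 0" "\<forall>w\<in>C. hdist z w < r'' \<longrightarrow> dist (\<tau> z) (\<tau> w) < e"
      using deck_cont[OF \<tau>] continuous_on_uhp_iff[OF C_uhp, of \<tau>] z e by blast
    have "P a b" if ab: "a \<le> x \<and> x \<le> b \<and> b - a < min r r''" for a b
      unfolding P_def
    proof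
      assume abd: "0 \<le> a \<and> b \<le> d"
      have c: "k a \<in> C" "k b \<in> C" using kC ab abd by auto
      have "hdist z (k a) < min r r''" "hdist z (k b) < min r r''" using ab kd by (auto simp: z_def)
      then have l: "hdist z (k a) < r" "hdist z (k b) < r" "dist (\<tau> z) (\<tau> (k a)) < e" "dist (\<tau> z) (\<tau> (k b)) < e"
        using r'' c by auto
      then have l': "hdist (\<tau> z) (\<tau> (k a)) < r'" "hdist (\<tau> z) (\<tau> (k b)) < r'"
        using e c \<tau> deck_C C_uhpD by auto
      have "hdist (\<tau> (k a)) (\<tau> (k b)) = dist (p (\<tau> (k a))) (p (\<tau> (k b)))"
        using r' l' c deck_C[OF \<tau>] by auto
      also have "\<dots> = dist (p (k a)) (p (k b))" using deck_p[OF \<tau>] c by simp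
      also have "\<dots> = hdist (k a) (k b)" using r l c by auto
      finally show "hdist (\<tau> (k a)) (\<tau> (k b)) \<le> b - a" using kd ab by simp
    qed
    then show "\<exists>d>0. \<forall>a b. a \<le> x \<and> x \<le> b \<and> b - a < d \<longrightarrow> P a b"
      using r r'' by (intro exI[of _ "min r r''"]) auto
  qed
  then show ?thesis using k d0 by (simp add: P_def d_def)
qed

lemma deck_isometry:
  assumes "\<tau> \<in> Deck" "u \<in> C" "v \<in> C"
  shows "hdist (\<tau> u) (\<tau> v) = hdist u v"
proof -
  obtain t where t: "t \<in> Deck" "\<And>z. z \<in> C \<Longrightarrow> t (\<tau> z) = z" using deck_inv[OF assms(1)] by metis
  have "hdist u v \<le> hdist (\<tau> u) (\<tau> v)"
    using deck_isometry_le[OF t(1) deck_C[OF assms(1,2)] deck_C[OF assms(1,3)]] t(2) assms by simp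
  then show ?thesis using deck_isometry_le[OF assms] by simp
qed

text \<open>\<open>\<tau>\<close> is an isometry of \<open>C\<close> alone, so the image is
  identified by its distances to the end points of the new segment.\<close>

lemma deck_hmix:
  assumes "\<tau> \<in> Deck" "z \<in> C" "w \<in> C" "s \<in> {0..1}"
  shows "\<tau> (hmix s z w) = hmix s (\<tau> z) (\<tau> w)"
proof -
  have c: "hmix s z w \<in> C" "\<tau> z \<in> C" "\<tau> w \<in> C" "\<tau> (hmix s z w) \<in> C"
    using hyp_convex_hmix[OF conv assms(2-4)] deck_C assms by auto
  have m: "hmix s (\<tau> z) (\<tau> w) \<in> C" using hyp_convex_hmix[OF conv c(2,3) assms(4)] .
  have B: "hB (\<tau> z) (\<tau> w) = hB z w"
    using deck_isometry[OF assms(1-3)] c assms C_uhpD by (metis cosh_hdist)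
  then have N: "hmixN s (\<tau> z) (\<tau> w) = hmixN s z w" by (simp add: hmixN_def)
  have u: "z \<in> uhp" "w \<in> uhp" "\<tau> z \<in> uhp" "\<tau> w \<in> uhp" "hmix s z w \<in> uhp" "hmix s (\<tau> z) (\<tau> w) \<in> uhp"
    using assms c m C_uhpD by auto
  have 1: "hdist (\<tau> z) (hmix s (\<tau> z) (\<tau> w)) = hdist z (hmix s z w)"
    using u B N hB_hmix[OF u(1,2) assms(4), of z] hB_hmix[OF u(3,4) assms(4), of "\<tau> z"]
    by (simp add: hdist_arcosh hB_self)
  have 2: "hdist (hmix s (\<tau> z) (\<tau> w)) (\<tau> w) = hdist (hmix s z w) w"
    using u B N hB_hmix[OF u(1,2) assms(4), of w] hB_hmix[OF u(3,4) assms(4), of "\<tau> w"]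
    by (simp add: hdist_arcosh hB_self hB_commute[of "hmix s z w"] hB_commute[of "hmix s (\<tau> z) (\<tau> w)"]
        hB_commute[of w z] hB_commute[of "\<tau> w" "\<tau> z"])
  have "hmix s (\<tau> z) (\<tau> w) = \<tau> (hmix s z w)"
    by (rule between_unique[of "\<tau> z" _ _ "\<tau> w"])
       (use u c m 1 2 C_uhpD deck_isometry[OF assms(1)] assms hmix_between[OF u(1,2) assms(4)] in auto)
  then show ?thesis by simp
qed

section \<open>Cocompactness and a uniform scale for the covering\<close>

lemma fundamental_compact:
  obtains K where "compact K" "K \<subseteq> C" "p ` K = Sg"
proof -
  define N where "N z = {w\<in>C. hdist z w < 1}" for z
  have "openin (top_of_set Sg) (p ` N z)" if "z \<in> C" for z
    using covering_space_open_map[OF cov] openin_hball[OF C_uhp] that C_uhpD unfolding N_def by blast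
  then obtain G where G: "\<And>z. z \<in> C \<Longrightarrow> open (G z) \<and> p ` N z = Sg \<inter> G z"
    by (auto simp: openin_open) metis
  have "Sg \<subseteq> (\<Union>z\<in>C. G z)"
  proof
    fix x assume "x \<in> Sg"
    then obtain z where z: "z \<in> C" "p z = x" using pC by auto
    then have "z \<in> N z" using C_uhpD by (simp add: N_def)
    then show "x \<in> (\<Union>z\<in>C. G z)" using G z by blast
  qed
  then obtain F where F: "F \<subseteq> C" "finite F" "Sg \<subseteq> (\<Union>z\<in>F. G z)"
    using compactE_image[OF comp, of C G] G by metis
  define K where "K = (\<Union>z\<in>F. {w\<in>C. hdist z w \<le> 1})"
  have "compact K" unfolding K_def using F compact_C_hcball C_uhpD by (intro compact_UN) auto
  moreover have "K \<subseteq> C" by (auto simp: K_def)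
  moreover have "Sg \<subseteq> p ` K"
  proof
    fix x assume "x \<in> Sg"
    then obtain z where "z \<in> F" "x \<in> Sg \<inter> G z" using F by blast
    then have "x \<in> p ` N z" "z \<in> F" using G F by auto
    then show "x \<in> p ` K" unfolding K_def N_def by force
  qed
  ultimately show ?thesis using that pC by blast
qed

lemma deck_to_K:
  assumes "K \<subseteq> C" "p ` K = Sg" "u \<in> C"
  obtains \<tau> where "\<tau> \<in> Deck" "\<tau> u \<in> K"
proof -
  have "p u \<in> p ` K" using assms p_Sg by simp
  then obtain w where "w \<in> K" "p w = p u" by auto
  then show ?thesis using deck_exists[of u w] assms that by (metis subsetD)
qed

text \<open>Deck transformations move a sequence of counterexamples into a compact set, where it
  accumulates at a point that contradicts \<open>local_iso\<close>.\<close>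

lemma uniform_local_iso:
  obtains \<rho> where "\<rho> > 0" "\<And>u v. u \<in> C \<Longrightarrow> v \<in> C \<Longrightarrow> hdist u v < \<rho> \<Longrightarrow> dist (p u) (p v) = hdist u v"
proof -
  have "\<exists>\<rho>>0. \<forall>u\<in>C. \<forall>v\<in>C. hdist u v < \<rho> \<longrightarrow> dist (p u) (p v) = hdist u v"
  proof (rule ccontr)
    assume n: "\<not> ?thesis"
    obtain K where K: "compact K" "K \<subseteq> C" "p ` K = Sg" using fundamental_compact .
    have "\<exists>u v. u \<in> K \<and> v \<in> C \<and> hdist u v < 1 / Suc n \<and> dist (p u) (p v) \<noteq> hdist u v" for n
    proof -
      obtain u v where uv: "u \<in> C" "v \<in> C" "hdist u v < 1 / Suc n" "dist (p u) (p v) \<noteq> hdist u v"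
        using n by (metis divide_pos_pos of_nat_0_less_iff zero_less_Suc zero_less_one)
      obtain \<tau> where t: "\<tau> \<in> Deck" "\<tau> u \<in> K" using deck_to_K[OF K(2,3) uv(1)] .
      then show ?thesis using uv deck_isometry[OF t(1) uv(1,2)] deck_p[OF t(1)] deck_C[OF t(1)]
        by (intro exI[of _ "\<tau> u"] exI[of _ "\<tau> v"]) simp
    qed
    then obtain u v where uv: "\<And>n. u n \<in> K" "\<And>n. v n \<in> C" "\<And>n. hdist (u n) (v n) < 1 / Suc n"
      "\<And>n. dist (p (u n)) (p (v n)) \<noteq> hdist (u n) (v n)" by metis
    obtain l f where l: "l \<in> K" "strict_mono f" "(u \<circ> f) \<longlonglongrightarrow> l"
      using K(1) uv(1) unfolding compact_def by metis
    obtain r where r: "r > 0" "\<forall>u\<in>C. \<forall>v\<in>C. hdist l u < r \<longrightarrow> hdist l v < r \<longrightarrow> dist (p u) (p v) = hdist u v"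
      using local_iso l K by blast
    have "(\<lambda>n. hdist l ((u \<circ> f) n)) \<longlonglongrightarrow> 0"
      using C_uhpD[OF subsetD[OF K(2)]] l(1) uv(1) by (intro tendsto_hdist[OF _ _ l(3)]) simp_all
    moreover have "(\<lambda>n. 1 / real (Suc n)) \<longlonglongrightarrow> 0" by (rule LIMSEQ_Suc[OF lim_1_over_n])
    then have "((\<lambda>n. 1 / real (Suc n)) \<circ> f) \<longlonglongrightarrow> 0" using LIMSEQ_subseq_LIMSEQ[OF _ l(2)] by blast
    ultimately have "(\<lambda>n. hdist l ((u \<circ> f) n) + 1 / real (Suc (f n))) \<longlonglongrightarrow> 0 + 0"
      unfolding o_def by (rule tendsto_add)
    then have "\<forall>\<^sub>F n in sequentially. hdist l ((u \<circ> f) n) + 1 / real (Suc (f n)) < r"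
      using r(1) by (auto simp: order_tendsto_iff)
    then obtain n where n: "hdist l (u (f n)) + 1 / real (Suc (f n)) < r"
      by (auto simp: eventually_sequentially)
    have c: "l \<in> C" "u (f n) \<in> C" "v (f n) \<in> C" using l K uv by auto
    have "hdist l (v (f n)) \<le> hdist l (u (f n)) + hdist (u (f n)) (v (f n))"
      using c C_uhpD by (intro hdist_triangle) auto
    also have "\<dots> < r" using n uv(3)[of "f n"] by linarith
    finally have "hdist l (v (f n)) < r" .
    moreover have "hdist l (u (f n)) < r"
      using n zero_le_divide_1_iff[of "real (Suc (f n))"] by linarith
    ultimately show False using r c uv(4)[of "f n"] by blast
  qed
  then show ?thesis using that by blast
qed

text \<open>The scale below which \<open>p\<close> preserves distances; distinct points of one fibre
  are at least this far apart. Paths and their lifts are compared below it.\<close>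

definition \<rho> :: real where
  "\<rho> = (SOME r. r > 0 \<and> (\<forall>u\<in>C. \<forall>v\<in>C. hdist u v < r \<longrightarrow> dist (p u) (p v) = hdist u v))"

lemma \<rho>: "\<rho> > 0" "\<And>u v. u \<in> C \<Longrightarrow> v \<in> C \<Longrightarrow> hdist u v < \<rho> \<Longrightarrow> dist (p u) (p v) = hdist u v"
proof -
  have "\<exists>r. r > 0 \<and> (\<forall>u\<in>C. \<forall>v\<in>C. hdist u v < r \<longrightarrow> dist (p u) (p v) = hdist u v)"
    using uniform_local_iso by metis
  from someI_ex[OF this] show "\<rho> > 0" "\<And>u v. u \<in> C \<Longrightarrow> v \<in> C \<Longrightarrow> hdist u v < \<rho> \<Longrightarrow> dist (p u) (p v) = hdist u v"
    by (auto simp: \<rho>_def)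
qed

lemma fibre_separated: "u \<in> C \<Longrightarrow> v \<in> C \<Longrightarrow> hdist u v < \<rho> \<Longrightarrow> p u = p v \<Longrightarrow> u = v"
  using \<rho>(2)[of u v] hdist_eq_0_iff[of u v] C_uhpD by simp

text \<open>If the lifts drifted apart, their distance would by continuity take a value strictly
  between \<open>e\<close> and \<open>\<rho>\<close>; but \<open>p\<close> preserves such a
  distance.\<close>

lemma close_lifts:
  assumes "continuous_on {0..1} f" "continuous_on {0..1} g" "f \<in> {0..1} \<rightarrow> C" "g \<in> {0..1} \<rightarrow> C"
    and "\<And>t. t \<in> {0..1} \<Longrightarrow> dist (p (f t)) (p (g t)) \<le> e" "e < \<rho>" "hdist (f 0) (g 0) < \<rho>" "t \<in> {0..1::real}"
  shows "hdist (f t) (g t) \<le> e"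
proof (rule ccontr)
  assume n: "\<not> ?thesis"
  define m where "m = (e + min \<rho> (hdist (f t) (g t))) / 2"
  have m: "e < m" "m < \<rho>" "m \<le> hdist (f t) (g t)" using n assms(6) by (auto simp: m_def)
  have c: "f s \<in> C" "g s \<in> C" if "s \<in> {0..1}" for s using assms that by auto
  have "hdist (f 0) (g 0) = dist (p (f 0)) (p (g 0))" using \<rho>(2) c assms(7) by simp
  also have "\<dots> \<le> e" using assms by simp
  finally have 0: "hdist (f 0) (g 0) \<le> m" using m by simp
  have "continuous_on {0..t} (\<lambda>s. hdist (f s) (g s))"
    by (rule continuous_on_subset[OF continuous_on_hdist_compose[OF assms(1,2)]]) (use assms C_uhpD in auto)
  then obtain s where s: "0 \<le> s" "s \<le> t" "hdist (f s) (g s) = m"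
    using IVT'[of "\<lambda>s. hdist (f s) (g s)" 0 m t] 0 m(3) assms by auto
  then have "s \<in> {0..1}" using assms by auto
  then have "dist (p (f s)) (p (g s)) = m" using \<rho>(2) c s m by simp
  then show False using assms(5)[OF \<open>s \<in> {0..1}\<close>] m by simp
qed

text \<open>Since \<open>dist\<close> is a length metric, there is a path of length below
  \<open>\<rho>\<close>; its lift cannot leave the region where \<open>p\<close> preserves
  distances, and it ends at the required point.\<close>

lemma near_lift:
  assumes "u \<in> C" "y \<in> Sg" "dist (p u) y < \<rho>"
  obtains v where "v \<in> C" "p v = y" "hdist u v = dist (p u) y"
proof -
  have "length_metric Sg dist" using surf by (simp add: hyperbolic_surface_def)
  then have "(INF c\<in>{c. path c \<and> path_image c \<subseteq> Sg \<and> pathstart c = p u \<and> pathfinish c = y}. curve_length dist c) < ennreal \<rho>"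
  proof -
    have "(INF c\<in>{c. path c \<and> path_image c \<subseteq> Sg \<and> pathstart c = p u \<and> pathfinish c = y}. curve_length dist c) = ennreal (dist (p u) y)"
      using bspec[OF bspec[OF \<open>length_metric Sg dist\<close>[unfolded length_metric_def] p_Sg[OF assms(1)]] assms(2)]
      by (rule sym)
    then show ?thesis using assms(3) by (simp add: ennreal_lessI le_less_trans[OF zero_le_dist])
  qed
  then obtain c where c': "c \<in> {c. path c \<and> path_image c \<subseteq> Sg \<and> pathstart c = p u \<and> pathfinish c = y}"
    "curve_length dist c < ennreal \<rho>"
    by (rule INF_less_iff[THEN iffD1, THEN bexE])
  then have c: "path c" "path_image c \<subseteq> Sg" "c 0 = p u" "c 1 = y" "curve_length dist c < ennreal \<rho>"
    by (simp_all add: pathstart_def pathfinish_def)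
  define L where "L = enn2real (curve_length dist c)"
  have L: "ennreal L = curve_length dist c" 
    using order.strict_trans[OF c(5) ennreal_less_top] by (simp add: L_def)
  have "L < \<rho>" using c(5) L \<rho>(1) by (metis L_def ennreal_less_iff enn2real_nonneg)
  have dL: "dist (p u) (c t) \<le> L" if "t \<in> {0..1}" for t
    using curve_length_ge[OF that, of dist c] c(3) by (simp flip: L) (simp add: L_def)
  obtain h where h: "path h" "path_image h \<subseteq> C" "h 0 = u" "\<And>t. t \<in> {0..1} \<Longrightarrow> p (h t) = c t"
    using metric_covering_lift_path[OF cov assms(1) c(1,2,3)] by blast
  have "hdist u (h 1) \<le> L"
  proof (rule close_lifts[of "\<lambda>_. u" h])
    show "continuous_on {0..1} h" using h(1) by (simp add: path_def)
    show "h \<in> {0..1} \<rightarrow> C" using h(2) by (auto simp: path_image_def)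
  qed (use h assms dL \<open>L < \<rho>\<close> \<rho> C_uhpD in auto)
  moreover have h1: "h 1 \<in> C" "p (h 1) = y" using h c by (auto simp: path_image_def)
  ultimately have "hdist u (h 1) = dist (p u) y" using \<rho>(2)[OF assms(1) h1(1)] \<open>L < \<rho>\<close> by simp
  then show ?thesis using that h1 by blast
qed

text \<open>Proper discontinuity: the points \<open>h n l\<close> belong to one fibre and approach
  \<open>v\<close>, while fibres are separated by \<open>\<rho>\<close>.\<close>

lemma deck_sequence_const:
  assumes "\<And>n. h n \<in> Deck" "\<And>n. w n \<in> C" "w \<longlonglongrightarrow> l" "l \<in> C" "(\<lambda>n. h n (w n)) \<longlonglongrightarrow> v" "v \<in> C"
  obtains J where "\<And>n. n \<ge> J \<Longrightarrow> h n l = v"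
proof -
  have "(\<lambda>n. hdist l (w n)) \<longlonglongrightarrow> 0" "(\<lambda>n. hdist v (h n (w n))) \<longlonglongrightarrow> 0"
    using assms C_uhpD deck_C by (intro tendsto_hdist; simp)+
  then have t: "(\<lambda>n. hdist l (w n) + hdist v (h n (w n))) \<longlonglongrightarrow> 0 + 0" by (rule tendsto_add)
  have b: "hdist v (h n l) \<le> hdist l (w n) + hdist v (h n (w n))" for n
  proof -
    have "hdist v (h n l) \<le> hdist v (h n (w n)) + hdist (h n (w n)) (h n l)"
      using assms C_uhpD deck_C by (intro hdist_triangle) auto
    also have "hdist (h n (w n)) (h n l) = hdist l (w n)"
      using deck_isometry[OF assms(1)] assms hdist_commute C_uhpD by metis
    finally show ?thesis by simp
  qed
  have "\<forall>\<^sub>F n in sequentially. hdist l (w n) + hdist v (h n (w n)) < \<rho> / 2"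
    using order_tendstoD(2)[OF t, of "\<rho> / 2"] \<rho>(1) by simp
  then obtain J where J: "\<And>n. n \<ge> J \<Longrightarrow> hdist l (w n) + hdist v (h n (w n)) < \<rho> / 2"
    by (auto simp: eventually_sequentially)
  have hJ: "h n l = h J l" if "n \<ge> J" for n
  proof (rule fibre_separated)
    have "hdist (h n l) (h J l) \<le> hdist (h n l) v + hdist v (h J l)"
      using assms C_uhpD deck_C by (intro hdist_triangle) auto
    also have "\<dots> = hdist v (h n l) + hdist v (h J l)" using hdist_commute assms C_uhpD deck_C by simp
    also have "\<dots> < \<rho>" using b[of n] b[of J] J[OF that] J[of J] by simp
    finally show "hdist (h n l) (h J l) < \<rho>" .
  qed (use assms deck_C deck_p in auto)
  have "hdist v (h J l) \<le> 0"
  proof (rule LIMSEQ_le_const[OF t[simplified]])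
    show "\<exists>N. \<forall>n\<ge>N. hdist v (h J l) \<le> hdist l (w n) + hdist v (h n (w n))"
      using b hJ by metis
  qed
  then have "h J l = v" using hdist_eq_0_iff[of v "h J l"] hdist_nonneg[of v "h J l"] assms C_uhpD deck_C by auto
  then show ?thesis using that hJ by metis
qed

lemma compact_subseq:
  assumes "\<And>n. w n \<in> C" "u \<in> uhp" "\<And>n. hdist u (w n) \<le> R"
  obtains l f where "l \<in> C" "strict_mono (f :: nat \<Rightarrow> nat)" "(w \<circ> f) \<longlonglongrightarrow> l"
proof -
  have "\<forall>n. w n \<in> {z\<in>C. hdist u z \<le> R}" using assms by auto
  then show ?thesis using compact_C_hcball[OF assms(2), of R] that unfolding compact_def
    by (metis (no_types, lifting) mem_Collect_eq)
qed


section \<open>Closed curves and deck transformations\<close>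

text \<open>Passing to another lift of \<open>\<gamma>\<close> conjugates \<open>g\<close>, so this
  is the correspondence between free homotopy classes and conjugacy classes of the deck group,
  without base points.\<close>

definition represents :: "(real \<Rightarrow> 'a) \<Rightarrow> (complex \<Rightarrow> complex) \<Rightarrow> bool" where
  "represents \<gamma> g \<longleftrightarrow> (\<exists>\<sigma>. continuous_on {0..1} \<sigma> \<and> \<sigma> \<in> {0..1} \<rightarrow> C \<and> (\<forall>t\<in>{0..1}. p (\<sigma> t) = \<gamma> t) \<and> \<sigma> 1 = g (\<sigma> 0))"

text \<open>The two lateral edges of the lifted homotopy cover the same path; they differ by
  \<open>g\<close> at one end, hence also at the other.\<close>

lemma represents_homotopic:
  assumes "represents \<gamma> g" "g \<in> Deck" "homotopic_loops Sg \<gamma> \<gamma>'"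
  shows "represents \<gamma>' g"
proof -
  obtain \<sigma> where s: "continuous_on {0..1} \<sigma>" "\<sigma> \<in> {0..1} \<rightarrow> C" "\<And>t. t \<in> {0..1} \<Longrightarrow> p (\<sigma> t) = \<gamma> t" "\<sigma> 1 = g (\<sigma> 0)"
    using assms(1) unfolding represents_def by blast
  have "\<exists>h :: real \<times> real \<Rightarrow> 'a. continuous_on ({0..1} \<times> {0..1}) h \<and> h \<in> ({0..1} \<times> {0..1}) \<rightarrow> Sg \<and>
      (\<forall>x\<in>{0..1}. h (0, x) = \<gamma> x) \<and> (\<forall>x\<in>{0..1}. h (1, x) = \<gamma>' x) \<and> (\<forall>t\<in>{0..1}. h (t, 1) = h (t, 0))"
    using assms(3) unfolding homotopic_loops pathfinish_def pathstart_def o_def .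
  then obtain h :: "real \<times> real \<Rightarrow> 'a" where h': "continuous_on ({0..1} \<times> {0..1}) h \<and> h \<in> ({0..1} \<times> {0..1}) \<rightarrow> Sg \<and>
      (\<forall>x\<in>{0..1}. h (0, x) = \<gamma> x) \<and> (\<forall>x\<in>{0..1}. h (1, x) = \<gamma>' x) \<and> (\<forall>t\<in>{0..1}. h (t, 1) = h (t, 0))" ..
  have h: "continuous_on ({0..1} \<times> {0..1}) h" "h \<in> ({0..1} \<times> {0..1}) \<rightarrow> Sg"
    "\<And>x. x \<in> {0..1} \<Longrightarrow> h (0, x) = \<gamma> x" "\<And>x. x \<in> {0..1} \<Longrightarrow> h (1, x) = \<gamma>' x"
    "\<And>t. t \<in> {0..1} \<Longrightarrow> h (t, 1) = h (t, 0)"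
    using h' by blast+
  obtain k where k: "continuous_on ({0..1} \<times> {0..1}) k" "k \<in> ({0..1} \<times> {0..1}) \<rightarrow> C"
    "\<And>y. y \<in> {0..1} \<Longrightarrow> k (0, y) = \<sigma> y" "\<And>z. z \<in> {0..1} \<times> {0..1} \<Longrightarrow> h z = p (k z)"
    using metric_covering_lift_homotopy[OF cov h(1,2) _ s(1,2)] h(3) s(3) by metis
  have kC: "k (a, b) \<in> C" if "a \<in> {0..1}" "b \<in> {0..1}" for a b using k(2) that by auto
  have ck: "continuous_on {0..1} (\<lambda>x. k (u x, v x))"
    if "continuous_on {0..1} u" "continuous_on {0..1} v" "u \<in> {0..1} \<rightarrow> {0..1}" "v \<in> {0..1} \<rightarrow> {0..1}" for u v :: "real \<Rightarrow> real"
    by (rule continuous_on_compose2[OF k(1)]) (use that in \<open>auto intro!: continuous_intros\<close>)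
  have "k (1, 1) = g (k (1, 0))"
  proof (rule lift_unique[of "{0..1::real}" 0 1 "\<lambda>s. k (s, 1)" "\<lambda>s. g (k (s, 0))"])
    show "continuous_on {0..1} (\<lambda>s. k (s, 1))" by (rule ck) (auto intro: continuous_intros)
    show "continuous_on {0..1} (\<lambda>s. g (k (s, 0)))"
      by (rule continuous_on_compose2[OF deck_cont[OF assms(2)] ck]) (use kC in \<open>auto intro: continuous_intros\<close>)
    show "k (0, 1) = g (k (0, 0))" using k(3) s(4) by simp
    show "p (k (y, 1)) = p (g (k (y, 0)))" if "y \<in> {0..1}" for y
      using deck_p[OF assms(2)] kC that h(5)[OF that] k(4)[of "(y, 1)"] k(4)[of "(y, 0)"] by simp
  qed (use kC deck_C[OF assms(2)] in auto)
  moreover have "continuous_on {0..1} (\<lambda>t. k (1, t))" by (rule ck) (auto intro: continuous_intros)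
  ultimately show ?thesis
    unfolding represents_def using kC k(4) h(4)
    by (intro exI[of _ "\<lambda>t. k (1, t)"] conjI ballI) (auto simp flip: k(4))
qed

text \<open>Joining the lifts pointwise by geodesic segments is a homotopy in the convex set
  \<open>C\<close>. It descends to a homotopy of loops because deck transformations commute with
  \<open>hmix\<close>.\<close>

lemma represents_imp_homotopic:
  assumes "represents \<gamma> g" "represents \<gamma>' g" "g \<in> Deck"
  shows "homotopic_loops Sg \<gamma> \<gamma>'"
proof -
  obtain \<sigma> where s: "continuous_on {0..1} \<sigma>" "\<sigma> \<in> {0..1} \<rightarrow> C" "\<And>t. t \<in> {0..1} \<Longrightarrow> p (\<sigma> t) = \<gamma> t" "\<sigma> 1 = g (\<sigma> 0)"
    using assms(1) unfolding represents_def by blast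
  obtain \<sigma>' where s': "continuous_on {0..1} \<sigma>'" "\<sigma>' \<in> {0..1} \<rightarrow> C" "\<And>t. t \<in> {0..1} \<Longrightarrow> p (\<sigma>' t) = \<gamma>' t" "\<sigma>' 1 = g (\<sigma>' 0)"
    using assms(2) unfolding represents_def by blast
  define h where "h q = p (hmix (fst q) (\<sigma> (snd q)) (\<sigma>' (snd q)))" for q :: "real \<times> real"
  have sC: "\<sigma> t \<in> C" "\<sigma>' t \<in> C" if "t \<in> {0..1}" for t using s s' that by auto
  have mC: "hmix a (\<sigma> t) (\<sigma>' t) \<in> C" if "t \<in> {0..1}" "a \<in> {0..1}" for a t
    using hyp_convex_hmix[OF conv] sC that by blast
  have c: "continuous_on ({0..1} \<times> {0..1}) (\<lambda>q. hmix (fst q) (\<sigma> (snd q)) (\<sigma>' (snd q)))"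
  proof (intro continuous_intros)
    show "continuous_on ({0..1} \<times> {0..1}) (\<lambda>q. \<sigma> (snd q))" for A :: "real set"
      by (rule continuous_on_compose2[OF s(1)]) (auto intro: continuous_intros)
    show "continuous_on ({0..1} \<times> {0..1}) (\<lambda>q. \<sigma>' (snd q))" for A :: "real set"
      by (rule continuous_on_compose2[OF s'(1)]) (auto intro: continuous_intros)
  qed (use sC C_uhpD in auto)
  show ?thesis
    unfolding homotopic_loops
  proof (intro exI[of _ h] conjI ballI)
    show "continuous_on ({0..1} \<times> {0..1}) h"
      unfolding h_def by (rule continuous_on_compose2[OF cont_p c]) (use mC in auto)
    show "h \<in> {0..1} \<times> {0..1} \<rightarrow> Sg" using mC p_Sg by (auto simp: h_def)
    show "h (0, x) = \<gamma> x" if "x \<in> {0..1}" for x using sC[OF that] C_uhpD s(3)[OF that] by (simp add: h_def hmix_0)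
    show "h (1, x) = \<gamma>' x" if "x \<in> {0..1}" for x using sC[OF that] C_uhpD s'(3)[OF that] by (simp add: h_def hmix_1)
    show "pathfinish (h \<circ> Pair t) = pathstart (h \<circ> Pair t)" if "t \<in> {0..1}" for t
    proof -
      have 0: "(0::real) \<in> {0..1}" by simp
      have "h (t, 1) = p (g (hmix t (\<sigma> 0) (\<sigma>' 0)))"
        using deck_hmix[OF assms(3) sC(1)[OF 0] sC(2)[OF 0] that] by (simp add: h_def s(4) s'(4))
      also have "\<dots> = h (t, 0)" using deck_p[OF assms(3) mC[OF 0 that]] by (simp add: h_def)
      finally show ?thesis by (simp add: pathfinish_def pathstart_def)
    qed
  qed
qed

lemma represents_exists:
  assumes "g \<in> Deck" "z \<in> C"
  obtains \<gamma> where "represents \<gamma> g" "path \<gamma>" "path_image \<gamma> \<subseteq> Sg" "pathfinish \<gamma> = pathstart \<gamma>"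
proof -
  have u: "z \<in> uhp" "g z \<in> uhp" "g z \<in> C" using assms deck_C C_uhpD by auto
  have c: "continuous_on {0..1} (\<lambda>t. hmix t z (g z))" using u by (intro continuous_intros) auto
  have m: "hmix t z (g z) \<in> C" if "t \<in> {0..1}" for t using hyp_convex_hmix[OF conv assms(2) u(3) that] .
  have "represents (\<lambda>t. p (hmix t z (g z))) g"
    unfolding represents_def
    by (rule exI[of _ "\<lambda>t. hmix t z (g z)"]) (use c m u in \<open>auto simp: hmix_0 hmix_1\<close>)
  moreover have "path (\<lambda>t. p (hmix t z (g z)))"
    unfolding path_def by (rule continuous_on_compose2[OF cont_p c]) (use m in auto)
  moreover have "path_image (\<lambda>t. p (hmix t z (g z))) \<subseteq> Sg"
    using m p_Sg by (auto simp: path_image_def)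
  moreover have "pathfinish (\<lambda>t. p (hmix t z (g z))) = pathstart (\<lambda>t. p (hmix t z (g z)))"
    using u assms C_uhpD deck_p[OF assms] by (simp add: pathfinish_def pathstart_def hmix_0 hmix_1)
  ultimately show ?thesis using that by blast
qed

section \<open>Closed geodesics of the compact surface\<close>

text \<open>A minimising sequence may run through infinitely many copies of a fundamental set. Its
  points are moved into a compact set at the price of conjugating \<open>g\<close>, and proper
  discontinuity makes the conjugates eventually agree at the limit point.\<close>

lemma min_displacement:
  assumes g: "g \<in> Deck"
  obtains z where "z \<in> C" "\<And>w. w \<in> C \<Longrightarrow> hdist z (g z) \<le> hdist w (g w)"
proof -
  obtain K where K: "compact K" "K \<subseteq> C" "p ` K = Sg" using fundamental_compact .
  define m where "m = (INF z\<in>C. hdist z (g z))"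
  have gC: "g z \<in> C" "z \<in> uhp" "g z \<in> uhp" if "z \<in> C" for z using that deck_C[OF g] C_uhpD by auto
  have C0: "C \<noteq> {}" using pC Sg_nonempty by auto
  have bdd: "bdd_below ((\<lambda>z. hdist z (g z)) ` C)"
    by (rule bdd_belowI[of _ 0]) (use gC hdist_nonneg in auto)
  have ml: "m \<le> hdist z (g z)" if "z \<in> C" for z unfolding m_def using bdd that by (rule cINF_lower)
  have "\<exists>z\<in>C. hdist z (g z) < m + 1 / Suc n" for n
  proof -
    have "m < m + 1 / Suc n" by simp
    then show ?thesis unfolding m_def using cINF_less_iff[OF C0 bdd] by blast
  qed
  then obtain z where z: "\<And>n. z n \<in> C" "\<And>n. hdist (z n) (g (z n)) < m + 1 / Suc n" by metis
  have "\<exists>\<tau>. \<tau> \<in> Deck \<and> \<tau> (z n) \<in> K" for n using deck_to_K[OF K(2,3) z(1)] by metis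
  then obtain \<tau> where t: "\<And>n. \<tau> n \<in> Deck" "\<And>n. \<tau> n (z n) \<in> K" by metis
  have "\<exists>\<tau>'. \<tau>' \<in> Deck \<and> (\<forall>z\<in>C. \<tau>' (\<tau> n z) = z \<and> \<tau> n (\<tau>' z) = z)" for n using deck_inv[OF t(1)] by metis
  then obtain \<tau>' where t': "\<And>n. \<tau>' n \<in> Deck" "\<And>n z. z \<in> C \<Longrightarrow> \<tau>' n (\<tau> n z) = z" "\<And>n z. z \<in> C \<Longrightarrow> \<tau> n (\<tau>' n z) = z"
    by metis
  define h where "h n = (\<lambda>z. \<tau> n (g (\<tau>' n z)))" for n
  have h: "h n \<in> Deck" for n
    unfolding h_def using deck_comp[OF t(1) deck_comp[OF g t'(1)]] .
  define w where "w n = \<tau> n (z n)" for n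
  have w: "w n \<in> K" "w n \<in> C" for n using t K by (auto simp: w_def)
  have dw: "hdist (w n) (h n (w n)) < m + 1 / Suc n" for n
    using z[of n] t'(2) deck_isometry[OF t(1)] gC by (simp add: w_def h_def)
  obtain l f where l: "l \<in> K" "strict_mono f" "(w \<circ> f) \<longlonglongrightarrow> l"
    using K(1) w(1) unfolding compact_def by metis
  have lC: "l \<in> C" using l K by auto
  have wl: "(\<lambda>n. hdist l (w (f n))) \<longlonglongrightarrow> 0"
    using tendsto_hdist[of l "w \<circ> f"] l lC w C_uhpD by (simp add: o_def)
  then obtain B where B: "\<And>n. \<bar>hdist l (w (f n))\<bar> \<le> B"
    using convergent_imp_Bseq[of "\<lambda>n. hdist l (w (f n))"] unfolding convergent_def Bseq_def
    by (metis real_norm_def)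
  have hb: "hdist l (h (f n) (w (f n))) \<le> B + (m + 1)" for n
  proof -
    have "hdist l (h (f n) (w (f n))) \<le> hdist l (w (f n)) + hdist (w (f n)) (h (f n) (w (f n)))"
      using lC w deck_C[OF h] C_uhpD by (intro hdist_triangle) auto
    moreover have "1 / real (Suc (f n)) \<le> 1" by simp
    ultimately show ?thesis using B[of n] dw[of "f n"] by linarith
  qed
  obtain v f' where v: "v \<in> C" "strict_mono f'" "((\<lambda>n. h (f n) (w (f n))) \<circ> f') \<longlonglongrightarrow> v"
    using compact_subseq[of "\<lambda>n. h (f n) (w (f n))", OF _ _ hb] deck_C[OF h w(2)] lC C_uhpD by metis
  let ?f = "f \<circ> f'"
  have wl': "(w \<circ> ?f) \<longlonglongrightarrow> l" using LIMSEQ_subseq_LIMSEQ[OF l(3) v(2)] by (simp add: o_assoc)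
  obtain J where J: "\<And>n. n \<ge> J \<Longrightarrow> h (?f n) l = v"
    using deck_sequence_const[of "\<lambda>n. h (?f n)" "\<lambda>n. w (?f n)" l v] h w wl' lC v by (auto simp: o_def)
  have "hdist l v \<le> m"
  proof -
    have e: "hdist l v \<le> 2 * hdist l (w (?f n)) + m + 1 / Suc n" if "n \<ge> J" for n
    proof -
      have "hdist l v \<le> hdist l (w (?f n)) + hdist (w (?f n)) v"
        using lC w v C_uhpD by (intro hdist_triangle) auto
      also have "hdist (w (?f n)) v \<le> hdist (w (?f n)) (h (?f n) (w (?f n))) + hdist (h (?f n) (w (?f n))) v"
        using w v deck_C[OF h] C_uhpD by (intro hdist_triangle) auto
      also have "hdist (h (?f n) (w (?f n))) v = hdist l (w (?f n))"
        using deck_isometry[OF h w(2) lC, of "?f n" "?f n"] J[OF that] hdist_commute lC w C_uhpD by metis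
      finally have 1: "hdist l v \<le> 2 * hdist l (w (?f n)) + hdist (w (?f n)) (h (?f n) (w (?f n)))" by simp
      have "n \<le> ?f n" using seq_suble[OF strict_mono_o[OF l(2) v(2)]] by simp
      then have "1 / real (Suc (?f n)) \<le> 1 / real (Suc n)" by (intro divide_left_mono) auto
      then show ?thesis using 1 dw[of "?f n"] by linarith
    qed
    have "(\<lambda>n. hdist l (w (?f n))) \<longlonglongrightarrow> 0"
      using LIMSEQ_subseq_LIMSEQ[OF wl v(2)] by (simp add: o_def)
    then have "(\<lambda>n. 2 * hdist l (w (?f n)) + m + 1 / real (Suc n)) \<longlonglongrightarrow> 2 * 0 + m + 0"
      by (intro tendsto_intros LIMSEQ_Suc[OF lim_1_over_n])
    then have "hdist l v \<le> 2 * 0 + m + 0" by (rule LIMSEQ_le_const) (use e in blast)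
    then show ?thesis by simp
  qed
  \<comment> \<open>Undoing the conjugation turns the limit point into a minimiser for
    \<open>g\<close> itself.\<close>
  define x where "x = \<tau>' (?f J) l"
  have x: "x \<in> C" using deck_C[OF t'(1) lC] by (simp add: x_def)
  have "hdist x (g x) = hdist (\<tau> (?f J) x) (\<tau> (?f J) (g x))" using deck_isometry[OF t(1) x] gC x by simp
  also have "\<dots> = hdist l (h (?f J) l)" using t'(3)[OF lC] by (simp add: x_def h_def)
  also have "\<dots> = hdist l v" using J by simp
  finally have "hdist x (g x) \<le> m" using \<open>hdist l v \<le> m\<close> by simp
  then show ?thesis using that[OF x] ml by (meson order_trans)
qed


text \<open>Integer exponents allow an axis to be followed in both directions.\<close>

lemma deck_powers:
  assumes g: "g \<in> Deck"
  obtains G :: "int \<Rightarrow> complex \<Rightarrow> complex" where "\<And>n. G n \<in> Deck" "\<And>z. z \<in> C \<Longrightarrow> G 0 z = z"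
    "\<And>n z. z \<in> C \<Longrightarrow> G (n + 1) z = g (G n z)" "\<And>n z. z \<in> C \<Longrightarrow> G n (g z) = g (G n z)"
proof -
  obtain h where h: "h \<in> Deck" "\<And>z. z \<in> C \<Longrightarrow> h (g z) = z" "\<And>z. z \<in> C \<Longrightarrow> g (h z) = z"
    using deck_inv[OF g] by metis
  have pow: "(f ^^ n) \<in> Deck" if f: "f \<in> Deck" for f and n :: nat
  proof (induction n)
    case 0
    then show ?case using deck_id by (simp add: id_def)
  next
    case (Suc n)
    then show ?case using deck_comp[OF f Suc] by (simp add: o_def)
  qed
  define G where "G n = (if n \<ge> 0 then g ^^ nat n else h ^^ nat (- n))" for n :: int
  have GD: "G n \<in> Deck" for n unfolding G_def using pow g h by auto
  have G0: "G 0 z = z" for z by (simp add: G_def)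
  have G1: "G (n + 1) z = g (G n z)" if z: "z \<in> C" for n z
  proof (cases "n \<ge> 0")
    case True
    then show ?thesis by (simp add: G_def nat_add_distrib)
  next
    case False
    then have "nat (- n) = Suc (nat (- (n + 1)))" by simp
    then have "G n z = h ((h ^^ nat (- (n + 1))) z)" using False by (simp add: G_def)
    moreover have "(h ^^ nat (- (n + 1))) z \<in> C" using deck_C[OF pow[OF h(1)] z] .
    ultimately have "g (G n z) = (h ^^ nat (- (n + 1))) z" using h(3) by simp
    also have "\<dots> = G (n + 1) z"
    proof (cases "n + 1 = 0")
      case True
      then show ?thesis by (simp add: G_def)
    next
      case F: False
      then show ?thesis using False by (simp add: G_def)
    qed
    finally show ?thesis by simp
  qed
  have "G n (g z) = g (G n z)" if z: "z \<in> C" for n z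
  proof (induction n rule: int_induct[where k = 0])
    case base
    then show ?case by (simp add: G0)
  next
    case (step1 i)
    then show ?case using G1 z deck_C[OF g z] by simp
  next
    case (step2 i)
    have "g (G (i - 1) (g z)) = G i (g z)" using G1[of "g z" "i - 1"] deck_C[OF g z] by simp
    also have "\<dots> = g (G i z)" using step2 by simp
    also have "\<dots> = g (g (G (i - 1) z))" using G1[of z "i - 1"] z by simp
    finally show ?case using h(2) deck_C GD g z by metis
  qed
  then show ?thesis using that GD G0 G1 by blast
qed

text \<open>The translates of a segment from a point of least displacement to its image form an
  axis. There are no corners at the junctions: a shortcut would produce a point that is moved by
  less than \<open>l\<close>.\<close>

lemma closed_geodesic_exists:
  assumes g: "g \<in> Deck" and free: "\<And>z. z \<in> C \<Longrightarrow> g z \<noteq> z"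
  obtains c l where "closed_geodesic Sg dist c l" "represents (\<lambda>t. c (l * t)) g"
proof -
  obtain z where z: "z \<in> C" "\<And>w. w \<in> C \<Longrightarrow> hdist z (g z) \<le> hdist w (g w)"
    using min_displacement[OF g] by blast
  define l where "l = hdist z (g z)"
  have gz: "g z \<in> C" using deck_C[OF g z(1)] .
  have l: "l > 0" using free[OF z(1)] hdist_eq_0_iff[of z "g z"] hdist_nonneg[of z "g z"] z gz C_uhpD
    unfolding l_def by fastforce
  obtain k0 where k0: "k0 \<in> unit_geodesics uhp" "k0 0 = z" "k0 l = g z"
    using geodesic_through[of z "g z"] z gz C_uhpD unfolding l_def by blast
  have k0C: "k0 t \<in> C" if "0 \<le> t" "t \<le> l" for t
    using hyp_convex_geodesic[OF conv k0(1), of 0 l t] k0 z gz that by simp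
  have k0d: "hdist (k0 s) (k0 t) = \<bar>s - t\<bar>" for s t using k0(1) by (auto simp: unit_geodesics_def)
  obtain G :: "int \<Rightarrow> complex \<Rightarrow> complex" where G: "\<And>n. G n \<in> Deck" "\<And>z. z \<in> C \<Longrightarrow> G 0 z = z"
    "\<And>n z. z \<in> C \<Longrightarrow> G (n + 1) z = g (G n z)" "\<And>n z. z \<in> C \<Longrightarrow> G n (g z) = g (G n z)"
    using deck_powers[OF g] by blast
  \<comment> \<open>The remainder modulo \<open>l\<close>: \<open>k t\<close> is read off on the
    initial segment and carried over by a power of \<open>g\<close>.\<close>
  define r where "r t = t - l * of_int \<lfloor>t / l\<rfloor>" for t
  have r: "0 \<le> r t" "r t < l" for t
  proof -
    have "of_int \<lfloor>t / l\<rfloor> \<le> t / l" "t / l < of_int \<lfloor>t / l\<rfloor> + 1" by linarith+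
    then have "of_int \<lfloor>t / l\<rfloor> * l \<le> t" "t < (of_int \<lfloor>t / l\<rfloor> + 1) * l"
      using l by (simp_all only: pos_le_divide_eq pos_divide_less_eq)
    then show "0 \<le> r t" "r t < l" by (simp_all add: r_def algebra_simps)
  qed
  define k where "k t = G \<lfloor>t / l\<rfloor> (k0 (r t))" for t
  have kC: "k t \<in> C" for t unfolding k_def using deck_C[OF G(1)] k0C r by (simp add: less_imp_le)
  have fl: "\<lfloor>(t + l) / l\<rfloor> = \<lfloor>t / l\<rfloor> + 1" for t using l by (simp add: add_divide_distrib)
  have kl: "k (t + l) = g (k t)" for t
  proof -
    have "r (t + l) = r t" unfolding r_def fl by (simp add: algebra_simps)
    then show ?thesis unfolding k_def fl using G(3)[OF k0C[OF r(1) less_imp_le[OF r(2)]]] by simp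
  qed
  have le: "hdist (k s) (k t) \<le> t - s" if st: "s \<le> t" "t \<le> s + l" for s t
  proof -
    have "s / l \<le> t / l" "t / l \<le> s / l + 1" using st l by (simp_all add: field_simps)
    then have "\<lfloor>s / l\<rfloor> \<le> \<lfloor>t / l\<rfloor>" "\<lfloor>t / l\<rfloor> \<le> \<lfloor>s / l\<rfloor> + 1" by (auto simp: floor_mono) linarith
    then consider "\<lfloor>t / l\<rfloor> = \<lfloor>s / l\<rfloor>" | "\<lfloor>t / l\<rfloor> = \<lfloor>s / l\<rfloor> + 1" by linarith
    then show ?thesis
    proof cases
      case 1
      have "hdist (k s) (k t) = hdist (k0 (r s)) (k0 (r t))"
        unfolding k_def 1 using deck_isometry[OF G(1)] k0C r by (simp add: less_imp_le)
      also have "\<dots> = t - s" using st by (simp add: k0d r_def 1)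
      finally show ?thesis by simp
    next
      case 2
      define n where "n = \<lfloor>s / l\<rfloor>"
      have "G n (k0 l) = G (n + 1) (k0 0)" using G(3,4) z k0 by simp
      then have "hdist (k s) (k t) \<le> hdist (G n (k0 (r s))) (G n (k0 l)) + hdist (G (n + 1) (k0 0)) (G (n + 1) (k0 (r t)))"
        unfolding k_def 2 n_def[symmetric]
        using hdist_triangle[of "G n (k0 (r s))" "G n (k0 l)" "G (n + 1) (k0 (r t))"] C_uhpD deck_C[OF G(1)] k0C r l
        by (simp add: less_imp_le)
      also have "\<dots> = hdist (k0 (r s)) (k0 l) + hdist (k0 0) (k0 (r t))"
        using deck_isometry[OF G(1)] k0C r l by (simp add: less_imp_le)
      also have "\<dots> = (l - r s) + r t" using r[of s] r[of t] by (simp add: k0d)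
      also have "\<dots> = t - s" by (simp add: r_def 2 algebra_simps)
      finally show ?thesis .
    qed
  qed
  have eq: "hdist (k s) (k t) = t - s" if st: "s \<le> t" "t \<le> s + l" for s t
  proof -
    \<comment> \<open>The point \<open>k s\<close> is moved by at least \<open>l\<close>, and
      neither part of the way is longer than expected; so both are exact.\<close>
    have "l \<le> hdist (k s) (k (s + l))" unfolding kl using z(2)[OF kC, of s] by (simp only: l_def)
    also have "\<dots> \<le> hdist (k s) (k t) + hdist (k t) (k (s + l))"
      using kC C_uhpD by (intro hdist_triangle) auto
    also have "hdist (k t) (k (s + l)) \<le> s + l - t" using le st by simp
    finally show ?thesis using le[OF st] by simp
  qed
  have kd: "hdist (k s) (k t) = \<bar>s - t\<bar>" if "\<bar>s - t\<bar> \<le> l" for s t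
    using eq[of s t] eq[of t s] that hdist_commute[of "k s" "k t"] kC C_uhpD by (cases "s \<le> t") auto
  have "closed_geodesic Sg dist (\<lambda>t. p (k t)) l"
    unfolding closed_geodesic_def
  proof (intro conjI allI l)
    fix t
    show "p (k t) \<in> Sg" using kC p_Sg by blast
    show "p (k (t + l)) = p (k t)" using kl deck_p[OF g kC] by simp
    show "\<exists>e>0. \<forall>s\<in>{t - e<..<t + e}. \<forall>s'\<in>{t - e<..<t + e}. dist (p (k s)) (p (k s')) = \<bar>s - s'\<bar>"
    proof (intro exI[of _ "min (l/2) (\<rho>/2)"] conjI ballI)
      fix s s' assume "s \<in> {t - min (l/2) (\<rho>/2)<..<t + min (l/2) (\<rho>/2)}"
        "s' \<in> {t - min (l/2) (\<rho>/2)<..<t + min (l/2) (\<rho>/2)}"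
      then have "\<bar>s - s'\<bar> < l" "\<bar>s - s'\<bar> < \<rho>" by auto
      then show "dist (p (k s)) (p (k s')) = \<bar>s - s'\<bar>" using kd[of s s'] \<rho>(2)[OF kC kC] by simp
    qed (use l \<rho>(1) in auto)
  qed
  moreover have "represents (\<lambda>t. p (k (l * t))) g"
    unfolding represents_def
  proof (intro exI[of _ "\<lambda>t. k (l * t)"] conjI ballI)
    show "continuous_on {0..1} (\<lambda>t. k (l * t))"
    proof (subst continuous_into_uhp_iff)
      show "\<forall>x\<in>{0..1}. \<forall>e>0. \<exists>r>0. \<forall>y\<in>{0..1}. dist x y < r \<longrightarrow> hdist (k (l * x)) (k (l * y)) < e"
      proof (intro ballI allI impI)
        fix x e :: real assume "e > 0"
        show "\<exists>r>0. \<forall>y\<in>{0..1}. dist x y < r \<longrightarrow> hdist (k (l * x)) (k (l * y)) < e"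
        proof (intro exI[of _ "min 1 (e / l)"] conjI ballI impI)
          fix y assume "dist x y < min 1 (e / l)"
          then have "l * \<bar>x - y\<bar> < l" "l * \<bar>x - y\<bar> < e" using l by (auto simp: dist_real_def field_simps)
          moreover have "\<bar>l * x - l * y\<bar> = l * \<bar>x - y\<bar>" using l by (simp add: abs_mult flip: right_diff_distrib)
          ultimately show "hdist (k (l * x)) (k (l * y)) < e" using kd[of "l * x" "l * y"] by simp
        qed (use l \<open>e > 0\<close> in auto)
      qed
    qed (use kC C_uhpD in auto)
    show "k (l * 1) = g (k (l * 0))" using kl[of 0] by simp
  qed (use kC in auto)
  ultimately show ?thesis using that by blast
qed


section \<open>The boundary of the universal cover\<close>

definition dC :: "complex set" where "dC = {z\<in>C. p z \<in> surface_boundary Sg}"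

lemma dC_C: "z \<in> dC \<Longrightarrow> z \<in> C" by (simp add: dC_def)

lemma deck_dC: "\<tau> \<in> Deck \<Longrightarrow> z \<in> dC \<Longrightarrow> \<tau> z \<in> dC"
  using deck_C deck_p by (simp add: dC_def)

text \<open>The local inverse of \<open>\<phi> \<circ> p\<close> embeds a disc or half-disc
  isometrically and extends to an isometry of the plane, so \<open>C\<close> looks near
  \<open>z\<close> like the range of the chart near \<open>\<i>\<close>. The predicate
  \<open>Q\<close> covers both kinds of charts at once.\<close>

lemma chart_lift:
  assumes z: "z \<in> C" and r: "r > 0" and \<phi>: "\<phi> (p z) = \<i>"
    and iso: "isometric_onto dist {y\<in>Sg. dist (p z) y < r} hdist {w\<in>uhp. hdist \<i> w < r \<and> Q w} \<phi>"
    and Q: "\<And>w. Re w \<ge> 0 \<Longrightarrow> Q w"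
  obtains r' M M' where "r' > 0" "hiso M M'" "M z = \<i>"
    "\<And>u. u \<in> uhp \<Longrightarrow> hdist z u < r' \<Longrightarrow> u \<in> C \<longleftrightarrow> Q (M u)"
proof -
  define r' where "r' = min r (\<rho> / 2)"
  have r': "r' > 0" "r' \<le> r" "r' \<le> \<rho> / 2" using r \<rho>(1) by (auto simp: r'_def)
  define D where "D = {w\<in>uhp. hdist \<i> w < r' \<and> Q w}"
  have Q0: "Q \<i>" by (rule Q) simp
  have bij: "bij_betw \<phi> {y\<in>Sg. dist (p z) y < r} {w\<in>uhp. hdist \<i> w < r \<and> Q w}"
    and isoD: "\<And>y y'. y \<in> Sg \<Longrightarrow> y' \<in> Sg \<Longrightarrow> dist (p z) y < r \<Longrightarrow> dist (p z) y' < r \<Longrightarrow> hdist (\<phi> y) (\<phi> y') = dist y y'"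
    using iso unfolding isometric_onto_def by auto
  have \<phi>i: "hdist \<i> (\<phi> y) = dist (p z) y" if "y \<in> Sg" "dist (p z) y < r" for y
    using isoD[of "p z" y] that r p_Sg[OF z] \<phi> by simp
  have zu: "z \<in> uhp" using z C_uhpD by blast
  have "\<exists>v. v \<in> C \<and> \<phi> (p v) = w \<and> hdist z v = hdist \<i> w" if w: "w \<in> D" for w
  proof -
    have "w \<in> \<phi> ` {y\<in>Sg. dist (p z) y < r}" using bij w r' by (auto simp: bij_betw_def D_def)
    then obtain y where y: "y \<in> Sg" "dist (p z) y < r" "\<phi> y = w" by auto
    have d: "dist (p z) y = hdist \<i> w" using \<phi>i[OF y(1,2)] by (simp add: y(3))
    then have "dist (p z) y < \<rho>" using w r' \<rho>(1) by (simp add: D_def)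
    then obtain v where "v \<in> C" "p v = y" "hdist z v = dist (p z) y" using near_lift[OF z y(1)] by blast
    then show ?thesis using y d by auto
  qed
  then obtain \<psi> where \<psi>: "\<And>w. w \<in> D \<Longrightarrow> \<psi> w \<in> C" "\<And>w. w \<in> D \<Longrightarrow> \<phi> (p (\<psi> w)) = w"
    "\<And>w. w \<in> D \<Longrightarrow> hdist z (\<psi> w) = hdist \<i> w" by metis
  have \<psi>p: "dist (p z) (p (\<psi> w)) = hdist \<i> w" if "w \<in> D" for w
    using \<rho>(2)[OF z \<psi>(1)] \<psi>(3) that r' \<rho>(1) by (simp add: D_def)
  have tri: "hdist u v < \<rho>" if "u \<in> C" "v \<in> C" "hdist z u < r'" "hdist z v < r'" for u v
  proof -
    have "hdist u v \<le> hdist u z + hdist z v" using that z C_uhpD by (intro hdist_triangle) auto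
    then show ?thesis using that hdist_commute[of u z] z C_uhpD r' by simp
  qed
  have \<psi>d: "hdist (\<psi> w) (\<psi> w') = hdist w w'" if "w \<in> D" "w' \<in> D" for w w'
  proof -
    have "hdist (\<psi> w) (\<psi> w') = dist (p (\<psi> w)) (p (\<psi> w'))"
      using \<rho>(2) tri \<psi> that by (simp add: D_def)
    also have "\<dots> = hdist (\<phi> (p (\<psi> w))) (\<phi> (p (\<psi> w')))"
      using isoD[of "p (\<psi> w)" "p (\<psi> w')"] \<psi>p that \<psi>(1) p_Sg r' by (simp add: D_def)
    finally show ?thesis using \<psi>(2) that by simp
  qed
  \<comment> \<open>The frame for \<open>isometry_extends\<close>: a point on the axis and, below, a
    point \<open>f\<close> to its right. Both satisfy \<open>Q\<close> for either kind of
    chart.\<close>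
  define e where "e = r' / 2"
  have ax: "iax e \<in> D" "e \<noteq> 0"
  proof -
    have "hdist \<i> (iax e) = \<bar>0 - e\<bar>" using hdist_iax[of 0 e] unfolding iax_0 .
    moreover have "Q (iax e)" by (rule Q) (simp add: iax_def)
    ultimately show "iax e \<in> D" "e \<noteq> 0" using r'(1) iax(1) unfolding D_def e_def by auto
  qed
  obtain s where s: "s > 0" "\<forall>w\<in>uhp. dist \<i> w < s \<longrightarrow> hdist \<i> w < r'"
    using ball_subset_hball[OF i_uhp r'(1)] by blast
  define f where "f = Complex (s/2) 1"
  have f: "f \<in> uhp" "hV f > 0" using s by (auto simp: f_def uhp_def hV_def)
  have "dist \<i> f = s / 2" using s by (simp add: f_def dist_complex_def cmod_def)
  then have fD: "f \<in> D" using s f by (auto simp: D_def f_def intro!: Q)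
  have iD: "\<i> \<in> D" using r' Q0 by (simp add: D_def)
  obtain M M' where M: "hiso M M'" "\<And>w. w \<in> D \<Longrightarrow> M (\<psi> w) = w"
  proof (rule isometry_extends[of D e f \<psi>])
    show "D \<subseteq> uhp" by (auto simp: D_def)
  qed (use iD ax f fD \<psi> \<psi>d C_uhpD in auto)
  have "hdist z (\<psi> \<i>) = 0" using \<psi>(3)[OF iD] by simp
  then have "\<psi> \<i> = z" using hdist_eq_0_iff[OF zu, of "\<psi> \<i>"] \<psi>(1)[OF iD] C_uhpD by simp
  then have Mz: "M z = \<i>" using M(2)[OF iD] by simp
  have "u \<in> C \<longleftrightarrow> Q (M u)" if u: "u \<in> uhp" "hdist z u < r'" for u
  proof
    assume "Q (M u)"
    moreover have "hdist \<i> (M u) = hdist z u" using hisoD(5)[OF M(1) zu u(1)] Mz by simp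
    ultimately have D: "M u \<in> D" using u hisoD(1)[OF M(1)] by (simp add: D_def)
    have "u = M' (M (\<psi> (M u)))" using M(2)[OF D] hisoD(3)[OF M(1) u(1)] by simp
    then have "u = \<psi> (M u)" using hisoD(3)[OF M(1)] \<psi>(1)[OF D] C_uhpD by simp
    then show "u \<in> C" using \<psi>(1)[OF D] by simp
  next
    assume uC: "u \<in> C"
    have d: "dist (p z) (p u) = hdist z u" using \<rho>(2)[OF z uC] u r' \<rho>(1) by simp
    then have "\<phi> (p u) \<in> {w\<in>uhp. hdist \<i> w < r \<and> Q w}"
      using bij u r' p_Sg[OF uC] by (auto simp: bij_betw_def)
    then have D: "\<phi> (p u) \<in> D" using \<phi>i[OF p_Sg[OF uC]] d u r' by (simp add: D_def)
    have "p (\<psi> (\<phi> (p u))) = p u"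
    proof -
      have "inj_on \<phi> {y\<in>Sg. dist (p z) y < r}" using bij by (simp add: bij_betw_def)
      moreover have "p (\<psi> (\<phi> (p u))) \<in> {y\<in>Sg. dist (p z) y < r}"
        using \<psi>p[OF D] D r' p_Sg \<psi>(1)[OF D] by (simp add: D_def)
      moreover have "p u \<in> {y\<in>Sg. dist (p z) y < r}" using d u r' p_Sg uC by simp
      ultimately show ?thesis using \<psi>(2)[OF D] by (meson inj_onD)
    qed
    moreover have "hdist (\<psi> (\<phi> (p u))) u < \<rho>"
      using tri[OF \<psi>(1)[OF D] uC] \<psi>(3)[OF D] D u by (simp add: D_def)
    ultimately have "\<psi> (\<phi> (p u)) = u" using fibre_separated \<psi>(1)[OF D] uC by blast
    then have "M u = \<phi> (p u)" using M(2)[OF D] by simp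
    then show "Q (M u)" using D by (simp add: D_def)
  qed
  then show ?thesis using that r'(1) M(1) Mz by blast
qed

lemma interior_ball:
  assumes "z \<in> C" "z \<notin> dC"
  obtains r where "r > 0" "\<And>u. u \<in> uhp \<Longrightarrow> hdist z u < r \<Longrightarrow> u \<in> C"
proof -
  have "p z \<in> Sg" "p z \<notin> surface_boundary Sg" using assms p_Sg by (auto simp: dC_def)
  then obtain r \<phi> where "disc_chart Sg dist (p z) r \<phi>"
    using surf unfolding hyperbolic_surface_def surface_boundary_def by blast
  then have "r > 0" "\<phi> (p z) = \<i>"
    "isometric_onto dist {y\<in>Sg. dist (p z) y < r} hdist {w\<in>uhp. hdist \<i> w < r \<and> True} \<phi>"
    by (auto simp: disc_chart_def)
  from chart_lift[OF assms(1) this] show ?thesis using that by metis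
qed

lemma hV_iff: "w \<in> uhp \<Longrightarrow> 0 \<le> Re w \<longleftrightarrow> 0 \<le> hV w"
  by (simp add: hV_def uhp_def zero_le_divide_iff)

lemma half_ball:
  assumes "z \<in> dC"
  obtains r M M' where "r > 0" "hiso M M'" "M z = \<i>"
    "\<And>u. u \<in> uhp \<Longrightarrow> hdist z u < r \<Longrightarrow> u \<in> C \<longleftrightarrow> hV (M u) \<ge> 0"
proof -
  obtain r \<phi> where "half_disc_chart Sg dist (p z) r \<phi>"
    using assms unfolding dC_def surface_boundary_def by blast
  then have "r > 0" "\<phi> (p z) = \<i>"
    "isometric_onto dist {y\<in>Sg. dist (p z) y < r} hdist {w\<in>uhp. hdist \<i> w < r \<and> 0 \<le> Re w} \<phi>"
    by (auto simp: half_disc_chart_def)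
  from chart_lift[OF dC_C[OF assms] this] show ?thesis
    using that hV_iff hisoD(1) by metis
qed

lemma hV_negative_near:
  assumes "hiso M M'" "z \<in> uhp" "hV (M z) = 0" "r > 0"
  obtains u where "u \<in> uhp" "hdist z u < r" "hV (M u) < 0"
proof -
  have Mz: "M z \<in> uhp" using hisoD(1)[OF assms(1,2)] .
  obtain s where s: "s > 0" "\<forall>w\<in>uhp. dist (M z) w < s \<longrightarrow> hdist (M z) w < r"
    using ball_subset_hball[OF Mz assms(4)] by blast
  define w where "w = M z - of_real (s / 2)"
  have w: "w \<in> uhp" using Mz by (simp add: w_def uhp_def)
  have "Re (M z) = 0" using assms(3) Mz by (simp add: hV_def uhp_def)
  then have "hV w < 0" using s w by (simp add: hV_def w_def uhp_def divide_less_0_iff)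
  moreover have "dist (M z) w < s" using s by (simp add: w_def dist_norm)
  then have "hdist (M z) w < r" using s w by blast
  then have "hdist z (M' w) < r"
    using hisoD(5)[OF assms(1,2) hisoD(2)[OF assms(1) w]] hisoD(4)[OF assms(1) w] by simp
  ultimately show ?thesis using that[of "M' w"] hisoD[OF assms(1)] w by simp
qed

text \<open>Along a geodesic from \<open>z\<close> the functional equals
  \<open>A * (exp t - exp (- t))\<close>, so a negative value far away would show up already near
  \<open>z\<close>.\<close>

lemma half_ball_global:
  assumes "hiso M M'" "z \<in> C" "M z = \<i>" "r > 0"
    "\<And>u. u \<in> C \<Longrightarrow> hdist z u < r \<Longrightarrow> hV (M u) \<ge> 0" "u \<in> C"
  shows "hV (M u) \<ge> 0"
proof (rule ccontr)
  assume n: "\<not> hV (M u) \<ge> 0"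
  obtain k where k: "k \<in> unit_geodesics uhp" "k 0 = z" "k (hdist z u) = u"
    using geodesic_through assms C_uhpD by metis
  define d where "d = hdist z u"
  have d: "d > 0" using n assms hdist_nonneg[of z u] hdist_eq_0_iff[of z u] C_uhpD
    by (cases "z = u") (auto simp: d_def order.strict_iff_order)
  obtain A B where AB: "\<And>t. hV (M (k t)) = A * exp t + B * exp (- t)"
    using hlin_geodesic[OF hlin_comp[OF assms(1) hlin_coords(2)] k(1)] by blast
  have "A + B = 0" using AB[of 0] k assms by simp
  then have AB': "hV (M (k t)) = A * (exp t - exp (- t))" for t using AB[of t] by (simp add: algebra_simps eq_neg_iff_add_eq_0[symmetric])
  have "A * (exp d - exp (- d)) < 0" using AB'[of d] n k by (simp add: d_def)
  then have A: "A < 0" using d by (simp add: mult_less_0_iff)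
  define t where "t = min (d / 2) (r / 2)"
  have t: "t > 0" "t < d" "t < r" using d assms(4) by (auto simp: t_def)
  have "k t \<in> C" using hyp_convex_geodesic[OF conv k(1), of 0 d t] k t assms by (simp add: d_def)
  moreover have "hdist z (k t) = t" using k t unfolding unit_geodesics_def
    by (metis (mono_tags, lifting) abs_minus_commute abs_of_pos diff_zero mem_Collect_eq)
  ultimately have "hV (M (k t)) \<ge> 0" using assms(5) t by simp
  then show False using A t AB'[of t] by (simp add: zero_le_mult_iff)
qed

text \<open>The isometry \<open>M\<close>, with inverse \<open>M'\<close>, takes a boundary line to the imaginary axis and \<open>C\<close> to its
  right.\<close>

definition bline :: "(complex \<Rightarrow> complex) \<Rightarrow> (complex \<Rightarrow> complex) \<Rightarrow> bool" where
  "bline M M' \<longleftrightarrow> hiso M M' \<and> (\<forall>u\<in>C. hV (M u) \<ge> 0) \<and> (\<forall>t. M' (iax t) \<in> C)"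

lemma blineD:
  assumes "bline M M'"
  shows "hiso M M'" "u \<in> C \<Longrightarrow> hV (M u) \<ge> 0" "M' (iax t) \<in> C" "M (M' (iax t)) = iax t" "hV (M (M' (iax t))) = 0"
  using assms hisoD(4)[of M M' "iax t"] by (auto simp: bline_def iax)

lemma bline_param:
  assumes "bline M M'" "u \<in> C" "hV (M u) = 0"
  obtains t where "u = M' (iax t)" "M u = iax t"
proof -
  have u: "u \<in> uhp" using assms C_uhpD by blast
  have "M u = iax (ln (hW (M u)))"
    using iax_eqI hisoD(1)[OF blineD(1)[OF assms(1)] u] assms(3) by blast
  then show ?thesis using that hisoD(3)[OF blineD(1)[OF assms(1)] u] by metis
qed

lemma bline_unit_geodesic: "bline M M' \<Longrightarrow> (\<lambda>t. M' (iax t)) \<in> unit_geodesics C"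
  using hiso_iax_unit_geodesic[of M M'] blineD(1,3)[of M M'] by (auto simp: unit_geodesics_def)

text \<open>The functional \<open>hV (M u)\<close> is nonnegative on \<open>C\<close>, so a geodesic
  of \<open>C\<close> meeting the line touches it from inside and runs along it. Nothing crosses a
  boundary line for this reason.\<close>

lemma bline_geodesic:
  assumes "bline M M'" "k \<in> unit_geodesics C" "hV (M (k s)) = 0"
  shows "hV (M (k t)) = 0"
  by (rule hlin_geodesic_nonneg_zero[OF hlin_comp[OF blineD(1)[OF assms(1)] hlin_coords(2)]
        unit_geodesics_uhp[OF assms(2) C_uhp] assms(3), of 1])
     (use assms(2) blineD(2)[OF assms(1)] in \<open>auto simp: unit_geodesics_def\<close>)

lemma bline_not_interior:
  assumes "bline M M'" "u \<in> C" "hV (M u) = 0" "r > 0"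
  shows "\<exists>v. v \<in> uhp \<and> hdist u v < r \<and> v \<notin> C"
proof -
  obtain v where "v \<in> uhp" "hdist u v < r" "hV (M v) < 0"
    using hV_negative_near[OF blineD(1)[OF assms(1)] C_uhpD[OF assms(2)] assms(3,4)] by blast
  then show ?thesis using blineD(2)[OF assms(1), of v] by force
qed

lemma bline_dC:
  assumes "bline M M'" "u \<in> C" "hV (M u) = 0"
  shows "u \<in> dC"
  using interior_ball[OF assms(2)] bline_not_interior[OF assms] by metis

text \<open>The edge of the local half-disc extends to a complete geodesic in \<open>C\<close>: the
  parameters at which it lies in \<open>C\<close> form a closed set, which is also open because each
  such point is again a boundary point whose own half-disc is aligned with the line.\<close>

lemma boundary_line:
  assumes "z \<in> dC"
  obtains r M M' where "r > 0" "bline M M'" "M z = \<i>"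
    "\<And>u. u \<in> uhp \<Longrightarrow> hdist z u < r \<Longrightarrow> u \<in> C \<longleftrightarrow> hV (M u) \<ge> 0"
proof -
  obtain r M M' where M: "r > 0" "hiso M M'" "M z = \<i>"
    "\<And>u. u \<in> uhp \<Longrightarrow> hdist z u < r \<Longrightarrow> u \<in> C \<longleftrightarrow> hV (M u) \<ge> 0" using half_ball[OF assms] by blast
  have nonneg: "hV (M u) \<ge> 0" if "u \<in> C" for u
    using half_ball_global[OF M(2) dC_C[OF assms] M(3,1) _ that] M(4) C_uhpD by blast
  let ?k = "\<lambda>t. M' (iax t)"
  have kg: "?k \<in> unit_geodesics uhp" using hiso_iax_unit_geodesic[OF M(2)] .
  have ku: "?k t \<in> uhp" for t using kg by (auto simp: unit_geodesics_def)
  have kd: "hdist (?k s) (?k t) = \<bar>s - t\<bar>" for s t using kg by (auto simp: unit_geodesics_def)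
  have Mk: "M (?k t) = iax t" for t using hisoD(4)[OF M(2)] iax by simp
  define T where "T = {t. ?k t \<in> C}"
  have "open T"
    unfolding open_dist
  proof
    fix t assume "t \<in> T"
    define w where "w = ?k t"
    have w: "w \<in> C" "hV (M w) = 0" using \<open>t \<in> T\<close> by (auto simp: T_def w_def Mk iax)
    have "w \<in> dC"
    proof (rule ccontr)
      assume "w \<notin> dC"
      then obtain s where s: "s > 0" "\<And>u. u \<in> uhp \<Longrightarrow> hdist w u < s \<Longrightarrow> u \<in> C" using interior_ball w by metis
      obtain u where "u \<in> uhp" "hdist w u < s" "hV (M u) < 0"
        using hV_negative_near[OF M(2) C_uhpD[OF w(1)] w(2) s(1)] by blast
      then show False using s nonneg[of u] by force
    qed
    then obtain s N N' where N: "s > 0" "hiso N N'" "N w = \<i>"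
      "\<And>u. u \<in> uhp \<Longrightarrow> hdist w u < s \<Longrightarrow> u \<in> C \<longleftrightarrow> hV (N u) \<ge> 0" using half_ball by blast
    let ?j = "\<lambda>t. N' (iax t)"
    have jg: "?j \<in> unit_geodesics uhp" using hiso_iax_unit_geodesic[OF N(2)] .
    have ju: "?j t \<in> uhp" for t using jg by (auto simp: unit_geodesics_def)
    have j0: "?j 0 = w" using hisoD(3)[OF N(2), of w] w C_uhpD N(3) by (simp add: iax_0)
    have jd: "hdist w (?j t) = \<bar>t\<bar>" for t
    proof -
      have "hdist (?j 0) (?j t) = \<bar>0 - t\<bar>" using jg unfolding unit_geodesics_def by blast
      then show ?thesis by (simp add: j0)
    qed
    have Nj: "hV (N (?j t)) = 0" for t using hisoD(4)[OF N(2)] iax by simp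
    \<comment> \<open>The edge of the second half-disc touches the first line from inside, so it
      runs along that line.\<close>
    have "hV (M (?j t)) = 0" for t
    proof (rule hlin_geodesic_nonneg_zero[OF hlin_comp[OF M(2) hlin_coords(2)] jg _ N(1), of 0])
      show "hV (M (?j 0)) = 0" using w j0 by simp
      fix t assume "\<bar>t - 0\<bar> < s"
      then have "?j t \<in> C" using N(4)[OF ju] jd Nj by simp
      then show "hV (M (?j t)) \<ge> 0" using nonneg by blast
    qed
    then have j1: "M (?j 1) = iax (ln (hW (M (?j 1))))" using iax_eqI hisoD(1)[OF M(2) ju] by blast
    define a where "a = ln (hW (M (?j 1)))"
    have ja: "?j 1 = ?k a" using hisoD(3)[OF M(2) ju] j1 by (metis a_def)
    have "a \<noteq> t" using jd[of 1] kd[of t t] by (auto simp: ja w_def)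
    have Nk: "hV (N (?k x)) = 0" for x
    proof (rule hlin_geodesic_zero[OF hlin_comp[OF N(2) hlin_coords(2)] kg, of t a])
      show "hV (N (?k t)) = 0" using N(3) by (simp add: w_def)
      show "hV (N (?k a)) = 0" using Nj[of 1] ja by simp
    qed (use \<open>a \<noteq> t\<close> in auto)
    have "x \<in> T" if "dist x t < s" for x
      using N(4)[OF ku, of x] kd[of t x] that Nk by (simp add: T_def w_def dist_real_def)
    then show "\<exists>e>0. \<forall>y. dist y t < e \<longrightarrow> y \<in> T" using N(1) by blast
  qed
  moreover have "closed T"
  proof -
    have ck: "continuous_on UNIV ?k"
      by (subst continuous_into_uhp_iff) (use ku kd in \<open>auto simp: dist_real_def\<close>)
    obtain F where "closed F" "C = uhp \<inter> F" using C_closed by (auto simp: closedin_closed)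
    moreover have "T = ?k -` F" using ku calculation by (auto simp: T_def)
    ultimately show ?thesis using continuous_closed_vimage[of F ?k] ck by (simp add: continuous_on_eq_continuous_at)
  qed
  moreover have "0 \<in> T" using hisoD(3)[OF M(2), of z] M(3) dC_C[OF assms] C_uhpD by (simp add: T_def iax_0)
  ultimately have "T = UNIV" using connected_clopen[of "UNIV :: real set"] by (auto simp: connected_UNIV)
  then have "bline M M'" unfolding bline_def using M(2) nonneg by (auto simp: T_def)
  then show ?thesis using that M by blast
qed

end

lemma mob_comp:
  assumes "z \<in> uhp" "a * d - b * c = 1" "a' * d' - b' * c' = 1"
  shows "mob a b c d (mob a' b' c' d' z) =
    mob (a * a' + b * c') (a * b' + b * d') (c * a' + d * c') (c * b' + d * d') z"
proof -
  have D: "(a * a' + b * c') * (c * b' + d * d') - (a * b' + b * d') * (c * a' + d * c') = 1"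
  proof -
    have "(a * a' + b * c') * (c * b' + d * d') - (a * b' + b * d') * (c * a' + d * c')
      = (a * d - b * c) * (a' * d' - b' * c')" by (simp add: algebra_simps)
    then show ?thesis using assms by simp
  qed
  note m1 = mob[OF assms(1,3)]
  note m2 = mob[OF m1(1) assms(2)]
  note m3 = mob[OF assms(1) D]
  show ?thesis
  proof (rule uhp_eqI[OF m2(1) m3(1)])
    show "hU (mob a b c d (mob a' b' c' d' z)) =
      hU (mob (a * a' + b * c') (a * b' + b * d') (c * a' + d * c') (c * b' + d * d') z)"
      unfolding m3(2) m2(2) m1(2-4) by (simp add: power2_eq_square algebra_simps)
    show "hV (mob a b c d (mob a' b' c' d' z)) =
      hV (mob (a * a' + b * c') (a * b' + b * d') (c * a' + d * c') (c * b' + d * d') z)"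
      unfolding m3(3) m2(3) m1(2-4) by (simp add: power2_eq_square algebra_simps)
  qed
qed

text \<open>When \<open>\<i>\<close> is the foot of the perpendicular, the two terms of
  \<open>hB x (iax t)\<close> balance at \<open>t = 0\<close>, so \<open>hU\<close> and
  \<open>hW\<close> agree.\<close>

lemma foot_coords:
  assumes "x \<in> uhp" "\<And>t. hdist x \<i> \<le> hdist x (iax t)" "hV x \<ge> 0"
  shows "hU x = cosh (hdist x \<i>)" "hW x = cosh (hdist x \<i>)" "hV x = sinh (hdist x \<i>)"
proof -
  define D where "D = hdist x \<i>"
  have D: "D \<ge> 0" using hdist_nonneg assms(1) by (simp add: D_def)
  have X: "(hU x + hW x) / 2 = cosh D" using cosh_hdist[OF assms(1) i_uhp] by (simp add: D_def hB_def)
  obtain t where t: "cosh (hdist x (iax t)) = sqrt (1 + (hV x)\<^sup>2)" using cosh_hdist_iax_attained[OF assms(1)] .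
  have "cosh D \<le> cosh (hdist x (iax t))"
    using assms(2)[of t] D by (simp add: D_def cosh_real_nonneg_le_iff)
  then have "cosh D \<le> sqrt (1 + (hV x)\<^sup>2)" using t by simp
  then have "(cosh D)\<^sup>2 \<le> 1 + (hV x)\<^sup>2" proof -
    have "(cosh D)\<^sup>2 \<le> (sqrt (1 + (hV x)\<^sup>2))\<^sup>2"
      by (rule power_mono[OF \<open>cosh D \<le> sqrt (1 + (hV x)\<^sup>2)\<close>]) simp
    then show ?thesis by simp
  qed
  then have "(hU x + hW x)\<^sup>2 \<le> 4 * (hU x * hW x)"
    unfolding X[symmetric] hUW[OF assms(1)] by (simp add: power2_eq_square field_simps)
  then have "(hU x - hW x)\<^sup>2 \<le> 0" by (simp add: power2_eq_square algebra_simps)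
  then have e: "hU x = hW x" by simp
  then show U: "hU x = cosh (hdist x \<i>)" and "hW x = cosh (hdist x \<i>)" using X by (simp_all add: D_def)
  have "(hV x)\<^sup>2 = (sinh D)\<^sup>2"
    using hUW[OF assms(1)] e U cosh_square_eq[of D] by (simp add: D_def power2_eq_square)
  then show "hV x = sinh (hdist x \<i>)" using assms(3) D by (simp add: D_def power2_eq_iff_nonneg)
qed

section \<open>Boundary lines and their stabilisers\<close>

context surface_cover
begin

text \<open>A relation between points takes the place of the set of boundary lines, so that no
  isometry \<open>M\<close> has to be fixed for each line.\<close>

definition sameline :: "complex \<Rightarrow> complex \<Rightarrow> bool" where
  "sameline u v \<longleftrightarrow> (\<exists>M M'. bline M M' \<and> hV (M u) = 0 \<and> hV (M v) = 0)"

lemma bline_same: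
  assumes "bline M M'" "bline N N'" "u \<in> C" "hV (M u) = 0" "hV (N u) = 0" "v \<in> C" "hV (M v) = 0"
  shows "hV (N v) = 0"
proof -
  obtain s t where "u = M' (iax s)" "v = M' (iax t)" using bline_param[OF assms(1)] assms by metis
  then show ?thesis using bline_geodesic[OF assms(2) bline_unit_geodesic[OF assms(1)], of s t] assms by simp
qed

lemma sameline_bline:
  assumes "sameline u v" "u \<in> C" "v \<in> C" "bline N N'" "hV (N u) = 0"
  shows "hV (N v) = 0"
  using assms bline_same unfolding sameline_def by blast

lemma sameline_sym: "sameline u v \<Longrightarrow> sameline v u"
  unfolding sameline_def by blast

lemma sameline_trans:
  assumes "sameline u v" "sameline v w" "u \<in> C" "v \<in> C" "w \<in> C"
  shows "sameline u w"
proof -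
  obtain M M' where M: "bline M M'" "hV (M u) = 0" "hV (M v) = 0" using assms(1) sameline_def by blast
  then show ?thesis using sameline_bline[OF assms(2,4,5) M(1,3)] sameline_def by blast
qed

lemma deck_geodesic: "\<tau> \<in> Deck \<Longrightarrow> k \<in> unit_geodesics C \<Longrightarrow> (\<lambda>t. \<tau> (k t)) \<in> unit_geodesics C"
  using deck_C deck_isometry by (simp add: unit_geodesics_def)

lemma sameline_deck:
  assumes "sameline u v" "\<tau> \<in> Deck" "u \<in> C" "v \<in> C"
  shows "sameline (\<tau> u) (\<tau> v)"
proof -
  obtain M M' where M: "bline M M'" "hV (M u) = 0" "hV (M v) = 0" using assms(1) sameline_def by blast
  obtain s t where st: "u = M' (iax s)" "v = M' (iax t)" using bline_param[OF M(1)] assms M by metis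
  have "u \<in> dC" using bline_dC[OF M(1)] assms M by blast
  then obtain N N' where N: "bline N N'" "N (\<tau> u) = \<i>" using boundary_line[OF deck_dC[OF assms(2)]] by metis
  have "hV (N (\<tau> v)) = 0"
    using bline_geodesic[OF N(1) deck_geodesic[OF assms(2) bline_unit_geodesic[OF M(1)]], of s t] st N by simp
  then show ?thesis using N unfolding sameline_def by (intro exI[of _ N] exI[of _ N']) simp
qed

text \<open>Near \<open>z\<close> the set \<open>C\<close> is a half-disc. A point strictly inside
  it has a full neighbourhood in \<open>C\<close>, which no boundary point has.\<close>

lemma sameline_near:
  assumes "z \<in> dC"
  obtains r where "r > 0" "\<And>v. v \<in> dC \<Longrightarrow> hdist z v < r \<Longrightarrow> sameline z v"
proof -
  obtain r M M' where M: "r > 0" "bline M M'" "M z = \<i>"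
    "\<And>u. u \<in> uhp \<Longrightarrow> hdist z u < r \<Longrightarrow> u \<in> C \<longleftrightarrow> hV (M u) \<ge> 0" using boundary_line[OF assms] by blast
  have "sameline z v" if v: "v \<in> dC" "hdist z v < r" for v
  proof (rule ccontr)
    assume n: "\<not> sameline z v"
    have vC: "v \<in> C" "v \<in> uhp" using v dC_C C_uhpD by auto
    have "hV (M v) \<noteq> 0" using n M unfolding sameline_def by (metis hcoords_i(2))
    then have pos: "hV (M v) > 0" using blineD(2)[OF M(2) vC(1)] by simp
    obtain N N' where N: "bline N N'" "N v = \<i>" using boundary_line[OF v(1)] by metis
    have "continuous_on uhp (\<lambda>u. hV (M u))"
      using continuous_on_hiso[OF blineD(1)[OF M(2)]] hisoD(1)[OF blineD(1)[OF M(2)]]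
      by (intro continuous_intros) auto
    then obtain e where e: "e > 0" "\<And>u. u \<in> uhp \<Longrightarrow> hdist v u < e \<Longrightarrow> dist (hV (M v)) (hV (M u)) < hV (M v)"
      using continuous_on_uhp_iff[of uhp "\<lambda>u. hV (M u)"] vC pos by blast
    define r' where "r' = min e (r - hdist z v)"
    have "r' > 0" using e v by (simp add: r'_def)
    then obtain u where u: "u \<in> uhp" "hdist v u < r'" "u \<notin> C"
      using bline_not_interior[OF N(1) vC(1) _ \<open>r' > 0\<close>] N(2) by auto
    have "hdist z u \<le> hdist z v + hdist v u"
      using u vC assms dC_C C_uhpD by (intro hdist_triangle) auto
    then have "hdist z u < r" using u by (simp add: r'_def)
    moreover have "hV (M u) \<ge> 0" using e(2)[OF u(1)] u(2) by (simp add: r'_def dist_real_def)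
    ultimately show False using M(4)[OF u(1)] u(3) by simp
  qed
  then show ?thesis using that M(1) by blast
qed

lemma dC_limit:
  assumes "\<And>n. u n \<in> dC" "u \<longlonglongrightarrow> z" "z \<in> C"
  shows "z \<in> dC"
proof (rule ccontr)
  assume "z \<notin> dC"
  then obtain r where r: "r > 0" "\<And>v. v \<in> uhp \<Longrightarrow> hdist z v < r \<Longrightarrow> v \<in> C" using interior_ball[OF assms(3)] by metis
  have "(\<lambda>n. hdist z (u n)) \<longlonglongrightarrow> 0" using assms dC_C C_uhpD by (intro tendsto_hdist) auto
  then obtain n where n: "hdist z (u n) < r"
    using order_tendstoD(2)[of _ 0 sequentially r] r by (metis eventually_sequentially order_refl)
  have un: "u n \<in> C" "u n \<in> uhp" using assms dC_C C_uhpD by auto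
  obtain N N' where N: "bline N N'" "N (u n) = \<i>" using boundary_line[OF assms(1)] by metis
  obtain v where v: "v \<in> uhp" "hdist (u n) v < r - hdist z (u n)" "v \<notin> C"
    using bline_not_interior[OF N(1) un(1), of "r - hdist z (u n)"] n N(2) by auto
  have "hdist z v \<le> hdist z (u n) + hdist (u n) v"
    using v un assms C_uhpD by (intro hdist_triangle) auto
  then show False using r v by simp
qed

text \<open>Equivariance moves a sequence of counterexamples into a compact set; at its limit, again
  a boundary point, \<open>sameline_near\<close> is violated.\<close>

lemma boundary_separated:
  obtains \<delta> where "\<delta> > 0" "\<And>u v. u \<in> dC \<Longrightarrow> v \<in> dC \<Longrightarrow> hdist u v < \<delta> \<Longrightarrow> sameline u v"
proof -
  have "\<exists>\<delta>>0. \<forall>u\<in>dC. \<forall>v\<in>dC. hdist u v < \<delta> \<longrightarrow> sameline u v"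
  proof (rule ccontr)
    assume n: "\<not> ?thesis"
    obtain K where K: "compact K" "K \<subseteq> C" "p ` K = Sg" using fundamental_compact .
    have "\<exists>u v. u \<in> K \<and> u \<in> dC \<and> v \<in> dC \<and> hdist u v < 1 / Suc n \<and> \<not> sameline u v" for n
    proof -
      obtain u v where uv: "u \<in> dC" "v \<in> dC" "hdist u v < 1 / Suc n" "\<not> sameline u v"
        using n by (metis divide_pos_pos of_nat_0_less_iff zero_less_Suc zero_less_one)
      have c: "u \<in> C" "v \<in> C" using uv dC_C by auto
      obtain \<tau> where t: "\<tau> \<in> Deck" "\<tau> u \<in> K" using deck_to_K[OF K(2,3) c(1)] .
      obtain \<tau>' where t': "\<tau>' \<in> Deck" "\<And>z. z \<in> C \<Longrightarrow> \<tau>' (\<tau> z) = z" using deck_inv[OF t(1)] by metis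
      have "\<not> sameline (\<tau> u) (\<tau> v)"
        using sameline_deck[of "\<tau> u" "\<tau> v", OF _ t'(1)] t'(2) uv(4) c deck_C[OF t(1)] by auto
      then show ?thesis using uv c t deck_isometry[OF t(1) c] deck_dC[OF t(1)]
        by (intro exI[of _ "\<tau> u"] exI[of _ "\<tau> v"]) simp
    qed
    then obtain u v where uv: "\<And>n. u n \<in> K" "\<And>n. u n \<in> dC" "\<And>n. v n \<in> dC" "\<And>n. hdist (u n) (v n) < 1 / Suc n"
      "\<And>n. \<not> sameline (u n) (v n)" by metis
    obtain l f where l: "l \<in> K" "strict_mono f" "(u \<circ> f) \<longlonglongrightarrow> l"
      using K(1) uv(1) unfolding compact_def by metis
    have lC: "l \<in> C" using l K by auto
    have lD: "l \<in> dC" using dC_limit[OF _ l(3) lC] uv by simp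
    obtain r where r: "r > 0" "\<And>v. v \<in> dC \<Longrightarrow> hdist l v < r \<Longrightarrow> sameline l v" using sameline_near[OF lD] by blast
    have "(\<lambda>n. hdist l ((u \<circ> f) n)) \<longlonglongrightarrow> 0"
      using lC uv dC_C C_uhpD by (intro tendsto_hdist[OF _ _ l(3)]) simp_all
    moreover have "(\<lambda>n. 1 / real (Suc n)) \<longlonglongrightarrow> 0" by (rule LIMSEQ_Suc[OF lim_1_over_n])
    then have "((\<lambda>n. 1 / real (Suc n)) \<circ> f) \<longlonglongrightarrow> 0" using LIMSEQ_subseq_LIMSEQ[OF _ l(2)] by blast
    ultimately have "(\<lambda>n. hdist l (u (f n)) + 1 / real (Suc (f n))) \<longlonglongrightarrow> 0 + 0"
      unfolding o_def by (rule tendsto_add)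
    from order_tendstoD(2)[OF this, of r] obtain n where n: "hdist l (u (f n)) + 1 / real (Suc (f n)) < r"
      using r(1) by (auto simp: eventually_sequentially)
    have c: "u (f n) \<in> C" "v (f n) \<in> C" using uv dC_C by auto
    have "hdist l (v (f n)) \<le> hdist l (u (f n)) + hdist (u (f n)) (v (f n))"
      using c lC C_uhpD by (intro hdist_triangle) auto
    also have "\<dots> < r" using n uv(4)[of "f n"] by linarith
    finally have "sameline l (v (f n))" using r uv by blast
    moreover have "hdist l (u (f n)) < r"
      using n zero_le_divide_1_iff[of "real (Suc (f n))"] by linarith
    then have "sameline l (u (f n))" using r uv by blast
    ultimately show False using sameline_trans[OF sameline_sym] c lC uv(5) by blast
  qed
  then show ?thesis using that by blast
qed

text \<open>Boundary components are closed curves. By compactness, two points of the line at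
  distance at least 1 project close together; the deck transformation matching them preserves the
  line, as other lines are a definite distance away. Freeness of the action excludes a reversal of
  the line.\<close>

lemma bline_translation:
  assumes M: "bline M M'"
  obtains \<tau> T where "\<tau> \<in> Deck" "T > 0"
    "\<And>u. u \<in> C \<Longrightarrow> hU (M (\<tau> u)) = exp (- T) * hU (M u) \<and> hV (M (\<tau> u)) = hV (M u) \<and> hW (M (\<tau> u)) = exp T * hW (M u)"
proof -
  note hM = blineD(1)[OF M]
  obtain \<delta> where \<delta>: "\<delta> > 0" "\<And>u v. u \<in> dC \<Longrightarrow> v \<in> dC \<Longrightarrow> hdist u v < \<delta> \<Longrightarrow> sameline u v"
    using boundary_separated by blast
  define k where "k t = M' (iax t)" for t
  have k: "k \<in> unit_geodesics C" using bline_unit_geodesic[OF M] by (simp add: k_def[abs_def])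
  have kC: "k t \<in> C" and kd: "hdist (k s) (k t) = \<bar>s - t\<bar>" for s t using k by (auto simp: unit_geodesics_def)
  have Mk: "M (k t) = iax t" for t using blineD(4)[OF M] by (simp add: k_def)
  have kdC: "k t \<in> dC" for t using bline_dC[OF M kC] Mk by (simp add: iax)
  \<comment> \<open>\<open>\<rho>\<close> serves for lifting, \<open>\<delta>\<close> for staying on
    the line, and 1/2 ensures that \<open>k m\<close> is moved forward, as
    \<open>n \<ge> m + 1\<close>.\<close>
  define \<epsilon> where "\<epsilon> = min \<rho> (min \<delta> (1/2))"
  have \<epsilon>: "\<epsilon> > 0" "\<epsilon> \<le> \<rho>" "\<epsilon> \<le> \<delta>" "\<epsilon> \<le> 1/2" using \<rho>(1) \<delta> by (auto simp: \<epsilon>_def)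
  obtain l f where f: "strict_mono (f :: nat \<Rightarrow> nat)" "((\<lambda>n. p (k (real n))) \<circ> f) \<longlonglongrightarrow> l"
    using comp p_Sg[OF kC] unfolding compact_def by metis
  then obtain N where N: "\<And>m n. m \<ge> N \<Longrightarrow> n \<ge> N \<Longrightarrow> dist (p (k (real (f m)))) (p (k (real (f n)))) < \<epsilon>"
    using LIMSEQ_imp_Cauchy[OF f(2)] \<epsilon>(1) unfolding Cauchy_def o_def by metis
  define m n where "m = real (f N)" and "n = real (f (Suc N))"
  have mn: "n \<ge> m + 1" using f(1) unfolding strict_mono_Suc_iff m_def n_def
    by (metis Suc_leI of_nat_Suc of_nat_le_iff add.commute)
  have d: "dist (p (k n)) (p (k m)) < \<epsilon>" using N[of "Suc N" N] by (simp add: m_def n_def)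
  obtain v where v: "v \<in> C" "p v = p (k m)" "hdist (k n) v = dist (p (k n)) (p (k m))"
    using near_lift[OF kC p_Sg[OF kC], of n m] d \<epsilon> by auto
  obtain \<tau> where \<tau>: "\<tau> \<in> Deck" "\<tau> (k m) = v" using deck_exists[OF kC v(1), of m] v(2) by metis
  have "v \<in> dC" using deck_dC[OF \<tau>(1) kdC] \<tau>(2) by metis
  then have "sameline (k n) v" using \<delta>(2)[OF kdC] v d \<epsilon> by simp
  then have Mv: "hV (M v) = 0" using sameline_bline[OF _ kC v(1) M] Mk by (simp add: iax)
  then obtain a where a: "v = k a" using bline_param[OF M v(1)] by (metis k_def)
  have "\<bar>n - a\<bar> < 1/2" using v(3) d \<epsilon> kd[of n a] by (simp add: a)
  then have am: "a > m" using mn by linarith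
  have "\<exists>s. \<tau> (k t) = k s" for t
  proof -
    have "hV (M (\<tau> (k t))) = 0"
      using bline_geodesic[OF M deck_geodesic[OF \<tau>(1) k], of m t] \<tau>(2) Mv by simp
    then show ?thesis using bline_param[OF M deck_C[OF \<tau>(1) kC]] by (metis k_def)
  qed
  then obtain \<theta> where \<theta>: "\<And>t. \<tau> (k t) = k (\<theta> t)" by metis
  have \<theta>d: "\<bar>\<theta> s - \<theta> t\<bar> = \<bar>s - t\<bar>" for s t
    using deck_isometry[OF \<tau>(1) kC kC, of s t] by (simp add: \<theta> kd)
  have \<theta>m: "\<theta> m = a" 
  proof -
    have "k (\<theta> m) = k a" using \<theta>[of m] \<tau>(2) a by metis
    then have "\<bar>\<theta> m - a\<bar> = 0" using kd[of "\<theta> m" a] hdist_self[OF C_uhpD[OF kC[of a]]] by metis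
    then show ?thesis by simp
  qed
  \<comment> \<open>A reversal of the line taking \<open>m\<close> to \<open>a\<close> would fix
    their midpoint.\<close>
  define t1 where "t1 = (a + m) / 2"
  have "\<theta> t1 \<noteq> t1"
  proof
    assume "\<theta> t1 = t1"
    then have "\<tau> (k t1) = k t1" using \<theta>[of t1] by metis
    then have "\<tau> (k m) = k m" using deck_free[OF \<tau>(1) kC _ kC] by metis
    then have "k a = k m" using \<tau>(2) a by metis
    then have "\<bar>a - m\<bar> = 0" using kd[of a m] hdist_self[OF C_uhpD[OF kC[of m]]] by metis
    then show False using am by simp
  qed
  then have 1: "\<theta> t1 = a + (t1 - m)" using \<theta>d[of t1 m] am by (auto simp: \<theta>m t1_def abs_if field_simps split: if_splits)
  have \<theta>t: "\<theta> t = t + (a - m)" for t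
  proof -
    have "\<bar>\<theta> t - a\<bar> = \<bar>t - m\<bar>" using \<theta>d[of t m] by (simp add: \<theta>m)
    then consider "\<theta> t = a + (t - m)" | "\<theta> t = a - (t - m)" by linarith
    then show ?thesis
    proof cases
      case 2
      have "\<bar>(a - (t - m)) - (a + (t1 - m))\<bar> = \<bar>t - t1\<bar>" using \<theta>d[of t t1] 1 2 by simp
      then have "2 * m - t - t1 = t - t1 \<or> 2 * m - t - t1 = t1 - t" by linarith
      moreover have "t1 \<noteq> m" using am by (simp add: t1_def)
      ultimately have "t = m" by linarith
      then show ?thesis using 2 by simp
    qed simp
  qed
  define T where "T = a - m"
  have T: "T > 0" using am by (simp add: T_def)
  have "hU (M (\<tau> u)) = exp (- T) * hU (M u) \<and> hV (M (\<tau> u)) = hV (M u) \<and> hW (M (\<tau> u)) = exp T * hW (M u)"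
    if u: "u \<in> C" for u
  proof -
    have uu: "u \<in> uhp" "\<tau> u \<in> uhp" "M u \<in> uhp" "M (\<tau> u) \<in> uhp"
      using u deck_C[OF \<tau>(1) u] C_uhpD hisoD(1)[OF hM] by auto
    have "hB (M (\<tau> u)) (iax (t + T)) = hB (M u) (iax t)" for t
    proof -
      have "hB (M (\<tau> u)) (iax (t + T)) = cosh (hdist (M (\<tau> u)) (M (k (t + T))))"
        using uu cosh_hdist iax by (simp add: Mk)
      also have "\<dots> = cosh (hdist (\<tau> u) (\<tau> (k t)))" using hisoD(5)[OF hM] uu C_uhpD[OF kC] by (simp add: \<theta> \<theta>t T_def)
      also have "\<dots> = cosh (hdist (M u) (M (k t)))"
        using deck_isometry[OF \<tau>(1) u kC] hisoD(5)[OF hM uu(1) C_uhpD[OF kC]] by simp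
      finally show ?thesis using uu cosh_hdist iax by (simp add: Mk)
    qed
    \<comment> \<open>Distances to two points of the axis determine \<open>hU\<close> and
      \<open>hW\<close>; the sign of \<open>hV\<close> is known on \<open>C\<close>.\<close>
    from this[of 0] this[of 1]
    have e1: "hU (M (\<tau> u)) * exp T + hW (M (\<tau> u)) * exp (- T) = hU (M u) + hW (M u)"
      and e2: "hU (M (\<tau> u)) * exp (1 + T) + hW (M (\<tau> u)) * exp (- 1 - T) = hU (M u) * exp 1 + hW (M u) * exp (- 1)"
      by (simp_all add: hB_iax)
    define x y where "x = hU (M (\<tau> u)) * exp T" and "y = hW (M (\<tau> u)) * exp (- T)"
    have e1': "x + y = hU (M u) + hW (M u)" using e1 by (simp add: x_def y_def)
    have e2': "x * exp 1 + y * exp (- 1) = hU (M u) * exp 1 + hW (M u) * exp (- 1)"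
      using e2 by (simp add: x_def y_def exp_add exp_diff exp_minus field_simps)
    have "(x - hU (M u)) * (exp 1 - exp (- 1)) = (x * exp 1 + y * exp (- 1)) - (hU (M u) * exp 1 + hW (M u) * exp (- 1))
       - exp (- 1) * ((x + y) - (hU (M u) + hW (M u)))" by (simp add: algebra_simps)
    also have "\<dots> = 0" using e1' e2' by simp
    finally have x: "x = hU (M u)" by simp
    then have y: "y = hW (M u)" using e1' by simp
    have U: "hU (M (\<tau> u)) = exp (- T) * hU (M u)" using x by (simp add: x_def exp_minus field_simps)
    have W: "hW (M (\<tau> u)) = exp T * hW (M u)" using y by (simp add: y_def exp_minus field_simps)
    have "1 + (hV (M (\<tau> u)))\<^sup>2 = 1 + (hV (M u))\<^sup>2"
      unfolding hUW[OF uu(3), symmetric] hUW[OF uu(4), symmetric] U W by (simp add: exp_minus)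
    then have "hV (M (\<tau> u)) = hV (M u)"
      using blineD(2)[OF M u] blineD(2)[OF M deck_C[OF \<tau>(1) u]] by (simp add: power2_eq_iff_nonneg)
    then show ?thesis using U W by simp
  qed
  then show ?thesis using that \<tau>(1) T by blast
qed

text \<open>\<open>hV (M u)\<close> is the hyperbolic sine of the distance to the line, and the foot
  of the perpendicular from \<open>u\<close> is carried to another point of the line.\<close>

lemma bline_invariant_le:
  assumes "bline M M'" "\<tau> \<in> Deck" "\<And>x. x \<in> C \<Longrightarrow> hV (M x) = 0 \<Longrightarrow> hV (M (\<tau> x)) = 0" "u \<in> C"
  shows "hV (M (\<tau> u)) \<le> hV (M u)"
proof -
  note hM = blineD(1)[OF assms(1)]
  have uu: "u \<in> uhp" "\<tau> u \<in> uhp" "\<tau> u \<in> C" using assms deck_C C_uhpD by auto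
  obtain t where t: "cosh (hdist (M u) (iax t)) = sqrt (1 + (hV (M u))\<^sup>2)"
    using cosh_hdist_iax_attained[OF hisoD(1)[OF hM uu(1)]] .
  define x where "x = M' (iax t)"
  have x: "x \<in> C" "M x = iax t" "hV (M x) = 0" using blineD[OF assms(1)] by (auto simp: x_def iax)
  obtain s where s: "M (\<tau> x) = iax s"
    using bline_param[OF assms(1) deck_C[OF assms(2) x(1)] assms(3)[OF x(1,3)]] by metis
  have "sqrt (1 + (hV (M (\<tau> u)))\<^sup>2) \<le> cosh (hdist (M (\<tau> u)) (iax s))"
    using cosh_hdist_iax_ge hisoD(1)[OF hM uu(2)] by blast
  also have "hdist (M (\<tau> u)) (iax s) = hdist (\<tau> u) (\<tau> x)"
    using hisoD(5)[OF hM uu(2) C_uhpD[OF deck_C[OF assms(2) x(1)]]] by (simp add: s)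
  also have "\<dots> = hdist (M u) (iax t)"
    using deck_isometry[OF assms(2,4) x(1)] hisoD(5)[OF hM uu(1) C_uhpD[OF x(1)]] by (simp add: x(2))
  finally have "(hV (M (\<tau> u)))\<^sup>2 \<le> (hV (M u))\<^sup>2" using t by simp
  then show ?thesis using blineD(2)[OF assms(1)] assms(4) by (simp add: power2_le_iff_abs_le)
qed

lemma bline_invariant_eq:
  assumes "bline M M'" "\<tau> \<in> Deck" "\<And>x. x \<in> C \<Longrightarrow> hV (M (\<tau> x)) = 0 \<longleftrightarrow> hV (M x) = 0" "u \<in> C"
  shows "hV (M (\<tau> u)) = hV (M u)"
proof -
  obtain t where t: "t \<in> Deck" "\<And>z. z \<in> C \<Longrightarrow> t (\<tau> z) = z" "\<And>z. z \<in> C \<Longrightarrow> \<tau> (t z) = z"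
    using deck_inv[OF assms(2)] by blast
  have "hV (M (t x)) = 0" if "x \<in> C" "hV (M x) = 0" for x
    using assms(3)[of "t x"] t that deck_C[OF t(1)] by simp
  then have "hV (M (t (\<tau> u))) \<le> hV (M (\<tau> u))"
    using bline_invariant_le[OF assms(1) t(1) _ deck_C[OF assms(2,4)]] by blast
  then show ?thesis using bline_invariant_le[OF assms(1,2) _ assms(4)] assms(3) t(2)[OF assms(4)] by force
qed

text \<open>With a single boundary line, the distance to it would be invariant under the deck group
  and attain its maximum at an interior point. But on a geodesic through that point the functional
  satisfies \<open>f t + f (- t) = 2 * cosh t * f 0\<close>, so it takes a larger value.\<close>

lemma two_lines:
  assumes "surface_boundary Sg \<noteq> {}"
  obtains u v where "u \<in> dC" "v \<in> dC" "\<not> sameline u v"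
proof -
  obtain x where "x \<in> surface_boundary Sg" using assms by auto
  moreover then have "x \<in> Sg" by (simp add: surface_boundary_def)
  ultimately obtain z where z: "z \<in> dC" using pC by (auto simp: dC_def)
  have "\<exists>v\<in>dC. \<not> sameline z v"
  proof (rule ccontr)
    assume "\<not> ?thesis"
    then have all: "\<And>v. v \<in> dC \<Longrightarrow> sameline z v" by blast
    obtain r M M' where M: "r > 0" "bline M M'" "M z = \<i>"
      "\<And>u. u \<in> uhp \<Longrightarrow> hdist z u < r \<Longrightarrow> u \<in> C \<longleftrightarrow> hV (M u) \<ge> 0" using boundary_line[OF z] by blast
    note hM = blineD(1)[OF M(2)]
    have dC0: "hV (M v) = 0" if "v \<in> dC" for v
      using sameline_bline[OF all[OF that] dC_C[OF z] dC_C[OF that] M(2)] M(3) by simp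
    have inv: "hV (M (\<tau> u)) \<le> hV (M u)" if "\<tau> \<in> Deck" "u \<in> C" for \<tau> u
      using bline_invariant_le[OF M(2) that(1) _ that(2)] dC0[OF deck_dC[OF that(1) bline_dC[OF M(2)]]] by blast
    obtain K where K: "compact K" "K \<subseteq> C" "p ` K = Sg" using fundamental_compact .
    have "K \<noteq> {}" using K Sg_nonempty by auto
    have "continuous_on K (\<lambda>u. hV (M u))"
      using continuous_on_subset[OF continuous_on_hiso[OF hM]] K C_uhp hisoD(1)[OF hM]
      by (intro continuous_intros) auto
    then obtain w where w: "w \<in> K" "\<And>u. u \<in> K \<Longrightarrow> hV (M u) \<le> hV (M w)"
      using continuous_attains_sup[OF K(1) \<open>K \<noteq> {}\<close>] by blast
    have wC: "w \<in> C" "w \<in> uhp" using w K C_uhpD by auto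
    have max: "hV (M u) \<le> hV (M w)" if u: "u \<in> C" for u
    proof -
      obtain \<tau> where t: "\<tau> \<in> Deck" "\<tau> u \<in> K" using deck_to_K[OF K(2,3) u] .
      obtain \<tau>' where t': "\<tau>' \<in> Deck" "\<And>z. z \<in> C \<Longrightarrow> \<tau>' (\<tau> z) = z" using deck_inv[OF t(1)] by metis
      have "hV (M u) \<le> hV (M (\<tau> u))" using inv[OF t'(1) deck_C[OF t(1) u]] t'(2)[OF u] by simp
      also have "\<dots> \<le> hV (M w)" using w t by simp
      finally show ?thesis .
    qed
    obtain s where s: "s > 0" "\<forall>x\<in>uhp. dist \<i> x < s \<longrightarrow> hdist \<i> x < r" using ball_subset_hball[OF i_uhp M(1)] by blast
    define x where "x = Complex (s/2) 1"
    have x: "x \<in> uhp" "hV x > 0" "dist \<i> x < s" using s by (auto simp: x_def uhp_def hV_def dist_complex_def cmod_def)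
    have "hdist z (M' x) < r"
      using hisoD(5)[OF hM C_uhpD[OF dC_C[OF z]] hisoD(2)[OF hM x(1)]] hisoD(4)[OF hM x(1)] M(3)
        s(2)[rule_format, OF x(1,3)] by simp
    then have "M' x \<in> C" using M(4) hisoD[OF hM] x by simp
    then have wp: "hV (M w) > 0" using max[of "M' x"] hisoD(4)[OF hM x(1)] x by simp
    then have "w \<notin> dC" using dC0 by force
    then obtain r' where r': "r' > 0" "\<And>u. u \<in> uhp \<Longrightarrow> hdist w u < r' \<Longrightarrow> u \<in> C" using interior_ball[OF wC(1)] by metis
    obtain k where k: "k \<in> unit_geodesics uhp" "k 0 = w" using geodesic_through[OF wC(2) wC(2)] by metis
    define t where "t = r' / 2"
    have kd: "hdist (k a) (k b) = \<bar>a - b\<bar>" "k a \<in> uhp" for a b using k(1) by (auto simp: unit_geodesics_def)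
    have "k t \<in> C" "k (- t) \<in> C" using r' kd(1)[of 0 t] kd(1)[of 0 "- t"] kd(2) k(2) by (auto simp: t_def)
    then have "hV (M (k t)) + hV (M (k (- t))) \<le> 2 * hV (M w)" using max by (metis add_mono mult_2)
    moreover have "hV (M (k t)) + hV (M (k (- t))) = 2 * cosh t * hV (M w)"
      using hlin_geodesic_midpoint[OF hlin_comp[OF hM hlin_coords(2)] k(1), of 0 t] k(2) by simp
    moreover have "cosh t > 1" using r' cosh_real_strict_mono[of 0 t] by (simp add: t_def)
    ultimately show False using wp by simp
  qed
  then show ?thesis using that z by blast
qed

end

section \<open>A family of closed curves crossing a shortest boundary arc\<close>

context surface_cover
begin

text \<open>One point of each pair of a minimising sequence is moved into a compact set and the
  other stays at bounded distance. The limits are on different lines because the pairs eventually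
  share the lines of their limits.\<close>

lemma closest_lines:
  assumes "surface_boundary Sg \<noteq> {}"
  obtains z w where "z \<in> dC" "w \<in> dC" "\<not> sameline z w"
    "\<And>u v. u \<in> dC \<Longrightarrow> v \<in> dC \<Longrightarrow> \<not> sameline u v \<Longrightarrow> hdist z w \<le> hdist u v"
proof -
  obtain K where K: "compact K" "K \<subseteq> C" "p ` K = Sg" using fundamental_compact .
  obtain \<delta> where \<delta>: "\<delta> > 0" "\<And>u v. u \<in> dC \<Longrightarrow> v \<in> dC \<Longrightarrow> hdist u v < \<delta> \<Longrightarrow> sameline u v"
    using boundary_separated by blast
  define P where "P = {(u, v). u \<in> dC \<and> v \<in> dC \<and> \<not> sameline u v}"
  have P0: "P \<noteq> {}" using two_lines[OF assms] by (metis (mono_tags, lifting) P_def case_prodI empty_iff mem_Collect_eq)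
  define m where "m = (INF q\<in>P. hdist (fst q) (snd q))"
  have bdd: "bdd_below ((\<lambda>q. hdist (fst q) (snd q)) ` P)"
    by (rule bdd_belowI[of _ 0]) (auto simp: P_def intro!: hdist_nonneg C_uhpD dC_C)
  have ml: "m \<le> hdist u v" if "u \<in> dC" "v \<in> dC" "\<not> sameline u v" for u v
    using cINF_lower[OF bdd, of "(u, v)"] that by (simp add: m_def P_def)
  have "\<exists>u v. u \<in> K \<and> u \<in> dC \<and> v \<in> dC \<and> \<not> sameline u v \<and> hdist u v < m + 1 / Suc n" for n
  proof -
    have "m < m + 1 / Suc n" by simp
    then obtain q where "q \<in> P" "hdist (fst q) (snd q) < m + 1 / Suc n"
      unfolding m_def using cINF_less_iff[OF P0 bdd] by blast
    then obtain u v where uv: "u \<in> dC" "v \<in> dC" "hdist u v < m + 1 / Suc n" "\<not> sameline u v"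
      by (auto simp: P_def)
    have c: "u \<in> C" "v \<in> C" using uv dC_C by auto
    obtain \<tau> where t: "\<tau> \<in> Deck" "\<tau> u \<in> K" using deck_to_K[OF K(2,3) c(1)] .
    obtain \<tau>' where t': "\<tau>' \<in> Deck" "\<And>z. z \<in> C \<Longrightarrow> \<tau>' (\<tau> z) = z" using deck_inv[OF t(1)] by metis
    have "\<not> sameline (\<tau> u) (\<tau> v)"
      using sameline_deck[of "\<tau> u" "\<tau> v", OF _ t'(1)] t'(2) uv(4) c deck_C[OF t(1)] by auto
    then show ?thesis using uv c t deck_isometry[OF t(1) c] deck_dC[OF t(1)]
      by (intro exI[of _ "\<tau> u"] exI[of _ "\<tau> v"]) simp
  qed
  then obtain u v where uv: "\<And>n. u n \<in> K" "\<And>n. u n \<in> dC" "\<And>n. v n \<in> dC" "\<And>n. \<not> sameline (u n) (v n)"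
    "\<And>n. hdist (u n) (v n) < m + 1 / Suc n" by metis
  obtain z f where z: "z \<in> K" "strict_mono f" "(u \<circ> f) \<longlonglongrightarrow> z"
    using K(1) uv(1) unfolding compact_def by metis
  have zC: "z \<in> C" using z K by auto
  have c: "u n \<in> C" "v n \<in> C" for n using uv dC_C by auto
  have uz: "(\<lambda>n. hdist z (u (f n))) \<longlonglongrightarrow> 0"
    using tendsto_hdist[of z "u \<circ> f"] z zC c C_uhpD by (simp add: o_def)
  then obtain B where B: "\<And>n. \<bar>hdist z (u (f n))\<bar> \<le> B"
    using convergent_imp_Bseq[of "\<lambda>n. hdist z (u (f n))"] unfolding convergent_def Bseq_def
    by (metis real_norm_def)
  have vb: "hdist z (v (f n)) \<le> B + (m + 1)" for n
  proof -
    have "hdist z (v (f n)) \<le> hdist z (u (f n)) + hdist (u (f n)) (v (f n))"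
      using zC c C_uhpD by (intro hdist_triangle) auto
    moreover have "1 / real (Suc (f n)) \<le> 1" by simp
    ultimately show ?thesis using B[of n] uv(5)[of "f n"] by linarith
  qed
  obtain w f' where w: "w \<in> C" "strict_mono f'" "((\<lambda>n. v (f n)) \<circ> f') \<longlonglongrightarrow> w"
    using compact_subseq[of "\<lambda>n. v (f n)", OF c(2) _ vb] zC C_uhpD by metis
  let ?f = "f \<circ> f'"
  have uz': "(\<lambda>n. hdist z (u (?f n))) \<longlonglongrightarrow> 0" using LIMSEQ_subseq_LIMSEQ[OF uz w(2)] by (simp add: o_def)
  have vw': "(\<lambda>n. hdist w (v (?f n))) \<longlonglongrightarrow> 0"
    using tendsto_hdist[of w "\<lambda>n. v (?f n)"] w c C_uhpD by (simp add: o_def)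
  have zd: "z \<in> dC" using dC_limit[OF _ z(3) zC] uv by simp
  have wd: "w \<in> dC" using dC_limit[OF _ w(3) w(1)] uv by simp
  have ns: "\<not> sameline z w"
  proof
    assume s: "sameline z w"
    have "\<forall>\<^sub>F n in sequentially. hdist z (u (?f n)) < \<delta> \<and> hdist w (v (?f n)) < \<delta>"
      using order_tendstoD(2)[OF uz' \<delta>(1)] order_tendstoD(2)[OF vw' \<delta>(1)] by (rule eventually_conj)
    then obtain n where "hdist z (u (?f n)) < \<delta>" "hdist w (v (?f n)) < \<delta>"
      by (auto simp: eventually_sequentially)
    then have "sameline z (u (?f n))" "sameline w (v (?f n))" using \<delta>(2) zd wd uv by blast+
    then have "sameline (u (?f n)) (v (?f n))"
      using s sameline_trans sameline_sym zC w(1) c by metis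
    then show False using uv(4) by blast
  qed
  have "hdist z w \<le> m"
  proof -
    have e: "hdist z w \<le> hdist z (u (?f n)) + m + 1 / Suc n + hdist w (v (?f n))" for n
    proof -
      have "hdist z w \<le> hdist z (u (?f n)) + hdist (u (?f n)) w"
        using zC w c C_uhpD by (intro hdist_triangle) auto
      moreover have "hdist (u (?f n)) w \<le> hdist (u (?f n)) (v (?f n)) + hdist (v (?f n)) w"
        using w c C_uhpD by (intro hdist_triangle) auto
      moreover have "hdist (v (?f n)) w = hdist w (v (?f n))" using hdist_commute w c C_uhpD by metis
      moreover have "1 / real (Suc (?f n)) \<le> 1 / real (Suc n)"
        using seq_suble[OF strict_mono_o[OF z(2) w(2)], of n] by (intro divide_left_mono) auto
      ultimately show ?thesis using uv(5)[of "?f n"] by linarith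
    qed
    have "(\<lambda>n. hdist z (u (?f n)) + m + 1 / real (Suc n) + hdist w (v (?f n))) \<longlonglongrightarrow> 0 + m + 0 + 0"
      by (intro tendsto_intros uz' vw' LIMSEQ_Suc[OF lim_1_over_n])
    then have "hdist z w \<le> 0 + m + 0 + 0" by (rule LIMSEQ_le_const) (use e in blast)
    then show ?thesis by simp
  qed
  then show ?thesis using that[OF zd wd ns] ml by (meson order_trans)
qed

text \<open>Together with \<open>hV\<close> these are Lorentz-orthonormal coordinates: translations
  along the imaginary axis are boosts in \<open>hX\<close> and \<open>hY\<close>, those along its
  perpendicular at \<open>\<i>\<close> are boosts in \<open>hX\<close> and
  \<open>hV\<close>.\<close>

definition hX :: "complex \<Rightarrow> real" where "hX u = (hU u + hW u) / 2"
definition hY :: "complex \<Rightarrow> real" where "hY u = (hW u - hU u) / 2"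

lemma hB_XY: "hB u v = hX u * hX v - hV u * hV v - hY u * hY v"
  by (simp add: hB_def hX_def hY_def field_simps)

text \<open>The common perpendicular of two closest boundary lines, in coordinates for which the first
  line is the imaginary axis and the perpendicular starts at \<open>\<i>\<close>. The coordinates adapted to the
  second line are obtained by a boost of length \<open>D\<close>, up to the sign \<open>s\<close>.\<close>

lemma perpendicular_frame:
  assumes "surface_boundary Sg \<noteq> {}"
  obtains z w M M' N N' D s where "z \<in> C" "w \<in> C" "bline M M'" "bline N N'" "M z = \<i>" "N w = \<i>" "D > 0"
    "s = 1 \<or> s = (-1 :: real)"
    "hX (M w) = cosh D" "hV (M w) = sinh D" "hY (M w) = 0"
    "\<And>u. u \<in> C \<Longrightarrow> hX (N u) = hX (M u) * cosh D - hV (M u) * sinh D"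
    "\<And>u. u \<in> C \<Longrightarrow> hV (N u) = hX (M u) * sinh D - hV (M u) * cosh D"
    "\<And>u. u \<in> C \<Longrightarrow> hY (N u) = s * hY (M u)"
proof -
  obtain z w where zw: "z \<in> dC" "w \<in> dC" "\<not> sameline z w"
    "\<And>u v. u \<in> dC \<Longrightarrow> v \<in> dC \<Longrightarrow> \<not> sameline u v \<Longrightarrow> hdist z w \<le> hdist u v"
    using closest_lines[OF assms] by blast
  obtain M M' where M: "bline M M'" "M z = \<i>" using boundary_line[OF zw(1)] by metis
  obtain N N' where N: "bline N N'" "N w = \<i>" using boundary_line[OF zw(2)] by metis
  note hM = blineD(1)[OF M(1)] and hN = blineD(1)[OF N(1)]
  have c: "z \<in> C" "w \<in> C" "z \<in> uhp" "w \<in> uhp" using zw dC_C C_uhpD by auto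
  define D where "D = hdist z w"
  have "z \<noteq> w" using zw(3) M unfolding sameline_def by (metis hcoords_i(2))
  then have D: "D > 0" using hdist_nonneg[of z w] hdist_eq_0_iff[of z w] c by (auto simp: D_def)
  \<comment> \<open>Closest points also realise the distance from each of them to the other line, so
    each is the foot of the perpendicular from the other.\<close>
  have key: "hdist (A y) \<i> \<le> hdist (A y) (iax t) \<and> hdist (A y) \<i> = hdist x y"
    if A: "bline A A'" "A x = \<i>" and xy: "x \<in> dC" "y \<in> dC" "\<not> sameline x y"
      and min: "\<And>u. u \<in> dC \<Longrightarrow> \<not> sameline u y \<Longrightarrow> hdist x y \<le> hdist u y" for A A' x y t
  proof -
    note hA = blineD(1)[OF A(1)]
    have u: "x \<in> uhp" "y \<in> uhp" "x \<in> C" "y \<in> C" using xy dC_C C_uhpD by auto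
    define v where "v = A' (iax t)"
    have v: "v \<in> C" "A v = iax t" "hV (A v) = 0" using blineD[OF A(1)] by (auto simp: v_def)
    have vd: "v \<in> dC" using bline_dC[OF A(1) v(1,3)] .
    have xv: "sameline x v" unfolding sameline_def using A v by (metis hcoords_i(2))
    then have "\<not> sameline v y" using sameline_trans[OF xv] xy(3) u v by blast
    then have "hdist x y \<le> hdist v y" using min[OF vd] by blast
    moreover have "hdist v y = hdist (A y) (iax t)"
      using hisoD(5)[OF hA C_uhpD[OF v(1)] u(2)] v(2) hdist_commute[OF iax(1) hisoD(1)[OF hA u(2)]] by metis
    moreover have "hdist (A y) \<i> = hdist x y"
      using hisoD(5)[OF hA u(1,2)] A(2) hdist_commute[OF i_uhp hisoD(1)[OF hA u(2)]] by metis
    ultimately show ?thesis by simp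
  qed
  have kM: "hdist (M w) \<i> \<le> hdist (M w) (iax t) \<and> hdist (M w) \<i> = hdist z w" for t
    using key[OF M zw(1,2,3)] zw(2,4) by blast
  have kN: "hdist (N z) \<i> \<le> hdist (N z) (iax t) \<and> hdist (N z) \<i> = hdist w z" for t
  proof (rule key[OF N zw(2,1)])
    show "\<not> sameline w z" using zw(3) sameline_sym by blast
    show "hdist w z \<le> hdist u z" if "u \<in> dC" "\<not> sameline u z" for u
      using zw(4)[of z u] zw(1) that sameline_sym hdist_commute dC_C C_uhpD c by metis
  qed
  have wz: "hdist w z = D" using hdist_commute c by (simp add: D_def)
  have Mw: "M w \<in> uhp" "N z \<in> uhp" using hisoD(1)[OF hM] hisoD(1)[OF hN] c by auto
  have "hdist (M w) \<i> \<le> hdist (M w) (iax t)" for t using kM by blast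
  moreover have "hdist (M w) \<i> = D" using kM unfolding D_def by blast
  ultimately have kM': "\<And>t. hdist (M w) \<i> \<le> hdist (M w) (iax t)" "hdist (M w) \<i> = D" by blast+
  note fM = foot_coords[OF Mw(1) kM'(1) blineD(2)[OF M(1) c(2)], unfolded kM'(2)]
  have "hdist (N z) \<i> \<le> hdist (N z) (iax t)" for t using kN by blast
  moreover have "hdist (N z) \<i> = D" using kN unfolding wz by blast
  ultimately have kN': "\<And>t. hdist (N z) \<i> \<le> hdist (N z) (iax t)" "hdist (N z) \<i> = D" by blast+
  note fN = foot_coords[OF Mw(2) kN'(1) blineD(2)[OF N(1) c(1)], unfolded kN'(2)]
  have iso: "hB (N u) (N v) = hB (M u) (M v)" if "u \<in> C" "v \<in> C" for u v
    using hiso_hB[OF hM] hiso_hB[OF hN] that C_uhpD by simp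
  \<comment> \<open>\<open>hX (N u)\<close> is \<open>hB\<close> of \<open>N u\<close> and
    \<open>\<i>\<close>, evaluated in the first frame. Using \<open>z\<close> in place of
    \<open>w\<close> gives \<open>hV\<close> below.\<close>
  have X: "hX (N u) = hX (M u) * cosh D - hV (M u) * sinh D" if "u \<in> C" for u
    using iso[OF that c(2)] unfolding hB_XY by (simp add: N(2) hX_def[of \<i>] hY_def[of \<i>] hX_def[of "M w"] hY_def[of "M w"] fM)
  have V: "hV (N u) = hX (M u) * sinh D - hV (M u) * cosh D" if "u \<in> C" for u
  proof -
    have "hX (N u) * cosh D - hV (N u) * sinh D = hX (M u)"
      using iso[OF that c(1)] unfolding hB_XY by (simp add: M(2) hX_def[of \<i>] hY_def[of \<i>] hX_def[of "N z"] hY_def[of "N z"] fN)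
    then have "hV (N u) * sinh D = hX (M u) * ((cosh D)\<^sup>2 - 1) - hV (M u) * sinh D * cosh D"
      unfolding X[OF that] by (simp add: power2_eq_square algebra_simps)
    also have "\<dots> = (hX (M u) * sinh D - hV (M u) * cosh D) * sinh D"
      unfolding cosh_square_eq by (simp add: power2_eq_square algebra_simps)
    finally show ?thesis using D by simp
  qed
  \<comment> \<open>The remaining part of \<open>hB\<close> agrees in both frames, so
    \<open>hY\<close> agrees up to one global sign.\<close>
  have Y: "hY (N u) * hY (N v) = hY (M u) * hY (M v)" if "u \<in> C" "v \<in> C" for u v
  proof -
    have "hX (N u) * hX (N v) - hV (N u) * hV (N v) = (hX (M u) * hX (M v) - hV (M u) * hV (M v)) * ((cosh D)\<^sup>2 - (sinh D)\<^sup>2)"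
      unfolding X[OF that(1)] X[OF that(2)] V[OF that(1)] V[OF that(2)] by (simp add: power2_eq_square algebra_simps)
    then have "hX (N u) * hX (N v) - hV (N u) * hV (N v) = hX (M u) * hX (M v) - hV (M u) * hV (M v)"
      by (simp add: cosh_square_eq)
    then show ?thesis using iso[OF that] unfolding hB_XY by simp
  qed
  define v where "v = M' (iax 1)"
  have v: "v \<in> C" "hY (M v) = sinh 1" using blineD(3,4)[OF M(1)] by (auto simp: v_def hY_def iax sinh_def)
  have v0: "hY (M v) \<noteq> 0" using v by simp
  define s where "s = hY (N v) / hY (M v)"
  have "(hY (N v))\<^sup>2 = (hY (M v))\<^sup>2" using Y[OF v(1) v(1)] by (simp add: power2_eq_square)
  then have "hY (N v) = hY (M v) \<or> hY (N v) = - hY (M v)" by (simp add: power2_eq_iff)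
  then have s: "s = 1 \<or> s = -1" using v0 by (auto simp: s_def)
  have sY: "hY (N u) = s * hY (M u)" if "u \<in> C" for u
  proof -
    have "hY (N v) = s * hY (M v)" using v0 by (simp add: s_def)
    then have "(hY (N u) * s) * hY (M v) = hY (M u) * hY (M v)" using Y[OF that v(1)] by (simp add: mult.assoc)
    then have "hY (N u) * s = hY (M u)" using v0 by simp
    moreover have "s * s = 1" using s by auto
    ultimately show ?thesis by (metis mult.assoc mult.commute mult.right_neutral)
  qed
  show ?thesis
    by (rule that[OF c(1,2) M(1) N(1) M(2) N(2) D s _ _ _ X V sY]) (auto simp: hX_def hY_def fM)
qed

text \<open>The product of the translations along the two lines in parallel directions: its axis crosses
  the common perpendicular, so that it is not a boundary curve.\<close>

lemma figure_eight_not_boundary: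
  fixes N :: "complex \<Rightarrow> complex"
  assumes "hlin f" "M z = \<i>" "M w \<in> uhp" "hiso M M'" "D > 0" "S > 0" "T > 0"
    and w: "hX (M w) = cosh D" "hV (M w) = sinh D" "hY (M w) = 0" "w \<in> uhp" "z \<in> uhp"
    and zT: "zT \<in> uhp" "hX (M zT) = cosh T" "hV (M zT) = 0" "hY (M zT) = sinh T"
    and wT: "wT \<in> uhp" "hX (M wT) = cosh D * cosh T" "hV (M wT) = sinh D" "hY (M wT) = cosh D * sinh T"
    and zS: "zS \<in> uhp" "hX (M zS) * cosh D - hV (M zS) * sinh D = cosh D * cosh S"
      "hX (M zS) * sinh D - hV (M zS) * cosh D = sinh D" "hY (M zS) = - (cosh D * sinh S)"
    and wS: "wS \<in> uhp" "hX (M wS) * cosh D - hV (M wS) * sinh D = cosh S"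
      "hX (M wS) * sinh D - hV (M wS) * cosh D = 0" "hY (M wS) = - sinh S"
    and f: "f zT = f zS" "f wT = f wS" "f z \<ge> 0" "f w \<ge> 0" "u \<in> uhp"
  shows "f u = 0"
proof -
  note hM = assms(4)
  have "hlin (\<lambda>x. f (M' x))" using hlin_comp[OF hiso_sym[OF hM] assms(1)] .
  then obtain a b c where abc: "\<And>x. x \<in> uhp \<Longrightarrow> f (M' x) = a * hU x + b * hV x + c * hW x"
    unfolding hlin_def by blast
  define x v y where "x = a + c" and "v = b" and "y = c - a"
  have F: "f q = x * hX (M q) + v * hV (M q) + y * hY (M q)" if "q \<in> uhp" for q
    using abc[OF hisoD(1)[OF hM that]] hisoD(3)[OF hM that]
    by (simp add: x_def v_def y_def hX_def hY_def field_simps)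
  define ch sh where "ch = cosh D" and "sh = sinh D"
  have csh: "ch\<^sup>2 = 1 + sh\<^sup>2" "sh > 0" "ch > 0" using assms(5) by (auto simp: ch_def sh_def cosh_square_eq)
  \<comment> \<open>The value of \<open>f\<close> at \<open>w\<close>; its value at \<open>z\<close>
    is \<open>x\<close>.\<close>
  define x2 where "x2 = x * ch + v * sh"
  have inv: "X = A * ch - B * sh" "V = A * sh - B * ch"
    if "X * ch - V * sh = A" "X * sh - V * ch = B" for X V A B
  proof -
    have "A * ch - B * sh = X * (ch\<^sup>2 - sh\<^sup>2)" "A * sh - B * ch = V * (ch\<^sup>2 - sh\<^sup>2)"
      unfolding that[symmetric] by (simp_all add: power2_eq_square algebra_simps)
    then show "X = A * ch - B * sh" "V = A * sh - B * ch" using csh by simp_all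
  qed
  have zS': "hX (M zS) = ch * cosh S * ch - sh * sh" "hV (M zS) = ch * cosh S * sh - sh * ch"
    using inv[OF zS(2,3)[folded ch_def sh_def]] by auto
  have wS': "hX (M wS) = cosh S * ch" "hV (M wS) = cosh S * sh"
    using inv[OF wS(2,3)[folded ch_def sh_def]] by auto
  \<comment> \<open>Increments of \<open>f\<close> under the translation along the first line and
    the inverse translation along the second: \<open>L\<close> and \<open>ch * R\<close> at
    \<open>z\<close>, \<open>ch * L\<close> and \<open>R\<close> at \<open>w\<close>. Equating them
    at both points forces both to vanish, as \<open>ch^2 > 1\<close>.\<close>
  define L R where "L = x * (cosh T - 1) + y * sinh T" and "R = x2 * (cosh S - 1) - y * sinh S"
  have fz: "f z = x" using F[OF w(5)] assms(2) by (simp add: hX_def hY_def)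
  have fw: "f w = x2" using F[OF w(4)] w by (simp add: x2_def ch_def sh_def)
  have "f zT - f z = L" using F[OF zT(1)] zT fz by (simp add: L_def algebra_simps)
  moreover have "f zS - f z = ch * R"
  proof -
    have "f zS = x * (ch * cosh S * ch - sh * sh) + v * (ch * cosh S * sh - sh * ch) - y * (ch * sinh S)"
      using F[OF zS(1)] zS' zS(4) by (simp add: ch_def)
    also have "\<dots> = ch * R + x * (ch\<^sup>2 - sh\<^sup>2)" by (simp add: R_def x2_def power2_eq_square algebra_simps)
    finally show ?thesis using csh fz by simp
  qed
  ultimately have E1: "L = ch * R" using f(1) by simp
  have "f wT - f w = ch * L" using F[OF wT(1)] wT fw by (simp add: L_def x2_def ch_def sh_def algebra_simps)
  moreover have "f wS - f w = R"
    using F[OF wS(1)] wS' wS(4) fw by (simp add: R_def x2_def algebra_simps)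
  ultimately have E2: "ch * L = R" using f(2) by simp
  have "(ch\<^sup>2 - 1) * R = 0" using E1 E2 by (simp add: power2_eq_square algebra_simps)
  then have R0: "R = 0" using csh by simp
  then have L0: "L = 0" using E1 by simp
  have p: "cosh T > 1" "cosh S > 1" "sinh T > 0" "sinh S > 0"
    using assms(6,7) cosh_real_strict_mono[of 0 T] cosh_real_strict_mono[of 0 S] by auto
  \<comment> \<open>As the translations are parallel, \<open>y\<close> enters \<open>L\<close> and
    \<open>R\<close> with opposite signs; nonnegativity of \<open>f\<close> at \<open>z\<close> and
    \<open>w\<close> then leaves only \<open>y = 0\<close>.\<close>
  have x0: "x \<ge> 0" "x2 \<ge> 0" using f fz fw by auto
  have "y * sinh S = x2 * (cosh S - 1)" using R0 by (simp add: R_def)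
  then have "y * sinh S \<ge> 0" using x0 p by simp
  then have y1: "y \<ge> 0" using p by (simp add: zero_le_mult_iff)
  have yT: "y * sinh T = - (x * (cosh T - 1))" using L0 by (simp add: L_def)
  then have "y * sinh T \<le> 0" using x0 p by simp
  then have y0: "y = 0" using y1 p by (simp add: mult_le_0_iff)
  have "x = 0" "x2 = 0" using yT \<open>y * sinh S = _\<close> p y0 by auto
  then have "v = 0" using csh by (simp add: x2_def)
  then show ?thesis using F[OF f(5)] \<open>x = 0\<close> y0 by simp
qed

text \<open>The bracket is the trace of the product of the four matrices, two diagonal ones and a
  boost with its inverse, and \<open>cosh_displacement_mob\<close> applies. Its term in
  \<open>\<mu>\<close> will dominate.\<close>

lemma figure_eight_displacement:
  assumes "x \<in> uhp" "\<mu> > 0" "\<nu> > 0" "c\<^sup>2 - s\<^sup>2 = (1::real)"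
  shows "cosh (hdist x (mob \<mu> 0 0 (1 / \<mu>) (mob c s s c (mob \<nu> 0 0 (1 / \<nu>) (mob c (- s) (- s) c x)))))
    \<ge> (\<mu> * (c\<^sup>2 * \<nu> - s\<^sup>2 / \<nu>) + (c\<^sup>2 / \<nu> - s\<^sup>2 * \<nu>) / \<mu>)\<^sup>2 / 2 - 1"
proof -
  have d: "c * c - (- s) * (- s) = 1" "\<nu> * (1 / \<nu>) - 0 * 0 = 1" "c * c - s * s = 1" "\<mu> * (1 / \<mu>) - 0 * 0 = 1"
    using assms by (auto simp: power2_eq_square)
  have 1: "mob \<nu> 0 0 (1 / \<nu>) (mob c (- s) (- s) c x) = mob (\<nu> * c) (- (\<nu> * s)) (- (s / \<nu>)) (c / \<nu>) x"
    using mob_comp[OF assms(1) d(2) d(1)] by simp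
  have d1: "(\<nu> * c) * (c / \<nu>) - (- (\<nu> * s)) * (- (s / \<nu>)) = 1" using assms d by simp
  have 2: "mob c s s c (mob (\<nu> * c) (- (\<nu> * s)) (- (s / \<nu>)) (c / \<nu>) x)
     = mob (c * (\<nu> * c) + s * (- (s / \<nu>))) (c * (- (\<nu> * s)) + s * (c / \<nu>)) (s * (\<nu> * c) + c * (- (s / \<nu>))) (s * (- (\<nu> * s)) + c * (c / \<nu>)) x"
    using mob_comp[OF assms(1) d(3) d1] .
  have d2: "(c * (\<nu> * c) + s * (- (s / \<nu>))) * (s * (- (\<nu> * s)) + c * (c / \<nu>))
     - (c * (- (\<nu> * s)) + s * (c / \<nu>)) * (s * (\<nu> * c) + c * (- (s / \<nu>))) = 1"
  proof -
    have "(c * (\<nu> * c) + s * (- (s / \<nu>))) * (s * (- (\<nu> * s)) + c * (c / \<nu>))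
     - (c * (- (\<nu> * s)) + s * (c / \<nu>)) * (s * (\<nu> * c) + c * (- (s / \<nu>))) = (c * c - s * s) * (\<nu> * c * (c / \<nu>) - \<nu> * s * (s / \<nu>))"
      by (simp add: algebra_simps)
    then show ?thesis using d assms by simp
  qed
  define a b e h where "a = c * (\<nu> * c) + s * (- (s / \<nu>))" and "b = c * (- (\<nu> * s)) + s * (c / \<nu>)"
    and "e = s * (\<nu> * c) + c * (- (s / \<nu>))" and "h = s * (- (\<nu> * s)) + c * (c / \<nu>)"
  have 3: "mob \<mu> 0 0 (1 / \<mu>) (mob a b e h x) = mob (\<mu> * a) (\<mu> * b) (e / \<mu>) (h / \<mu>) x"
    using mob_comp[OF assms(1) d(4), of a h b e] d2 by (simp add: a_def b_def e_def h_def)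
  have d3: "(\<mu> * a) * (h / \<mu>) - (\<mu> * b) * (e / \<mu>) = 1"
    using d2 assms(2) unfolding a_def[symmetric] b_def[symmetric] e_def[symmetric] h_def[symmetric] by simp
  have "(\<mu> * a + h / \<mu>) = \<mu> * (c\<^sup>2 * \<nu> - s\<^sup>2 / \<nu>) + (c\<^sup>2 / \<nu> - s\<^sup>2 * \<nu>) / \<mu>"
    by (simp add: a_def h_def power2_eq_square algebra_simps)
  then show ?thesis
    using cosh_displacement_mob[OF assms(1) d3] unfolding 1 2 a_def[symmetric] b_def[symmetric] e_def[symmetric] h_def[symmetric] 3
    by simp
qed


section \<open>Deck transformations representing the family of curves\<close>

lemma deck_funpow: "\<tau> \<in> Deck \<Longrightarrow> (\<tau> ^^ n) \<in> Deck"
proof (induction n)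
  case 0
  then show ?case using deck_id by (simp add: id_def)
next
  case (Suc n)
  then show ?case using deck_comp[OF Suc(2) Suc(1)[OF Suc(2)]] by (simp add: o_def)
qed

text \<open>Only the winding number along one of the lines varies with \<open>n\<close>. This
  suffices for the trace to tend to infinity, and it leaves \<open>z\<close>, \<open>w\<close> and
  the arc between them unchanged.\<close>

lemma figure_eight_family:
  assumes "surface_boundary Sg \<noteq> {}"
  obtains z w \<beta>' and b :: "nat \<Rightarrow> complex \<Rightarrow> complex" where "z \<in> C" "w \<in> C" "\<beta>' \<in> Deck" "\<And>n. b n \<in> Deck"
    "\<And>n. sameline z (b n z)" "sameline w (\<beta>' w)"
    "\<And>n N N'. n \<ge> 1 \<Longrightarrow> bline N N' \<Longrightarrow> \<exists>x\<in>C. \<not> (hV (N (b n (\<beta>' x))) = 0 \<longleftrightarrow> hV (N x) = 0)"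
    "\<And>R. \<exists>n0. \<forall>n\<ge>n0. \<forall>u\<in>C. hdist u (b n (\<beta>' u)) > R"
proof -
  obtain z w M M' N N' D s where zw: "z \<in> C" "w \<in> C" and M: "bline M M'" and N: "bline N N'"
    and Mz: "M z = \<i>" and Nw: "N w = \<i>" and D: "D > 0" and s: "s = 1 \<or> s = (-1 :: real)"
    and Mw: "hX (M w) = cosh D" "hV (M w) = sinh D" "hY (M w) = 0"
    and X2: "\<And>u. u \<in> C \<Longrightarrow> hX (N u) = hX (M u) * cosh D - hV (M u) * sinh D"
    and V2: "\<And>u. u \<in> C \<Longrightarrow> hV (N u) = hX (M u) * sinh D - hV (M u) * cosh D"
    and Y2: "\<And>u. u \<in> C \<Longrightarrow> hY (N u) = s * hY (M u)"
    using perpendicular_frame[OF assms] by blast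
  note hM = blineD(1)[OF M] and hN = blineD(1)[OF N]
  have Mu: "M u \<in> uhp" "N u \<in> uhp" if "u \<in> C" for u
    using hisoD(1)[OF hM] hisoD(1)[OF hN] C_uhpD[OF that] by auto
  obtain \<tau> T where \<tau>: "\<tau> \<in> Deck" "T > 0"
    "\<And>u. u \<in> C \<Longrightarrow> hU (M (\<tau> u)) = exp (- T) * hU (M u) \<and> hV (M (\<tau> u)) = hV (M u) \<and> hW (M (\<tau> u)) = exp T * hW (M u)"
    using bline_translation[OF M] by blast
  obtain \<sigma> S where \<sigma>: "\<sigma> \<in> Deck" "S > 0"
    "\<And>u. u \<in> C \<Longrightarrow> hU (N (\<sigma> u)) = exp (- S) * hU (N u) \<and> hV (N (\<sigma> u)) = hV (N u) \<and> hW (N (\<sigma> u)) = exp S * hW (N u)"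
    using bline_translation[OF N] by blast
  obtain \<sigma>' where \<sigma>': "\<sigma>' \<in> Deck" "\<And>u. u \<in> C \<Longrightarrow> \<sigma>' (\<sigma> u) = u" "\<And>u. u \<in> C \<Longrightarrow> \<sigma> (\<sigma>' u) = u"
    using deck_inv[OF \<sigma>(1)] by blast
  have \<sigma>'N: "hU (N (\<sigma>' u)) = exp S * hU (N u) \<and> hV (N (\<sigma>' u)) = hV (N u) \<and> hW (N (\<sigma>' u)) = exp (- S) * hW (N u)"
    if "u \<in> C" for u
    using \<sigma>(3)[OF deck_C[OF \<sigma>'(1) that]] \<sigma>'(3)[OF that] by (simp add: exp_minus)
  \<comment> \<open>If the frames have opposite orientation along the lines, the second translation
    is inverted, so that both move in the direction of increasing \<open>hY (M u)\<close>.\<close>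
  define \<beta>' \<beta>'' where "\<beta>' = (if s = 1 then \<sigma> else \<sigma>')" and "\<beta>'' = (if s = 1 then \<sigma>' else \<sigma>)"
  have \<beta>D: "\<beta>' \<in> Deck" "\<beta>'' \<in> Deck" "\<And>u. u \<in> C \<Longrightarrow> \<beta>' (\<beta>'' u) = u"
    using \<sigma>(1) \<sigma>' by (auto simp: \<beta>'_def \<beta>''_def)
  have \<beta>N: "hU (N (\<beta>' u)) = exp (- s * S) * hU (N u)" "hV (N (\<beta>' u)) = hV (N u)" "hW (N (\<beta>' u)) = exp (s * S) * hW (N u)"
    and \<beta>N': "hU (N (\<beta>'' u)) = exp (s * S) * hU (N u)" "hV (N (\<beta>'' u)) = hV (N u)" "hW (N (\<beta>'' u)) = exp (- s * S) * hW (N u)"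
    if "u \<in> C" for u
    using \<sigma>(3)[OF that] \<sigma>'N[OF that] s by (auto simp: \<beta>'_def \<beta>''_def)
  define b where "b n = \<tau> ^^ n" for n
  have bD: "b n \<in> Deck" for n unfolding b_def using deck_funpow[OF \<tau>(1)] .
  have bM: "hU (M (b n u)) = exp (- (n * T)) * hU (M u) \<and> hV (M (b n u)) = hV (M u) \<and> hW (M (b n u)) = exp (n * T) * hW (M u)"
    if u: "u \<in> C" for n u
  proof (induction n)
    case 0
    then show ?case by (simp add: b_def)
  next
    case (Suc n)
    have "b (Suc n) u = \<tau> (b n u)" by (simp add: b_def)
    then show ?case using \<tau>(3)[OF deck_C[OF bD u], of n] Suc by (simp add: exp_add exp_diff exp_minus field_simps)
  qed
  have zl: "hV (M z) = 0" "hV (N w) = 0" using Mz Nw by simp_all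
  have same1: "sameline z (b n z)" for n
    unfolding sameline_def using M zl bM[OF zw(1), of n] by metis
  have same2: "sameline w (\<beta>' w)"
    unfolding sameline_def using N zl \<beta>N(2)[OF zw(2)] by metis
  have Nz: "hU (N z) = cosh D" "hV (N z) = sinh D" "hW (N z) = cosh D"
    using X2[OF zw(1)] V2[OF zw(1)] Y2[OF zw(1)] by (auto simp: Mz hX_def hY_def)
  have Mw': "hU (M w) = cosh D" "hW (M w) = cosh D" using Mw by (auto simp: hX_def hY_def)
  have hYM: "hY (M u) = s * hY (N u)" if "u \<in> C" for u using Y2[OF that] s by auto
  have notb: "\<exists>x\<in>C. \<not> (hV (A (b n (\<beta>' x))) = 0 \<longleftrightarrow> hV (A x) = 0)" if n: "n \<ge> 1" and A: "bline A A'" for n A A'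
  proof (rule ccontr)
    assume "\<not> ?thesis"
    then have inv: "\<And>x. x \<in> C \<Longrightarrow> hV (A (b n (\<beta>' x))) = 0 \<longleftrightarrow> hV (A x) = 0" by blast
    have gD: "(\<lambda>x. b n (\<beta>' x)) \<in> Deck" using deck_comp[OF bD \<beta>D(1)] .
    have fg: "hV (A (b n (\<beta>' x))) = hV (A x)" if "x \<in> C" for x
      using bline_invariant_eq[OF A gD _ that] inv by blast
    \<comment> \<open>Invariance under the product, rewritten so that each side involves one
      translation only.\<close>
    have fe: "hV (A (b n y)) = hV (A (\<beta>'' y))" if "y \<in> C" for y
      using fg[OF deck_C[OF \<beta>D(2) that]] \<beta>D(3)[OF that] by simp
    define T' where "T' = n * T"
    have T': "T' > 0" using n \<tau>(2) by (simp add: T'_def)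
    note bz = bM[OF zw(1), of n, folded T'_def] and bw = bM[OF zw(2), of n, folded T'_def]
    have cC: "b n z \<in> C" "b n w \<in> C" "\<beta>'' z \<in> C" "\<beta>'' w \<in> C" using zw deck_C[OF bD] deck_C[OF \<beta>D(2)] by auto
    have sS: "(exp (- s * S) + exp (s * S)) / 2 = cosh S" "s * ((exp (- s * S) - exp (s * S)) / 2) = - sinh S"
      using s by (auto simp: cosh_def sinh_def field_simps)
    have zS: "hX (N (\<beta>'' z)) = cosh D * cosh S" "hV (N (\<beta>'' z)) = sinh D" "hY (M (\<beta>'' z)) = - (cosh D * sinh S)"
    proof -
      show "hX (N (\<beta>'' z)) = cosh D * cosh S"
        unfolding hX_def \<beta>N'[OF zw(1)] Nz sS(1)[symmetric] by (simp add: algebra_simps)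
      show "hV (N (\<beta>'' z)) = sinh D" unfolding \<beta>N'[OF zw(1)] Nz ..
      have "hY (M (\<beta>'' z)) = cosh D * (s * ((exp (- s * S) - exp (s * S)) / 2))"
        unfolding hYM[OF cC(3)] unfolding hY_def \<beta>N'[OF zw(1)] Nz by (simp add: algebra_simps)
      then show "hY (M (\<beta>'' z)) = - (cosh D * sinh S)" unfolding sS(2) by simp
    qed
    have wS: "hX (N (\<beta>'' w)) = cosh S" "hV (N (\<beta>'' w)) = 0" "hY (M (\<beta>'' w)) = - sinh S"
    proof -
      show "hX (N (\<beta>'' w)) = cosh S"
        unfolding hX_def \<beta>N'[OF zw(2)] Nw sS(1)[symmetric] by simp
      show "hV (N (\<beta>'' w)) = 0" unfolding \<beta>N'[OF zw(2)] Nw by simp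
      have "hY (M (\<beta>'' w)) = s * ((exp (- s * S) - exp (s * S)) / 2)"
        unfolding hYM[OF cC(4)] unfolding hY_def \<beta>N'[OF zw(2)] Nw by simp
      then show "hY (M (\<beta>'' w)) = - sinh S" unfolding sS(2) .
    qed
    have "hV (A u) = 0" if u: "u \<in> uhp" for u
    proof (rule figure_eight_not_boundary[OF hlin_comp[OF blineD(1)[OF A] hlin_coords(2)] Mz Mu(1)[OF zw(2)] hM D \<sigma>(2) T' Mw
          C_uhpD[OF zw(2)] C_uhpD[OF zw(1)] C_uhpD[OF cC(1)] _ _ _ C_uhpD[OF cC(2)] _ _ _ C_uhpD[OF cC(3)] _ _ zS(3)
          C_uhpD[OF cC(4)] _ _ wS(3) fe[OF zw(1)] fe[OF zw(2)] blineD(2)[OF A zw(1)] blineD(2)[OF A zw(2)] u])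
      show "hX (M (b n z)) = cosh T'" "hV (M (b n z)) = 0" "hY (M (b n z)) = sinh T'"
        using bz by (simp_all add: hX_def hY_def Mz cosh_def sinh_def)
      show "hX (M (b n w)) = cosh D * cosh T'" "hV (M (b n w)) = sinh D" "hY (M (b n w)) = cosh D * sinh T'"
        using bw Mw by (simp_all add: hX_def hY_def Mw' cosh_def sinh_def field_simps)
      show "hX (M (\<beta>'' z)) * cosh D - hV (M (\<beta>'' z)) * sinh D = cosh D * cosh S"
        "hX (M (\<beta>'' z)) * sinh D - hV (M (\<beta>'' z)) * cosh D = sinh D"
        using X2[OF cC(3)] V2[OF cC(3)] zS by simp_all
      show "hX (M (\<beta>'' w)) * cosh D - hV (M (\<beta>'' w)) * sinh D = cosh S"
        "hX (M (\<beta>'' w)) * sinh D - hV (M (\<beta>'' w)) * cosh D = 0"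
        using X2[OF cC(4)] V2[OF cC(4)] wS by simp_all
    qed
    \<comment> \<open>The functional has been shown to vanish identically, but it is negative beyond
      the line.\<close>
    moreover obtain u where "u \<in> uhp" "hV (A u) < 0"
      using hV_negative_near[OF blineD(1)[OF A] C_uhpD[OF blineD(3)[OF A]] blineD(5)[OF A], of 1] by auto
    ultimately show False by force
  qed
  \<comment> \<open>Half lengths: a diagonal matrix with entries \<open>exp (S / 2)\<close> and
    \<open>exp (- S / 2)\<close> translates by \<open>S\<close>, and similarly for the boost by
    \<open>D\<close>.\<close>
  define c h \<nu> where "c = cosh (D / 2)" and "h = sinh (D / 2)" and "\<nu> = exp (S / 2)"
  have ch: "c\<^sup>2 - h\<^sup>2 = 1" by (simp add: c_def h_def cosh_square_eq)
  have chD: "cosh D = c\<^sup>2 + h\<^sup>2" "sinh D = 2 * h * c"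
    using cosh_double[of "D / 2"] sinh_double[of "D / 2"] by (simp_all add: c_def h_def)
  have d: "c * c - (- h) * (- h) = 1" "c * c - h * h = 1" using ch by (simp_all add: power2_eq_square)
  have \<nu>: "\<nu> \<ge> 1" "\<nu>\<^sup>2 = exp S" using \<sigma>(2) by (simp_all add: \<nu>_def exp_double[symmetric])
  have dn: "\<nu> * (1 / \<nu>) - 0 * 0 = 1" using \<nu> by simp
  \<comment> \<open>The second frame up to the signs of \<open>hV\<close> and \<open>hY\<close>,
    reached from the first by an explicit matrix; in it \<open>\<beta>'\<close> is diagonal.\<close>
  define Q where "Q u = mob c (- h) (- h) c (M u)" for u
  have Q: "Q u \<in> uhp" "hU (Q u) = hX (N u) - hY (M u)" "hV (Q u) = - hV (N u)" if "u \<in> C" for u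
  proof -
    note m = mob[OF Mu(1)[OF that] d(1)]
    show "Q u \<in> uhp" using m by (simp add: Q_def)
    have "hU (Q u) = h\<^sup>2 * hW (M u) - 2 * h * c * hV (M u) + c\<^sup>2 * hU (M u)"
      unfolding Q_def m by (simp add: algebra_simps)
    also have "\<dots> = hX (M u) * (c\<^sup>2 + h\<^sup>2) - hV (M u) * (2 * h * c) - hY (M u) * (c\<^sup>2 - h\<^sup>2)"
      by (simp add: hX_def hY_def field_simps)
    finally show "hU (Q u) = hX (N u) - hY (M u)" unfolding X2[OF that] chD ch by simp
    have "hV (Q u) = - (hX (M u) * (2 * h * c) - hV (M u) * (c\<^sup>2 + h\<^sup>2))"
      unfolding Q_def m by (simp add: hX_def power2_eq_square field_simps)
    then show "hV (Q u) = - hV (N u)" unfolding V2[OF that] chD by simp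
  qed
  have Q\<beta>: "Q (\<beta>' u) = mob \<nu> 0 0 (1 / \<nu>) (Q u)" if u: "u \<in> C" for u
  proof -
    note bu = deck_C[OF \<beta>D(1) u]
    note m = mob[OF Q(1)[OF u] dn]
    show ?thesis
    proof (rule uhp_eqI[OF Q(1)[OF bu] m(1)])
      have "hU (Q (\<beta>' u)) = hX (N (\<beta>' u)) - s * hY (N (\<beta>' u))" using Q(2)[OF bu] hYM[OF bu] by simp
      also have "\<dots> = exp (- S) * (hX (N u) - s * hY (N u))"
        using s unfolding hX_def hY_def \<beta>N[OF u] by (auto simp: field_simps)
      also have "\<dots> = exp (- S) * hU (Q u)" using Q(2)[OF u] hYM[OF u] by simp
      also have "exp (- S) = (1 / \<nu>)\<^sup>2" using \<nu>(2) by (simp add: power_divide exp_minus inverse_eq_divide)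
      finally show "hU (Q (\<beta>' u)) = hU (mob \<nu> 0 0 (1 / \<nu>) (Q u))" unfolding m by simp
      show "hV (Q (\<beta>' u)) = hV (mob \<nu> 0 0 (1 / \<nu>) (Q u))"
        unfolding m using Q(3)[OF bu] Q(3)[OF u] \<beta>N(2)[OF u] \<nu> by simp
    qed
  qed
  have MQ: "M u = mob c h h c (Q u)" if "u \<in> C" for u
    using mob_inverse[OF Mu(1)[OF that] d(1)] by (simp add: Q_def)
  have disp: "\<exists>n0. \<forall>n\<ge>n0. \<forall>u\<in>C. hdist u (b n (\<beta>' u)) > R" for R
  proof -
    \<comment> \<open>By \<open>\<mu> \<ge> 1 + n * T / 2\<close> this makes \<open>\<mu>\<close>
      exceed \<open>h^2 * \<nu> + 2 * cosh R + 2\<close>. The trace \<open>t\<close> is at least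
      \<open>\<mu> - h^2 * \<nu>\<close>, and \<open>t \<ge> 2 * cosh R + 2\<close> yields
      \<open>t^2 / 2 - 1 > cosh R\<close>.\<close>
    obtain n0 :: nat where n0: "n0 > (h\<^sup>2 * \<nu> + 2 * cosh R + 2) / (T / 2)" using reals_Archimedean2 by blast
    show ?thesis
    proof (intro exI[of _ n0] allI impI ballI)
      fix n u assume n: "n \<ge> n0" and u: "u \<in> C"
      define \<mu> where "\<mu> = exp (n * T / 2)"
      have "(h\<^sup>2 * \<nu> + 2 * cosh R + 2) / (T / 2) < n" using n0 n by linarith
      then have "h\<^sup>2 * \<nu> + 2 * cosh R + 2 < n * (T / 2)" using \<tau>(2) by (simp add: field_simps)
      also have "\<dots> \<le> \<mu>" unfolding \<mu>_def using exp_ge_add_one_self[of "n * T / 2"] by linarith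
      finally have \<mu>: "\<mu> > h\<^sup>2 * \<nu> + 2 * cosh R + 2" .
      have "h\<^sup>2 * \<nu> \<ge> 0" using \<nu> by simp
      then have \<mu>1: "\<mu> \<ge> 1" using \<mu> cosh_real_ge_1[of R] by linarith
      have dm: "\<mu> * (1 / \<mu>) - 0 * 0 = 1" using \<mu>1 by simp
      have \<mu>2: "\<mu>\<^sup>2 = exp (n * T)" by (simp add: \<mu>_def exp_double[symmetric])
      note bu = deck_C[OF \<beta>D(1) u]
      have "M (b n (\<beta>' u)) = mob \<mu> 0 0 (1 / \<mu>) (M (\<beta>' u))"
      proof (rule uhp_eqI[OF Mu(1)[OF deck_C[OF bD bu]] mob(1)[OF Mu(1)[OF bu] dm]])
        show "hU (M (b n (\<beta>' u))) = hU (mob \<mu> 0 0 (1 / \<mu>) (M (\<beta>' u)))"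
          unfolding mob(2)[OF Mu(1)[OF bu] dm] using bM[OF bu, of n] by (simp add: power_divide \<mu>2 exp_minus inverse_eq_divide)
        show "hV (M (b n (\<beta>' u))) = hV (mob \<mu> 0 0 (1 / \<mu>) (M (\<beta>' u)))"
          unfolding mob(3)[OF Mu(1)[OF bu] dm] using bM[OF bu, of n] \<mu>1 by simp
      qed
      then have e: "M (b n (\<beta>' u)) = mob \<mu> 0 0 (1 / \<mu>) (mob c h h c (mob \<nu> 0 0 (1 / \<nu>) (mob c (- h) (- h) c (M u))))"
        unfolding MQ[OF bu] Q\<beta>[OF u] unfolding Q_def .
      define t where "t = \<mu> * (c\<^sup>2 * \<nu> - h\<^sup>2 / \<nu>) + (c\<^sup>2 / \<nu> - h\<^sup>2 * \<nu>) / \<mu>"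
      have "hdist u (b n (\<beta>' u)) = hdist (M u) (M (b n (\<beta>' u)))"
        using hisoD(5)[OF hM C_uhpD[OF u] C_uhpD[OF deck_C[OF bD bu]]] by simp
      then have 1: "cosh (hdist u (b n (\<beta>' u))) \<ge> t\<^sup>2 / 2 - 1"
        using figure_eight_displacement[OF Mu(1)[OF u] _ _ ch, of \<mu> \<nu>] \<mu>1 \<nu> unfolding e t_def by simp
      have "1 / \<nu> \<le> \<nu>" using \<nu>(1) by (simp add: divide_le_eq) (metis mult_mono' one_le_numeral mult.left_neutral zero_le_one)
      then have "h\<^sup>2 * (1 / \<nu>) \<le> h\<^sup>2 * \<nu>" by (intro mult_left_mono) auto
      moreover have "c\<^sup>2 * \<nu> = \<nu> + h\<^sup>2 * \<nu>" using ch by (simp add: algebra_simps flip: distrib_right)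
      ultimately have "c\<^sup>2 * \<nu> - h\<^sup>2 / \<nu> \<ge> 1" using \<nu>(1) by simp
      then have 2: "\<mu> * (c\<^sup>2 * \<nu> - h\<^sup>2 / \<nu>) \<ge> \<mu> * 1" using \<mu>1 by (intro mult_left_mono) auto
      have "(c\<^sup>2 / \<nu> - h\<^sup>2 * \<nu>) / \<mu> \<ge> (- (h\<^sup>2 * \<nu>)) / \<mu>"
        using \<mu>1 \<nu> by (intro divide_right_mono) auto
      moreover have "(h\<^sup>2 * \<nu>) * 1 \<le> (h\<^sup>2 * \<nu>) * \<mu>"
        using \<mu>1 \<open>h\<^sup>2 * \<nu> \<ge> 0\<close> by (rule mult_left_mono)
      then have "(h\<^sup>2 * \<nu>) / \<mu> \<le> h\<^sup>2 * \<nu>" using \<mu>1 by (simp add: divide_le_eq)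
      ultimately have "t \<ge> 2 * cosh R + 2" using 2 \<mu> unfolding t_def by simp
      then have "t\<^sup>2 \<ge> (2 * cosh R + 2)\<^sup>2" using cosh_real_ge_1[of R] by (intro power_mono) auto
      moreover have "(2 * cosh R + 2)\<^sup>2 / 2 - 1 > cosh R"
      proof -
        have "(2 * cosh R + 2)\<^sup>2 / 2 - 1 = 2 * (cosh R * cosh R) + 4 * cosh R + 1"
          by (simp add: power2_eq_square field_simps)
        then show ?thesis using cosh_real_ge_1[of R] zero_le_square[of "cosh R"] by linarith
      qed
      ultimately have "cosh R < cosh (hdist u (b n (\<beta>' u)))" using 1 by linarith
      then have "cosh \<bar>R\<bar> < cosh (hdist u (b n (\<beta>' u)))" by simp
      then have "\<bar>R\<bar> < hdist u (b n (\<beta>' u))"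
        using cosh_real_nonneg_le_iff[of "hdist u (b n (\<beta>' u))" "\<bar>R\<bar>"] hdist_nonneg[of u "b n (\<beta>' u)"] C_uhpD u deck_C[OF bD bu]
        by force
      then show "hdist u (b n (\<beta>' u)) > R" by linarith
    qed
  qed
  show ?thesis using that[OF zw \<beta>D(1) bD same1 same2 notb disp] .
qed


section \<open>Essential curves\<close>

text \<open>A geodesic of \<open>C\<close> meeting the line runs along it, so a single point of the
  line that stays on it forces invariance.\<close>

lemma bline_invariantI:
  assumes M: "bline M M'" and g: "g \<in> Deck" and w: "w \<in> C" "hV (M w) = 0" "hV (M (g w)) = 0" and x: "x \<in> C"
  shows "hV (M (g x)) = 0 \<longleftrightarrow> hV (M x) = 0"
proof -
  have *: "hV (M (h y)) = 0" if h: "h \<in> Deck" and v: "v \<in> C" "hV (M v) = 0" "hV (M (h v)) = 0" and y: "y \<in> C" "hV (M y) = 0" for h v y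
  proof -
    obtain s t where "v = M' (iax s)" "y = M' (iax t)" using bline_param[OF M] v y by metis
    then show ?thesis using bline_geodesic[OF M deck_geodesic[OF h bline_unit_geodesic[OF M]], of s t] v by simp
  qed
  obtain h where h: "h \<in> Deck" "\<And>z. z \<in> C \<Longrightarrow> h (g z) = z" using deck_inv[OF g] by metis
  show ?thesis
    using *[OF g w x] *[OF h(1) deck_C[OF g w(1)] w(3) _ deck_C[OF g x]] h(2)[OF w(1)] h(2)[OF x] w(2) by auto
qed

text \<open>Boundary points that follow a path closely cannot jump to another line, since different
  lines keep a definite distance. A loop in the collar follows one line, which its deck
  transformation then preserves.\<close>

lemma collar:
  obtains \<delta> where "\<delta> > 0"
    "\<And>g \<sigma>. g \<in> Deck \<Longrightarrow> continuous_on {0..1} \<sigma> \<Longrightarrow> \<sigma> \<in> {0..1::real} \<rightarrow> C \<Longrightarrow> \<sigma> 1 = g (\<sigma> 0) \<Longrightarrow>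
      (\<And>t. t \<in> {0..1} \<Longrightarrow> \<exists>w\<in>dC. hdist (\<sigma> t) w < \<delta>) \<Longrightarrow>
      \<exists>M M'. bline M M' \<and> (\<forall>x\<in>C. hV (M (g x)) = 0 \<longleftrightarrow> hV (M x) = 0)"
proof -
  obtain d where d: "d > 0" "\<And>u v. u \<in> dC \<Longrightarrow> v \<in> dC \<Longrightarrow> hdist u v < d \<Longrightarrow> sameline u v"
    using boundary_separated by blast
  \<comment> \<open>A quarter, since neighbouring boundary points are compared through four steps
    shorter than \<open>\<delta>\<close>.\<close>
  define \<delta> where "\<delta> = d / 4"
  have \<delta>: "\<delta> > 0" "4 * \<delta> = d" using d by (auto simp: \<delta>_def)
  have "\<exists>M M'. bline M M' \<and> (\<forall>x\<in>C. hV (M (g x)) = 0 \<longleftrightarrow> hV (M x) = 0)"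
    if g: "g \<in> Deck" and \<sigma>: "continuous_on {0..1} \<sigma>" "\<sigma> \<in> {0..1} \<rightarrow> C" "\<sigma> 1 = g (\<sigma> 0)"
      and near: "\<And>t. t \<in> {0..1} \<Longrightarrow> \<exists>w\<in>dC. hdist (\<sigma> t) w < \<delta>" for g and \<sigma> :: "real \<Rightarrow> complex"
  proof -
    have sC: "\<sigma> t \<in> C" if "t \<in> {0..1}" for t using \<sigma>(2) that by auto
    obtain w where w: "\<And>t. t \<in> {0..1} \<Longrightarrow> w t \<in> dC" "\<And>t. t \<in> {0..1} \<Longrightarrow> hdist (\<sigma> t) (w t) < \<delta>" using near by metis
    have wC: "w t \<in> C" if "t \<in> {0..1}" for t using w dC_C that by blast
    define P where "P a b \<longleftrightarrow> (0 \<le> a \<and> b \<le> 1 \<longrightarrow> sameline (w a) (w b))" for a b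
    have "P 0 1"
    proof (rule Bolzano)
      fix a b c :: real assume "P a b" "P b c" "a \<le> b" "b \<le> c"
      then show "P a c" unfolding P_def using sameline_trans[of "w a" "w b" "w c"] wC by auto
    next
      fix x :: real assume x: "0 \<le> x" "x \<le> 1"
      then obtain e where e: "e > 0" "\<And>y. y \<in> {0..1} \<Longrightarrow> dist x y < e \<Longrightarrow> hdist (\<sigma> x) (\<sigma> y) < \<delta>"
      proof -
        have "\<sigma> ` {0..1} \<subseteq> uhp" using sC C_uhpD by auto
        then show ?thesis using continuous_into_uhp_iff[of \<sigma> "{0..1}"] \<sigma>(1) \<delta>(1) x that by (metis atLeastAtMost_iff)
      qed
      have "P a b" if ab: "a \<le> x \<and> x \<le> b \<and> b - a < e" for a b
        unfolding P_def
      proof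
        assume "0 \<le> a \<and> b \<le> 1"
        then have i: "a \<in> {0..1}" "b \<in> {0..1}" "x \<in> {0..1}" using ab x by auto
        note c = sC[OF i(1)] sC[OF i(2)] sC[OF i(3)] wC[OF i(1)] wC[OF i(2)]
        have 1: "hdist (\<sigma> x) (\<sigma> a) < \<delta>" "hdist (\<sigma> x) (\<sigma> b) < \<delta>" using e(2) i ab by (auto simp: dist_real_def)
        have "hdist (w a) (w b) \<le> hdist (w a) (\<sigma> a) + hdist (\<sigma> a) (w b)" using c C_uhpD by (intro hdist_triangle) auto
        also have "hdist (\<sigma> a) (w b) \<le> hdist (\<sigma> a) (\<sigma> x) + hdist (\<sigma> x) (w b)" using c C_uhpD by (intro hdist_triangle) auto
        also have "hdist (\<sigma> x) (w b) \<le> hdist (\<sigma> x) (\<sigma> b) + hdist (\<sigma> b) (w b)" using c C_uhpD by (intro hdist_triangle) auto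
        finally have "hdist (w a) (w b) < d"
          using 1 w(2)[OF i(1)] w(2)[OF i(2)] hdist_commute[of "w a" "\<sigma> a"] hdist_commute[of "\<sigma> a" "\<sigma> x"] c C_uhpD \<delta>(2) by simp
        then show "sameline (w a) (w b)" using d(2) w(1) i by blast
      qed
      then show "\<exists>d>0. \<forall>a b. a \<le> x \<and> x \<le> b \<and> b - a < d \<longrightarrow> P a b" using e(1) by blast
    qed simp
    then have s01: "sameline (w 0) (w 1)" by (simp add: P_def)
    have i: "(0::real) \<in> {0..1}" "(1::real) \<in> {0..1}" by auto
    note c = sC[OF i(1)] sC[OF i(2)] wC[OF i(1)] wC[OF i(2)]
    note gc = deck_C[OF g c(3)]
    have "hdist (g (w 0)) (w 1) \<le> hdist (g (w 0)) (\<sigma> 1) + hdist (\<sigma> 1) (w 1)"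
      using c gc C_uhpD by (intro hdist_triangle) auto
    also have "hdist (g (w 0)) (\<sigma> 1) = hdist (\<sigma> 0) (w 0)"
      using deck_isometry[OF g c(3,1)] hdist_commute[of "w 0" "\<sigma> 0"] c C_uhpD by (simp add: \<sigma>(3))
    finally have "hdist (g (w 0)) (w 1) < d" using w(2)[OF i(1)] w(2)[OF i(2)] \<delta> by simp
    then have "sameline (g (w 0)) (w 1)" using d(2) deck_dC[OF g w(1)[OF i(1)]] w(1)[OF i(2)] by blast
    then have s: "sameline (w 0) (g (w 0))" using sameline_trans[OF s01 sameline_sym] c gc by blast
    then obtain M M' where M: "bline M M'" "hV (M (w 0)) = 0" "hV (M (g (w 0))) = 0" unfolding sameline_def by blast
    then show ?thesis using bline_invariantI[OF M(1) g c(3) M(2,3)] by blast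
  qed
  then show ?thesis using that[OF \<delta>(1)] by blast
qed

text \<open>A null-homotopy would give a constant lift and hence a fixed point of \<open>g\<close>.
  A homotopy into the boundary would give a lift inside \<open>dC\<close>, so \<open>collar\<close>
  would provide an invariant line.\<close>

lemma essential_if_no_invariant_line:
  assumes g: "g \<in> Deck" and rep: "represents \<gamma> g" and \<gamma>: "path \<gamma>" "path_image \<gamma> \<subseteq> Sg" "pathfinish \<gamma> = pathstart \<gamma>"
    and free: "\<And>z. z \<in> C \<Longrightarrow> g z \<noteq> z"
    and inv: "\<And>M M'. bline M M' \<Longrightarrow> \<exists>x\<in>C. \<not> (hV (M (g x)) = 0 \<longleftrightarrow> hV (M x) = 0)"
  shows "essential_loop Sg \<gamma>"
  unfolding essential_loop_def
proof (intro conjI \<gamma> notI)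
  assume "\<exists>a. homotopic_loops Sg \<gamma> (\<lambda>_. a)"
  then obtain a where "homotopic_loops Sg \<gamma> (\<lambda>_. a)" ..
  then have "represents (\<lambda>_. a) g" using represents_homotopic[OF rep g] by blast
  then obtain \<sigma> :: "real \<Rightarrow> complex" where \<sigma>: "continuous_on {0..1} \<sigma>" "\<sigma> \<in> {0..1} \<rightarrow> C" "\<And>t. t \<in> {0..1} \<Longrightarrow> p (\<sigma> t) = a" "\<sigma> 1 = g (\<sigma> 0)"
    unfolding represents_def by blast
  have "\<sigma> 1 = (\<lambda>_. \<sigma> 0) (1::real)"
    by (rule lift_unique[of "{0..1::real}" 0 1 \<sigma> "\<lambda>_. \<sigma> 0"]) (use \<sigma> in auto)
  then show False using \<sigma>(4) free[OF Pi_mem[OF \<sigma>(2), of 0]] by simp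
next
  assume "\<exists>\<delta>. path_image \<delta> \<subseteq> surface_boundary Sg \<and> homotopic_loops Sg \<gamma> \<delta>"
  then obtain \<delta> where \<delta>: "path_image \<delta> \<subseteq> surface_boundary Sg" "homotopic_loops Sg \<gamma> \<delta>" by blast
  then have "represents \<delta> g" using represents_homotopic[OF rep g] by blast
  then obtain \<sigma> where \<sigma>: "continuous_on {0..1} \<sigma>" "\<sigma> \<in> {0..1} \<rightarrow> C" "\<And>t. t \<in> {0..1} \<Longrightarrow> p (\<sigma> t) = \<delta> t" "\<sigma> 1 = g (\<sigma> 0)"
    unfolding represents_def by blast
  have sd: "\<sigma> t \<in> dC" if "t \<in> {0..1}" for t
    using \<sigma>(2) \<sigma>(3)[OF that] \<delta>(1) that by (auto simp: dC_def path_image_def)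
  obtain e where e: "e > 0" "\<And>g \<sigma>. g \<in> Deck \<Longrightarrow> continuous_on {0..1} \<sigma> \<Longrightarrow> \<sigma> \<in> {0..1::real} \<rightarrow> C \<Longrightarrow> \<sigma> 1 = g (\<sigma> 0) \<Longrightarrow>
      (\<And>t. t \<in> {0..1} \<Longrightarrow> \<exists>w\<in>dC. hdist (\<sigma> t) w < e) \<Longrightarrow>
      \<exists>M M'. bline M M' \<and> (\<forall>x\<in>C. hV (M (g x)) = 0 \<longleftrightarrow> hV (M x) = 0)" using collar by metis
  have "\<exists>M M'. bline M M' \<and> (\<forall>x\<in>C. hV (M (g x)) = 0 \<longleftrightarrow> hV (M x) = 0)"
  proof (rule e(2)[OF g \<sigma>(1,2,4)])
    fix t :: real assume "t \<in> {0..1}"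
    then show "\<exists>w\<in>dC. hdist (\<sigma> t) w < e" using sd[of t] e(1) C_uhpD dC_C by (intro bexI[of _ "\<sigma> t"]) auto
  qed
  then show False using inv by blast
qed

end

section \<open>The space of geodesics\<close>

text \<open>The determinant of the hyperboloid coordinates of \<open>k 0\<close>, \<open>k 1\<close> and \<open>u\<close>; it vanishes on the geodesic \<open>k\<close>
  and takes opposite signs on its two sides.\<close>

definition hside :: "(real \<Rightarrow> complex) \<Rightarrow> complex \<Rightarrow> real" where
  "hside k u = (hV (k 0) * hW (k 1) - hW (k 0) * hV (k 1)) * hU u
     + (hW (k 0) * hU (k 1) - hU (k 0) * hW (k 1)) * hV u
     + (hU (k 0) * hV (k 1) - hV (k 0) * hU (k 1)) * hW u"

lemma hlin_hside: "hlin (hside k)"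
  unfolding hlin_def hside_def by blast

lemma unit_geodesicsD:
  assumes "k \<in> unit_geodesics D"
  shows "k t \<in> D" "hdist (k s) (k t) = \<bar>s - t\<bar>"
  using assms by (auto simp: unit_geodesics_def)

lemma hside_geodesic:
  assumes "k \<in> unit_geodesics uhp"
  shows "hside k (k t) = 0"
proof -
  have "hside k (k 0) = 0" "hside k (k 1) = 0" by (simp_all add: hside_def algebra_simps)
  then show ?thesis using hlin_geodesic_zero[OF hlin_hside assms, of k 0 1 t] by simp
qed

text \<open>Functionals vanishing at two points form a one-dimensional space, spanned by the
  coordinate \<open>hV\<close> adapted to the line through them.\<close>

lemma hlin_zero_on_geodesic:
  assumes f: "hlin f" and k: "k \<in> unit_geodesics uhp" and M: "hiso M M'" "\<And>t. M (k t) = iax t"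
    and z: "f (k 0) = 0" "f (k 1) = 0"
  obtains c where "\<And>u. u \<in> uhp \<Longrightarrow> f u = c * hV (M u)"
proof -
  obtain a b d where abd: "\<And>x. x \<in> uhp \<Longrightarrow> f (M' x) = a * hU x + b * hV x + d * hW x"
    using hlin_comp[OF hiso_sym[OF M(1)] f] unfolding hlin_def by blast
  have F: "f u = a * hU (M u) + b * hV (M u) + d * hW (M u)" if "u \<in> uhp" for u
    using abd[OF hisoD(1)[OF M(1) that]] hisoD(3)[OF M(1) that] by simp
  have "a + d = 0" "a * exp (- 1) + d * exp 1 = 0"
    using F[OF unit_geodesicsD(1)[OF k, of 0]] F[OF unit_geodesicsD(1)[OF k, of 1]] z by (simp_all add: M(2) iax)
  then have d: "d = - a" and "a * exp (- 1) + d * exp 1 = 0" by linarith+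
  then have "a * (exp (- 1) - exp 1) = 0" by (simp add: algebra_simps)
  then have "a = 0" "d = 0" using d by simp_all
  then show ?thesis using F by (intro that[of b]) simp
qed

lemma hside_zero:
  assumes k: "k \<in> unit_geodesics uhp" and u: "u \<in> uhp" "hside k u = 0"
  shows "u \<in> range k"
proof -
  obtain M M' where M: "hiso M M'" "\<And>t. M (k t) = iax t" using geodesic_normal_form[OF k] by blast
  obtain c where c: "\<And>u. u \<in> uhp \<Longrightarrow> hside k u = c * hV (M u)"
    using hlin_zero_on_geodesic[OF hlin_hside k M] hside_geodesic[OF k] by metis
  note k0 = unit_geodesicsD(1)[OF k, of 0] and k1 = unit_geodesicsD(1)[OF k, of 1]
  \<comment> \<open>If the determinant vanished identically, the vectors of \<open>k 0\<close> and
    \<open>k 1\<close> would be proportional and, being normalised, equal.\<close>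
  have "c \<noteq> 0"
  proof
    assume "c = 0"
    then have z: "hside k u = 0" if "u \<in> uhp" for u using c that by simp
    define \<alpha> \<beta> \<gamma> where "\<alpha> = hV (k 0) * hW (k 1) - hW (k 0) * hV (k 1)"
      and "\<beta> = hW (k 0) * hU (k 1) - hU (k 0) * hW (k 1)" and "\<gamma> = hU (k 0) * hV (k 1) - hV (k 0) * hU (k 1)"
    have s: "hside k u = \<alpha> * hU u + \<beta> * hV u + \<gamma> * hW u" for u by (simp add: hside_def \<alpha>_def \<beta>_def \<gamma>_def)
    have "\<alpha> + \<gamma> = 0" using z[OF i_uhp] s by simp
    moreover have "\<alpha> * exp (- 1) + \<gamma> * exp 1 = 0" using z[OF iax(1)[of 1]] s by (simp add: iax)
    ultimately have g: "\<gamma> = - \<alpha>" and "\<alpha> * exp (- 1) + \<gamma> * exp 1 = 0" by linarith+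
    then have "\<alpha> * (exp (- 1) - exp 1) = 0" by (simp add: algebra_simps)
    then have ag: "\<alpha> = 0" "\<gamma> = 0" using g by simp_all
    have "Complex 1 1 \<in> uhp" "hV (Complex 1 1) = 1" by (auto simp: uhp_def hV_def)
    then have b: "\<beta> = 0" using z[of "Complex 1 1"] s ag by simp
    have p: "hU (k 0) > 0" "hU (k 1) > 0" using hU_pos k0 k1 by auto
    define r where "r = hU (k 1) / hU (k 0)"
    have r: "hU (k 1) = r * hU (k 0)" "r > 0" using p by (auto simp: r_def)
    have V: "hV (k 1) = r * hV (k 0)" and W: "hW (k 1) = r * hW (k 0)"
      using ag(2) b p by (auto simp: \<beta>_def \<gamma>_def r_def field_simps)
    have "1 + (hV (k 1))\<^sup>2 = r\<^sup>2 * (1 + (hV (k 0))\<^sup>2)"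
      unfolding hUW[OF k0, symmetric] hUW[OF k1, symmetric] r(1) W by (simp add: power2_eq_square)
    then have "r\<^sup>2 = 1" unfolding V by (simp add: power_mult_distrib algebra_simps)
    then have "r = 1" using r(2) by (simp add: power2_eq_1_iff)
    then have "k 1 = k 0" using r V k0 k1 by (intro uhp_eqI) auto
    then show False using unit_geodesicsD(2)[OF k, of 0 1] k0 by simp
  qed
  then have "hV (M u) = 0" using c[OF u(1)] u(2) by simp
  then obtain t where "M u = iax t" using iax_eqI[OF hisoD(1)[OF M(1) u(1)]] by blast
  then have "M u = M (k t)" by (simp add: M(2))
  then have "u = k t" using hisoD(3)[OF M(1) u(1)] hisoD(3)[OF M(1) unit_geodesicsD(1)[OF k]] by metis
  then show ?thesis by blast
qed

lemma geodesics_meet_twice: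
  assumes "k \<in> unit_geodesics uhp" "j \<in> unit_geodesics uhp" "a \<in> range k" "b \<in> range k" "a \<in> range j" "b \<in> range j" "a \<noteq> b"
  shows "range k = range j"
proof -
  have sub: "range j \<subseteq> range k"
    if h: "k \<in> unit_geodesics uhp" "j \<in> unit_geodesics uhp" "a \<in> range k" "b \<in> range k" "a \<in> range j" "b \<in> range j" for k j
  proof
    fix u assume "u \<in> range j"
    then obtain t where t: "u = j t" by auto
    obtain r s where rs: "a = j r" "b = j s" using h by auto
    have "hside k (j r) = 0" "hside k (j s) = 0" using h(3,4) hside_geodesic[OF h(1)] rs by auto
    then have "hside k u = 0" unfolding t using hlin_geodesic_zero[OF hlin_hside h(2)] rs assms(7) by metis
    then show "u \<in> range k" using hside_zero[OF h(1)] unit_geodesicsD(1)[OF h(2)] t by blast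
  qed
  show ?thesis using sub[OF assms(1,2,3,4,5,6)] sub[OF assms(2,1,5,6,3,4)] by blast
qed

lemma hlin_hmix:
  assumes "hlin f" "z \<in> uhp" "w \<in> uhp" "s \<in> {0..1}"
  shows "f (hmix s z w) = ((1 - s) * f z + s * f w) / hmixN s z w"
proof -
  obtain a b c where f: "\<And>z. z \<in> uhp \<Longrightarrow> f z = a * hU z + b * hV z + c * hW z"
    using assms(1) unfolding hlin_def by blast
  show ?thesis
    using hmixN_sq(2)[OF assms(2-4)] unfolding f[OF hmix(1)[OF assms(2-4)]] f[OF assms(2)] f[OF assms(3)] hmix(2-4)[OF assms(2-4)]
    by (simp add: field_simps)
qed

definition hseg :: "complex \<Rightarrow> complex \<Rightarrow> complex set" where
  "hseg z w = (\<lambda>s. hmix s z w) ` {0..1}"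

text \<open>Up to a positive factor \<open>hside k\<close> is affine along the segment, and it
  vanishes only on \<open>k\<close>. The criterion is a closed condition on \<open>k 0\<close> and
  \<open>k 1\<close>, which makes the set of geodesics meeting a segment measurable.\<close>

lemma meets_hseg_iff:
  assumes k: "k \<in> unit_geodesics uhp" and zw: "z \<in> uhp" "w \<in> uhp"
  shows "range k \<inter> hseg z w \<noteq> {} \<longleftrightarrow> hside k z * hside k w \<le> 0"
proof
  assume "range k \<inter> hseg z w \<noteq> {}"
  then obtain t where "k t \<in> hseg z w" by blast
  then obtain s where s: "s \<in> {0..1}" "k t = hmix s z w" unfolding hseg_def by blast
  have "hside k (hmix s z w) = 0" using hside_geodesic[OF k, of t] s by simp
  then have e: "(1 - s) * hside k z + s * hside k w = 0"
    using hlin_hmix[OF hlin_hside zw s(1), of k] hmixN_sq(2)[OF zw s(1)] by simp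
  show "hside k z * hside k w \<le> 0"
  proof (rule ccontr)
    assume "\<not> ?thesis"
    then have "(hside k z > 0 \<and> hside k w > 0) \<or> (hside k z < 0 \<and> hside k w < 0)" by (auto simp: not_le zero_less_mult_iff)
    then show False
    proof
      assume h: "hside k z > 0 \<and> hside k w > 0"
      have "(1 - s) * hside k z \<ge> 0" "s * hside k w \<ge> 0" using h s by auto
      then have "(1 - s) * hside k z = 0" "s * hside k w = 0" using e by linarith+
      then show False using h by auto
    next
      assume h: "hside k z < 0 \<and> hside k w < 0"
      have "(1 - s) * hside k z \<le> 0" "s * hside k w \<le> 0" using h s by (auto simp: mult_le_0_iff)
      then have "(1 - s) * hside k z = 0" "s * hside k w = 0" using e by linarith+
      then show False using h by auto
    qed
  qed
next
  assume le: "hside k z * hside k w \<le> 0"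
  define x y where "x = hside k z" and "y = hside k w"
  have "\<exists>s\<in>{0..1}. (1 - s) * x + s * y = 0"
  proof (cases "x = y")
    case True
    then have "x = 0" using le by (auto simp: x_def y_def mult_le_0_iff)
    then show ?thesis using True by (intro bexI[of _ 0]) auto
  next
    case False
    define s where "s = x / (x - y)"
    have "s \<in> {0..1}"
    proof (cases "x > y")
      case True
      then have "x \<ge> 0" "y \<le> 0" using le unfolding x_def[symmetric] y_def[symmetric] by (auto simp: mult_le_0_iff)
      then show ?thesis using True by (simp add: s_def field_simps)
    next
      case F: False
      then have "x \<le> 0" "y \<ge> 0" using False le unfolding x_def[symmetric] y_def[symmetric] by (auto simp: mult_le_0_iff)
      then show ?thesis using F False by (simp add: s_def field_simps)
    qed
    moreover have "(1 - s) * x + s * y = 0" using False by (simp add: s_def field_simps)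
    ultimately show ?thesis by blast
  qed
  then obtain s where s: "s \<in> {0..1}" "(1 - s) * x + s * y = 0" by blast
  then have "hside k (hmix s z w) = 0" using hlin_hmix[OF hlin_hside zw s(1), of k] by (simp add: x_def y_def)
  then have "hmix s z w \<in> range k" using hside_zero[OF k hmix(1)[OF zw s(1)]] by blast
  moreover have "hmix s z w \<in> hseg z w" unfolding hseg_def using s(1) by blast
  ultimately show "range k \<inter> hseg z w \<noteq> {}" by blast
qed

lemma continuous_on_apply: "continuous_on S (\<lambda>k :: 'a \<Rightarrow> 'b::topological_space. k t)"
  by (rule continuous_on_subset[OF continuous_on_product_coordinates]) simp

lemma topspace_geodesic_topology: "topspace (geodesic_topology D) = geodesics D"
proof
  show "topspace (geodesic_topology D) \<subseteq> geodesics D"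
    unfolding topspace_def openin_geodesic_topology by blast
  have "{k \<in> unit_geodesics D. range k \<in> geodesics D} = unit_geodesics D" by (auto simp: geodesics_def)
  then have "openin (geodesic_topology D) (geodesics D)" by (simp add: openin_geodesic_topology)
  then show "geodesics D \<subseteq> topspace (geodesic_topology D)" by (simp add: openin_subset)
qed

lemma range_continuous_map:
  "continuous_map (top_of_set (unit_geodesics D)) (geodesic_topology D) range"
proof -
  have "openin (top_of_set (unit_geodesics D)) {k \<in> unit_geodesics D. range k \<in> U}"
    if "openin (geodesic_topology D) U" for U
    using that by (simp add: openin_geodesic_topology)
  then show ?thesis
    by (auto simp: continuous_map_def topspace_geodesic_topology geodesics_def)
qed

lemma space_geodesic_borel: "space (geodesic_borel D) = geodesics D"
  unfolding geodesic_borel_def by (rule space_measure_of) (auto simp: openin_geodesic_topology)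

lemma open_geodesic_borel:
  assumes "openin (geodesic_topology D) U"
  shows "U \<in> sets (geodesic_borel D)"
  unfolding geodesic_borel_def using assms
  by (subst sets_measure_of) (auto simp: openin_geodesic_topology)

section \<open>The deck action on geodesics, compactness and measurability\<close>

context surface_cover
begin

lemma geodesicsE:
  assumes "h \<in> geodesics C"
  obtains k where "k \<in> unit_geodesics C" "h = range k"
  using assms by (auto simp: geodesics_def)

lemma deck_geodesics: "\<tau> \<in> Deck \<Longrightarrow> h \<in> geodesics C \<Longrightarrow> \<tau> ` h \<in> geodesics C"
  using deck_geodesic by (force simp: geodesics_def image_image image_iff)

lemma geodesics_sub: "h \<in> geodesics C \<Longrightarrow> h \<subseteq> C"
  by (auto simp: geodesics_def unit_geodesics_def)

lemma deck_image_inv: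
  assumes "h \<in> geodesics C" "\<And>u. u \<in> C \<Longrightarrow> \<tau>' (\<tau> u) = u"
  shows "\<tau>' ` \<tau> ` h = h"
  using geodesics_sub[OF assms(1)] assms(2) by (force simp: image_image)

lemma deck_measurable:
  assumes "\<tau> \<in> Deck"
  shows "(`) \<tau> \<in> measurable (geodesic_borel C) (geodesic_borel C)"
  unfolding geodesic_borel_def[of C]
proof (rule measurable_measure_of)
  fix U assume "U \<in> {U. openin (geodesic_topology C) U}"
  then have U: "openin (geodesic_topology C) U" by simp
  define UG where "UG = unit_geodesics C"
  have "openin (top_of_set UG) {k \<in> UG. range k \<in> U}" using U by (simp add: openin_geodesic_topology UG_def)
  moreover have "continuous_on UG (\<lambda>k t. \<tau> (k t))"
  proof (rule continuous_on_coordinatewise_then_product)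
    fix t :: real
    show "continuous_on UG (\<lambda>k. \<tau> (k t))"
      by (rule continuous_on_compose2[OF deck_cont[OF assms] continuous_on_apply])
         (auto simp: UG_def unit_geodesics_def)
  qed
  moreover have "(\<lambda>k t. \<tau> (k t)) \<in> UG \<rightarrow> UG" using deck_geodesic[OF assms] by (auto simp: UG_def)
  ultimately have "openin (top_of_set UG) (UG \<inter> (\<lambda>k t. \<tau> (k t)) -` {k \<in> UG. range k \<in> U})"
    using continuous_openin_preimage by blast
  moreover have "UG \<inter> (\<lambda>k t. \<tau> (k t)) -` {k \<in> UG. range k \<in> U} = {k \<in> UG. range k \<in> ((`) \<tau> -` U \<inter> geodesics C)}"
    using deck_geodesic[OF assms] by (auto simp: UG_def geodesics_def image_image)
  ultimately have "openin (geodesic_topology C) ((`) \<tau> -` U \<inter> geodesics C)"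
    by (simp add: openin_geodesic_topology UG_def)
  then show "(`) \<tau> -` U \<inter> space (sigma (geodesics C) {U. openin (geodesic_topology C) U})
      \<in> sets (sigma (geodesics C) {U. openin (geodesic_topology C) U})"
    using open_geodesic_borel space_geodesic_borel unfolding geodesic_borel_def by metis
next
  show "{U. openin (geodesic_topology C) U} \<subseteq> Pow (geodesics C)" by (auto simp: openin_geodesic_topology)
  show "(`) \<tau> \<in> space (sigma (geodesics C) {U. openin (geodesic_topology C) U}) \<rightarrow> geodesics C"
    using space_geodesic_borel[of C] deck_geodesics[OF assms] unfolding geodesic_borel_def by auto
qed

text \<open>The image under \<open>\<tau>\<close> is the preimage under its inverse. Images are
  needed because the invariance of currents is stated with them.\<close>

lemma deck_image_sets:
  assumes "\<tau> \<in> Deck" "A \<in> sets (geodesic_borel C)"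
  shows "(`) \<tau> ` A \<in> sets (geodesic_borel C)"
proof -
  obtain \<tau>' where t: "\<tau>' \<in> Deck" "\<And>u. u \<in> C \<Longrightarrow> \<tau>' (\<tau> u) = u" "\<And>u. u \<in> C \<Longrightarrow> \<tau> (\<tau>' u) = u"
    using deck_inv[OF assms(1)] by blast
  have A: "A \<subseteq> geodesics C" using sets.sets_into_space[OF assms(2)] by (simp add: space_geodesic_borel)
  have "(`) \<tau> ` A = (`) \<tau>' -` A \<inter> space (geodesic_borel C)"
  proof
    show "(`) \<tau> ` A \<subseteq> (`) \<tau>' -` A \<inter> space (geodesic_borel C)"
    proof
      fix y assume "y \<in> (`) \<tau> ` A"
      then obtain h where h: "h \<in> A" "y = \<tau> ` h" by auto
      then have hg: "h \<in> geodesics C" using A by blast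
      have "\<tau>' ` y = h" unfolding h(2) by (rule deck_image_inv[of h \<tau>' \<tau>, OF hg t(2)])
      then show "y \<in> (`) \<tau>' -` A \<inter> space (geodesic_borel C)"
        using h deck_geodesics[OF assms(1) hg] by (simp add: space_geodesic_borel)
    qed
    show "(`) \<tau>' -` A \<inter> space (geodesic_borel C) \<subseteq> (`) \<tau> ` A"
    proof
      fix y assume "y \<in> (`) \<tau>' -` A \<inter> space (geodesic_borel C)"
      then have y: "\<tau>' ` y \<in> A" "y \<in> geodesics C" by (auto simp: space_geodesic_borel)
      have "y = \<tau> ` \<tau>' ` y" using deck_image_inv[of y \<tau> \<tau>', OF y(2) t(3)] by simp
      then show "y \<in> (`) \<tau> ` A" using y by blast
    qed
  qed
  then show ?thesis using measurable_sets[OF deck_measurable[OF t(1)] assms(2)] by simp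
qed

definition meeting :: "complex \<Rightarrow> complex \<Rightarrow> complex set set" where
  "meeting z w = {h \<in> geodesics C. h \<inter> hseg z w \<noteq> {}}"

lemma meeting_sets:
  assumes "z \<in> C" "w \<in> C"
  shows "meeting z w \<in> sets (geodesic_borel C)"
proof -
  define UG where "UG = unit_geodesics C"
  have zw: "z \<in> uhp" "w \<in> uhp" using assms C_uhpD by auto
  have u: "(\<lambda>k. k t) ` UG \<subseteq> uhp" for t :: real using C_uhpD by (auto simp: UG_def unit_geodesics_def)
  have c: "continuous_on UG (\<lambda>k. hside k x)" for x
    unfolding hside_def by (intro continuous_intros continuous_on_apply u)
  have "openin (top_of_set UG) (UG \<inter> (\<lambda>k. hside k z * hside k w) -` {0<..})"
    by (intro continuous_openin_preimage_gen continuous_intros c)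
  moreover have "UG \<inter> (\<lambda>k. hside k z * hside k w) -` {0<..} = {k \<in> UG. range k \<in> geodesics C - meeting z w}"
  proof -
    have "range k \<in> meeting z w \<longleftrightarrow> hside k z * hside k w \<le> 0" if "k \<in> UG" for k
      using meets_hseg_iff[OF unit_geodesics_uhp[OF _ C_uhp] zw, of k] that
      by (auto simp: meeting_def UG_def geodesics_def)
    then show ?thesis by (auto simp: UG_def geodesics_def)
  qed
  ultimately have "openin (geodesic_topology C) (geodesics C - meeting z w)"
    by (simp add: openin_geodesic_topology UG_def)
  then have "geodesics C - (geodesics C - meeting z w) \<in> sets (geodesic_borel C)"
    using open_geodesic_borel sets.compl_sets[of "geodesics C - meeting z w" "geodesic_borel C"] by (simp add: space_geodesic_borel)
  moreover have "geodesics C - (geodesics C - meeting z w) = meeting z w" by (auto simp: meeting_def)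
  ultimately show ?thesis by simp
qed

text \<open>A form of Arzela-Ascoli: a geodesic parametrised from a point of the segment has its
  value at time \<open>t\<close> in a compact ball, so Tychonoff applies, and unit speed is a closed
  condition for pointwise convergence. The quotient map takes these parametrisations onto
  \<open>meeting z w\<close>.\<close>

lemma meeting_compact:
  assumes "z \<in> C" "w \<in> C"
  shows "compactin (geodesic_topology C) (meeting z w)"
proof -
  have zw: "z \<in> uhp" "w \<in> uhp" using assms C_uhpD by auto
  define d where "d = hdist z w"
  define B where "B t = {u\<in>C. hdist z u \<le> d + \<bar>t\<bar>}" for t :: real
  have cB: "compact (B t)" for t unfolding B_def by (rule compact_C_hcball[OF zw(1)])
  have Bu: "u \<in> uhp" if "u \<in> B t" for u t using that C_uhpD by (auto simp: B_def)
  define X :: "(real \<Rightarrow> complex) set" where "X = {k. \<forall>t. k t \<in> B t}"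
  have "compactin (product_topology (\<lambda>t. euclidean) UNIV) (PiE UNIV B)"
    using cB by (simp add: compactin_PiE)
  then have cX: "compact X" unfolding euclidean_product_topology by (simp add: X_def PiE_UNIV_domain Pi_def)
  have segc: "compact (hseg z w)" unfolding hseg_def
    by (rule compact_continuous_image) (use zw in \<open>auto intro!: continuous_intros\<close>)
  have seg: "u \<in> C" "hdist z u \<le> d" if u: "u \<in> hseg z w" for u
  proof -
    obtain s where s: "s \<in> {0..1}" "u = hmix s z w" using u unfolding hseg_def by blast
    show "u \<in> C" using hyp_convex_hmix[OF conv assms s(1)] s by simp
    then have "hdist u w \<ge> 0" using hdist_nonneg zw C_uhpD by simp
    then show "hdist z u \<le> d" using hmix_between[OF zw s(1)] s by (simp add: d_def)
  qed
  define Y where "Y = {k \<in> X. k 0 \<in> hseg z w} \<inter> (\<Inter>s. \<Inter>t. {k \<in> X. hdist (k s) (k t) = \<bar>s - t\<bar>})"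
  have "closedin (top_of_set X) {k \<in> X. k 0 \<in> hseg z w}"
  proof -
    have "closedin (top_of_set X) (X \<inter> (\<lambda>k. k 0) -` hseg z w)"
      by (intro continuous_closedin_preimage continuous_on_apply compact_imp_closed[OF segc])
    then show ?thesis by (simp add: Int_def vimage_def)
  qed
  moreover have "closedin (top_of_set X) {k \<in> X. hdist (k s) (k t) = \<bar>s - t\<bar>}" for s t
  proof -
    have "continuous_on X (\<lambda>k. hdist (k s) (k t))"
      by (intro continuous_intros continuous_on_apply) (use Bu in \<open>auto simp: X_def\<close>)
    then have "closedin (top_of_set X) (X \<inter> (\<lambda>k. hdist (k s) (k t)) -` {\<bar>s - t\<bar>})"
      by (rule continuous_closedin_preimage) simp
    then show ?thesis by (simp add: Int_def vimage_def)
  qed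
  ultimately have "closedin (top_of_set X) Y"
    unfolding Y_def by (intro closedin_Int closedin_INT) auto
  then have cY: "compact Y" using closedin_compact[OF cX] by blast
  have YU: "Y \<subseteq> unit_geodesics C" by (auto simp: Y_def X_def B_def unit_geodesics_def)
  have "compactin (top_of_set (unit_geodesics C)) Y" using cY YU by (simp add: compactin_subtopology)
  then have "compactin (geodesic_topology C) (range ` Y)" using image_compactin range_continuous_map by blast
  moreover have "range ` Y = meeting z w"
  proof
    show "range ` Y \<subseteq> meeting z w"
    proof
      fix h assume "h \<in> range ` Y"
      then obtain k where k: "k \<in> Y" "h = range k" by blast
      then have "k 0 \<in> hseg z w" by (simp add: Y_def)
      then have "h \<inter> hseg z w \<noteq> {}" using k(2) by blast
      moreover have "h \<in> geodesics C" using YU k by (auto simp: geodesics_def)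
      ultimately show "h \<in> meeting z w" by (simp add: meeting_def)
    qed
    show "meeting z w \<subseteq> range ` Y"
    proof
      fix h assume "h \<in> meeting z w"
      then obtain k where k: "k \<in> unit_geodesics C" "h = range k" "range k \<inter> hseg z w \<noteq> {}"
        by (auto simp: meeting_def geodesics_def)
      then obtain t0 where t0: "k t0 \<in> hseg z w" by auto
      define j where "j t = k (t + t0)" for t
      have jr: "range j = h" unfolding k(2) j_def by (metis (no_types) image_image surj_plus_right add.commute)
      have jd: "j t \<in> C" "hdist (j s) (j t) = \<bar>s - t\<bar>" for s t using unit_geodesicsD[OF k(1)] by (auto simp: j_def)
      have j0: "j 0 \<in> hseg z w" using t0 by (simp add: j_def)
      have "hdist z (j t) \<le> d + \<bar>t\<bar>" for t
      proof -
        have "hdist z (j t) \<le> hdist z (j 0) + hdist (j 0) (j t)" using zw jd C_uhpD by (intro hdist_triangle) auto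
        then show ?thesis using seg(2)[OF j0] jd(2)[of 0 t] by simp
      qed
      then have "j \<in> Y" using j0 jd by (auto simp: Y_def X_def B_def)
      then show "h \<in> range ` Y" using jr by blast
    qed
  qed
  ultimately show ?thesis by simp
qed

text \<open>Balls of radius \<open>\<rho> / 2\<close> around the points of a fibre are open and
  disjoint.\<close>

lemma countable_fibre: "countable {v\<in>C. p v = x}"
proof -
  define F where "F = {v\<in>C. p v = x}"
  define N where "N v = {u\<in>uhp. hdist v u < \<rho> / 2}" for v
  have Fu: "v \<in> uhp" if "v \<in> F" for v using that C_uhpD by (auto simp: F_def)
  have "open uhp" unfolding uhp_def by (simp add: open_halfspace_Im_gt)
  then have op: "open (N v)" if "v \<in> F" for v
    using openin_hball[of uhp v "\<rho>/2"] Fu[OF that] openin_open_trans unfolding N_def by blast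
  have dj: "u = v" if "u \<in> F" "v \<in> F" "x \<in> N u" "x \<in> N v" for u v x
  proof (rule fibre_separated)
    show "u \<in> C" "v \<in> C" "p u = p v" using that by (auto simp: F_def)
    have "hdist u v \<le> hdist u x + hdist x v" using that Fu by (intro hdist_triangle) (auto simp: N_def)
    then show "hdist u v < \<rho>" using that Fu hdist_commute[of x v] by (auto simp: N_def)
  qed
  have vN: "v \<in> N v" if "v \<in> F" for v using Fu[OF that] \<rho>(1) by (simp add: N_def)
  have "inj_on N F" using dj vN by (metis inj_onI)
  moreover have "countable (N ` F)"
    by (rule countable_disjoint_open_subsets) (use op dj in \<open>auto simp: pairwise_def disjnt_def\<close>)
  ultimately show ?thesis using countable_image_inj_on unfolding F_def[symmetric] by blast
qed

end

section \<open>Bounding intersection numbers\<close>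

lemma unit_geodesic_continuous:
  assumes "k \<in> unit_geodesics uhp"
  shows "continuous_on S k"
proof -
  have "continuous_on UNIV k"
    by (subst continuous_into_uhp_iff) (use unit_geodesicsD[OF assms] in \<open>auto simp: dist_real_def\<close>)
  then show ?thesis using continuous_on_subset by blast
qed

context surface_cover
begin

lemma geodesic_lift_unique:
  assumes "k \<in> unit_geodesics C" "j \<in> unit_geodesics C" "\<And>t. p (k t) = p (j t)" "k s = j s"
  shows "k t = j t"
  by (rule lift_unique[OF connected_UNIV UNIV_I UNIV_I])
     (use assms unit_geodesic_continuous unit_geodesics_uhp[OF _ C_uhp] in \<open>auto simp: unit_geodesics_def\<close>)

definition dinv :: "(complex \<Rightarrow> complex) \<Rightarrow> complex \<Rightarrow> complex" where
  "dinv \<tau> = (SOME \<tau>'. \<tau>' \<in> Deck \<and> (\<forall>z\<in>C. \<tau>' (\<tau> z) = z \<and> \<tau> (\<tau>' z) = z))"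

lemma dinv:
  assumes "\<tau> \<in> Deck"
  shows "dinv \<tau> \<in> Deck" "z \<in> C \<Longrightarrow> dinv \<tau> (\<tau> z) = z" "z \<in> C \<Longrightarrow> \<tau> (dinv \<tau> z) = z"
proof -
  have "\<exists>\<tau>'. \<tau>' \<in> Deck \<and> (\<forall>z\<in>C. \<tau>' (\<tau> z) = z \<and> \<tau> (\<tau>' z) = z)" using deck_inv[OF assms] by metis
  from someI_ex[OF this]
  show "dinv \<tau> \<in> Deck" "z \<in> C \<Longrightarrow> dinv \<tau> (\<tau> z) = z" "z \<in> C \<Longrightarrow> \<tau> (dinv \<tau> z) = z"
    by (auto simp: dinv_def)
qed

lemma dinv_image:
  assumes "\<tau> \<in> Deck" "h \<subseteq> C"
  shows "dinv \<tau> ` \<tau> ` h = h" "\<tau> ` dinv \<tau> ` h = h"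
  using assms dinv[OF assms(1)] by (force simp: image_image)+

lemma deck_inj: "\<tau> \<in> Deck \<Longrightarrow> u \<in> C \<Longrightarrow> v \<in> C \<Longrightarrow> \<tau> u = \<tau> v \<Longrightarrow> u = v"
  using dinv(2) by metis

lemma axis_powers:
  assumes g: "g \<in> Deck" and k: "k \<in> unit_geodesics C" and kg: "\<And>t. k (t + l) = g (k t)"
    and G: "\<And>n :: int. G n \<in> Deck" "\<And>z. z \<in> C \<Longrightarrow> G 0 z = z" "\<And>n z. z \<in> C \<Longrightarrow> G (n + 1) z = g (G n z)"
  shows "G n (k t) = k (t + of_int n * l)"
proof (induction n rule: int_induct[where k = 0])
  case base
  then show ?case using G(2) unit_geodesicsD(1)[OF k] by simp
next
  case (step1 i)
  have "G (i + 1) (k t) = g (k (t + of_int i * l))" using G(3) unit_geodesicsD(1)[OF k] step1 by simp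
  also have "\<dots> = k (t + of_int (i + 1) * l)" by (simp add: kg[symmetric] algebra_simps)
  finally show ?case .
next
  case (step2 i)
  have "g (G (i - 1) (k t)) = G i (k t)" using G(3)[of "k t" "i - 1"] unit_geodesicsD(1)[OF k] by simp
  also have "\<dots> = k (t + of_int i * l)" using step2 by simp
  also have "\<dots> = g (k (t + of_int (i - 1) * l))" by (simp add: kg[symmetric] algebra_simps)
  finally show ?case using deck_inj[OF g deck_C[OF G(1) unit_geodesicsD(1)[OF k]] unit_geodesicsD(1)[OF k]] by blast
qed

text \<open>A geodesic that crosses the axis moves away from it on both sides, while the translates of \<open>P\<close>
  stay at bounded distance from the axis; so the geodesic separates the two ends of their union.\<close>

lemma crossing:
  assumes g: "g \<in> Deck" and k0: "k0 \<in> unit_geodesics C" and l: "l > 0" and kg: "\<And>t. k0 (t + l) = g (k0 t)"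
    and G: "\<And>n :: int. G n \<in> Deck" "\<And>z. z \<in> C \<Longrightarrow> G 0 z = z" "\<And>n z. z \<in> C \<Longrightarrow> G (n + 1) z = g (G n z)"
      "\<And>n z. z \<in> C \<Longrightarrow> G n (g z) = g (G n z)"
    and h: "h \<in> geodesics C" "h \<noteq> range k0" "h \<inter> range k0 \<noteq> {}"
    and P: "continuous_on {0..1} P" "P \<in> {0..1::real} \<rightarrow> C" "P 1 = g (P 0)"
  obtains j t where "t \<in> {0..1}" "G j (P t) \<in> h"
proof (rule ccontr)
  assume "\<not> thesis"
  then have no: "G j (P t) \<notin> h" if "t \<in> {0..1}" for j t using that \<open>\<And>t j. t \<in> {0..1} \<Longrightarrow> G j (P t) \<in> h \<Longrightarrow> thesis\<close> by blast
  obtain k where k: "k \<in> unit_geodesics C" "h = range k" using geodesicsE[OF h(1)] .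
  note ku = unit_geodesics_uhp[OF k(1) C_uhp] and k0u = unit_geodesics_uhp[OF k0 C_uhp]
  obtain M M' where M: "hiso M M'" "\<And>t. M (k t) = iax t" using geodesic_normal_form[OF ku] by blast
  define f where "f u = hV (M u)" for u
  have f: "hlin f" unfolding f_def[abs_def] using hlin_comp[OF M(1) hlin_coords(2)] .
  have f0: "u \<in> h" if "u \<in> uhp" "f u = 0" for u
  proof -
    have "M u = iax (ln (hW (M u)))" using iax_eqI[OF hisoD(1)[OF M(1) that(1)]] that(2) by (simp add: f_def)
    then have "M u = M (k (ln (hW (M u))))" by (simp add: M(2))
    then have "u = k (ln (hW (M u)))" using hisoD(3)[OF M(1)] that(1) unit_geodesicsD(1)[OF ku] by metis
    then show ?thesis using k(2) by blast
  qed
  obtain A B where AB: "\<And>t. f (k0 t) = A * exp t + B * exp (- t)" using hlin_geodesic[OF f k0u] by blast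
  obtain t0 where t0: "k0 t0 \<in> h" using h(3) by blast
  then obtain s0 where "k0 t0 = k s0" using k(2) by auto
  then have "f (k0 t0) = 0" by (simp add: f_def M(2) iax)
  then have z: "A * exp t0 + B * exp (- t0) = 0" using AB by simp
  have A0: "A \<noteq> 0"
  proof
    assume "A = 0"
    then have "B = 0" using z by simp
    then have "f (k0 t) = 0" for t using AB \<open>A = 0\<close> by simp
    then have kh: "k0 t \<in> h" for t using f0 unit_geodesicsD(1)[OF k0u] by blast
    have "k0 0 \<noteq> k0 1" using unit_geodesicsD(2)[OF k0u, of 0 1] unit_geodesicsD(1)[OF k0u] by auto
    then have "range k = range k0"
      using geodesics_meet_twice[OF ku k0u, of "k0 0" "k0 1"] kh k(2) by blast
    then show False using h(2) k(2) by simp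
  qed
  have Be: "B = - A * exp (2 * t0)"
  proof -
    have "(A * exp t0 + B * exp (- t0)) * exp t0 = A * exp (2 * t0) + B" by (simp add: algebra_simps mult_exp_exp flip: exp_add)
    then show ?thesis using z by simp
  qed
  \<comment> \<open>A multiple of \<open>sinh (t - t0)\<close>: the axis lies on opposite sides of
    \<open>k\<close> before and after the crossing.\<close>
  have F: "f (k0 t) = A * exp t0 * (exp (t - t0) - exp (t0 - t))" for t
    unfolding AB Be by (simp add: algebra_simps mult_exp_exp flip: exp_add)
  define D where "D = hdist (k0 0) (P 0)"
  have PC: "P t \<in> C" if "t \<in> {0..1}" for t using P(2) that by auto
  have P0: "P 0 \<in> C" using PC by simp
  have kC: "k0 t \<in> C" for t using unit_geodesicsD(1)[OF k0] .
  have Gk: "G n (k0 t) = k0 (t + of_int n * l)" for n t using axis_powers[OF g k0 kg G(1-3)] .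
  have dn: "hdist (k0 (of_int n * l)) (G n (P 0)) = D" for n
    using deck_isometry[OF G(1) kC P0, of n 0] Gk[of n 0] by (simp add: D_def)
  have sg: "sgn (f (G n (P 0))) = sgn (f (k0 (of_int n * l)))" if "\<bar>f (k0 (of_int n * l))\<bar> > sinh D" for n
    unfolding f_def
  proof (rule hV_sign_preserved)
    show "hdist (M (k0 (of_int n * l))) (M (G n (P 0))) \<le> D"
      using hisoD(5)[OF M(1)] dn C_uhpD kC deck_C[OF G(1) P0] by simp
    show "M (k0 (of_int n * l)) \<in> uhp" "M (G n (P 0)) \<in> uhp"
      using hisoD(1)[OF M(1)] C_uhpD kC deck_C[OF G(1) P0] by auto
  qed (use that in \<open>simp add: f_def\<close>)
  define a where "a = \<bar>A * exp t0\<bar>"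
  have a: "a > 0" using A0 by (simp add: a_def)
  define R where "R = sinh D / a + 1"
  have R: "sinh D < a * R" using a by (simp add: R_def field_simps)
  have D0: "D \<ge> 0" using hdist_nonneg kC P0 C_uhpD by (simp add: D_def)
  then have R1: "R \<ge> 1" using a by (simp add: R_def)
  have big: "exp x - exp (- x) \<ge> R" if "x \<ge> R" for x :: real
  proof -
    have "exp x \<ge> 1 + x" by (rule exp_ge_add_one_self)
    moreover have "exp (- x) \<le> 1" using that R1 by simp
    ultimately show ?thesis using that by linarith
  qed
  have pos: "sgn (f (k0 t)) = sgn A \<and> \<bar>f (k0 t)\<bar> > sinh D" if "t - t0 \<ge> R" for t
  proof -
    have b: "exp (t - t0) - exp (t0 - t) \<ge> R" using big[OF that] by simp
    then have "exp (t - t0) - exp (t0 - t) > 0" using R1 by linarith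
    then have "sgn (f (k0 t)) = sgn A" unfolding F by (simp add: sgn_mult)
    moreover have "a * R \<le> a * (exp (t - t0) - exp (t0 - t))" using a b by (intro mult_left_mono) auto
    then have "\<bar>f (k0 t)\<bar> > sinh D" unfolding F using R \<open>exp (t - t0) - exp (t0 - t) > 0\<close> by (simp add: abs_mult a_def)
    ultimately show ?thesis by blast
  qed
  have neg: "sgn (f (k0 t)) = - sgn A \<and> \<bar>f (k0 t)\<bar> > sinh D" if "t0 - t \<ge> R" for t
  proof -
    have b: "exp (t0 - t) - exp (t - t0) \<ge> R" using big[OF that] by simp
    then have n: "exp (t - t0) - exp (t0 - t) < 0" using R1 by linarith
    then have "sgn (f (k0 t)) = - sgn A" unfolding F by (simp add: sgn_mult)
    moreover have "a * R \<le> a * (exp (t0 - t) - exp (t - t0))" using a b by (intro mult_left_mono) auto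
    then have "\<bar>f (k0 t)\<bar> > sinh D" unfolding F using R n by (simp add: abs_mult a_def)
    ultimately show ?thesis by blast
  qed
  obtain N :: nat where N: "real N > (R + \<bar>t0\<bar>) / l" using reals_Archimedean2 by blast
  then have "real N * l > R + \<bar>t0\<bar>" using l by (simp add: field_simps)
  then have N': "of_int (int N) * l - t0 \<ge> R" "t0 - of_int (- int N) * l \<ge> R" by auto
  have s1: "sgn (f (G (int N) (P 0))) = sgn A" using sg pos[OF N'(1)] by simp
  have s2: "sgn (f (G (- int N) (P 0))) = - sgn A" using sg neg[OF N'(2)] by simp
  have nz: "f (G j (P t)) \<noteq> 0" if "t \<in> {0..1}" for j t
    using no[OF that] f0 C_uhpD deck_C[OF G(1) PC[OF that]] by blast
  \<comment> \<open>One translate of \<open>P\<close> ends where the next begins, and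
    \<open>f\<close> has no zero on it.\<close>
  have step: "sgn (f (G (j + 1) (P 0))) = sgn (f (G j (P 0)))" for j
  proof -
    have "continuous_on {0..1} (\<lambda>t. G j (P t))"
      by (rule continuous_on_compose2[OF deck_cont[OF G(1)] P(1)]) (use PC in auto)
    then have "continuous_on {0..1} (\<lambda>t. M (G j (P t)))"
      by (rule continuous_on_compose2[OF continuous_on_hiso[OF M(1)]]) (use PC deck_C[OF G(1)] C_uhpD in auto)
    then have c: "continuous_on {0..1} (\<lambda>t. f (G j (P t)))"
      unfolding f_def using PC deck_C[OF G(1)] C_uhpD hisoD(1)[OF M(1)] by (intro continuous_intros) auto
    have "G j (P 1) = G (j + 1) (P 0)" using G(3,4) P0 by (simp add: P(3))
    moreover have "sgn (f (G j (P 1))) = sgn (f (G j (P 0)))"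
    proof (rule ccontr)
      assume n: "sgn (f (G j (P 1))) \<noteq> sgn (f (G j (P 0)))"
      have "f (G j (P 1)) \<noteq> 0" "f (G j (P 0)) \<noteq> 0" using nz by auto
      then have "(f (G j (P 0)) < 0 \<and> f (G j (P 1)) > 0) \<or> (f (G j (P 0)) > 0 \<and> f (G j (P 1)) < 0)"
        using n by (auto simp: sgn_if split: if_splits)
      then have "\<exists>t. 0 \<le> t \<and> t \<le> 1 \<and> f (G j (P t)) = 0"
        using IVT'[of "\<lambda>t. f (G j (P t))" 0 0 1] IVT2'[of "\<lambda>t. f (G j (P t))" 1 0 0] c by fastforce
      then show False using nz by force
    qed
    ultimately show ?thesis by simp
  qed
  have all: "sgn (f (G j (P 0))) = sgn (f (G 0 (P 0)))" for j
  proof (induction j rule: int_induct[where k = 0])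
    case (step2 i)
    then show ?case using step[of "i - 1"] by simp
  qed (use step in auto)
  then have "sgn A = - sgn A" using s1 s2 all[of "int N"] all[of "- int N"] by simp
  then show False using A0 by (simp add: sgn_if split: if_splits)
qed

text \<open>A geodesic of \<open>C\<close> meeting a boundary line is that line. Meeting a boundary
  piece of the curve therefore entails passing through the end point of the piece, which also
  belongs to an arc.\<close>

lemma geodesic_through_bline_segment:
  assumes "sameline u v" "u \<in> C" "v \<in> C" "y \<in> hseg u v" "\<tau> \<in> Deck" "h \<in> geodesics C" "\<tau> y \<in> h"
  shows "\<tau> u \<in> h"
proof -
  obtain s where s: "s \<in> {0..1}" "y = hmix s u v" using assms(4) unfolding hseg_def by blast
  have y: "y \<in> C" using hyp_convex_hmix[OF conv assms(2,3) s(1)] s(2) by simp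
  obtain M M' where M: "bline M M'" "hV (M u) = 0" "hV (M v) = 0" using assms(1) unfolding sameline_def by blast
  have "hV (M y) = 0"
    using hlin_hmix[OF hlin_comp[OF blineD(1)[OF M(1)] hlin_coords(2)] C_uhpD[OF assms(2)] C_uhpD[OF assms(3)] s(1)] M s by simp
  then have "sameline u y" using M unfolding sameline_def by blast
  then have "sameline (\<tau> u) (\<tau> y)" using sameline_deck assms(2,5) y by blast
  then obtain N N' where N: "bline N N'" "hV (N (\<tau> u)) = 0" "hV (N (\<tau> y)) = 0" unfolding sameline_def by blast
  obtain k where k: "k \<in> unit_geodesics C" "h = range k" using geodesicsE[OF assms(6)] .
  obtain t where t: "\<tau> y = k t" using assms(7) k by auto
  define j where "j t = N' (iax t)" for t
  have j: "j \<in> unit_geodesics C" using bline_unit_geodesic[OF N(1)] by (simp add: j_def[abs_def])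
  have "k r \<in> range j" for r
  proof -
    have "hV (N (k r)) = 0" using bline_geodesic[OF N(1) k(1), of t r] N(3) t by simp
    then show ?thesis using bline_param[OF N(1) unit_geodesicsD(1)[OF k(1)]] unfolding j_def by blast
  qed
  moreover have "k 0 \<noteq> k 1"
    using unit_geodesicsD(2)[OF k(1), of 0 1] C_uhpD[OF unit_geodesicsD(1)[OF k(1)]] by auto
  ultimately have "range k = range j"
    using geodesics_meet_twice[OF unit_geodesics_uhp[OF k(1) C_uhp] unit_geodesics_uhp[OF j C_uhp], of "k 0" "k 1"] by blast
  moreover have "\<tau> u \<in> range j" using bline_param[OF N(1) deck_C[OF assms(5,2)] N(2)] unfolding j_def by blast
  ultimately show ?thesis using k(2) by simp
qed

text \<open>One period is the path \<open>z\<close>, \<open>b z\<close>, \<open>b w\<close>,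
  \<open>g w\<close>, \<open>g z\<close>. Its boundary pieces are traded for their end points; of
  its two arcs, one is the image of \<open>hseg z w\<close> under \<open>b\<close>, the other its
  image under \<open>g\<close>, which is absorbed into the next power. The flag \<open>e\<close>
  tells the two kinds apart and is the origin of the factor 2.\<close>

lemma crossing_meets:
  assumes k0: "k0 \<in> unit_geodesics C" and l: "l > 0" and kg: "\<And>t. k0 (t + l) = b (\<beta>' (k0 t))"
    and D: "b \<in> Deck" "\<beta>' \<in> Deck" and zw: "z \<in> C" "w \<in> C" "sameline z (b z)" "sameline w (\<beta>' w)"
    and G: "\<And>n :: int. G n \<in> Deck" "\<And>z. z \<in> C \<Longrightarrow> G 0 z = z" "\<And>n z. z \<in> C \<Longrightarrow> G (n + 1) z = b (\<beta>' (G n z))"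
      "\<And>n z. z \<in> C \<Longrightarrow> G n (b (\<beta>' z)) = b (\<beta>' (G n z))"
    and h: "h \<in> geodesics C" "h \<noteq> range k0" "h \<inter> range k0 \<noteq> {}"
  obtains j e where "h \<inter> (\<lambda>x. G j (if e then b x else x)) ` hseg z w \<noteq> {}"
proof -
  define g where "g x = b (\<beta>' x)" for x
  have g: "g \<in> Deck" unfolding g_def[abs_def] using deck_comp[OF D] .
  have c: "b z \<in> C" "b w \<in> C" "\<beta>' w \<in> C" "g w \<in> C" "g z \<in> C" using zw deck_C D g by (auto simp: g_def)
  note u = C_uhpD[OF zw(1)] C_uhpD[OF zw(2)] c[THEN C_uhpD]
  define arc where "arc x y = (\<lambda>s. hmix s x y)" for x y
  have arc: "path (arc x y)" "path_image (arc x y) = hseg x y" "pathstart (arc x y) = x" "pathfinish (arc x y) = y" if "x \<in> C" "y \<in> C" for x y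
    using that C_uhpD by (auto simp: arc_def path_def path_image_def hseg_def pathstart_def pathfinish_def hmix_0 hmix_1 intro!: continuous_intros)
  define P where "P = arc z (b z) +++ (arc (b z) (b w) +++ (arc (b w) (g w) +++ reversepath (arc (g z) (g w))))"
  have "path P" using arc zw c by (simp add: P_def)
  have im: "path_image P = hseg z (b z) \<union> (hseg (b z) (b w) \<union> (hseg (b w) (g w) \<union> hseg (g z) (g w)))"
    using arc zw c by (simp add: P_def path_image_join)
  have P01: "P 0 = z" "P 1 = g z"
    using arc(3,4) zw c unfolding P_def by (simp_all add: pathstart_join pathfinish_join flip: pathstart_def pathfinish_def)
  have segC: "hseg x y \<subseteq> C" if "x \<in> C" "y \<in> C" for x y
    unfolding hseg_def using hyp_convex_hmix[OF conv that] by auto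
  have imC: "path_image P \<subseteq> C" unfolding im using segC zw c by auto
  obtain j t where jt: "t \<in> {0..1}" "G j (P t) \<in> h"
  proof (rule crossing[OF g k0 l, of G h P])
    show "continuous_on {0..1} P" using \<open>path P\<close> by (simp add: path_def)
    show "P \<in> {0..1} \<rightarrow> C" using imC by (auto simp: path_image_def)
  qed (use kg G h P01 in \<open>simp_all add: g_def\<close>)
  have z0: "z \<in> hseg z w"
    unfolding hseg_def by (rule image_eqI[of _ _ 0]) (use u in \<open>simp_all add: hmix_0\<close>)
  have w0: "w \<in> hseg z w"
    unfolding hseg_def by (rule image_eqI[of _ _ 1]) (use u in \<open>simp_all add: hmix_1\<close>)
  have "P t \<in> path_image P" using jt(1) by (simp add: path_image_def)
  then consider "P t \<in> hseg z (b z)" | "P t \<in> hseg (b z) (b w)" | "P t \<in> hseg (b w) (g w)" | "P t \<in> hseg (g z) (g w)"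
    unfolding im by blast
  then show ?thesis
  proof cases
    case 1
    then have "G j z \<in> h" using geodesic_through_bline_segment[OF zw(3,1) c(1) 1 G(1) h(1) jt(2)] by simp
    then show ?thesis using that[of j False] z0 by auto
  next
    case 2
    then obtain s where s: "s \<in> {0..1}" "P t = hmix s (b z) (b w)" unfolding hseg_def by blast
    then have "P t = b (hmix s z w)" using deck_hmix[OF D(1) zw(1,2)] by simp
    moreover have "hmix s z w \<in> hseg z w" unfolding hseg_def using s(1) by blast
    ultimately have "G j (P t) \<in> (\<lambda>x. G j (if True then b x else x)) ` hseg z w" by auto
    then show ?thesis using that[of j True] jt(2) by blast
  next
    case 3
    have "sameline (b w) (g w)" unfolding g_def using sameline_deck[OF zw(4) D(1) zw(2) c(3)] .
    then have "G j (b w) \<in> h" using geodesic_through_bline_segment[OF _ c(2,4) 3 G(1) h(1) jt(2)] by simp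
    then show ?thesis using that[of j True] w0 by auto
  next
    case 4
    then obtain s where s: "s \<in> {0..1}" "P t = hmix s (g z) (g w)" unfolding hseg_def by blast
    then have "P t = g (hmix s z w)" using deck_hmix[OF g zw(1,2)] by simp
    moreover have m: "hmix s z w \<in> C" using hyp_convex_hmix[OF conv zw(1,2) s(1)] .
    ultimately have "G j (P t) = G (j + 1) (hmix s z w)" using G(3,4)[OF m, of j] by (simp add: g_def)
    moreover have "hmix s z w \<in> hseg z w" unfolding hseg_def using s(1) by blast
    ultimately have "G j (P t) \<in> (\<lambda>x. G (j + 1) (if False then b x else x)) ` hseg z w" by auto
    then show ?thesis using that[of "j + 1" False] jt(2) by blast
  qed
qed

end

text \<open>\<open>pair_measure\<close> is a \<open>measure_of\<close>: its value is the iterated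
  integral if this defines a measure, and 0 otherwise. The inequality holds in both cases.\<close>

lemma emeasure_pair_le:
  assumes "B \<in> sets (M \<Otimes>\<^sub>M N)"
  shows "emeasure (M \<Otimes>\<^sub>M N) B \<le> (\<integral>\<^sup>+x. \<integral>\<^sup>+y. indicator B (x, y) \<partial>N \<partial>M)"
  unfolding pair_measure_def by (subst emeasure_measure_of_conv) simp

section \<open>Counting crossings with a closed geodesic\<close>

context surface_cover
begin

text \<open>A lift is determined by its value at time 0, which lies in a countable fibre.\<close>

lemma lifts_countable: "countable (lifts C p c)"
proof -
  define F where "F = {v\<in>C. p v = c 0}"
  have "\<exists>v\<in>F. \<forall>k. k \<in> unit_geodesics C \<longrightarrow> (\<forall>t. p (k t) = c t) \<longrightarrow> k 0 = v \<longrightarrow> h = range k" if h: "h \<in> lifts C p c" for h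
  proof -
    obtain k where k: "k \<in> unit_geodesics C" "\<forall>t. p (k t) = c t" "h = range k" using h unfolding lifts_def by blast
    show ?thesis
    proof (intro bexI[of _ "k 0"] allI impI)
      fix j assume j: "j \<in> unit_geodesics C" "\<forall>t. p (j t) = c t" "j 0 = k 0"
      have "j t = k t" for t by (rule geodesic_lift_unique[OF j(1) k(1) _ j(3)]) (simp add: j(2) k(2))
      then have "j = k" by blast
      then show "h = range j" using k(3) by simp
    qed (use k unit_geodesicsD(1)[OF k(1)] in \<open>simp add: F_def\<close>)
  qed
  then obtain v where v: "\<And>h. h \<in> lifts C p c \<Longrightarrow> v h \<in> F"
    "\<And>h k. h \<in> lifts C p c \<Longrightarrow> k \<in> unit_geodesics C \<Longrightarrow> (\<forall>t. p (k t) = c t) \<Longrightarrow> k 0 = v h \<Longrightarrow> h = range k" by metis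
  define w where "w h = (SOME x. \<exists>k. k \<in> unit_geodesics C \<and> (\<forall>t. p (k t) = c t) \<and> h = range k \<and> x = k 0)" for h
  have w: "\<exists>k. k \<in> unit_geodesics C \<and> (\<forall>t. p (k t) = c t) \<and> h = range k \<and> w h = k 0" if "h \<in> lifts C p c" for h
    unfolding w_def by (rule someI_ex) (use that in \<open>auto simp: lifts_def\<close>)
  have "inj_on w (lifts C p c)"
  proof (rule inj_onI)
    fix h h' assume h: "h \<in> lifts C p c" "h' \<in> lifts C p c" "w h = w h'"
    obtain k where k: "k \<in> unit_geodesics C" "\<forall>t. p (k t) = c t" "h = range k" "w h = k 0" using w[OF h(1)] by blast
    obtain j where j: "j \<in> unit_geodesics C" "\<forall>t. p (j t) = c t" "h' = range j" "w h' = j 0" using w[OF h(2)] by blast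
    have "j t = k t" for t by (rule geodesic_lift_unique[OF j(1) k(1), of 0]) (use j k h in simp_all)
    then have "j = k" by blast
    then show "h = h'" using k j by simp
  qed
  moreover have "w ` lifts C p c \<subseteq> F"
  proof
    fix x assume "x \<in> w ` lifts C p c"
    then obtain h where h: "h \<in> lifts C p c" "x = w h" by blast
    obtain k where "k \<in> unit_geodesics C" "\<forall>t. p (k t) = c t" "w h = k 0" using w[OF h(1)] by blast
    then show "x \<in> F" using h unit_geodesicsD(1) by (simp add: F_def)
  qed
  ultimately show ?thesis
    using countable_fibre[of "c 0"] countable_subset countable_image_inj_on unfolding F_def[symmetric] by blast
qed

text \<open>Every crossing in \<open>B\<close> is carried by a deck transformation to a geodesic of
  \<open>meeting z w\<close>. As the crossings in \<open>B\<close> have distinct orbits, the images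
  are disjoint for each of the two kinds of arcs. For a power, each crossing is counted once for
  every period in \<open>(0, l]\<close>, and the corresponding shifts along the axis keep these
  copies disjoint.\<close>

lemma intersection_bound:
  assumes L: "geodesic_current C p L" and cl: "closed_geodesic Sg dist c l" and rep: "represents (\<lambda>t. c (l * t)) (\<lambda>x. b (\<beta>' x))"
    and D: "b \<in> Deck" "\<beta>' \<in> Deck" and zw: "z \<in> C" "w \<in> C" "sameline z (b z)" "sameline w (\<beta>' w)"
  shows "intersection_form C p L (closed_geodesic_current C p c l) \<le> 2 * emeasure L (meeting z w)"
proof -
  define g where "g x = b (\<beta>' x)" for x
  have g: "g \<in> Deck" unfolding g_def[abs_def] using deck_comp[OF D] .
  define S where "S = meeting z w"
  define Li where "Li = lifts C p c"
  define Per where "Per = {s. 0 < s \<and> s \<le> l \<and> (\<forall>t. c (t + s) = c t)}"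
  have m: "multiplicity_of c l = card Per" by (simp add: multiplicity_of_def Per_def)
  have l: "l > 0" and cper: "\<And>t. c (t + l) = c t" using cl by (auto simp: closed_geodesic_def)
  have setsL: "sets L = sets (geodesic_borel C)" and inv: "\<And>\<tau> A. \<tau> \<in> Deck \<Longrightarrow> A \<in> sets L \<Longrightarrow> emeasure L ((`) \<tau> ` A) = emeasure L A"
    using L by (auto simp: geodesic_current_def)
  have spL: "space L = geodesics C" using sets_eq_imp_space_eq[OF setsL] space_geodesic_borel by simp
  have S: "S \<in> sets L" "S \<subseteq> geodesics C" using meeting_sets[OF zw(1,2)] by (auto simp: S_def setsL meeting_def)
  define \<nu> where "\<nu> = closed_geodesic_current C p c l"
  have Lig: "h \<in> geodesics C" if "h \<in> Li" for h using that by (auto simp: Li_def lifts_def geodesics_def)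
  have setsN: "sets \<nu> = sets (geodesic_borel C)" by (simp add: \<nu>_def closed_geodesic_current_def)
  have bound: "emeasure (L \<Otimes>\<^sub>M \<nu>) B \<le> 2 * emeasure L S"
    if B: "B \<in> sets (L \<Otimes>\<^sub>M \<nu>)" "B \<subseteq> transverse_pairs C" "orbit_injective C p B" for B
  proof -
    \<comment> \<open>The slice of geodesics paired with the lift \<open>h\<close>. The mass of
      \<open>B\<close> is at most the multiplicity times the sum of the masses of the
      slices.\<close>
    define Bh where "Bh h = (\<lambda>x. (x, h)) -` B" for h
    have Bh: "Bh h \<in> sets L" for h unfolding Bh_def using B(1) by (rule sets_Pair2)
    have "emeasure (L \<Otimes>\<^sub>M \<nu>) B \<le> (\<integral>\<^sup>+x. \<integral>\<^sup>+y. indicator B (x, y) \<partial>\<nu> \<partial>L)" by (rule emeasure_pair_le[OF B(1)])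
    also have "\<dots> = (\<integral>\<^sup>+x. of_nat (card Per) * (\<integral>\<^sup>+h. indicator (Bh h) x \<partial>count_space Li) \<partial>L)"
    proof (rule nn_integral_cong)
      fix x
      have sx: "Pair x -` B \<in> sets (geodesic_borel C)" using sets_Pair1[OF B(1)] setsN by simp
      have meas: "(\<lambda>y. indicator B (x, y) :: ennreal) \<in> borel_measurable (geodesic_borel C)"
      proof -
        have "(\<lambda>y. indicator (Pair x -` B) y :: ennreal) \<in> borel_measurable (geodesic_borel C)" using sx by simp
        then show ?thesis by (simp add: indicator_def vimage_def)
      qed
      have id: "(\<lambda>g. g) \<in> measurable (count_space Li) (geodesic_borel C)"
        using Lig by (simp add: space_geodesic_borel)
      have "(\<integral>\<^sup>+y. indicator B (x, y) \<partial>\<nu>) = of_nat (card Per) * (\<integral>\<^sup>+y. indicator B (x, y) \<partial>distr (count_space Li) (geodesic_borel C) (\<lambda>g. g))"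
        unfolding \<nu>_def closed_geodesic_current_def m Li_def[symmetric]
        by (rule nn_integral_scale_measure) (use meas in simp)
      also have "(\<integral>\<^sup>+y. indicator B (x, y) \<partial>distr (count_space Li) (geodesic_borel C) (\<lambda>g. g)) = (\<integral>\<^sup>+h. indicator B (x, h) \<partial>count_space Li)"
        by (rule nn_integral_distr[OF id]) (use meas in simp)
      also have "\<dots> = (\<integral>\<^sup>+h. indicator (Bh h) x \<partial>count_space Li)" by (simp add: Bh_def indicator_def)
      finally show "(\<integral>\<^sup>+y. indicator B (x, y) \<partial>\<nu>) = of_nat (card Per) * (\<integral>\<^sup>+h. indicator (Bh h) x \<partial>count_space Li)" .
    qed
    also have "\<dots> = (\<integral>\<^sup>+x. \<integral>\<^sup>+h. of_nat (card Per) * indicator (Bh h) x \<partial>count_space Li \<partial>L)"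
      by (simp add: nn_integral_cmult)
    also have "\<dots> = (\<integral>\<^sup>+h. \<integral>\<^sup>+x. of_nat (card Per) * indicator (Bh h) x \<partial>L \<partial>count_space Li)"
      by (rule nn_integral_count_space_nn_integral) (use lifts_countable[of c] Bh in \<open>auto simp: Li_def\<close>)
    also have "\<dots> = (\<integral>\<^sup>+h. of_nat (card Per) * emeasure L (Bh h) \<partial>count_space Li)"
      using Bh by (simp add: nn_integral_cmult)
    also have "\<dots> = of_nat (card Per) * (\<integral>\<^sup>+h. emeasure L (Bh h) \<partial>count_space Li)"
      by (simp add: nn_integral_cmult)
    finally have e1: "emeasure (L \<Otimes>\<^sub>M \<nu>) B \<le> of_nat (card Per) * (\<integral>\<^sup>+h. emeasure L (Bh h) \<partial>count_space Li)" .
    show ?thesis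
    proof (cases "Li = {} \<or> infinite Per")
      \<comment> \<open>The right-hand side vanishes: there are no lifts, or \<open>card Per\<close>
        is 0 for an infinite set.\<close>
      case True
      then have "of_nat (card Per) * (\<integral>\<^sup>+h. emeasure L (Bh h) \<partial>count_space Li) = 0"
        by (auto simp: nn_integral_empty)
      then have "emeasure (L \<Otimes>\<^sub>M \<nu>) B \<le> 0" using e1 by (simp only:)
      then show ?thesis by (rule order_trans) simp
    next
      case False
      then have fin: "finite Per" and ne: "Li \<noteq> {}" by auto
      obtain k1 where k1: "k1 \<in> unit_geodesics C" "\<And>t. p (k1 t) = c t" using ne by (auto simp: Li_def lifts_def)
      obtain \<sigma> where \<sigma>: "continuous_on {0..1} \<sigma>" "\<sigma> \<in> {0..1} \<rightarrow> C" "\<And>t. t \<in> {0..1} \<Longrightarrow> p (\<sigma> t) = c (l * t)" "\<sigma> 1 = g (\<sigma> 0)"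
        using rep unfolding represents_def g_def by blast
      have s0: "\<sigma> 0 \<in> C" "p (\<sigma> 0) = c 0" using \<sigma>(2) \<sigma>(3)[of 0] by auto
      obtain \<tau>1 where t1: "\<tau>1 \<in> Deck" "\<tau>1 (k1 0) = \<sigma> 0"
        using deck_exists[of "k1 0" "\<sigma> 0"] unit_geodesicsD(1)[OF k1(1)] s0 k1(2) by metis
      \<comment> \<open>The lift that \<open>g\<close> itself translates by \<open>l\<close>; other
        lifts are translated by conjugates of \<open>g\<close>.\<close>
      define k0 where "k0 t = \<tau>1 (k1 t)" for t
      have k0: "k0 \<in> unit_geodesics C" unfolding k0_def[abs_def] using deck_geodesic[OF t1(1) k1(1)] .
      have k0p: "p (k0 t) = c t" for t using deck_p[OF t1(1) unit_geodesicsD(1)[OF k1(1)]] k1(2) by (simp add: k0_def)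
      have kC: "k0 t \<in> C" for t using unit_geodesicsD(1)[OF k0] .
      have "k0 (l * 1) = \<sigma> 1"
      proof (rule lift_unique[of "{0..1::real}" 0 1 "\<lambda>t. k0 (l * t)" \<sigma>])
        show "continuous_on {0..1} (\<lambda>t. k0 (l * t))"
          by (intro continuous_on_compose2[OF unit_geodesic_continuous[OF unit_geodesics_uhp[OF k0 C_uhp], of UNIV]] continuous_intros) auto
        show "k0 (l * 0) = \<sigma> 0" using t1(2) by (simp add: k0_def)
      qed (use kC k0p \<sigma> in auto)
      then have kl: "k0 l = g (k0 0)" using \<sigma>(4) t1(2) by (simp add: k0_def)
      have shiftU: "(\<lambda>t. k0 (t + s)) \<in> unit_geodesics C" for s
        using unit_geodesicsD[OF k0] by (simp add: unit_geodesics_def)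
      have shift: "\<tau> (k0 t) = k0 (t + s)" if "\<tau> \<in> Deck" "\<tau> (k0 0) = k0 s" "\<And>t. c (t + s) = c t" for \<tau> s t
        by (rule geodesic_lift_unique[OF deck_geodesic[OF that(1) k0] shiftU, of s 0])
           (use that deck_p[OF that(1) kC] k0p in auto)
      have kg: "k0 (t + l) = b (\<beta>' (k0 t))" for t using shift[OF g kl[symmetric] cper] by (simp add: g_def)
      obtain G :: "int \<Rightarrow> complex \<Rightarrow> complex" where G: "\<And>n. G n \<in> Deck" "\<And>z. z \<in> C \<Longrightarrow> G 0 z = z"
        "\<And>n z. z \<in> C \<Longrightarrow> G (n + 1) z = g (G n z)" "\<And>n z. z \<in> C \<Longrightarrow> G n (g z) = g (G n z)"
        using deck_powers[OF g] by blast
      have Gk: "G n (k0 t) = k0 (t + of_int n * l)" for n t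
        using axis_powers[OF g k0 _ G(1-3)] kg by (simp add: g_def)
      define h0 where "h0 = range k0"
      have h0: "h0 \<in> geodesics C" "h0 \<subseteq> C" using k0 kC by (auto simp: h0_def geodesics_def)
      have "\<exists>\<tau>\<in>Deck. \<tau> ` h = h0" if h: "h \<in> Li" for h
      proof -
        obtain k where k: "k \<in> unit_geodesics C" "\<And>t. p (k t) = c t" "h = range k" using h by (auto simp: Li_def lifts_def)
        obtain \<tau> where t: "\<tau> \<in> Deck" "\<tau> (k 0) = k0 0"
          using deck_exists[of "k 0" "k0 0"] unit_geodesicsD(1)[OF k(1)] kC k(2) k0p by metis
        have "\<tau> (k t) = k0 t" for t
          by (rule geodesic_lift_unique[OF deck_geodesic[OF t(1) k(1)] k0, of 0])
             (use t deck_p[OF t(1) unit_geodesicsD(1)[OF k(1)]] k k0p in auto)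
        then have "\<tau> ` h = h0" unfolding k(3) h0_def by (auto simp: image_image)
        then show ?thesis using t by blast
      qed
      then obtain \<tau> where \<tau>: "\<And>h. h \<in> Li \<Longrightarrow> \<tau> h \<in> Deck" "\<And>h. h \<in> Li \<Longrightarrow> \<tau> h ` h = h0" by metis
      have "\<exists>s'\<in>Deck. s' (k0 0) = k0 s" if s: "s \<in> Per" for s
      proof -
        have "c (0 + s) = c 0" using s unfolding Per_def by blast
        then show ?thesis using deck_exists[OF kC kC, of 0 s] k0p by (metis add_0)
      qed
      \<comment> \<open>Deck transformations that realise the periods of \<open>c\<close> in
        \<open>(0, l]\<close> as shifts of the axis.\<close>
      then obtain sg where sg: "\<And>s. s \<in> Per \<Longrightarrow> sg s \<in> Deck" "\<And>s. s \<in> Per \<Longrightarrow> sg s (k0 0) = k0 s" by metis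
      have sgk: "sg s (k0 t) = k0 (t + s)" if "s \<in> Per" for s t
        using shift[OF sg(1)[OF that] sg(2)[OF that]] that by (simp add: Per_def)
      have sgh: "sg s ` h0 = h0" if "s \<in> Per" for s
      proof -
        have "sg s ` h0 = range (\<lambda>t. k0 (t + s))" using sgk[OF that] by (auto simp: h0_def image_image)
        also have "\<dots> = h0" unfolding h0_def by (metis (no_types) image_image surj_plus_right)
        finally show ?thesis .
      qed
      have Gh: "G n ` h0 = h0" for n
      proof -
        have "G n ` h0 = range (\<lambda>t. k0 (t + of_int n * l))" using Gk by (auto simp: h0_def image_image)
        also have "\<dots> = h0" unfolding h0_def by (metis (no_types) image_image surj_plus_right)
        finally show ?thesis .
      qed
      define be where "be e = (if e then b else (\<lambda>x. x))" for e
      have be: "be e \<in> Deck" for e using D(1) deck_id by (simp add: be_def)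
      \<comment> \<open>\<open>V\<close> carries \<open>h\<close> to the axis, shifts by the period
        \<open>s\<close> and goes back by \<open>j\<close> periods of length \<open>l\<close>;
        \<open>T\<close> also undoes \<open>b\<close> if the arc met is of the second kind.\<close>
      define V where "V s h j = (\<lambda>u. dinv (G j) (sg s (\<tau> h u)))" for s h j
      define T where "T s h q = (\<lambda>u. dinv (be (snd q)) (V s h (fst q) u))" for s h and q :: "int \<times> bool"
      have VD: "V s h j \<in> Deck" if "s \<in> Per" "h \<in> Li" for s h j
        unfolding V_def using deck_comp[OF dinv(1)[OF G(1)] deck_comp[OF sg(1)[OF that(1)] \<tau>(1)[OF that(2)]]] .
      have TD: "T s h q \<in> Deck" if "s \<in> Per" "h \<in> Li" for s h q
        unfolding T_def using deck_comp[OF dinv(1)[OF be] VD[OF that]] .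
      have beT: "be (snd q) (T s h q u) = V s h (fst q) u" if "s \<in> Per" "h \<in> Li" "u \<in> C" for s h q u
        unfolding T_def using dinv(3)[OF be deck_C[OF VD[OF that(1,2)] that(3)]] .
      have Vh: "V s h j ` h = h0" if "s \<in> Per" "h \<in> Li" for s h j
      proof -
        have "V s h j ` h = dinv (G j) ` sg s ` \<tau> h ` h" by (simp add: V_def image_image)
        also have "\<dots> = dinv (G j) ` h0" using \<tau>(2)[OF that(2)] sgh[OF that(1)] by simp
        also have "\<dots> = dinv (G j) ` G j ` h0" using Gh by simp
        also have "\<dots> = h0" using dinv_image(1)[OF G(1) h0(2)] .
        finally show ?thesis .
      qed
      define A where "A s h q = Bh h \<inter> ((`) (T s h q) -` S \<inter> space L)" for s h q
      have As: "A s h q \<in> sets L" if "s \<in> Per" "h \<in> Li" for s h q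
      proof -
        have "(`) (T s h q) -` S \<inter> space L \<in> sets L"
          using measurable_sets[OF deck_measurable[OF TD[OF that]], of S] S(1) spL by (simp add: setsL space_geodesic_borel)
        then show ?thesis unfolding A_def using Bh by blast
      qed
      \<comment> \<open>Each geodesic of the slice is assigned to the first suitable pair
        \<open>(j, e)\<close> in an enumeration.\<close>
      define F where "F s h q = A s h q - (\<Union>q'\<in>{q'. to_nat q' < to_nat q}. A s h q')" for s h q
      have Fs: "F s h q \<in> sets L" if "s \<in> Per" "h \<in> Li" for s h q
        unfolding F_def using As[OF that] by (intro sets.Diff sets.countable_UN') auto
      have Bcover: "Bh h \<subseteq> (\<Union>q. A s h q)" if sh: "s \<in> Per" "h \<in> Li" for s h
      proof
        fix x assume x: "x \<in> Bh h"
        then have xh: "(x, h) \<in> B" by (simp add: Bh_def)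
        then have t: "x \<in> geodesics C" "h \<in> geodesics C" "x \<noteq> h" "x \<inter> h \<noteq> {}"
          using B(2) by (auto simp: transverse_pairs_def)
        define y where "y = V s h 0 ` x"
        have y: "y \<in> geodesics C" unfolding y_def using deck_geodesics[OF VD[OF sh] t(1)] .
        have y1: "y \<noteq> range k0" unfolding h0_def[symmetric]
        proof
          assume "y = h0"
          then have "dinv (V s h 0) ` V s h 0 ` x = dinv (V s h 0) ` V s h 0 ` h" using Vh[OF sh] y_def by simp
          then show False using dinv_image(1)[OF VD[OF sh]] geodesics_sub t by metis
        qed
        have y2: "y \<inter> range k0 \<noteq> {}"
          unfolding h0_def[symmetric] using t(4) Vh[OF sh, of 0] unfolding y_def by blast
        obtain j e where "y \<inter> (\<lambda>x. G j (if e then b x else x)) ` hseg z w \<noteq> {}"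
          using crossing_meets[of k0 l b \<beta>' z w G y, OF k0 l kg D zw G(1,2) G(3,4)[unfolded g_def] y y1 y2] by blast
        then obtain u where u: "u \<in> hseg z w" "G j (be e u) \<in> y" by (auto simp: be_def split: if_splits)
        have uC: "u \<in> C" using u(1) hyp_convex_hmix[OF conv zw(1,2)] by (auto simp: hseg_def)
        obtain v where v: "v \<in> x" "G j (be e u) = V s h 0 v" using u(2) y_def by blast
        have vC: "v \<in> C" using v t geodesics_sub by blast
        have V0: "V s h 0 v = sg s (\<tau> h v)"
        proof -
          have c: "sg s (\<tau> h v) \<in> C" using deck_C sg \<tau> sh vC by blast
          have "G 0 (dinv (G 0) (sg s (\<tau> h v))) = sg s (\<tau> h v)" using dinv(3)[OF G(1) c] .
          then show ?thesis unfolding V_def using G(2)[OF deck_C[OF dinv(1)[OF G(1)] c]] by simp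
        qed
        have "V s h j v = be e u"
          unfolding V_def using dinv(2)[OF G(1) deck_C[OF be uC], of j e] v(2) V0 by simp
        then have "T s h (j, e) v = u" unfolding T_def using dinv(2)[OF be uC] by simp
        then have "T s h (j, e) ` x \<inter> hseg z w \<noteq> {}" using v(1) u(1) by blast
        then have "T s h (j, e) ` x \<in> S" unfolding S_def meeting_def using deck_geodesics[OF TD[OF sh] t(1)] by blast
        then show "x \<in> (\<Union>q. A s h q)" using x t(1) by (auto simp: A_def spL)
      qed
      have Fcover: "Bh h = (\<Union>q. F s h q)" if sh: "s \<in> Per" "h \<in> Li" for s h
      proof
        show "(\<Union>q. F s h q) \<subseteq> Bh h" by (auto simp: F_def A_def)
        show "Bh h \<subseteq> (\<Union>q. F s h q)"
        proof
          fix x assume "x \<in> Bh h"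
          then obtain q0 where "x \<in> A s h q0" using Bcover[OF sh] by blast
          then obtain q where q: "x \<in> A s h q" "\<And>q'. to_nat q' < to_nat q \<Longrightarrow> x \<notin> A s h q'"
            using exists_least_iff[of "\<lambda>n. \<exists>q. n = to_nat q \<and> x \<in> A s h q"] by metis
          then show "x \<in> (\<Union>q. F s h q)" unfolding F_def by blast
        qed
      qed
      have Fdisj: "q = q'" if "x \<in> F s h q" "x \<in> F s h q'" for x s h q q'
      proof (rule ccontr)
        assume "q \<noteq> q'"
        then have "to_nat q \<noteq> to_nat q'" by simp
        then have "to_nat q < to_nat q' \<or> to_nat q' < to_nat q" by linarith
        then show False using that unfolding F_def by blast
      qed
      define Ds where "Ds s h q = (`) (T s h q) ` F s h q" for s h q
      have DsS: "Ds s h q \<subseteq> S" for s h q unfolding Ds_def F_def A_def by blast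
      have Dsets: "Ds s h q \<in> sets L" "emeasure L (Ds s h q) = emeasure L (F s h q)" if "s \<in> Per" "h \<in> Li" for s h q
        unfolding Ds_def using deck_image_sets[OF TD[OF that]] Fs[OF that] inv[OF TD[OF that] Fs[OF that]] by (auto simp: setsL)
      \<comment> \<open>If two images coincide, some \<open>\<omega>\<close> in the deck group
        carries one crossing of \<open>B\<close> to the other. Orbit injectivity makes the crossings
        equal; then \<open>\<omega>\<close> fixes the crossing point, so it is the identity and the
        shifts agree.\<close>
      have key: "s = s' \<and> h = h' \<and> j = j'"
        if sh: "s \<in> Per" "h \<in> Li" "s' \<in> Per" "h' \<in> Li" and y: "y \<in> Ds s h (j, e)" "y \<in> Ds s' h' (j', e)" for s h s' h' j j' e y
      proof -
        obtain x where x: "x \<in> F s h (j, e)" "y = T s h (j, e) ` x" using y(1) unfolding Ds_def by blast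
        obtain x' where x': "x' \<in> F s' h' (j', e)" "y = T s' h' (j', e) ` x'" using y(2) unfolding Ds_def by blast
        have xB: "(x, h) \<in> B" "(x', h') \<in> B" using x x' by (auto simp: F_def A_def Bh_def)
        then have t: "x \<in> geodesics C" "h \<in> geodesics C" "x \<noteq> h" "x \<inter> h \<noteq> {}" and t': "x' \<in> geodesics C" "h' \<in> geodesics C"
          using B(2) by (auto simp: transverse_pairs_def)
        have beV: "be e ` y = V s h j ` x" "be e ` y = V s' h' j' ` x'"
        proof -
          show "be e ` y = V s h j ` x"
            unfolding x(2) image_image using beT[OF sh(1,2), of _ "(j, e)"] geodesics_sub[OF t(1)] by (intro image_cong) auto
          show "be e ` y = V s' h' j' ` x'"
            unfolding x'(2) image_image using beT[OF sh(3,4), of _ "(j', e)"] geodesics_sub[OF t'(1)] by (intro image_cong) auto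
        qed
        define V1 V2 where "V1 = V s h j" and "V2 = V s' h' j'"
        have V12: "V1 \<in> Deck" "V2 \<in> Deck" using VD sh by (auto simp: V1_def V2_def)
        define \<omega> where "\<omega> u = dinv V2 (V1 u)" for u
        have \<omega>D: "\<omega> \<in> Deck" unfolding \<omega>_def[abs_def] using deck_comp[OF dinv(1)[OF V12(2)] V12(1)] .
        have \<omega>x: "\<omega> ` x = x'"
        proof -
          have "\<omega> ` x = dinv V2 ` V1 ` x" by (simp add: \<omega>_def image_image)
          also have "\<dots> = dinv V2 ` V2 ` x'" using beV by (simp add: V1_def V2_def)
          finally show ?thesis using dinv_image(1)[OF V12(2) geodesics_sub[OF t'(1)]] by simp
        qed
        have \<omega>h: "\<omega> ` h = h'"
        proof -
          have "\<omega> ` h = dinv V2 ` V1 ` h" by (simp add: \<omega>_def image_image)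
          also have "\<dots> = dinv V2 ` V2 ` h'" using Vh[OF sh(1,2)] Vh[OF sh(3,4)] by (simp add: V1_def V2_def)
          finally show ?thesis using dinv_image(1)[OF V12(2) geodesics_sub[OF t'(2)]] by simp
        qed
        have "(x', h') = (x, h)"
          using B(3) xB \<omega>D \<omega>x \<omega>h unfolding orbit_injective_def by (metis fst_conv snd_conv)
        then have eq: "x' = x" "h' = h" by auto
        obtain u where u: "u \<in> x" "u \<in> h" using t(4) by blast
        have uC: "u \<in> C" using u geodesics_sub t by blast
        obtain kx kh where kk: "kx \<in> unit_geodesics C" "x = range kx" "kh \<in> unit_geodesics C" "h = range kh"
          using geodesicsE t(1,2) by metis
        have "\<omega> u = u"
        proof (rule ccontr)
          assume "\<omega> u \<noteq> u"
          moreover have "\<omega> u \<in> x" "\<omega> u \<in> h" using \<omega>x \<omega>h eq u by blast+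
          ultimately have "x = h"
            using geodesics_meet_twice[OF unit_geodesics_uhp[OF kk(1) C_uhp] unit_geodesics_uhp[OF kk(3) C_uhp], of u "\<omega> u"] u kk
            by metis
          then show False using t(3) by blast
        qed
        then have \<omega>id: "\<omega> v = v" if "v \<in> C" for v using deck_free[OF \<omega>D uC _ that] by blast
        define v where "v = dinv (\<tau> h) (k0 0)"
        have v: "v \<in> C" "\<tau> h v = k0 0"
          using dinv(1,3)[OF \<tau>(1)[OF sh(2)]] deck_C kC by (auto simp: v_def)
        have Vv: "V r h i v = k0 (r - of_int i * l)" if "r \<in> Per" for r i
        proof -
          have "sg r (\<tau> h v) = k0 r" using sg(2)[OF that] v(2) by simp
          also have "k0 r = G i (k0 (r - of_int i * l))" using Gk by simp
          finally show ?thesis unfolding V_def using dinv(2)[OF G(1) kC] by simp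
        qed
        have "V2 v = V1 v" using \<omega>id[OF v(1)] dinv(3)[OF V12(2) deck_C[OF V12(1) v(1)]] by (simp add: \<omega>_def)
        then have "k0 (s' - of_int j' * l) = k0 (s - of_int j * l)"
          using Vv[OF sh(1)] Vv[OF sh(3)] eq by (simp add: V1_def V2_def)
        then have ps: "s' - of_int j' * l = s - of_int j * l"
          using unit_geodesicsD(2)[OF k0, of "s' - of_int j' * l" "s - of_int j * l"] C_uhpD[OF kC] by simp
        \<comment> \<open>Numbers in \<open>(0, l]\<close> that are congruent modulo
          \<open>l\<close> are equal.\<close>
        have b: "0 < s" "s \<le> l" "0 < s'" "s' \<le> l" using sh by (auto simp: Per_def)
        have "j = j'"
        proof (rule ccontr)
          assume "j \<noteq> j'"
          then have "1 \<le> \<bar>j - j'\<bar>" by simp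
          then have "1 \<le> \<bar>real_of_int (j - j')\<bar>" by linarith
          then have "l \<le> \<bar>real_of_int (j - j')\<bar> * l" using l by simp
          also have "\<dots> = \<bar>of_int j * l - of_int j' * l\<bar>" using l by (simp add: abs_mult flip: left_diff_distrib)
          also have "\<dots> = \<bar>s - s'\<bar>" using ps by linarith
          finally show False using b by linarith
        qed
        then show ?thesis using ps eq by simp
      qed
      define De where "De e s h = (\<Union>j. Ds s h (j, e))" for e s h
      have Des: "De e s h \<in> sets L" if "s \<in> Per" "h \<in> Li" for e s h
        unfolding De_def using Dsets(1)[OF that] by (intro sets.countable_UN') auto
      \<comment> \<open>\<open>L\<close> is invariant, so the pieces of a slice may be measured by
        their images; these are disjoint only for a fixed kind of arc, hence two terms.\<close>
      have le1: "emeasure L (Bh h) \<le> emeasure L (De True s h) + emeasure L (De False s h)" if sh: "s \<in> Per" "h \<in> Li" for s h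
      proof -
        have Fe: "emeasure L (\<Union>j. F s h (j, e)) = emeasure L (De e s h)" for e
        proof -
          have "emeasure L (\<Union>j. F s h (j, e)) = (\<integral>\<^sup>+j. emeasure L (F s h (j, e)) \<partial>count_space UNIV)"
            by (rule emeasure_UN_countable) (use Fs[OF sh] Fdisj in \<open>auto simp: disjoint_family_on_def\<close>)
          also have "\<dots> = (\<integral>\<^sup>+j. emeasure L (Ds s h (j, e)) \<partial>count_space UNIV)" using Dsets(2)[OF sh] by simp
          also have "\<dots> = emeasure L (De e s h)"
            unfolding De_def
            by (rule emeasure_UN_countable[symmetric]) (use Dsets(1)[OF sh] key[OF sh sh] in \<open>auto simp: disjoint_family_on_def\<close>)
          finally show ?thesis .
        qed
        have "Bh h = (\<Union>j. F s h (j, True)) \<union> (\<Union>j. F s h (j, False))"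
        proof -
          have "(\<Union>q. F s h q) = (\<Union>j. F s h (j, True)) \<union> (\<Union>j. F s h (j, False))" 
            by (auto; metis (full_types) surj_pair)
          then show ?thesis using Fcover[OF sh] by simp
        qed
        then have "emeasure L (Bh h) \<le> emeasure L (\<Union>j. F s h (j, True)) + emeasure L (\<Union>j. F s h (j, False))"
          using emeasure_subadditive[of "\<Union>j. F s h (j, True)" L "\<Union>j. F s h (j, False)"] Fs[OF sh]
          by (simp add: sets.countable_UN')
        then show ?thesis unfolding Fe .
      qed
      have le2: "(\<integral>\<^sup>+s. \<integral>\<^sup>+h. emeasure L (De e s h) \<partial>count_space Li \<partial>count_space Per) \<le> emeasure L S" for e
      proof -
        have cL: "countable Li" unfolding Li_def by (rule lifts_countable)
        have same: "s = s' \<and> h = h'"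
          if sh: "s \<in> Per" "h \<in> Li" "s' \<in> Per" "h' \<in> Li" "y \<in> De e s h" "y \<in> De e s' h'" for s h s' h' y
        proof -
          obtain j j' where "y \<in> Ds s h (j, e)" "y \<in> Ds s' h' (j', e)" using sh(5,6) unfolding De_def by blast
          then show ?thesis using key[OF sh(1-4)] by blast
        qed
        have 1: "(\<integral>\<^sup>+h. emeasure L (De e s h) \<partial>count_space Li) = emeasure L (\<Union>h\<in>Li. De e s h)" if s: "s \<in> Per" for s
        proof (rule emeasure_UN_countable[symmetric, OF Des[OF s] cL])
          show "disjoint_family_on (De e s) Li"
            unfolding disjoint_family_on_def
          proof (intro ballI impI equals0I)
            fix h h' y assume a: "h \<in> Li" "h' \<in> Li" "h \<noteq> h'" "y \<in> De e s h \<inter> De e s h'"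
            then show False using same[OF s a(1) s a(2), of y] by blast
          qed
        qed
        have Us: "(\<Union>h\<in>Li. De e s h) \<in> sets L" if "s \<in> Per" for s using Des[OF that] cL by (intro sets.countable_UN') auto
        have "(\<integral>\<^sup>+s. \<integral>\<^sup>+h. emeasure L (De e s h) \<partial>count_space Li \<partial>count_space Per)
            = (\<integral>\<^sup>+s. emeasure L (\<Union>h\<in>Li. De e s h) \<partial>count_space Per)"
          by (rule nn_integral_cong) (simp add: 1)
        also have "\<dots> = emeasure L (\<Union>s\<in>Per. \<Union>h\<in>Li. De e s h)"
        proof (rule emeasure_UN_countable[symmetric, OF Us countable_finite[OF fin]])
          show "disjoint_family_on (\<lambda>s. \<Union>h\<in>Li. De e s h) Per"
            unfolding disjoint_family_on_def
          proof (intro ballI impI equals0I)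
            fix s s' y assume a: "s \<in> Per" "s' \<in> Per" "s \<noteq> s'" "y \<in> (\<Union>h\<in>Li. De e s h) \<inter> (\<Union>h\<in>Li. De e s' h)"
            then obtain h h' where "h \<in> Li" "h' \<in> Li" "y \<in> De e s h" "y \<in> De e s' h'" by blast
            then show False using same[OF a(1) _ a(2), of h h' y] a(3) by blast
          qed
        qed
        also have "\<dots> \<le> emeasure L S"
        proof (rule emeasure_mono[OF _ S(1)], rule subsetI)
          fix y assume "y \<in> (\<Union>s\<in>Per. \<Union>h\<in>Li. De e s h)"
          then obtain s h where sh: "s \<in> Per" "h \<in> Li" "y \<in> De e s h" by blast
          show "y \<in> S" using subsetD[OF DsS] sh(3) unfolding De_def by blast
        qed
        finally show ?thesis .
      qed
      \<comment> \<open>The multiplicity becomes a sum over \<open>Per\<close>, whose terms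
        correspond to the shifted copies.\<close>
      have "of_nat (card Per) * (\<integral>\<^sup>+h. emeasure L (Bh h) \<partial>count_space Li)
          = (\<integral>\<^sup>+s. \<integral>\<^sup>+h. emeasure L (Bh h) \<partial>count_space Li \<partial>count_space Per)"
        using fin by (simp add: mult.commute)
      also have "\<dots> \<le> (\<integral>\<^sup>+s. \<integral>\<^sup>+h. (emeasure L (De True s h) + emeasure L (De False s h)) \<partial>count_space Li \<partial>count_space Per)"
        using le1 by (intro nn_integral_mono) auto
      also have "\<dots> = (\<integral>\<^sup>+s. \<integral>\<^sup>+h. emeasure L (De True s h) \<partial>count_space Li \<partial>count_space Per)
          + (\<integral>\<^sup>+s. \<integral>\<^sup>+h. emeasure L (De False s h) \<partial>count_space Li \<partial>count_space Per)"
        by (simp add: nn_integral_add)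
      also have "\<dots> \<le> emeasure L S + emeasure L S" using le2 by (intro add_mono)
      also have "\<dots> = 2 * emeasure L S" by (simp add: mult_2)
      finally show ?thesis using e1 by (rule order_trans[rotated])
    qed
  qed
  show ?thesis
    unfolding intersection_form_def \<nu>_def[symmetric] S_def[symmetric]
    by (rule SUP_least) (use bound in auto)
qed

end

section \<open>Metrics on the interior and the Hopf-Rinow theorem\<close>

lemma curve_length_ge3:
  assumes "t \<in> {0..1}"
  shows "ennreal (d (c 0) (c t)) + ennreal (d (c t) (c 1)) \<le> curve_length d c"
proof -
  have "[0, t, 1] \<in> {ts. sorted ts \<and> set ts \<subseteq> {0..1}}" using assms by auto
  then have "(\<Sum>i<length [0, t, 1] - 1. ennreal (d (c ([0, t, 1] ! i)) (c ([0, t, 1] ! Suc i)))) \<le> curve_length d c"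
    unfolding curve_length_def by (rule SUP_upper)
  moreover have "{..<2::nat} = {0, 1}" by auto
  ultimately show ?thesis by simp
qed

lemma locally_Lipschitz_imp_Lipschitz:
  fixes c :: "real \<Rightarrow> 'b" and a b :: real
  assumes tri: "\<And>x y z. x \<in> {a..b} \<Longrightarrow> y \<in> {a..b} \<Longrightarrow> z \<in> {a..b} \<Longrightarrow> d (c x) (c z) \<le> d (c x) (c y) + d (c y) (c z)"
    and loc: "\<And>t. t \<in> {a..b} \<Longrightarrow> \<exists>e>0. \<forall>s\<in>{t-e<..<t+e}. \<forall>s'\<in>{t-e<..<t+e}. s \<le> s' \<longrightarrow> d (c s) (c s') \<le> R * (s' - s)"
    and "a \<le> b"
  shows "d (c a) (c b) \<le> R * (b - a)"
proof -
  have "a \<le> a \<longrightarrow> b \<le> b \<longrightarrow> d (c a) (c b) \<le> R * (b - a)"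
    using \<open>a \<le> b\<close>
  proof (rule Bolzano[where P = "\<lambda>x y. a \<le> x \<longrightarrow> y \<le> b \<longrightarrow> d (c x) (c y) \<le> R * (y - x)"])
    fix x y z assume h: "a \<le> x \<longrightarrow> y \<le> b \<longrightarrow> d (c x) (c y) \<le> R * (y - x)" "a \<le> y \<longrightarrow> z \<le> b \<longrightarrow> d (c y) (c z) \<le> R * (z - y)"
      "x \<le> y" "y \<le> z"
    show "a \<le> x \<longrightarrow> z \<le> b \<longrightarrow> d (c x) (c z) \<le> R * (z - x)"
    proof (intro impI)
      assume "a \<le> x" "z \<le> b"
      then show "d (c x) (c z) \<le> R * (z - x)" using h tri[of x y z] by (simp add: algebra_simps)
    qed
  next
    fix x assume x: "a \<le> x" "x \<le> b"
    then obtain e where e: "e > 0" "\<And>s s'. s\<in>{x-e<..<x+e} \<Longrightarrow> s'\<in>{x-e<..<x+e} \<Longrightarrow> s \<le> s' \<Longrightarrow> d (c s) (c s') \<le> R * (s' - s)"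
      using loc[of x] by auto
    have "d (c u) (c v) \<le> R * (v - u)" if "u \<le> x" "x \<le> v" "v - u < e" for u v
      using that by (intro e(2)) auto
    then show "\<exists>\<delta>>0. \<forall>u v. u \<le> x \<and> x \<le> v \<and> v - u < \<delta> \<longrightarrow> a \<le> u \<longrightarrow> v \<le> b \<longrightarrow> d (c u) (c v) \<le> R * (v - u)"
      using e(1) by blast
  qed
  then show ?thesis by simp
qed

locale hyperbolic_metric = Metric_space S d for S :: "'a::metric_space set" and d +
  assumes topology: "mtopology = top_of_set S" and complete: mcomplete and length: "length_metric S d"
    and charts: "\<And>x. x \<in> S \<Longrightarrow> \<exists>r \<phi>. disc_chart S d x r \<phi>"
begin

lemma tendsto_iff_metric:
  assumes "x \<in> S" "\<And>n. y n \<in> S"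
  shows "y \<longlonglongrightarrow> x \<longleftrightarrow> (\<lambda>n. d (y n) x) \<longlonglongrightarrow> 0"
proof -
  have "limitin mtopology y x sequentially \<longleftrightarrow> (\<lambda>n. d (y n) x) \<longlonglongrightarrow> 0"
    using assms by (simp add: limitin_metric_dist_null)
  moreover have "limitin mtopology y x sequentially \<longleftrightarrow> y \<longlonglongrightarrow> x"
    unfolding topology using assms by (simp add: limitin_subtopology)
  ultimately show ?thesis by simp
qed

lemma compactin_iff_compact: "K \<subseteq> S \<Longrightarrow> compactin mtopology K \<longleftrightarrow> compact K"
  unfolding topology by (simp add: compactin_subtopology)

text \<open>Both metrics induce the same topology, so a sequence converging for one converges for
  the other. Only the first point is confined to the compact set; the second one follows it to the
  same limit.\<close>

lemma uniform_equivalence: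
  assumes "compact Q" "Q \<subseteq> S" "e > 0"
  shows "\<exists>r>0. \<forall>x\<in>Q. \<forall>y\<in>S. d x y < r \<longrightarrow> dist x y < e"
    and "\<exists>r>0. \<forall>x\<in>Q. \<forall>y\<in>S. dist x y < r \<longrightarrow> d x y < e"
proof -
  have inv: "(\<lambda>n. 1 / real (Suc n)) \<longlonglongrightarrow> 0" by (rule LIMSEQ_Suc[OF lim_1_over_n])
  show "\<exists>r>0. \<forall>x\<in>Q. \<forall>y\<in>S. d x y < r \<longrightarrow> dist x y < e"
  proof (rule ccontr)
    assume n: "\<not> ?thesis"
    have "\<exists>x y. x \<in> Q \<and> y \<in> S \<and> d x y < 1 / Suc n \<and> dist x y \<ge> e" for n
    proof (rule ccontr)
      assume "\<not> ?thesis"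
      then have "\<forall>x\<in>Q. \<forall>y\<in>S. d x y < 1 / Suc n \<longrightarrow> dist x y < e" by (simp only: not_ex de_Morgan_conj not_le) blast
      moreover have "(0::real) < 1 / Suc n" by simp
      ultimately show False using n by blast
    qed
    then obtain x y where xy: "\<And>n. x n \<in> Q" "\<And>n. y n \<in> S" "\<And>n. d (x n) (y n) < 1 / Suc n" "\<And>n. dist (x n) (y n) \<ge> e"
      by metis
    obtain l f where l: "l \<in> Q" "strict_mono f" "(x \<circ> f) \<longlonglongrightarrow> l"
      using assms(1) xy(1) unfolding compact_def by metis
    have S: "l \<in> S" "x n \<in> S" for n using l xy assms(2) by auto
    have "(\<lambda>n. d ((x \<circ> f) n) l) \<longlonglongrightarrow> 0" using tendsto_iff_metric[of l "x \<circ> f"] l(3) S by simp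
    moreover have "(\<lambda>n. 1 / real (Suc (f n))) \<longlonglongrightarrow> 0" using LIMSEQ_subseq_LIMSEQ[OF inv l(2)] by (simp add: o_def)
    ultimately have "(\<lambda>n. 1 / real (Suc (f n)) + d ((x \<circ> f) n) l) \<longlonglongrightarrow> 0 + 0" by (rule tendsto_add[rotated])
    then have z: "(\<lambda>n. 1 / real (Suc (f n)) + d ((x \<circ> f) n) l) \<longlonglongrightarrow> 0" by simp
    have "(\<lambda>n. d ((y \<circ> f) n) l) \<longlonglongrightarrow> 0"
    proof (rule Lim_null_comparison[OF _ z])
      have "norm (d ((y \<circ> f) n) l) \<le> 1 / real (Suc (f n)) + d ((x \<circ> f) n) l" for n
        using triangle[of "y (f n)" "x (f n)" l] xy(2) S commute[of "y (f n)" "x (f n)"] less_imp_le[OF xy(3)[of "f n"]] by simp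
      then show "\<forall>\<^sub>F n in sequentially. norm (d ((y \<circ> f) n) l) \<le> 1 / real (Suc (f n)) + d ((x \<circ> f) n) l"
        by simp
    qed
    then have "(y \<circ> f) \<longlonglongrightarrow> l" using tendsto_iff_metric[of l "y \<circ> f"] xy S by simp
    then have "(\<lambda>n. dist ((x \<circ> f) n) ((y \<circ> f) n)) \<longlonglongrightarrow> dist l l" using l(3) by (intro tendsto_dist)
    then have "\<forall>\<^sub>F n in sequentially. dist ((x \<circ> f) n) ((y \<circ> f) n) < e"
      using assms(3) by (auto dest: order_tendstoD)
    then show False using xy(4) by (auto simp: eventually_sequentially not_less[symmetric])
  qed
  show "\<exists>r>0. \<forall>x\<in>Q. \<forall>y\<in>S. dist x y < r \<longrightarrow> d x y < e"
  proof (rule ccontr)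
    assume n: "\<not> ?thesis"
    have "\<exists>x y. x \<in> Q \<and> y \<in> S \<and> dist x y < 1 / Suc n \<and> d x y \<ge> e" for n
    proof (rule ccontr)
      assume "\<not> ?thesis"
      then have "\<forall>x\<in>Q. \<forall>y\<in>S. dist x y < 1 / Suc n \<longrightarrow> d x y < e" by (simp only: not_ex de_Morgan_conj not_le) blast
      moreover have "(0::real) < 1 / Suc n" by simp
      ultimately show False using n by blast
    qed
    then obtain x y where xy: "\<And>n. x n \<in> Q" "\<And>n. y n \<in> S" "\<And>n. dist (x n) (y n) < 1 / Suc n" "\<And>n. d (x n) (y n) \<ge> e"
      by metis
    obtain l f where l: "l \<in> Q" "strict_mono f" "(x \<circ> f) \<longlonglongrightarrow> l"
      using assms(1) xy(1) unfolding compact_def by metis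
    have S: "l \<in> S" "x n \<in> S" for n using l xy assms(2) by auto
    have x0: "(\<lambda>n. d ((x \<circ> f) n) l) \<longlonglongrightarrow> 0" using tendsto_iff_metric[of l "x \<circ> f"] l(3) S by simp
    have "(\<lambda>n. 1 / real (Suc (f n))) \<longlonglongrightarrow> 0" using LIMSEQ_subseq_LIMSEQ[OF inv l(2)] by (simp add: o_def)
    then have "(\<lambda>n. dist ((x \<circ> f) n) ((y \<circ> f) n)) \<longlonglongrightarrow> 0"
      using xy(3) by (intro Lim_null_comparison[of "\<lambda>n. dist ((x \<circ> f) n) ((y \<circ> f) n)" "\<lambda>n. 1 / real (Suc (f n))"])
        (auto intro!: always_eventually less_imp_le simp del: of_nat_Suc)
    then have z: "(\<lambda>n. dist ((x \<circ> f) n) ((y \<circ> f) n) + dist ((x \<circ> f) n) l) \<longlonglongrightarrow> 0"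
      using tendsto_add l(3)[unfolded tendsto_dist_iff[of _ l]] by fastforce
    have "(\<lambda>n. dist ((y \<circ> f) n) l) \<longlonglongrightarrow> 0"
      by (rule Lim_null_comparison[OF _ z]) (simp add: dist_triangle3 always_eventually)
    then have "(y \<circ> f) \<longlonglongrightarrow> l" by (simp add: tendsto_dist_iff[of _ l])
    then have "(\<lambda>n. d ((y \<circ> f) n) l) \<longlonglongrightarrow> 0" using tendsto_iff_metric[of l "y \<circ> f"] xy S by simp
    then have "(\<lambda>n. d ((x \<circ> f) n) l + d ((y \<circ> f) n) l) \<longlonglongrightarrow> 0 + 0" using x0 by (intro tendsto_add)
    then have "\<forall>\<^sub>F n in sequentially. d ((x \<circ> f) n) l + d ((y \<circ> f) n) l < e"
      using assms(3) by (auto dest: order_tendstoD)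
    then obtain n where "d (x (f n)) l + d (y (f n)) l < e" by (auto simp: eventually_sequentially)
    then show False using xy(4)[of "f n"] triangle[of "x (f n)" l "y (f n)"] S xy(2) commute[of l "y (f n)"] by simp
  qed
qed

lemma chart_inverse:
  assumes "x \<in> S"
  obtains r \<phi> \<psi> where "r > 0" "\<phi> x = \<i>" "\<And>y. y \<in> S \<Longrightarrow> d x y < r \<Longrightarrow> \<phi> y \<in> uhp \<and> hdist \<i> (\<phi> y) < r \<and> \<psi> (\<phi> y) = y"
    "\<And>z. z \<in> uhp \<Longrightarrow> hdist \<i> z < r \<Longrightarrow> \<psi> z \<in> S \<and> d x (\<psi> z) < r \<and> \<phi> (\<psi> z) = z"
    "\<And>y y'. y \<in> S \<Longrightarrow> y' \<in> S \<Longrightarrow> d x y < r \<Longrightarrow> d x y' < r \<Longrightarrow> hdist (\<phi> y) (\<phi> y') = d y y'"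
proof -
  obtain r \<phi> where r: "r > 0" "\<phi> x = \<i>" and b: "bij_betw \<phi> {y\<in>S. d x y < r} {z\<in>uhp. hdist \<i> z < r}"
    and i: "\<forall>y\<in>{y\<in>S. d x y < r}. \<forall>z\<in>{y\<in>S. d x y < r}. hdist (\<phi> y) (\<phi> z) = d y z"
    using charts[OF assms] unfolding disc_chart_def isometric_onto_def by blast
  define \<psi> where "\<psi> = the_inv_into {y\<in>S. d x y < r} \<phi>"
  have 1: "\<phi> y \<in> uhp \<and> hdist \<i> (\<phi> y) < r \<and> \<psi> (\<phi> y) = y" if "y \<in> S" "d x y < r" for y
    using bij_betwE[OF b] the_inv_into_f_f[OF bij_betw_imp_inj_on[OF b], of y] that by (simp add: \<psi>_def)
  have 2: "\<psi> z \<in> S \<and> d x (\<psi> z) < r \<and> \<phi> (\<psi> z) = z" if "z \<in> uhp" "hdist \<i> z < r" for z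
    using bij_betwE[OF bij_betw_the_inv_into[OF b]] f_the_inv_into_f_bij_betw[OF b, of z] that by (simp add: \<psi>_def)
  show ?thesis using that[OF r 1 2] i by simp
qed

lemma chart_segment:
  assumes "x \<in> S"
  shows "\<exists>r>0. \<forall>y\<in>S. \<forall>y'\<in>S. d x y < r \<longrightarrow> d x y' < r \<longrightarrow>
    (\<exists>s. s 0 = y \<and> s 1 = y' \<and> (\<forall>a\<in>{0..1}. s a \<in> S) \<and> (\<forall>a\<in>{0..1}. \<forall>b\<in>{0..1}. d (s a) (s b) = d y y' * \<bar>a - b\<bar>))"
proof -
  obtain r \<phi> \<psi> where c: "r > 0" "\<phi> x = \<i>" "\<And>y. y \<in> S \<Longrightarrow> d x y < r \<Longrightarrow> \<phi> y \<in> uhp \<and> hdist \<i> (\<phi> y) < r \<and> \<psi> (\<phi> y) = y"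
    "\<And>z. z \<in> uhp \<Longrightarrow> hdist \<i> z < r \<Longrightarrow> \<psi> z \<in> S \<and> d x (\<psi> z) < r \<and> \<phi> (\<psi> z) = z"
    "\<And>y y'. y \<in> S \<Longrightarrow> y' \<in> S \<Longrightarrow> d x y < r \<Longrightarrow> d x y' < r \<Longrightarrow> hdist (\<phi> y) (\<phi> y') = d y y'"
    using chart_inverse[OF assms] by blast
  show ?thesis
  \<comment> \<open>Points within \<open>r / 3\<close> of \<open>x\<close> are less than
    \<open>2 * r / 3\<close> apart, so the segment between them stays in the domain of the
    chart.\<close>
  proof (intro exI[of _ "r / 3"] conjI ballI impI)
    fix y y' assume y: "y \<in> S" "y' \<in> S" "d x y < r / 3" "d x y' < r / 3"
    then have yr: "d x y < r" "d x y' < r" using c(1) by auto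
    define L where "L = d y y'"
    have L: "L = hdist (\<phi> y) (\<phi> y')" "L \<ge> 0" "L < 2 * r / 3"
      using c(5)[OF y(1,2) yr] triangle[of y x y'] y assms commute[of y x] by (auto simp: L_def)
    obtain k where k: "k \<in> unit_geodesics uhp" "k 0 = \<phi> y" "k L = \<phi> y'"
      using geodesic_through[of "\<phi> y" "\<phi> y'"] c(3) y yr L(1) by metis
    have ku: "k t \<in> uhp" and kd: "hdist (k t) (k t') = \<bar>t - t'\<bar>" for t t' using k(1) by (auto simp: unit_geodesics_def)
    have ki: "hdist \<i> (k t) < r" if "0 \<le> t" "t \<le> L" for t
    proof -
      have "hdist \<i> (k t) \<le> hdist \<i> (k 0) + hdist (k 0) (k t)" using ku by (intro hdist_triangle) auto
      moreover have "hdist \<i> (k 0) = d x y" using c(5)[OF assms y(1) _ yr(1)] c(1,2) assms k(2) by simp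
      ultimately show ?thesis using that y(3) L(3) kd[of 0 t] by simp
    qed
    define s where "s a = \<psi> (k (L * a))" for a
    have La: "0 \<le> L * a" "L * a \<le> L" if "a \<in> {0..1}" for a using that L(2) mult_left_mono[of a 1 L] by auto
    have s: "s a \<in> S" "d x (s a) < r" "\<phi> (s a) = k (L * a)" if "a \<in> {0..1}" for a
      using c(4)[OF ku ki[OF La[OF that]]] by (auto simp: s_def)
    have "d (s a) (s b) = d y y' * \<bar>a - b\<bar>" if "a \<in> {0..1}" "b \<in> {0..1}" for a b
    proof -
      have "d (s a) (s b) = hdist (k (L * a)) (k (L * b))" using c(5)[of "s a" "s b"] s that by simp
      also have "\<dots> = L * \<bar>a - b\<bar>" using L(2) by (simp add: kd abs_mult flip: right_diff_distrib)
      finally show ?thesis by (simp add: L_def)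
    qed
    moreover have "s 0 = y" "s 1 = y'" using c(3) y yr k by (auto simp: s_def)
    ultimately show "\<exists>s. s 0 = y \<and> s 1 = y' \<and> (\<forall>a\<in>{0..1}. s a \<in> S) \<and> (\<forall>a\<in>{0..1}. \<forall>b\<in>{0..1}. d (s a) (s b) = d y y' * \<bar>a - b\<bar>)"
      using s(1) by (intro exI[of _ s]) blast
  qed (use c(1) in auto)
qed

lemma compact_small_ball:
  assumes "x \<in> S"
  shows "\<exists>r>0. compactin mtopology (mcball x r)"
proof -
  obtain r \<phi> \<psi> where c: "r > 0" "\<phi> x = \<i>" "\<And>y. y \<in> S \<Longrightarrow> d x y < r \<Longrightarrow> \<phi> y \<in> uhp \<and> hdist \<i> (\<phi> y) < r \<and> \<psi> (\<phi> y) = y"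
    "\<And>z. z \<in> uhp \<Longrightarrow> hdist \<i> z < r \<Longrightarrow> \<psi> z \<in> S \<and> d x (\<psi> z) < r \<and> \<phi> (\<psi> z) = z"
    "\<And>y y'. y \<in> S \<Longrightarrow> y' \<in> S \<Longrightarrow> d x y < r \<Longrightarrow> d x y' < r \<Longrightarrow> hdist (\<phi> y) (\<phi> y') = d y y'"
    using chart_inverse[OF assms] by blast
  have xr: "d x x < r" using assms c(1) by simp
  have "compactin mtopology (mcball x (r / 2))"
    unfolding compactin_sequentially
  proof (intro conjI allI impI)
    show "mcball x (r / 2) \<subseteq> S" by (rule mcball_subset_mspace)
    fix \<sigma> :: "nat \<Rightarrow> 'a" assume "range \<sigma> \<subseteq> mcball x (r / 2)"
    then have s: "\<sigma> n \<in> S" "d x (\<sigma> n) \<le> r / 2" for n by (auto simp: subset_iff)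
    have sr: "d x (\<sigma> n) < r" for n using s(2)[of n] c(1) by simp
    have "\<forall>n. \<phi> (\<sigma> n) \<in> {w\<in>uhp. hdist \<i> w \<le> r / 2}"
      using c(3)[OF s(1) sr] c(5)[OF assms s(1) xr sr] c(2) s(2) by simp
    then obtain l f where l: "l \<in> {w\<in>uhp. hdist \<i> w \<le> r / 2}" "strict_mono (f::nat\<Rightarrow>nat)" "(\<lambda>n. \<phi> (\<sigma> (f n))) \<longlonglongrightarrow> l"
      unfolding o_def by (rule seq_compactE[OF compact_imp_seq_compact[OF compact_hcball[OF i_uhp, of "r / 2"]]])
        (simp add: o_def)
    have lr: "l \<in> uhp" "hdist \<i> l < r" using l(1) c(1) by simp_all
    have pl: "\<psi> l \<in> S" "d x (\<psi> l) < r" "\<phi> (\<psi> l) = l" using c(4)[OF lr] by auto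
    have "(\<lambda>n. hdist l (\<phi> (\<sigma> (f n)))) \<longlonglongrightarrow> 0"
      by (rule tendsto_hdist[OF lr(1) _ l(3)]) (use c(3)[OF s(1) sr] in simp)
    moreover have "hdist l (\<phi> (\<sigma> (f n))) = d ((\<sigma> \<circ> f) n) (\<psi> l)" for n
      using c(5)[OF pl(1) s(1)[of "f n"] pl(2) sr] pl commute by simp
    ultimately have "(\<lambda>n. d ((\<sigma> \<circ> f) n) (\<psi> l)) \<longlonglongrightarrow> 0" by simp
    then have "limitin mtopology (\<sigma> \<circ> f) (\<psi> l) sequentially"
      using pl s by (simp add: limitin_metric_dist_null)
    moreover have "\<psi> l \<in> mcball x (r / 2)" using pl l(1) c(5)[OF assms pl(1) xr pl(2)] c(2) assms by simp
    ultimately show "\<exists>l q. l \<in> mcball x (r / 2) \<and> strict_mono q \<and> limitin mtopology (\<sigma> \<circ> q) l sequentially"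
      using l(2) by blast
  qed
  then show ?thesis using c(1) by (intro exI[of _ "r / 2"]) simp
qed

text \<open>On an almost shortest path from \<open>x\<close> to \<open>y\<close> the distance from
  \<open>x\<close> takes every intermediate value, and the length of the rest of the path bounds the
  distance to \<open>y\<close>.\<close>

lemma between_point:
  assumes "x \<in> S" "y \<in> S" "0 \<le> s" "s \<le> d x y" "e > 0"
  shows "\<exists>m\<in>S. d x m = s \<and> d m y < d x y - s + e"
proof -
  have "(INF c\<in>{c. path c \<and> path_image c \<subseteq> S \<and> pathstart c = x \<and> pathfinish c = y}. curve_length d c) = ennreal (d x y)"
    using bspec[OF bspec[OF length[unfolded length_metric_def] assms(1)] assms(2)] by (rule sym)
  then have "(INF c\<in>{c. path c \<and> path_image c \<subseteq> S \<and> pathstart c = x \<and> pathfinish c = y}. curve_length d c) < ennreal (d x y + e)"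
    using assms(5) by (simp add: ennreal_lessI nonneg add_nonneg_pos)
  then obtain c where c': "c \<in> {c. path c \<and> path_image c \<subseteq> S \<and> pathstart c = x \<and> pathfinish c = y}"
    "curve_length d c < ennreal (d x y + e)"
    by (rule INF_less_iff[THEN iffD1, THEN bexE])
  then have c: "path c" "\<And>t. t \<in> {0..1} \<Longrightarrow> c t \<in> S" "c 0 = x" "c 1 = y"
    by (auto simp: pathstart_def pathfinish_def path_image_def)
  have cont: "continuous_on {0..1} (\<lambda>t. d x (c t))"
  proof (rule continuous_on_sequentiallyI)
    fix u :: "nat \<Rightarrow> real" and a assume u: "\<forall>n. u n \<in> {0..1}" "a \<in> {0..1}" "u \<longlonglongrightarrow> a"
    have "(\<lambda>n. c (u n)) \<longlonglongrightarrow> c a"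
      using c(1) u continuous_on_sequentially[of "{0..1}" c] by (auto simp: path_def o_def)
    then have 0: "(\<lambda>n. d (c (u n)) (c a)) \<longlonglongrightarrow> 0" using tendsto_iff_metric[of "c a" "\<lambda>n. c (u n)"] c(2) u by simp
    have "(\<lambda>n. d x (c (u n)) - d x (c a)) \<longlonglongrightarrow> 0"
    proof (rule Lim_null_comparison[OF _ 0])
      have "\<bar>d x (c (u n)) - d x (c a)\<bar> \<le> d (c (u n)) (c a)" for n
        using triangle[of x "c (u n)" "c a"] triangle[of x "c a" "c (u n)"] c(2) u assms(1) commute[of "c a" "c (u n)"] by simp
      then show "\<forall>\<^sub>F n in sequentially. norm (d x (c (u n)) - d x (c a)) \<le> d (c (u n)) (c a)" by simp
    qed
    then show "(\<lambda>n. d x (c (u n))) \<longlonglongrightarrow> d x (c a)" by (rule LIM_zero_cancel)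
  qed
  obtain t where t: "0 \<le> t" "t \<le> 1" "d x (c t) = s"
    using IVT'[of "\<lambda>t. d x (c t)" 0 s 1] cont assms c by auto
  then have tt: "t \<in> {0..1}" by simp
  have "ennreal (s + d (c t) y) \<le> curve_length d c"
    using curve_length_ge3[OF tt, of d c] c t assms(3) by (simp add: ennreal_plus nonneg)
  then have "ennreal (s + d (c t) y) < ennreal (d x y + e)" using c'(2) by (rule le_less_trans)
  then have "s + d (c t) y < d x y + e" using ennreal_less_iff[of "s + d (c t) y" "d x y + e"] assms nonneg by simp
  then show ?thesis using t c(2)[OF tt] by (intro bexI[of _ "c t"]) auto
qed

text \<open>Hopf--Rinow: the set of radii of compact balls around \<open>x\<close> is open by local compactness, and
  closed since in a length space a ball is totally bounded once all smaller concentric ones are.\<close>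

lemma compact_mcball:
  assumes x: "x \<in> S"
  shows "compactin mtopology (mcball x R)"
proof (rule ccontr)
  assume n: "\<not> ?thesis"
  define A where "A = {r. r \<ge> 0 \<and> compactin mtopology (mcball x r)}"
  have sub: "compactin mtopology (mcball x r)" if "compactin mtopology (mcball x r')" "r \<le> r'" for r r'
    by (rule closed_compactin[OF that(1) mcball_subset_concentric[OF that(2)] closedin_mcball])
  have "R \<ge> 0"
  proof (rule ccontr)
    assume "\<not> R \<ge> 0"
    then have "mcball x R = {}" by (simp add: mcball_eq_empty)
    then show False using n by simp
  qed
  have bd: "r \<le> R" if "r \<in> A" for r using sub[of r R] n that by (force simp: A_def)
  have "mcball x 0 = {x}"
  proof (intro equalityI subsetI)
    fix y assume "y \<in> mcball x 0"
    then have "y \<in> S" "d x y = 0" using nonneg[of x y] by auto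
    then show "y \<in> {x}" using zero[OF x] by simp
  qed (use x in auto)
  then have A0: "0 \<in> A" using x by (simp add: A_def)
  have bA: "bdd_above A" using bd by (rule bdd_aboveI)
  define s where "s = Sup A"
  have s0: "s \<ge> 0" and su: "r \<le> s" if "r \<in> A" for r unfolding s_def using A0 bA cSup_upper that by metis+
  have s0: "s \<ge> 0" using s0[OF A0] .
  have below: "compactin mtopology (mcball x r)" if r: "r < s" for r
  proof -
    obtain r' where "r' \<in> A" "r < r'" using less_cSupD[of A r] A0 r unfolding s_def by blast
    then show ?thesis using sub[of r' r] by (simp add: A_def)
  qed
  have "mtotally_bounded (mcball x s)"
    unfolding mtotally_bounded_def
  proof (intro allI impI)
    fix e :: real assume e: "e > 0"
    \<comment> \<open>By \<open>between_point\<close> every point of the larger ball is within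
      \<open>e / 2\<close> of this smaller one, so a finite net of the smaller ball serves for
      both.\<close>
    define s' where "s' = max 0 (s - e / 3)"
    have s': "0 \<le> s'" "s' \<le> s" "s - e / 3 \<le> s'" using s0 e by (auto simp: s'_def)
    have "compactin mtopology (mcball x s')"
      using below[of s'] A0 e by (cases "s - e / 3 \<le> 0") (auto simp: s'_def A_def)
    then have "mtotally_bounded (mcball x s')" by (rule compactin_imp_mtotally_bounded)
    then obtain K where K: "finite K" "K \<subseteq> mcball x s'" "mcball x s' \<subseteq> (\<Union>k\<in>K. mball k (e / 2))"
      unfolding mtotally_bounded_def using e by (metis half_gt_zero)
    have "mcball x s \<subseteq> (\<Union>k\<in>K. mball k e)"
    proof
      fix y assume "y \<in> mcball x s"
      then have y: "y \<in> S" "d x y \<le> s" by auto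
      obtain m where m: "m \<in> S" "d x m = min (d x y) s'" "d m y < d x y - min (d x y) s' + e / 6"
        using between_point[OF x y(1), of "min (d x y) s'" "e / 6"] s' e nonneg by auto
      have "m \<in> mcball x s'" using m x by simp
      then obtain k where k: "k \<in> K" "m \<in> mball k (e / 2)" using K(3) by blast
      have "d x y - min (d x y) s' \<le> e / 3" using y s' e by auto
      then have "d m y < e / 2" using m(3) by simp
      then have "d k y < e" using k(2) triangle[of k m y] y m by simp
      then show "y \<in> (\<Union>k\<in>K. mball k e)" using k y by auto
    qed
    then show "\<exists>K. finite K \<and> K \<subseteq> mcball x s \<and> mcball x s \<subseteq> (\<Union>x\<in>K. mball x e)"
      using K mcball_subset_concentric[OF s'(2), of x] by blast
  qed
  then have cs: "compactin mtopology (mcball x s)"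
    using mtotally_bounded_eq_compact_closure_of[OF complete, of "mcball x s"] closure_of_closedin[OF closedin_mcball] by simp
  have "\<exists>r. y \<in> S \<longrightarrow> r > 0 \<and> compactin mtopology (mcball y r)" for y using compact_small_ball by blast
  then obtain r where r: "\<And>y. y \<in> S \<Longrightarrow> r y > 0" "\<And>y. y \<in> S \<Longrightarrow> compactin mtopology (mcball y (r y))"
    by metis
  define \<C> where "\<C> = (\<lambda>y. mball y (r y)) ` S"
  have cov: "mcball x s \<subseteq> \<Union>\<C>"
  proof
    fix y assume "y \<in> mcball x s"
    then have y: "y \<in> S" by simp
    then have "y \<in> mball y (r y)" using r(1) by simp
    then show "y \<in> \<Union>\<C>" unfolding \<C>_def using y by blast
  qed
  \<comment> \<open>With a Lebesgue number, finitely many small compact balls cover even a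
    concentric ball of radius larger than \<open>s\<close>.\<close>
  obtain e where e: "e > 0" "\<And>y. y \<in> mcball x s \<Longrightarrow> \<exists>U\<in>\<C>. mball y e \<subseteq> U"
    using lebesgue_number[OF cs cov] unfolding \<C>_def by blast
  have "mtotally_bounded (mcball x s)" using compactin_imp_mtotally_bounded[OF cs] .
  then obtain K where K: "finite K" "K \<subseteq> mcball x s" "mcball x s \<subseteq> (\<Union>k\<in>K. mball k (e / 2))"
    unfolding mtotally_bounded_def using e by (metis half_gt_zero)
  have "\<forall>k\<in>K. \<exists>y\<in>S. mball k e \<subseteq> mball y (r y)" using K(2) e(2) unfolding \<C>_def by blast
  then obtain h where h: "\<And>k. k \<in> K \<Longrightarrow> h k \<in> S" "\<And>k. k \<in> K \<Longrightarrow> mball k e \<subseteq> mball (h k) (r (h k))" by metis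
  have "compactin mtopology (\<Union>k\<in>K. mcball (h k) (r (h k)))"
    by (rule compactin_Union) (use K(1) h r in auto)
  moreover have "mcball x (s + e / 4) \<subseteq> (\<Union>k\<in>K. mcball (h k) (r (h k)))"
  proof
    fix y assume "y \<in> mcball x (s + e / 4)"
    then have y: "y \<in> S" "d x y \<le> s + e / 4" by auto
    obtain m where m: "m \<in> S" "d x m = min (d x y) s" "d m y < d x y - min (d x y) s + e / 4"
      using between_point[OF x y(1), of "min (d x y) s" "e / 4"] s0 e nonneg by auto
    then have "m \<in> mcball x s" using x by simp
    then obtain k where k: "k \<in> K" "m \<in> mball k (e / 2)" using K(3) by blast
    have "d x y - min (d x y) s \<le> e / 4" using y e by auto
    then have "d k y < e" using k(2) triangle[of k m y] y m by simp
    then have "y \<in> mball k e" using k y by simp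
    then have "y \<in> mball (h k) (r (h k))" using h(2)[OF k(1)] by blast
    then show "y \<in> (\<Union>k\<in>K. mcball (h k) (r (h k)))" using k(1) mball_subset_mcball by blast
  qed
  ultimately have "compactin mtopology (mcball x (s + e / 4))" using closed_compactin closedin_mcball by blast
  then have "s + e / 4 \<in> A" using s0 e by (simp add: A_def)
  then show False using su[of "s + e / 4"] e by simp
qed


lemma Lipschitz_continuous_on:
  fixes c :: "real \<Rightarrow> 'a"
  assumes "\<And>t. t \<in> A \<Longrightarrow> c t \<in> S" "\<And>s t. s \<in> A \<Longrightarrow> t \<in> A \<Longrightarrow> d (c s) (c t) \<le> R * \<bar>s - t\<bar>"
  shows "continuous_on A c"
proof (rule continuous_on_sequentiallyI)
  fix u :: "nat \<Rightarrow> real" and a assume u: "\<forall>n. u n \<in> A" "a \<in> A" "u \<longlonglongrightarrow> a"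
  have z: "(\<lambda>n. R * \<bar>u n - a\<bar>) \<longlonglongrightarrow> 0"
    using u(3) by (auto intro!: tendsto_eq_intros simp: LIM_zero)
  have "(\<lambda>n. d (c (u n)) (c a)) \<longlonglongrightarrow> 0"
    by (rule Lim_null_comparison[OF _ z]) (use assms(2) u in \<open>simp add: always_eventually\<close>)
  then show "(\<lambda>n. c (u n)) \<longlonglongrightarrow> c a" using tendsto_iff_metric[of "c a" "\<lambda>n. c (u n)"] assms(1) u by simp
qed

end

section \<open>The interior of the universal cover\<close>

locale interior_structure = surface_cover Sg C p + hyperbolic_metric "surface_interior Sg" d
  for Sg :: "'a::metric_space set" and C p d
begin

definition D :: "complex set" where "D = C - dC"

text \<open>The substitute for being non-peripheral: \<open>g\<close> stabilises no boundary
  line.\<close>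

definition free_of_boundary :: "(complex \<Rightarrow> complex) \<Rightarrow> bool" where
  "free_of_boundary g \<longleftrightarrow> (\<forall>M M'. bline M M' \<longrightarrow> (\<exists>x\<in>C. \<not> (hV (M (g x)) = 0 \<longleftrightarrow> hV (M x) = 0)))"

lemma D_iff: "z \<in> D \<longleftrightarrow> z \<in> C \<and> p z \<in> surface_interior Sg"
  using p_Sg by (auto simp: D_def dC_def surface_interior_def)

lemma D_C: "z \<in> D \<Longrightarrow> z \<in> C" and D_uhp: "z \<in> D \<Longrightarrow> z \<in> uhp" and D_S: "z \<in> D \<Longrightarrow> p z \<in> surface_interior Sg"
  using D_iff C_uhpD by auto

lemma deck_D: "g \<in> Deck \<Longrightarrow> z \<in> D \<Longrightarrow> g z \<in> D"
  using D_iff deck_C deck_p by simp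

text \<open>A segment of \<open>C\<close> that touches a boundary line at an inner point runs along
  it, end points included.\<close>

lemma hyp_convex_D: "hyp_convex D"
  unfolding hyp_convex_def
proof (intro conjI ballI impI)
  show "D \<subseteq> uhp" using D_uhp by blast
  fix u v z assume uv: "u \<in> D" "v \<in> D" and z: "z \<in> uhp" "hdist u z + hdist z v = hdist u v"
  have zC: "z \<in> C" using hyp_convexD(2)[OF conv D_C[OF uv(1)] D_C[OF uv(2)] z] .
  show "z \<in> D"
  proof (rule ccontr)
    assume "z \<notin> D"
    then have zd: "z \<in> dC" using zC by (simp add: D_def)
    have ne: "u \<noteq> z" "v \<noteq> z" using uv zd by (auto simp: D_def)
    obtain k where k: "k \<in> unit_geodesics uhp" "k 0 = u" "k (hdist u v) = v"
      using geodesic_through[OF D_uhp[OF uv(1)] D_uhp[OF uv(2)]] .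
    have ku: "k t \<in> uhp" and kd: "hdist (k t) (k t') = \<bar>t - t'\<bar>" for t t' using k(1) by (auto simp: unit_geodesics_def)
    define s where "s = hdist u z"
    have s: "s > 0" "s < hdist u v"
      using ne hdist_eq_0_iff[of u z] hdist_eq_0_iff[of z v] hdist_nonneg[of u z] hdist_nonneg[of z v] uv D_uhp z
      by (auto simp: s_def less_le)
    have ks: "k s = z"
      using between_unique[of u z "k s" v] kd[of 0 s] kd[of s "hdist u v"] k s uv D_uhp ku z by (simp add: s_def)
    obtain r M M' where M: "bline M M'" "M z = \<i>" using boundary_line[OF zd] by metis
    have "hV (M (k 0)) = 0"
    proof (rule hlin_geodesic_nonneg_zero[OF hlin_comp[OF blineD(1)[OF M(1)] hlin_coords(2)] k(1), of s "min s (hdist u v - s)"])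
      show "hV (M (k s)) = 0" using ks M(2) by simp
      fix t assume "\<bar>t - s\<bar> < min s (hdist u v - s)"
      then have "0 \<le> t" "t \<le> hdist u v" by auto
      then have "k t \<in> C" using hyp_convex_geodesic[OF conv k(1), of 0 "hdist u v" t] k uv D_C by simp
      then show "hV (M (k t)) \<ge> 0" using blineD(2)[OF M(1)] by blast
    qed (use s in auto)
    then have "u \<in> dC" using bline_dC[OF M(1) D_C[OF uv(1)]] k(2) by simp
    then show False using uv by (simp add: D_def)
  qed
qed

lemma connected_D: "connected D"
proof (rule path_connected_imp_connected)
  show "path_connected D"
    unfolding path_connected_def
  proof (intro ballI)
    fix u v assume uv: "u \<in> D" "v \<in> D"
    have "continuous_on {0..1} (\<lambda>t. hmix t u v)" using uv D_uhp by (intro continuous_intros) auto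
    then show "\<exists>g. path g \<and> path_image g \<subseteq> D \<and> pathstart g = u \<and> pathfinish g = v"
      using uv D_uhp hyp_convex_hmix[OF hyp_convex_D uv]
      by (intro exI[of _ "\<lambda>t. hmix t u v"])
         (auto simp: path_def path_image_def pathstart_def pathfinish_def hmix_0 hmix_1)
  qed
qed


section \<open>Lipschitz paths\<close>

text \<open>Up to reparametrisation, \<open>reach u v A\<close> says that a path of \<open>d\<close>-length at most \<open>A\<close> joins the
  images of \<open>u\<close> and \<open>v\<close> in the homotopy class given by the cover.\<close>

definition reach :: "complex \<Rightarrow> complex \<Rightarrow> real \<Rightarrow> bool" where
  "reach u v A \<longleftrightarrow> (\<exists>\<sigma>. continuous_on {0..1} \<sigma> \<and> \<sigma> \<in> {0..1} \<rightarrow> D \<and> \<sigma> 0 = u \<and> \<sigma> 1 = v \<and>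
     (\<forall>a\<in>{0..1}. \<forall>b\<in>{0..1}. d (p (\<sigma> a)) (p (\<sigma> b)) \<le> A * \<bar>a - b\<bar>))"

lemma reachE:
  assumes "reach u v A"
  obtains \<sigma> :: "real \<Rightarrow> complex" where "continuous_on {0..1} \<sigma>" "\<And>a. a \<in> {0..1} \<Longrightarrow> \<sigma> a \<in> D" "\<sigma> 0 = u" "\<sigma> 1 = v"
    "\<And>a b. a \<in> {0..1} \<Longrightarrow> b \<in> {0..1} \<Longrightarrow> d (p (\<sigma> a)) (p (\<sigma> b)) \<le> A * \<bar>a - b\<bar>"
  using assms that unfolding reach_def by blast

lemma reach_D:
  assumes "reach u v A"
  shows "u \<in> D" "v \<in> D"
proof -
  obtain \<sigma> :: "real \<Rightarrow> complex" where "\<And>a. a \<in> {0..1} \<Longrightarrow> \<sigma> a \<in> D" "\<sigma> 0 = u" "\<sigma> 1 = v"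
    using reachE[OF assms] by blast
  from this(1)[of 0] this(1)[of 1] this(2,3) show "u \<in> D" "v \<in> D" by simp_all
qed

lemma reach_dist:
  assumes "reach u v A"
  shows "d (p u) (p v) \<le> A"
proof -
  obtain \<sigma> :: "real \<Rightarrow> complex" where "\<sigma> 0 = u" "\<sigma> 1 = v"
    "\<And>a b. a \<in> {0..1} \<Longrightarrow> b \<in> {0..1} \<Longrightarrow> d (p (\<sigma> a)) (p (\<sigma> b)) \<le> A * \<bar>a - b\<bar>"
    using reachE[OF assms] by blast
  from this(3)[of 0 1] this(1,2) show ?thesis by simp
qed

lemma reach_restrict:
  assumes "continuous_on {a..b} \<sigma>" "\<And>t. t \<in> {a..b} \<Longrightarrow> \<sigma> t \<in> D" "a \<le> b"
    and "\<And>s t. s \<in> {a..b} \<Longrightarrow> t \<in> {a..b} \<Longrightarrow> d (p (\<sigma> s)) (p (\<sigma> t)) \<le> R * \<bar>s - t\<bar>"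
  shows "reach (\<sigma> a) (\<sigma> b) (R * (b - a))"
proof -
  define f where "f t = a + (b - a) * t" for t
  have f: "f t \<in> {a..b}" if "t \<in> {0..1}" for t
    using that assms(3) mult_left_mono[of t 1 "b - a"] by (auto simp: f_def)
  have "d (p (\<sigma> (f s))) (p (\<sigma> (f t))) \<le> R * (b - a) * \<bar>s - t\<bar>" if "s \<in> {0..1}" "t \<in> {0..1}" for s t
  proof -
    have "\<bar>f s - f t\<bar> = (b - a) * \<bar>s - t\<bar>" using assms(3) by (simp add: f_def abs_mult flip: right_diff_distrib)
    then show ?thesis using assms(4)[OF f f, OF that] by (simp add: mult.assoc)
  qed
  moreover have "continuous_on {0..1} (\<lambda>t. \<sigma> (f t))"
    by (rule continuous_on_compose2[OF assms(1)]) (use f in \<open>auto intro!: continuous_intros simp: f_def\<close>)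
  ultimately show ?thesis
    unfolding reach_def using f assms(2) by (intro exI[of _ "\<lambda>t. \<sigma> (f t)"]) (auto simp: f_def)
qed

lemma reach_mono:
  assumes "reach u v A" "A \<le> B"
  shows "reach u v B"
proof -
  obtain \<sigma> where s: "continuous_on {0..1} \<sigma>" "\<And>a. a \<in> {0..1} \<Longrightarrow> \<sigma> a \<in> D" "\<sigma> 0 = u" "\<sigma> 1 = v"
    "\<And>a b. a \<in> {0..1} \<Longrightarrow> b \<in> {0..1} \<Longrightarrow> d (p (\<sigma> a)) (p (\<sigma> b)) \<le> A * \<bar>a - b\<bar>" using reachE[OF assms(1)] by blast
  have "d (p (\<sigma> a)) (p (\<sigma> b)) \<le> B * \<bar>a - b\<bar>" if "a \<in> {0..1}" "b \<in> {0..1}" for a b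
    using s(5)[OF that] mult_right_mono[OF assms(2) abs_ge_zero[of "a - b"]] by simp
  then show ?thesis unfolding reach_def using s(1-4) by (intro exI[of _ \<sigma>]) auto
qed

lemma reach_sym:
  assumes "reach u v A"
  shows "reach v u A"
proof -
  obtain \<sigma> where s: "continuous_on {0..1} \<sigma>" "\<And>a. a \<in> {0..1} \<Longrightarrow> \<sigma> a \<in> D" "\<sigma> 0 = u" "\<sigma> 1 = v"
    "\<And>a b. a \<in> {0..1} \<Longrightarrow> b \<in> {0..1} \<Longrightarrow> d (p (\<sigma> a)) (p (\<sigma> b)) \<le> A * \<bar>a - b\<bar>" using reachE[OF assms(1)] by blast
  have "continuous_on {0..1} (\<lambda>t. \<sigma> (1 - t))"
    by (rule continuous_on_compose2[OF s(1)]) (auto intro!: continuous_intros)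
  moreover have "d (p (\<sigma> (1 - a))) (p (\<sigma> (1 - b))) \<le> A * \<bar>a - b\<bar>" if "a \<in> {0..1}" "b \<in> {0..1}" for a b
    using s(5)[of "1 - a" "1 - b"] that abs_minus_commute[of a b] by simp
  ultimately show ?thesis unfolding reach_def using s(2-4) by (intro exI[of _ "\<lambda>t. \<sigma> (1 - t)"]) auto
qed

lemma reach_deck:
  assumes "reach u v A" "g \<in> Deck"
  shows "reach (g u) (g v) A"
proof -
  obtain \<sigma> where s: "continuous_on {0..1} \<sigma>" "\<And>a. a \<in> {0..1} \<Longrightarrow> \<sigma> a \<in> D" "\<sigma> 0 = u" "\<sigma> 1 = v"
    "\<And>a b. a \<in> {0..1} \<Longrightarrow> b \<in> {0..1} \<Longrightarrow> d (p (\<sigma> a)) (p (\<sigma> b)) \<le> A * \<bar>a - b\<bar>" using reachE[OF assms(1)] by blast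
  have "continuous_on {0..1} (\<lambda>t. g (\<sigma> t))"
    by (rule continuous_on_compose2[OF deck_cont[OF assms(2)] s(1)]) (use s(2) D_C in auto)
  then show ?thesis unfolding reach_def using s(2-5) deck_D[OF assms(2)] deck_p[OF assms(2)] D_C
    by (intro exI[of _ "\<lambda>t. g (\<sigma> t)"]) auto
qed

text \<open>A path that is short for \<open>d\<close> stays close to \<open>p z\<close> for
  \<open>dist\<close>, because the topologies agree; by \<open>close_lifts\<close> its lift stays
  close to \<open>z\<close>.\<close>

lemma reach_hdist:
  assumes "z \<in> D" "r > 0"
  shows "\<exists>a>0. \<forall>u A. reach z u A \<longrightarrow> A < a \<longrightarrow> hdist z u < r"
proof -
  have "0 < min (\<rho> / 2) (r / 2)" using \<rho>(1) assms(2) by simp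
  then obtain \<eta> where \<eta>: "\<eta> > 0" "\<And>y. y \<in> surface_interior Sg \<Longrightarrow> d (p z) y < \<eta> \<Longrightarrow> dist (p z) y < min (\<rho> / 2) (r / 2)"
    using uniform_equivalence(1)[of "{p z}"] D_S[OF assms(1)] by (metis compact_insert compact_empty empty_subsetI insert_subset singletonI)
  have "hdist z u < r" if u: "reach z u A" "A < \<eta>" for u A
  proof -
    obtain \<sigma> where s: "continuous_on {0..1} \<sigma>" "\<And>a. a \<in> {0..1} \<Longrightarrow> \<sigma> a \<in> D" "\<sigma> 0 = z" "\<sigma> 1 = u"
      "\<And>a b. a \<in> {0..1} \<Longrightarrow> b \<in> {0..1} \<Longrightarrow> d (p (\<sigma> a)) (p (\<sigma> b)) \<le> A * \<bar>a - b\<bar>" using reachE[OF u(1)] by blast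
    have "d (p (\<sigma> 0)) (p (\<sigma> 1)) \<le> A" using s(5)[of 0 1] by simp
    then have A0: "A \<ge> 0" by (rule order_trans[OF nonneg])
    have "hdist z (\<sigma> 1) \<le> min (\<rho> / 2) (r / 2)"
    proof (rule close_lifts[of "\<lambda>_. z" \<sigma>])
      show "dist (p z) (p (\<sigma> t)) \<le> min (\<rho> / 2) (r / 2)" if t: "t \<in> {0..1}" for t
      proof -
        have "d (p z) (p (\<sigma> t)) \<le> A * t" using s(5)[of 0 t] t s(3) by simp
        also have "\<dots> \<le> A" using A0 t mult_left_mono[of t 1 A] by simp
        finally show ?thesis using \<eta>(2)[OF D_S[OF s(2)[OF t]]] u(2) by simp
      qed
    qed (use s D_C D_uhp assms \<rho>(1) in auto)
    then show ?thesis using s(4) assms(2) by simp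
  qed
  then show ?thesis using \<eta>(1) by blast
qed

lemma reach_0: "reach u v 0 \<Longrightarrow> u = v"
proof (rule ccontr)
  assume r: "reach u v 0" and ne: "u \<noteq> v"
  note uv = reach_D[OF r]
  have "hdist u v > 0" using ne hdist_eq_0_iff[of u v] hdist_nonneg[of u v] uv D_uhp by (simp add: less_le)
  then show False using reach_hdist[OF uv(1), of "hdist u v"] r by blast
qed

lemma reach_nonneg: "reach u v A \<Longrightarrow> A \<ge> 0"
  using reach_dist nonneg order_trans by blast

lemma reach_trans:
  assumes "reach u v A" "reach v w B"
  shows "reach u w (A + B)"
proof -
  \<comment> \<open>The concatenation spends time \<open>A\<close> on the first path and
    \<open>B\<close> on the second, which makes it 1-Lipschitz; a path of length 0 is
    constant.\<close>
  consider "A = 0" | "B = 0" | "A > 0" "B > 0" using reach_nonneg[OF assms(1)] reach_nonneg[OF assms(2)] by linarith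
  then show ?thesis
  proof cases
    case 3
    obtain \<sigma> where s: "continuous_on {0..1} \<sigma>" "\<And>a. a \<in> {0..1} \<Longrightarrow> \<sigma> a \<in> D" "\<sigma> 0 = u" "\<sigma> 1 = v"
      "\<And>a b. a \<in> {0..1} \<Longrightarrow> b \<in> {0..1} \<Longrightarrow> d (p (\<sigma> a)) (p (\<sigma> b)) \<le> A * \<bar>a - b\<bar>" using reachE[OF assms(1)] by blast
    obtain \<tau> where t: "continuous_on {0..1} \<tau>" "\<And>a. a \<in> {0..1} \<Longrightarrow> \<tau> a \<in> D" "\<tau> 0 = v" "\<tau> 1 = w"
      "\<And>a b. a \<in> {0..1} \<Longrightarrow> b \<in> {0..1} \<Longrightarrow> d (p (\<tau> a)) (p (\<tau> b)) \<le> B * \<bar>a - b\<bar>" using reachE[OF assms(2)] by blast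
    define f where "f x = (if x \<le> A then \<sigma> (x / A) else \<tau> ((x - A) / B))" for x
    have i1: "x / A \<in> {0..1}" if "0 \<le> x" "x \<le> A" for x using that 3 by simp
    have i2: "(x - A) / B \<in> {0..1}" if "A \<le> x" "x \<le> A + B" for x using that 3 by simp
    have f2: "f x = \<tau> ((x - A) / B)" if "A \<le> x" for x using that 3 s(4) t(3) by (auto simp: f_def)
    have fD: "f x \<in> D" if "x \<in> {0..A + B}" for x
      using that s(2)[OF i1] t(2)[OF i2] by (auto simp: f_def)
    have "continuous_on ({0..A} \<union> {A..A+B}) f"
      unfolding f_def
    proof (rule continuous_on_cases)
      show "continuous_on {0..A} (\<lambda>x. \<sigma> (x / A))"
        by (rule continuous_on_compose2[OF s(1)]) (use 3 in \<open>auto intro!: continuous_intros\<close>)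
      show "continuous_on {A..A+B} (\<lambda>x. \<tau> ((x - A) / B))"
        by (rule continuous_on_compose2[OF t(1)]) (use 3 in \<open>auto intro!: continuous_intros\<close>)
    qed (use 3 s(4) t(3) in auto)
    moreover have "{0..A} \<union> {A..A+B} = {0..A+B}" using 3 by auto
    ultimately have cf: "continuous_on {0..A+B} f" by simp
    have l1: "d (p (f x)) (p (f y)) \<le> y - x" if "0 \<le> x" "x \<le> y" "y \<le> A" for x y
    proof -
      have "d (p (f x)) (p (f y)) \<le> A * \<bar>x / A - y / A\<bar>" using s(5)[OF i1 i1] that by (simp add: f_def)
      also have "\<dots> = y - x" using 3 that by (simp add: abs_if field_simps flip: diff_divide_distrib)
      finally show ?thesis .
    qed
    have l2: "d (p (f x)) (p (f y)) \<le> y - x" if "A \<le> x" "x \<le> y" "y \<le> A + B" for x y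
    proof -
      have "d (p (f x)) (p (f y)) \<le> B * \<bar>(x - A) / B - (y - A) / B\<bar>" using t(5)[OF i2 i2] that by (simp add: f2)
      also have "\<dots> = y - x" using 3 that by (simp add: abs_if field_simps flip: diff_divide_distrib)
      finally show ?thesis .
    qed
    have l3: "d (p (f x)) (p (f y)) \<le> y - x" if "0 \<le> x" "x \<le> y" "y \<le> A + B" for x y
    proof -
      consider "y \<le> A" | "A \<le> x" | "x \<le> A" "A \<le> y" by linarith
      then show ?thesis
      proof cases
        case 3
        have "d (p (f x)) (p (f y)) \<le> d (p (f x)) (p (f A)) + d (p (f A)) (p (f y))"
          using fD that 3 by (intro triangle D_S) auto
        then show ?thesis using l1[of x A] l2[of A y] that 3 by simp
      qed (use l1 l2 that in auto)
    qed
    have "reach (f 0) (f (A + B)) (1 * (A + B - 0))"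
    proof (rule reach_restrict[OF cf fD])
      fix x y assume xy: "x \<in> {0..A+B}" "y \<in> {0..A+B}"
      show "d (p (f x)) (p (f y)) \<le> 1 * \<bar>x - y\<bar>"
        using l3[of x y] l3[of y x] xy commute[of "p (f x)" "p (f y)"] by (cases "x \<le> y") auto
    qed (use 3 in auto)
    moreover have "f 0 = u" "f (A + B) = w" using 3 s t by (auto simp: f_def)
    ultimately show ?thesis by simp
  qed (use reach_0 assms in auto)
qed

text \<open>A chart for \<open>d\<close> supplies the segment between the images and
  \<open>p\<close> lifts it; the end of the lift is \<open>w\<close> because fibres are separated.
  The two metrics are compared through their common topology.\<close>

lemma reach_local:
  assumes z: "z \<in> D"
  shows "\<exists>r>0. \<forall>u\<in>D. \<forall>w\<in>D. hdist z u < r \<longrightarrow> hdist z w < r \<longrightarrow> reach u w (d (p u) (p w))"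
proof -
  note x = D_S[OF z]
  obtain r1 where r1: "r1 > 0" "\<forall>y\<in>surface_interior Sg. \<forall>y'\<in>surface_interior Sg. d (p z) y < r1 \<longrightarrow> d (p z) y' < r1 \<longrightarrow>
    (\<exists>s. s 0 = y \<and> s 1 = y' \<and> (\<forall>a\<in>{0..1}. s a \<in> surface_interior Sg) \<and> (\<forall>a\<in>{0..1}. \<forall>b\<in>{0..1}. d (s a) (s b) = d y y' * \<bar>a - b\<bar>))"
    using chart_segment[OF x] by (elim exE conjE)
  have Q: "compact {p z}" "{p z} \<subseteq> surface_interior Sg" using x by auto
  have "\<rho> / 4 > 0" using \<rho>(1) by simp
  then obtain \<eta> where \<eta>: "\<eta> > 0" "\<And>y. y \<in> surface_interior Sg \<Longrightarrow> d (p z) y < \<eta> \<Longrightarrow> dist (p z) y < \<rho> / 4"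
    using uniform_equivalence(1)[OF Q] by (metis singletonI)
  \<comment> \<open>A third of \<open>\<eta>\<close> keeps the whole segment, of length below
    \<open>2 * \<eta> / 3\<close>, within \<open>\<eta>\<close> of \<open>p z\<close>.\<close>
  have "min r1 (\<eta> / 3) > 0" using r1(1) \<eta>(1) by simp
  then obtain \<eta>' where \<eta>': "\<eta>' > 0" "\<And>y. y \<in> surface_interior Sg \<Longrightarrow> dist (p z) y < \<eta>' \<Longrightarrow> d (p z) y < min r1 (\<eta> / 3)"
    using uniform_equivalence(2)[OF Q] by (metis singletonI)
  define r where "r = min (\<rho> / 4) \<eta>'"
  have near: "d (p z) (p u) < min r1 (\<eta> / 3)" if "u \<in> D" "hdist z u < r" for u
  proof -
    have "dist (p z) (p u) = hdist z u" using \<rho>(2)[of z u] that z D_C \<rho>(1) by (simp add: r_def)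
    then show ?thesis using \<eta>'(2)[OF D_S[OF that(1)]] that(2) by (simp add: r_def)
  qed
  have "reach u w (d (p u) (p w))" if u: "u \<in> D" "hdist z u < r" and w: "w \<in> D" "hdist z w < r" for u w
  proof -
    have nu: "d (p z) (p u) < r1" "d (p z) (p u) < \<eta> / 3" and nw: "d (p z) (p w) < r1" "d (p z) (p w) < \<eta> / 3"
      using near[OF u] near[OF w] by auto
    obtain s where s: "s 0 = p u" "s 1 = p w" "\<And>a. a\<in>{0..1} \<Longrightarrow> s a \<in> surface_interior Sg"
      "\<And>a b. a\<in>{0..1} \<Longrightarrow> b\<in>{0..1} \<Longrightarrow> d (s a) (s b) = d (p u) (p w) * \<bar>a - b\<bar>"
      using mp[OF mp[OF bspec[OF bspec[OF r1(2) D_S[OF u(1)]] D_S[OF w(1)]] nu(1)] nw(1)] by blast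
    have "continuous_on {0..1} s"
      by (rule Lipschitz_continuous_on[of _ _ "d (p u) (p w)"]) (use s in auto)
    then have ps: "path s" "path_image s \<subseteq> Sg" using s(3) by (auto simp: path_def path_image_def surface_interior_def)
    obtain h where h: "path h" "path_image h \<subseteq> C" "h 0 = u" "\<And>t. t \<in> {0..1} \<Longrightarrow> p (h t) = s t"
      using metric_covering_lift_path[OF cov D_C[OF u(1)] ps s(1)] by blast
    have hC: "h t \<in> C" if "t \<in> {0..1}" for t using h(2) that by (auto simp: path_image_def)
    have duw: "d (p u) (p w) < 2 * \<eta> / 3"
      using triangle[OF D_S[OF u(1)] x D_S[OF w(1)]] nu nw commute[of "p u" "p z"] by simp
    have xs: "dist (p z) (s a) < \<rho> / 4" if a: "a \<in> {0..1}" for a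
    proof -
      have "d (p z) (s a) \<le> d (p z) (p u) + d (s 0) (s a)" using triangle[OF x D_S[OF u(1)] s(3)[OF a]] s(1) by simp
      also have "d (s 0) (s a) \<le> d (p u) (p w)" using s(4)[of 0 a] a mult_left_mono[of a 1 "d (p u) (p w)"] nonneg by simp
      finally show ?thesis using duw nu(2) \<eta>(2)[OF s(3)[OF a]] by simp
    qed
    have "hdist u (h 1) \<le> \<rho> / 2"
    proof (rule close_lifts[of "\<lambda>_. u" h])
      show "dist (p u) (p (h t)) \<le> \<rho> / 2" if t: "t \<in> {0..1}" for t
        using xs[of 0] xs[OF t] s(1) h(4)[OF t] dist_triangle3[of "p u" "s t" "p z"] by simp
    qed (use h hC u D_C D_uhp \<rho>(1) in \<open>auto simp: path_def\<close>)
    moreover have "hdist u w < \<rho> / 2"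
      using hdist_triangle[of u z w] hdist_commute[of u z] u w z D_uhp by (simp add: r_def)
    moreover have "hdist (h 1) w \<le> hdist u (h 1) + hdist u w"
      using hdist_triangle[of "h 1" u w] hdist_commute[of "h 1" u] hC[of 1] u w D_uhp C_uhpD by simp
    ultimately have "hdist (h 1) w < \<rho>" by simp
    then have "h 1 = w" using fibre_separated[OF hC D_C[OF w(1)]] h(4)[of 1] s(2) by simp
    moreover have "h t \<in> D" if "t \<in> {0..1}" for t using hC[OF that] s(3)[OF that] h(4)[OF that] by (simp add: D_iff)
    ultimately show ?thesis
      unfolding reach_def using h s(4) by (intro exI[of _ h]) (auto simp: path_def)
  qed
  moreover have "r > 0" using \<rho>(1) \<eta>'(1) by (simp add: r_def)
  ultimately show ?thesis by blast
qed

lemma reach_exists: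
  assumes "u \<in> D" "v \<in> D"
  shows "\<exists>A. reach u v A"
proof (rule connected_equivalence_relation[OF connected_D assms, where R = "\<lambda>u v. \<exists>A. reach u v A"])
  fix z assume z: "z \<in> D"
  obtain r where r: "r > 0" "\<forall>u\<in>D. \<forall>w\<in>D. hdist z u < r \<longrightarrow> hdist z w < r \<longrightarrow> reach u w (d (p u) (p w))"
    using reach_local[OF z] by blast
  have "openin (top_of_set D) {w\<in>D. hdist z w < r}"
    using openin_hball[OF hyp_convexD(1)[OF hyp_convex_D] D_uhp[OF z]] .
  moreover have "z \<in> {w\<in>D. hdist z w < r}" using z r(1) D_uhp by simp
  moreover have "\<exists>A. reach z w A" if "w \<in> {w\<in>D. hdist z w < r}" for w
  proof -
    have "w \<in> D" "hdist z w < r" "hdist z z < r" using that r(1) D_uhp[OF z] by simp_all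
    then show ?thesis using r(2) z by blast
  qed
  ultimately show "\<exists>T. openin (top_of_set D) T \<and> z \<in> T \<and> (\<forall>x\<in>T. \<exists>A. reach z x A)" by blast
qed (use reach_sym reach_trans in blast)+


section \<open>Loops outside a collar of the boundary\<close>

text \<open>A path inside the collar would give an invariant line. Hence some point of it has
  distance at least \<open>e\<close> from the boundary, and such points of \<open>Sg\<close> form a
  compact set.\<close>

lemma compact_core:
  obtains K where "compact K" "K \<subseteq> surface_interior Sg"
    "\<And>g \<sigma>. g \<in> Deck \<Longrightarrow> free_of_boundary g \<Longrightarrow> continuous_on {0..1} \<sigma> \<Longrightarrow> \<sigma> \<in> {0..1::real} \<rightarrow> C \<Longrightarrow> \<sigma> 1 = g (\<sigma> 0) \<Longrightarrow>
      \<exists>t\<in>{0..1}. p (\<sigma> t) \<in> K"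
proof -
  obtain \<delta> where \<delta>: "\<delta> > 0" "\<And>g \<sigma>. g \<in> Deck \<Longrightarrow> continuous_on {0..1} \<sigma> \<Longrightarrow> \<sigma> \<in> {0..1::real} \<rightarrow> C \<Longrightarrow> \<sigma> 1 = g (\<sigma> 0) \<Longrightarrow>
      (\<And>t. t \<in> {0..1} \<Longrightarrow> \<exists>w\<in>dC. hdist (\<sigma> t) w < \<delta>) \<Longrightarrow>
      \<exists>M M'. bline M M' \<and> (\<forall>x\<in>C. hV (M (g x)) = 0 \<longleftrightarrow> hV (M x) = 0)" using collar by blast
  define e where "e = min \<delta> \<rho>"
  have e: "e > 0" using \<delta>(1) \<rho>(1) by (simp add: e_def)
  define K where "K = Sg \<inter> (\<Inter>y\<in>surface_boundary Sg. {x. e \<le> dist x y})"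
  have "closed {x. e \<le> dist x y}" for y :: 'a by (intro closed_Collect_le continuous_intros)
  then have "compact K" unfolding K_def by (intro compact_Int_closed[OF comp] closed_INT) auto
  moreover have "K \<subseteq> surface_interior Sg"
  proof
    fix x assume x: "x \<in> K"
    have "x \<notin> surface_boundary Sg"
    proof
      assume "x \<in> surface_boundary Sg"
      then have "e \<le> dist x x" using x unfolding K_def by blast
      then show False using e by simp
    qed
    then show "x \<in> surface_interior Sg" using x by (simp add: K_def surface_interior_def)
  qed
  moreover have "\<exists>t\<in>{0..1}. p (\<sigma> t) \<in> K" if g: "g \<in> Deck" "free_of_boundary g"
    and s: "continuous_on {0..1} \<sigma>" "\<sigma> \<in> {0..1::real} \<rightarrow> C" "\<sigma> 1 = g (\<sigma> 0)" for g \<sigma>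
  proof (rule ccontr)
    assume n: "\<not> (\<exists>t\<in>{0..1}. p (\<sigma> t) \<in> K)"
    have "\<exists>w\<in>dC. hdist (\<sigma> t) w < \<delta>" if t: "t \<in> {0..1}" for t
    proof -
      have st: "\<sigma> t \<in> C" using s(2) t by auto
      obtain y where y: "y \<in> surface_boundary Sg" "dist (p (\<sigma> t)) y < e"
        using n t p_Sg[OF st] by (auto simp: K_def not_le)
      then have "y \<in> Sg" by (simp add: surface_boundary_def)
      then obtain v where "v \<in> C" "p v = y" "hdist (\<sigma> t) v = dist (p (\<sigma> t)) y"
        using near_lift[OF st, of y] y(2) by (auto simp: e_def)
      then show ?thesis using y by (intro bexI[of _ v]) (auto simp: dC_def e_def)
    qed
    then obtain M M' where "bline M M'" "\<forall>x\<in>C. hV (M (g x)) = 0 \<longleftrightarrow> hV (M x) = 0" using \<delta>(2)[OF g(1) s] by blast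
    then show False using g(2) unfolding free_of_boundary_def by blast
  qed
  ultimately show ?thesis using that by blast
qed

text \<open>Each such loop meets the compact core and has bounded length, so it stays in one closed
  ball for \<open>d\<close>, which is compact by \<open>compact_mcball\<close>.\<close>

lemma reach_compact:
  obtains Q where "compact Q" "Q \<subseteq> surface_interior Sg"
    "\<And>g \<sigma> t. g \<in> Deck \<Longrightarrow> free_of_boundary g \<Longrightarrow> continuous_on {0..1} \<sigma> \<Longrightarrow> (\<And>a. a \<in> {0..1} \<Longrightarrow> \<sigma> a \<in> D) \<Longrightarrow> \<sigma> 1 = g (\<sigma> 0) \<Longrightarrow>
      (\<And>a b. a \<in> {0..1} \<Longrightarrow> b \<in> {0..1} \<Longrightarrow> d (p (\<sigma> a)) (p (\<sigma> b)) \<le> A * \<bar>a - b\<bar>) \<Longrightarrow> t \<in> {0..1::real} \<Longrightarrow> p (\<sigma> t) \<in> Q"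
proof -
  obtain K where K: "compact K" "K \<subseteq> surface_interior Sg"
    "\<And>g \<sigma>. g \<in> Deck \<Longrightarrow> free_of_boundary g \<Longrightarrow> continuous_on {0..1} \<sigma> \<Longrightarrow> \<sigma> \<in> {0..1::real} \<rightarrow> C \<Longrightarrow> \<sigma> 1 = g (\<sigma> 0) \<Longrightarrow>
      \<exists>t\<in>{0..1}. p (\<sigma> t) \<in> K" using compact_core by blast
  have "mbounded K" using compactin_imp_mbounded K compactin_iff_compact by blast
  then obtain x B where xB: "0 < B" "K \<subseteq> mcball x B" using mbounded_pos by blast
  show ?thesis
  proof (cases "x \<in> surface_interior Sg")
    \<comment> \<open>\<open>mbounded\<close> admits a centre outside the space; then the core is
      empty and no such loop exists.\<close>
    case False
    then have "K = {}" using xB by (auto simp: mcball_def)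
    show ?thesis
    proof (rule that[of "{}"])
      fix g and \<sigma> :: "real \<Rightarrow> complex"
      assume "g \<in> Deck" "free_of_boundary g" "continuous_on {0..1} \<sigma>" "\<And>a. a \<in> {0..1} \<Longrightarrow> \<sigma> a \<in> D" "\<sigma> 1 = g (\<sigma> 0)"
      then have "\<exists>t\<in>{0..1}. p (\<sigma> t) \<in> K" using D_C by (intro K(3)) auto
      then show "p (\<sigma> t) \<in> {}" for t :: real using \<open>K = {}\<close> by blast
    qed auto
  next
    case True
    define Q where "Q = mcball x (B + \<bar>A\<bar>)"
    have Qs: "Q \<subseteq> surface_interior Sg" unfolding Q_def by (rule mcball_subset_mspace)
    have "compact Q" using compact_mcball[OF True] compactin_iff_compact[OF Qs] by (simp add: Q_def)
    then show ?thesis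
    proof (rule that[OF _ Qs])
      fix g and t :: real and \<sigma> :: "real \<Rightarrow> complex"
      assume g: "g \<in> Deck" "free_of_boundary g" and s: "continuous_on {0..1} \<sigma>" "\<And>a. a \<in> {0..1} \<Longrightarrow> \<sigma> a \<in> D" "\<sigma> 1 = g (\<sigma> 0)"
        and l: "\<And>a b. a \<in> {0..1} \<Longrightarrow> b \<in> {0..1} \<Longrightarrow> d (p (\<sigma> a)) (p (\<sigma> b)) \<le> A * \<bar>a - b\<bar>" and t: "t \<in> {0..1}"
      have "\<exists>t\<in>{0..1}. p (\<sigma> t) \<in> K" using s D_C by (intro K(3)[OF g]) auto
      then obtain t' where t': "t' \<in> {0..1}" "p (\<sigma> t') \<in> K" by blast
      have "d x (p (\<sigma> t)) \<le> d x (p (\<sigma> t')) + d (p (\<sigma> t')) (p (\<sigma> t))" using True s(2) t t' by (intro triangle D_S) auto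
      also have "d x (p (\<sigma> t')) \<le> B" using t'(2) xB(2) by auto
      also have "d (p (\<sigma> t')) (p (\<sigma> t)) \<le> \<bar>A\<bar>"
      proof -
        have "A * \<bar>t' - t\<bar> \<le> \<bar>A\<bar> * 1" using t t' by (intro mult_mono) auto
        then show ?thesis using l[OF t'(1) t] by simp
      qed
      finally show "p (\<sigma> t) \<in> Q" using True D_S[OF s(2)[OF t]] by (simp add: Q_def)
    qed
  qed
qed

text \<open>The loop is cut into \<open>n\<close> pieces of length below \<open>\<eta>\<close>,
  where \<open>n\<close> depends on \<open>A\<close> only. Inside the compact set such a piece is
  short for \<open>dist\<close>, so its lift moves by at most \<open>\<rho> / 2\<close>.\<close>

lemma displacement_bound:
  obtains B where "\<And>g z. g \<in> Deck \<Longrightarrow> free_of_boundary g \<Longrightarrow> reach z (g z) A \<Longrightarrow> hdist z (g z) \<le> B"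
proof -
  obtain Q where Q: "compact Q" "Q \<subseteq> surface_interior Sg"
    "\<And>g \<sigma> t. g \<in> Deck \<Longrightarrow> free_of_boundary g \<Longrightarrow> continuous_on {0..1} \<sigma> \<Longrightarrow> (\<And>a. a \<in> {0..1} \<Longrightarrow> \<sigma> a \<in> D) \<Longrightarrow> \<sigma> 1 = g (\<sigma> 0) \<Longrightarrow>
      (\<And>a b. a \<in> {0..1} \<Longrightarrow> b \<in> {0..1} \<Longrightarrow> d (p (\<sigma> a)) (p (\<sigma> b)) \<le> A * \<bar>a - b\<bar>) \<Longrightarrow> t \<in> {0..1::real} \<Longrightarrow> p (\<sigma> t) \<in> Q"
    using reach_compact[of A] by blast
  have "\<rho> / 2 > 0" using \<rho>(1) by simp
  then obtain \<eta> where \<eta>: "\<eta> > 0" "\<And>x y. x \<in> Q \<Longrightarrow> y \<in> surface_interior Sg \<Longrightarrow> d x y < \<eta> \<Longrightarrow> dist x y < \<rho> / 2"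
    using uniform_equivalence(1)[OF Q(1,2)] by metis
  obtain N where N: "real N > A / \<eta>" using reals_Archimedean2 by blast
  define n where "n = Suc N"
  have n: "n > 0" "A / real n < \<eta>" using N \<eta>(1) by (auto simp: n_def field_simps)
  have "hdist z (g z) \<le> real n * (\<rho> / 2)" if g: "g \<in> Deck" "free_of_boundary g" "reach z (g z) A" for g z
  proof -
    obtain \<sigma> where s: "continuous_on {0..1} \<sigma>" "\<And>a. a \<in> {0..1} \<Longrightarrow> \<sigma> a \<in> D" "\<sigma> 0 = z" "\<sigma> 1 = g z"
      "\<And>a b. a \<in> {0..1} \<Longrightarrow> b \<in> {0..1} \<Longrightarrow> d (p (\<sigma> a)) (p (\<sigma> b)) \<le> A * \<bar>a - b\<bar>" using reachE[OF g(3)] by blast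
    have A0: "A \<ge> 0" using reach_nonneg[OF g(3)] .
    have sQ: "p (\<sigma> t) \<in> Q" if "t \<in> {0..1}" for t using Q(3)[OF g(1,2) s(1,2) _ s(5) that] s(3,4) by simp
    have step: "hdist (\<sigma> a) (\<sigma> b) \<le> \<rho> / 2" if a: "a \<in> {0..1}" "b \<in> {0..1}" "a \<le> b" "b - a \<le> 1 / real n" for a b
    proof -
      define f where "f t = a + (b - a) * t" for t
      have f: "f t \<in> {a..b}" if "t \<in> {0..1}" for t
        using that a mult_left_mono[of t 1 "b - a"] by (auto simp: f_def)
      have f1: "f t \<in> {0..1}" if "t \<in> {0..1}" for t using f[OF that] a by auto
      have "hdist (\<sigma> a) (\<sigma> (f 1)) \<le> \<rho> / 2"
      proof (rule close_lifts[of "\<lambda>_. \<sigma> a" "\<lambda>t. \<sigma> (f t)"])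
        show "continuous_on {0..1} (\<lambda>t. \<sigma> (f t))"
        proof (rule continuous_on_compose2[OF s(1)])
          show "continuous_on {0..1} f" unfolding f_def by (intro continuous_intros)
        qed (use f1 in blast)
        show "dist (p (\<sigma> a)) (p (\<sigma> (f t))) \<le> \<rho> / 2" if t: "t \<in> {0..1}" for t
        proof -
          have "d (p (\<sigma> a)) (p (\<sigma> (f t))) \<le> A * \<bar>a - f t\<bar>" by (rule s(5)[OF a(1) f1[OF t]])
          also have "\<dots> \<le> A * (1 / real n)" using f[OF t] a A0 by (intro mult_left_mono) auto
          also have "\<dots> < \<eta>" using n by simp
          finally show ?thesis using \<eta>(2)[OF sQ[OF a(1)] D_S[OF s(2)[OF f1[OF t]]]] by simp
        qed
      qed (use f1 s(2)[OF a(1)] s(2) D_C D_uhp \<rho>(1) in \<open>auto simp: f_def\<close>)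
      then show ?thesis by (simp add: f_def)
    qed
    have "i \<le> n \<Longrightarrow> hdist (\<sigma> 0) (\<sigma> (real i / real n)) \<le> real i * (\<rho> / 2)" for i
    proof (induction i)
      case 0
      then show ?case using s(2)[of 0] D_uhp by simp
    next
      case (Suc i)
      have i: "real i / real n \<in> {0..1}" "real (Suc i) / real n \<in> {0..1}" using Suc.prems by auto
      have "hdist (\<sigma> 0) (\<sigma> (real (Suc i) / real n)) \<le> hdist (\<sigma> 0) (\<sigma> (real i / real n)) + hdist (\<sigma> (real i / real n)) (\<sigma> (real (Suc i) / real n))"
        using s(2) i D_uhp by (intro hdist_triangle) auto
      also have "hdist (\<sigma> (real i / real n)) (\<sigma> (real (Suc i) / real n)) \<le> \<rho> / 2"
        by (rule step[OF i]) (auto simp: divide_right_mono add_divide_distrib)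
      finally show ?case using Suc by (simp add: algebra_simps add_divide_distrib)
    qed
    from this[of n] show ?thesis using n s by simp
  qed
  then show ?thesis using that by blast
qed


section \<open>Shortest loops in a free homotopy class\<close>

text \<open>Arzela-Ascoli: Tychonoff for a countable product gives convergence at rational times,
  and the common Lipschitz constant with completeness of \<open>d\<close> extends it to all
  times.\<close>

lemma Lipschitz_subsequence:
  assumes Q: "compact Q" "Q \<subseteq> surface_interior Sg" and cQ: "\<And>n t. t \<in> {0..1} \<Longrightarrow> c n t \<in> Q"
    and lip: "\<And>n s t. s \<in> {0..1} \<Longrightarrow> t \<in> {0..1} \<Longrightarrow> d (c n s) (c n t) \<le> B * \<bar>s - t\<bar>"
  obtains f :: "nat \<Rightarrow> nat" and x :: "real \<Rightarrow> 'a" where "strict_mono f" "\<And>t. t \<in> {0..1} \<Longrightarrow> x t \<in> surface_interior Sg"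
    "\<And>t. t \<in> {0..1} \<Longrightarrow> (\<lambda>n. d (c (f n) t) (x t)) \<longlonglongrightarrow> 0"
proof -
  \<comment> \<open>Rational times are clamped to the unit interval, so that all of
    \<open>rat\<close> can serve as index set.\<close>
  define r where "r q = max 0 (min 1 (real_of_rat q))" for q
  have r: "r q \<in> {0..1}" for q by (auto simp: r_def)
  define F where "F n q = c n (r q)" for n and q :: rat
  have "compactin (product_topology (\<lambda>_. euclidean) (UNIV :: rat set)) (PiE UNIV (\<lambda>_. Q))"
    by (simp add: compactin_PiE Q(1))
  then have "compact (PiE (UNIV :: rat set) (\<lambda>_. Q))" by (simp add: euclidean_product_topology)
  moreover have "\<forall>n. F n \<in> PiE (UNIV :: rat set) (\<lambda>_. Q)" using cQ r by (simp add: F_def PiE_def)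
  ultimately obtain l and f :: "nat \<Rightarrow> nat" where l: "l \<in> PiE (UNIV :: rat set) (\<lambda>_. Q)" "strict_mono f" "(F \<circ> f) \<longlonglongrightarrow> l"
    by (meson compact_imp_seq_compact seq_compactE)
  have cS: "c n t \<in> surface_interior Sg" if "t \<in> {0..1}" for n t using cQ[OF that] Q(2) by blast
  have lS: "l q \<in> surface_interior Sg" for q using l(1) Q(2) by (auto simp: PiE_def)
  have lq: "(\<lambda>n. d (c (f n) (r q)) (l q)) \<longlonglongrightarrow> 0" for q
  proof -
    have "isCont (\<lambda>h :: rat \<Rightarrow> 'a. h q) l"
      using continuous_on_interior[OF continuous_on_product_coordinates[of q], of l] by simp
    then have "(\<lambda>n. (F \<circ> f) n q) \<longlonglongrightarrow> l q" using isCont_tendsto_compose[OF _ l(3)] by blast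
    then show ?thesis using tendsto_iff_metric[OF lS[of q], of "\<lambda>n. F (f n) q"] cS r by (simp add: F_def)
  qed
  have B0: "B \<ge> 0"
  proof -
    have "d (c 0 0) (c 0 1) \<le> B" using lip[of 0 1 0] by simp
    then show ?thesis by (rule order_trans[OF nonneg])
  qed
  have "\<exists>y. y \<in> surface_interior Sg \<and> (\<lambda>n. d (c (f n) t) y) \<longlonglongrightarrow> 0" if t: "t \<in> {0..1}" for t
  proof -
    have "MCauchy (\<lambda>n. c (f n) t)"
      unfolding MCauchy_def
    proof (intro conjI allI impI)
      show "range (\<lambda>n. c (f n) t) \<subseteq> surface_interior Sg" using cS t by auto
      fix e :: real assume e: "e > 0"
      define \<eta> where "\<eta> = e / (4 * (B + 1))"
      have \<eta>: "\<eta> > 0" "B * \<eta> \<le> e / 4" using e B0 by (auto simp: \<eta>_def field_simps)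
      have "t - \<eta> < t + \<eta>" using \<eta> by simp
      then obtain q where q: "t - \<eta> < real_of_rat q" "real_of_rat q < t + \<eta>" using of_rat_dense by blast
      have rt: "\<bar>t - r q\<bar> \<le> \<eta>" using q t by (auto simp: r_def)
      obtain N where N: "\<And>n. n \<ge> N \<Longrightarrow> d (c (f n) (r q)) (l q) < e / 4"
        using order_tendstoD(2)[OF lq[of q], of "e / 4"] e by (auto simp: eventually_sequentially)
      have b: "d (c (f n) t) (l q) < e / 2" if "n \<ge> N" for n
      proof -
        have "d (c (f n) t) (c (f n) (r q)) \<le> B * \<bar>t - r q\<bar>" by (rule lip[OF t r])
        also have "\<dots> \<le> B * \<eta>" using rt B0 by (intro mult_left_mono)
        finally show ?thesis using triangle[OF cS[OF t, of "f n"] cS[OF r, of "f n" q] lS[of q]] N[OF that] \<eta>(2) by simp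
      qed
      have "d (c (f n) t) (c (f n') t) < e" if "N \<le> n" "N \<le> n'" for n n'
        using triangle[OF cS[OF t, of "f n"] lS[of q] cS[OF t, of "f n'"]] b[OF that(1)] b[OF that(2)] commute[of "l q" "c (f n') t"] by simp
      then show "\<exists>N. \<forall>n n'. N \<le> n \<longrightarrow> N \<le> n' \<longrightarrow> d (c (f n) t) (c (f n') t) < e" by blast
    qed
    then obtain y where "limitin mtopology (\<lambda>n. c (f n) t) y sequentially" using complete unfolding mcomplete_def by blast
    then show ?thesis by (auto simp: limitin_metric_dist_null)
  qed
  then obtain x where "\<And>t. t \<in> {0..1} \<Longrightarrow> x t \<in> surface_interior Sg \<and> (\<lambda>n. d (c (f n) t) (x t)) \<longlonglongrightarrow> 0" by metis
  then show ?thesis using that l(2) by blast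
qed

text \<open>Almost shortest loops stay in one compact set, and a pointwise limit inherits the
  Lipschitz bound. That the limit still belongs to \<open>g\<close> needs uniform closeness, which
  follows from closeness at finitely many times.\<close>

lemma reach_limit:
  assumes g: "g \<in> Deck" "free_of_boundary g" and reach: "\<And>n::nat. \<exists>z. reach z (g z) (R + 1 / Suc n)"
  shows "\<exists>z. reach z (g z) R"
proof -
  define R' where "R' n = R + 1 / Suc n" for n :: nat
  have "\<exists>\<sigma>. continuous_on {0..1} \<sigma> \<and> (\<forall>a\<in>{0..1}. \<sigma> a \<in> D) \<and> \<sigma> 1 = g (\<sigma> 0) \<and>
    (\<forall>a\<in>{0..1}. \<forall>b\<in>{0..1}. d (p (\<sigma> a)) (p (\<sigma> b)) \<le> R' n * \<bar>a - b\<bar>)" for n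
  proof -
    obtain z where z: "reach z (g z) (R' n)" using reach[of n] unfolding R'_def by blast
    obtain \<sigma> where "continuous_on {0..1} \<sigma>" "\<And>a. a \<in> {0..1} \<Longrightarrow> \<sigma> a \<in> D" "\<sigma> 0 = z" "\<sigma> 1 = g z"
      "\<And>a b. a \<in> {0..1} \<Longrightarrow> b \<in> {0..1} \<Longrightarrow> d (p (\<sigma> a)) (p (\<sigma> b)) \<le> R' n * \<bar>a - b\<bar>" using reachE[OF z] by blast
    then show ?thesis by (intro exI[of _ \<sigma>]) simp
  qed
  then obtain \<sigma> where s: "\<And>n. continuous_on {0..1} (\<sigma> n)" "\<And>n a. a \<in> {0..1} \<Longrightarrow> \<sigma> n a \<in> D" "\<And>n. \<sigma> n 1 = g (\<sigma> n 0)"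
    "\<And>n a b. a \<in> {0..1} \<Longrightarrow> b \<in> {0..1} \<Longrightarrow> d (p (\<sigma> n a)) (p (\<sigma> n b)) \<le> R' n * \<bar>a - b\<bar>" by metis
  have R'1: "R' n \<le> R + 1" "R \<le> R' n" for n by (simp_all add: R'_def)
  have lip: "d (p (\<sigma> n a)) (p (\<sigma> n b)) \<le> (R + 1) * \<bar>a - b\<bar>" if "a \<in> {0..1}" "b \<in> {0..1}" for n a b
    using s(4)[OF that, of n] mult_right_mono[OF R'1(1)[of n] abs_ge_zero[of "a - b"]] by simp
  obtain Q where Q: "compact Q" "Q \<subseteq> surface_interior Sg"
    "\<And>g \<sigma> t. g \<in> Deck \<Longrightarrow> free_of_boundary g \<Longrightarrow> continuous_on {0..1} \<sigma> \<Longrightarrow> (\<And>a. a \<in> {0..1} \<Longrightarrow> \<sigma> a \<in> D) \<Longrightarrow> \<sigma> 1 = g (\<sigma> 0) \<Longrightarrow>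
      (\<And>a b. a \<in> {0..1} \<Longrightarrow> b \<in> {0..1} \<Longrightarrow> d (p (\<sigma> a)) (p (\<sigma> b)) \<le> (R + 1) * \<bar>a - b\<bar>) \<Longrightarrow> t \<in> {0..1::real} \<Longrightarrow> p (\<sigma> t) \<in> Q"
    using reach_compact[of "R + 1"] by blast
  define c where "c n t = p (\<sigma> n t)" for n t
  have cQ: "c n t \<in> Q" if "t \<in> {0..1}" for n t unfolding c_def using Q(3)[OF g s(1) s(2) s(3) lip that] .
  have cS: "c n t \<in> surface_interior Sg" if "t \<in> {0..1}" for n t using cQ[OF that] Q(2) by blast
  obtain f :: "nat \<Rightarrow> nat" and x where f: "strict_mono f" and xS: "\<And>t. t \<in> {0..1} \<Longrightarrow> x t \<in> surface_interior Sg"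
    and lim: "\<And>t. t \<in> {0..1} \<Longrightarrow> (\<lambda>n. d (c (f n) t) (x t)) \<longlonglongrightarrow> 0"
    using Lipschitz_subsequence[of Q c "R + 1", OF Q(1,2) cQ] lip unfolding c_def by blast
  have xL: "d (x s) (x t) \<le> R * \<bar>s - t\<bar>" if st: "s \<in> {0..1}" "t \<in> {0..1}" for s t
  proof (rule LIMSEQ_le_const)
    have "(\<lambda>n. 1 / real (Suc n)) \<longlonglongrightarrow> 0" by (rule LIMSEQ_Suc[OF lim_1_over_n])
    then have "(\<lambda>n. R' (f n)) \<longlonglongrightarrow> R + 0" unfolding R'_def
      using LIMSEQ_subseq_LIMSEQ[OF _ f] by (intro tendsto_add tendsto_const) (fastforce simp: o_def)
    then have "(\<lambda>n. d (c (f n) s) (x s) + R' (f n) * \<bar>s - t\<bar> + d (c (f n) t) (x t)) \<longlonglongrightarrow> 0 + (R + 0) * \<bar>s - t\<bar> + 0"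
      using lim st by (intro tendsto_add tendsto_mult tendsto_const) auto
    then show "(\<lambda>n. d (c (f n) s) (x s) + R' (f n) * \<bar>s - t\<bar> + d (c (f n) t) (x t)) \<longlonglongrightarrow> R * \<bar>s - t\<bar>" by simp
    have "d (x s) (x t) \<le> d (c (f n) s) (x s) + R' (f n) * \<bar>s - t\<bar> + d (c (f n) t) (x t)" for n
      using triangle[OF xS[OF st(1)] cS[OF st(1), of "f n"] xS[OF st(2)]] triangle[OF cS[OF st(1), of "f n"] cS[OF st(2), of "f n"] xS[OF st(2)]]
        s(4)[OF st, of "f n"] commute[of "x s" "c (f n) s"] by (simp add: c_def)
    then show "\<exists>N. \<forall>n\<ge>N. d (x s) (x t) \<le> d (c (f n) s) (x s) + R' (f n) * \<bar>s - t\<bar> + d (c (f n) t) (x t)" by blast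
  qed
  have "d (x 0) (x 1) \<le> R" using xL[of 0 1] by simp
  then have R0: "R \<ge> 0" by (rule order_trans[OF nonneg])
  have x01: "x 1 = x 0"
  proof -
    have "c (f n) 1 = c (f n) 0" for n using s(3)[of "f n"] deck_p[OF g(1) D_C[OF s(2)[of 0 "f n"]]] by (simp add: c_def)
    then have "(\<lambda>n. d (c (f n) 0) (x 0) + d (c (f n) 0) (x 1)) \<longlonglongrightarrow> 0 + 0" using lim[of 0] lim[of 1] by (intro tendsto_add) auto
    moreover have "d (x 0) (x 1) \<le> d (c (f n) 0) (x 0) + d (c (f n) 0) (x 1)" for n
      using triangle[of "x 0" "c (f n) 0" "x 1"] xS[of 0] xS[of 1] cS[of 0 "f n"] commute[of "x 0" "c (f n) 0"] by simp
    ultimately have "d (x 0) (x 1) \<le> 0 + 0" by (intro LIMSEQ_le_const) blast+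
    then show ?thesis using zero[OF xS[of 0] xS[of 1]] order_antisym[OF _ nonneg[of "x 0" "x 1"]] by simp
  qed
  have "\<rho> / 3 > 0" using \<rho>(1) by simp
  then obtain \<eta> where \<eta>: "\<eta> > 0" "\<And>x y. x \<in> Q \<Longrightarrow> y \<in> surface_interior Sg \<Longrightarrow> d x y < \<eta> \<Longrightarrow> dist x y < \<rho> / 3"
    using uniform_equivalence(1)[OF Q(1,2)] by metis
  \<comment> \<open>Within \<open>1 / N\<close> of a time \<open>i / N\<close> both loops together
    move by at most \<open>(2 * R + 1) / N\<close>, which is then below
    \<open>\<eta> / 2\<close>.\<close>
  obtain N where N: "real N > 2 * (2 * R + 1) / \<eta>" using reals_Archimedean2 by blast
  have "2 * (2 * R + 1) / \<eta> > 0" using R0 \<eta>(1) by simp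
  then have N0: "real N > 0" using N by linarith
  have "2 * (2 * R + 1) < real N * \<eta>" using N \<eta>(1) by (simp only: pos_divide_less_eq)
  then have N1: "(2 * R + 1) / real N < \<eta> / 2" using N0 by (simp add: pos_divide_less_eq mult.commute)
  have "\<forall>\<^sub>F n in sequentially. \<forall>i\<in>{..N}. d (c (f n) (real i / real N)) (x (real i / real N)) < \<eta> / 2"
  proof (subst eventually_ball_finite_distrib, simp, intro ballI)
    fix i assume "i \<in> {..N}"
    then have "real i / real N \<in> {0..1}" using N0 by simp
    then show "\<forall>\<^sub>F n in sequentially. d (c (f n) (real i / real N)) (x (real i / real N)) < \<eta> / 2"
      using order_tendstoD(2)[OF lim, of "real i / real N" "\<eta> / 2"] \<eta>(1) by simp
  qed
  then obtain n where n: "\<And>i. i \<le> N \<Longrightarrow> d (c (f n) (real i / real N)) (x (real i / real N)) < \<eta> / 2"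
    by (auto simp: eventually_sequentially)
  have close: "dist (c (f n) t) (x t) \<le> \<rho> / 3" if t: "t \<in> {0..1}" for t
  proof -
    define i where "i = nat \<lfloor>t * N\<rfloor>"
    have "t * real N \<le> 1 * real N" using t by (intro mult_right_mono) auto
    then have i: "real i \<le> t * N" "t * N < real i + 1" "i \<le> N" using t by (auto simp: i_def) linarith+
    define u where "u = real i / real N"
    have "t - u = (t * real N - real i) / real N" using N0 by (simp add: u_def field_simps)
    then have "\<bar>t - u\<bar> = (t * real N - real i) / real N" using i N0 by simp
    also have "\<dots> \<le> 1 / real N" using i by (intro divide_right_mono) auto
    finally have u: "u \<in> {0..1}" "\<bar>t - u\<bar> \<le> 1 / real N" using i N0 by (auto simp: u_def)
    have "d (c (f n) t) (x t) \<le> d (c (f n) t) (c (f n) u) + (d (c (f n) u) (x u) + d (x u) (x t))"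
      using triangle[OF cS[OF t, of "f n"] cS[OF u(1), of "f n"] xS[OF t]] triangle[OF cS[OF u(1), of "f n"] xS[OF u(1)] xS[OF t]] by simp
    also have "d (c (f n) t) (c (f n) u) \<le> (R + 1) * \<bar>t - u\<bar>" unfolding c_def by (rule lip[OF t u(1)])
    also have "\<dots> \<le> (R + 1) * (1 / real N)" using u(2) R0 by (intro mult_left_mono) auto
    also have "d (x u) (x t) \<le> R * \<bar>t - u\<bar>" using xL[OF u(1) t] by (simp add: abs_minus_commute)
    also have "\<dots> \<le> R * (1 / real N)" using u(2) R0 by (intro mult_left_mono) auto
    also have "d (c (f n) u) (x u) < \<eta> / 2" unfolding u_def by (rule n[OF i(3)])
    finally have "d (c (f n) t) (x t) < \<eta> / 2 + (2 * R + 1) / real N" by (simp add: algebra_simps add_divide_distrib)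
    then show ?thesis using \<eta>(2)[OF cQ[OF t] xS[OF t], of "f n"] N1 by simp
  qed
  have cx: "continuous_on {0..1} x" by (rule Lipschitz_continuous_on[OF xS xL])
  have xSg: "x t \<in> Sg" if "t \<in> {0..1}" for t using xS[OF that] by (simp add: surface_interior_def)
  define m where "m = f n"
  have sm: "\<sigma> m t \<in> C" if "t \<in> {0..1}" for t using s(2)[OF that] D_C by blast
  have "dist (p (\<sigma> m 0)) (x 0) < \<rho>" using close[of 0] \<rho>(1) by (simp add: c_def m_def)
  \<comment> \<open>The limit loop is lifted next to \<open>\<sigma> m\<close>; the lifts stay
    within \<open>\<rho> / 3\<close> of each other, which identifies the end of the new lift as
    \<open>g v\<close>.\<close>
  then obtain v where v: "v \<in> C" "p v = x 0" "hdist (\<sigma> m 0) v = dist (p (\<sigma> m 0)) (x 0)"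
    using near_lift[OF sm[of 0] xSg[of 0]] by auto
  have hv: "hdist (\<sigma> m 0) v \<le> \<rho> / 3" using v(3) close[of 0] by (simp add: c_def m_def)
  have px: "path x" "path_image x \<subseteq> Sg" using cx xSg by (auto simp: path_def path_image_def)
  obtain h where h: "path h" "path_image h \<subseteq> C" "h 0 = v" "\<And>t. t \<in> {0..1} \<Longrightarrow> p (h t) = x t"
    using metric_covering_lift_path[OF cov v(1) px v(2)[symmetric]] by blast
  have hC: "h t \<in> C" if "t \<in> {0..1}" for t using h(2) that by (auto simp: path_image_def)
  have "hdist (\<sigma> m 1) (h 1) \<le> \<rho> / 3"
  proof (rule close_lifts[of "\<sigma> m" h])
    show "dist (p (\<sigma> m t)) (p (h t)) \<le> \<rho> / 3" if "t \<in> {0..1}" for t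
      using close[OF that] h(4)[OF that] by (simp add: c_def m_def)
  qed (use s(1) sm h(1,3) hC hv \<rho>(1) in \<open>auto simp: path_def\<close>)
  moreover have "hdist (\<sigma> m 1) (g v) \<le> \<rho> / 3" using deck_isometry[OF g(1) sm[of 0] v(1)] hv s(3)[of m] by simp
  moreover have "hdist (h 1) (g v) \<le> hdist (\<sigma> m 1) (h 1) + hdist (\<sigma> m 1) (g v)"
    using hdist_triangle[of "h 1" "\<sigma> m 1" "g v"] hdist_commute[of "h 1" "\<sigma> m 1"] hC[of 1] sm[of 1] deck_C[OF g(1) v(1)] C_uhpD by simp
  ultimately have "hdist (h 1) (g v) < \<rho>" using \<rho>(1) by simp
  then have h1: "h 1 = g v" using fibre_separated[OF hC[of 1] deck_C[OF g(1) v(1)]] h(4)[of 1] deck_p[OF g(1) v(1)] v(2) x01 by simp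
  have "h t \<in> D" if "t \<in> {0..1}" for t using hC[OF that] xS[OF that] h(4)[OF that] by (simp add: D_iff)
  then have "reach v (g v) R"
    unfolding reach_def using h h1 xL by (intro exI[of _ h]) (auto simp: path_def)
  then show ?thesis by blast
qed

text \<open>A competitor of finite length exists because the segment from a point \<open>z\<close>
  to \<open>g z\<close> enters the interior, by \<open>compact_core\<close>, and points of
  \<open>D\<close> are joined by Lipschitz paths.\<close>

lemma shortest_loop:
  assumes g: "g \<in> Deck" "free_of_boundary g"
  obtains z R where "reach z (g z) R" "\<And>u A. reach u (g u) A \<Longrightarrow> R \<le> A"
proof -
  have "\<exists>u A. reach u (g u) A"
  proof -
    obtain z where z: "z \<in> C" using pC Sg_nonempty by auto
    have gz: "g z \<in> C" using deck_C[OF g(1) z] .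
    obtain K where K: "compact K" "K \<subseteq> surface_interior Sg"
      "\<And>g \<sigma>. g \<in> Deck \<Longrightarrow> free_of_boundary g \<Longrightarrow> continuous_on {0..1} \<sigma> \<Longrightarrow> \<sigma> \<in> {0..1::real} \<rightarrow> C \<Longrightarrow> \<sigma> 1 = g (\<sigma> 0) \<Longrightarrow>
      \<exists>t\<in>{0..1}. p (\<sigma> t) \<in> K" using compact_core by blast
    have "\<exists>t\<in>{0..1}. p (hmix t z (g z)) \<in> K"
    proof (rule K(3)[OF g])
      show "continuous_on {0..1} (\<lambda>t. hmix t z (g z))" using z gz C_uhpD by (intro continuous_intros) auto
      show "(\<lambda>t. hmix t z (g z)) \<in> {0..1} \<rightarrow> C" using hyp_convex_hmix[OF conv z gz] by blast
      show "hmix 1 z (g z) = g (hmix 0 z (g z))" using z gz C_uhpD by (simp add: hmix_0 hmix_1)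
    qed
    then obtain t where t: "t \<in> {0..1}" "p (hmix t z (g z)) \<in> K" by blast
    have "hmix t z (g z) \<in> D" using hyp_convex_hmix[OF conv z gz t(1)] t(2) K(2) by (auto simp: D_iff)
    then show ?thesis using reach_exists deck_D[OF g(1)] by blast
  qed
  then have ne: "{A. \<exists>u. reach u (g u) A} \<noteq> {}" by blast
  define R where "R = Inf {A. \<exists>u. reach u (g u) A}"
  have bdd: "bdd_below {A. \<exists>u. reach u (g u) A}" by (rule bdd_belowI[of _ 0]) (use reach_nonneg in blast)
  have "R \<le> A" if "reach u (g u) A" for u A unfolding R_def using that bdd by (intro cInf_lower) auto
  moreover have "\<exists>z. reach z (g z) (R + 1 / Suc n)" for n :: nat
  proof -
    have "Inf {A. \<exists>u. reach u (g u) A} < R + 1 / Suc n" by (simp add: R_def)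
    then obtain A where "A \<in> {A. \<exists>u. reach u (g u) A}" "A < R + 1 / Suc n" using cInf_lessD[OF ne] by blast
    then show ?thesis using reach_mono by (blast intro: less_imp_le)
  qed
  ultimately show ?thesis using that reach_limit[OF g] by blast
qed

text \<open>The equivariant extension of a shortest loop is locally length minimising, since a shortcut
  could be repeated equivariantly.\<close>

lemma interior_geodesic_exists:
  assumes g: "g \<in> Deck" "free_of_boundary g" and free: "\<And>z. z \<in> C \<Longrightarrow> g z \<noteq> z"
  obtains c l where "closed_geodesic (surface_interior Sg) d c l" "represents (\<lambda>t. c (l * t)) g"
proof -
  obtain z R where z: "reach z (g z) R" and min: "\<And>u A. reach u (g u) A \<Longrightarrow> R \<le> A"
    using shortest_loop[OF g] by blast
  obtain \<sigma> where s: "continuous_on {0..1} \<sigma>" "\<And>a. a \<in> {0..1} \<Longrightarrow> \<sigma> a \<in> D" "\<sigma> 0 = z" "\<sigma> 1 = g z"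
    "\<And>a b. a \<in> {0..1} \<Longrightarrow> b \<in> {0..1} \<Longrightarrow> d (p (\<sigma> a)) (p (\<sigma> b)) \<le> R * \<bar>a - b\<bar>" using reachE[OF z] by blast
  have zD: "z \<in> D" using reach_D[OF z] by blast
  have R: "R > 0"
  proof -
    have "R \<noteq> 0" using reach_0 z free[OF D_C[OF zD]] by metis
    then show ?thesis using reach_nonneg[OF z] by simp
  qed
  obtain G :: "int \<Rightarrow> complex \<Rightarrow> complex" where G: "\<And>n. G n \<in> Deck" "\<And>z. z \<in> C \<Longrightarrow> G 0 z = z"
    "\<And>n z. z \<in> C \<Longrightarrow> G (n + 1) z = g (G n z)" "\<And>n z. z \<in> C \<Longrightarrow> G n (g z) = g (G n z)"
    using deck_powers[OF g(1)] by blast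
  define k where "k t = G \<lfloor>t\<rfloor> (\<sigma> (frac t))" for t
  have fr: "frac t \<in> {0..1}" for t :: real using frac_ge_0[of t] frac_lt_1[of t] by simp
  have kD: "k t \<in> D" for t unfolding k_def using deck_D[OF G(1) s(2)[OF fr]] .
  have k1: "k (t + 1) = g (k t)" for t
  proof -
    have "frac (t + 1) = frac t" by (simp add: frac_def)
    then show ?thesis using G(3)[OF D_C[OF s(2)[OF fr]]] by (simp add: k_def)
  qed
  have piece: "reach (\<sigma> a) (\<sigma> b) (R * (b - a))" if "0 \<le> a" "a \<le> b" "b \<le> 1" for a b
    by (rule reach_restrict[OF continuous_on_subset[OF s(1)]]) (use that s(2,5) in auto)
  have kr: "reach (k x) (k y) (R * (y - x))" if xy: "x \<le> y" "y \<le> x + 1" for x y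
  proof -
    have "\<lfloor>x\<rfloor> \<le> \<lfloor>y\<rfloor>" "\<lfloor>y\<rfloor> \<le> \<lfloor>x\<rfloor> + 1" using xy by linarith+
    then consider "\<lfloor>y\<rfloor> = \<lfloor>x\<rfloor>" | "\<lfloor>y\<rfloor> = \<lfloor>x\<rfloor> + 1" by linarith
    then show ?thesis
    proof cases
      case 1
      have "reach (G \<lfloor>x\<rfloor> (\<sigma> (frac x))) (G \<lfloor>x\<rfloor> (\<sigma> (frac y))) (R * (frac y - frac x))"
        using fr[of x] fr[of y] xy 1 by (intro reach_deck[OF _ G(1)] piece) (auto simp: frac_def)
      then show ?thesis by (simp add: k_def 1 frac_def)
    next
      case 2
      have "reach (G \<lfloor>x\<rfloor> (\<sigma> (frac x))) (G \<lfloor>x\<rfloor> (\<sigma> 1)) (R * (1 - frac x))"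
        using fr[of x] by (intro reach_deck[OF _ G(1)] piece) auto
      moreover have "reach (G \<lfloor>y\<rfloor> (\<sigma> 0)) (G \<lfloor>y\<rfloor> (\<sigma> (frac y))) (R * (frac y - 0))"
        using fr[of y] by (intro reach_deck[OF _ G(1)] piece) auto
      moreover have "G \<lfloor>x\<rfloor> (\<sigma> 1) = G \<lfloor>y\<rfloor> (\<sigma> 0)" using G(3,4) D_C[OF zD] s(3,4) by (simp add: 2)
      ultimately have "reach (k x) (k y) (R * (1 - frac x) + R * (frac y - 0))" unfolding k_def using reach_trans by metis
      then show ?thesis by (simp add: frac_def 2 algebra_simps)
    qed
  qed
  have le: "d (p (k x)) (p (k y)) \<le> R * (y - x)" if "x \<le> y" "y \<le> x + 1" for x y using reach_dist[OF kr[OF that]] .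
  have loc: "\<exists>e>0. \<forall>x\<in>{t-e<..<t+e}. \<forall>y\<in>{t-e<..<t+e}. d (p (k x)) (p (k y)) = R * \<bar>x - y\<bar>" for t
  proof -
    obtain r where r: "r > 0" "\<forall>u\<in>D. \<forall>w\<in>D. hdist (k t) u < r \<longrightarrow> hdist (k t) w < r \<longrightarrow> reach u w (d (p u) (p w))"
      using reach_local[OF kD] by blast
    obtain a where a: "a > 0" "\<And>u A. reach (k t) u A \<Longrightarrow> A < a \<Longrightarrow> hdist (k t) u < r" using reach_hdist[OF kD r(1)] by blast
    \<comment> \<open>\<open>1 / 2\<close> keeps two parameters within one period, and
      \<open>a / R\<close> keeps the points where \<open>reach_local\<close> applies.\<close>
    define e where "e = min (1 / 2) (a / R)"
    have e: "e > 0" "e \<le> 1 / 2" "R * e \<le> a" using R a(1) by (auto simp: e_def min_def field_simps)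
    have near: "hdist (k t) (k x) < r" if "x \<in> {t-e<..<t+e}" for x
    proof -
      have "reach (k t) (k x) (R * \<bar>x - t\<bar>)"
      proof (cases "t \<le> x")
        case True
        then show ?thesis using kr[of t x] that e by simp
      next
        case False
        then show ?thesis using reach_sym[OF kr[of x t]] that e by (simp add: abs_minus_commute)
      qed
      moreover have "R * \<bar>x - t\<bar> < R * e" using that R by (intro mult_strict_left_mono) auto
      ultimately show ?thesis using a(2) e(3) by force
    qed
    \<comment> \<open>A shortest connection from \<open>k x\<close> to \<open>k y\<close>, followed
      by the rest of the period, is a competitor for the shortest loop.\<close>
    have eq: "d (p (k x)) (p (k y)) = R * (y - x)" if xy: "x \<in> {t-e<..<t+e}" "y \<in> {t-e<..<t+e}" "x \<le> y" for x y
    proof -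
      have "reach (k x) (k y) (d (p (k x)) (p (k y)))" using r(2) kD near xy by blast
      moreover have "reach (k y) (k (x + 1)) (R * (x + 1 - y))" by (rule kr) (use xy e in auto)
      ultimately have "reach (k x) (g (k x)) (d (p (k x)) (p (k y)) + R * (x + 1 - y))" unfolding k1 by (rule reach_trans)
      then have "R \<le> d (p (k x)) (p (k y)) + R * (x + 1 - y)" by (rule min)
      moreover have "d (p (k x)) (p (k y)) \<le> R * (y - x)" by (rule le) (use xy e in auto)
      ultimately show ?thesis by (simp add: algebra_simps)
    qed
    have "d (p (k x)) (p (k y)) = R * \<bar>x - y\<bar>" if "x \<in> {t-e<..<t+e}" "y \<in> {t-e<..<t+e}" for x y
      using eq[of x y] eq[of y x] that commute[of "p (k x)" "p (k y)"] by (cases "x \<le> y") (auto simp: abs_minus_commute)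
    then show ?thesis using e(1) by blast
  qed
  have "closed_geodesic (surface_interior Sg) d (\<lambda>t. p (k (t / R))) R"
    unfolding closed_geodesic_def
  proof (intro conjI allI R)
    fix t
    show "p (k (t / R)) \<in> surface_interior Sg" using D_S[OF kD] .
    show "p (k ((t + R) / R)) = p (k (t / R))"
      using R k1[of "t / R"] deck_p[OF g(1) D_C[OF kD]] by (simp add: add_divide_distrib)
    obtain e where e: "e > 0" "\<And>x y. x\<in>{t/R-e<..<t/R+e} \<Longrightarrow> y\<in>{t/R-e<..<t/R+e} \<Longrightarrow> d (p (k x)) (p (k y)) = R * \<bar>x - y\<bar>"
      using loc[of "t / R"] by blast
    show "\<exists>e>0. \<forall>s\<in>{t-e<..<t+e}. \<forall>s'\<in>{t-e<..<t+e}. d (p (k (s / R))) (p (k (s' / R))) = \<bar>s - s'\<bar>"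
    proof (intro exI[of _ "R * e"] conjI ballI)
      fix x y assume xy: "x \<in> {t - R*e<..<t + R*e}" "y \<in> {t - R*e<..<t + R*e}"
      have "t / R - e = (t - R * e) / R" "t / R + e = (t + R * e) / R" using R by (simp_all add: field_simps)
      then have "x / R \<in> {t/R-e<..<t/R+e}" "y / R \<in> {t/R-e<..<t/R+e}" using xy R by (auto simp: divide_strict_right_mono)
      then have "d (p (k (x / R))) (p (k (y / R))) = R * \<bar>x / R - y / R\<bar>" by (rule e(2))
      also have "\<dots> = \<bar>x - y\<bar>" using R by (simp flip: diff_divide_distrib)
      finally show "d (p (k (x / R))) (p (k (y / R))) = \<bar>x - y\<bar>" .
    qed (use R e(1) in simp)
  qed
  moreover have "represents (\<lambda>t. p (k (R * t / R))) g"
    unfolding represents_def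
  proof (intro exI[of _ \<sigma>] conjI ballI)
    fix t :: real assume t: "t \<in> {0..1}"
    show "p (\<sigma> t) = p (k (R * t / R))"
    proof (cases "t = 1")
      case True
      have "k 1 = g (k 0)" using k1[of 0] by simp
      moreover have "k 0 = z" using G(2)[OF D_C[OF zD]] by (simp add: k_def s(3))
      ultimately show ?thesis using R True s(4) by simp
    next
      case False
      then have "\<lfloor>t\<rfloor> = 0" using t by (simp add: floor_eq_iff)
      then show ?thesis using R G(2)[OF D_C[OF s(2)[OF t]]] by (simp add: k_def frac_def)
    qed
  qed (use s D_C in auto)
  ultimately show ?thesis using that by blast
qed

section \<open>Lengths and currents of free homotopy classes\<close>

lemma closed_geodesic_reach:
  assumes "closed_geodesic (surface_interior Sg) d c l" "represents (\<lambda>t. c (l * t)) g"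
  shows "\<exists>z. reach z (g z) l"
proof -
  obtain \<sigma> where s: "continuous_on {0..1} \<sigma>" "\<sigma> \<in> {0..1} \<rightarrow> C" "\<And>t. t \<in> {0..1} \<Longrightarrow> p (\<sigma> t) = c (l * t)" "\<sigma> 1 = g (\<sigma> 0)"
    using assms(2) unfolding represents_def by blast
  have c: "l > 0" "\<And>t. c t \<in> surface_interior Sg"
    "\<And>t. \<exists>e>0. \<forall>s\<in>{t-e<..<t+e}. \<forall>s'\<in>{t-e<..<t+e}. d (c s) (c s') = \<bar>s - s'\<bar>"
    using assms(1) unfolding closed_geodesic_def by blast+
  have L: "d (c x) (c y) \<le> 1 * (y - x)" if "x \<le> y" for x y
  proof (rule locally_Lipschitz_imp_Lipschitz[of x y d c 1, OF _ _ that])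
    show "d (c u) (c w) \<le> d (c u) (c v) + d (c v) (c w)" for u v w using triangle c(2) by blast
    fix t
    obtain e where e: "e > 0" "\<forall>s\<in>{t-e<..<t+e}. \<forall>s'\<in>{t-e<..<t+e}. d (c s) (c s') = \<bar>s - s'\<bar>" using c(3) by blast
    then show "\<exists>e>0. \<forall>s\<in>{t-e<..<t+e}. \<forall>s'\<in>{t-e<..<t+e}. s \<le> s' \<longrightarrow> d (c s) (c s') \<le> 1 * (s' - s)"
      by (intro exI[of _ e]) auto
  qed
  have "d (p (\<sigma> a)) (p (\<sigma> b)) \<le> l * \<bar>a - b\<bar>" if ab: "a \<in> {0..1}" "b \<in> {0..1}" for a b
  proof -
    have "d (c (l * a)) (c (l * b)) \<le> \<bar>l * a - l * b\<bar>"
      using L[of "l * a" "l * b"] L[of "l * b" "l * a"] commute[of "c (l * a)" "c (l * b)"]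
      by (cases "l * a \<le> l * b") auto
    then show ?thesis using s(3) ab c(1) by (simp add: abs_mult flip: right_diff_distrib)
  qed
  moreover have "\<sigma> t \<in> D" if "t \<in> {0..1}" for t using s(2,3) c(2) that by (auto simp: D_iff)
  ultimately have "reach (\<sigma> 0) (g (\<sigma> 0)) l" unfolding reach_def using s by (intro exI[of _ \<sigma>]) auto
  then show ?thesis by blast
qed

text \<open>Existence of a closed geodesic in the class gives the choice in
  \<open>geodesic_length\<close> its meaning. Whichever geodesic realises the chosen length, its
  lift runs from some \<open>z\<close> to \<open>g z\<close> with that Lipschitz constant.\<close>

lemma geodesic_length_reach:
  assumes g: "g \<in> Deck" "free_of_boundary g" and free: "\<And>z. z \<in> C \<Longrightarrow> g z \<noteq> z" and \<gamma>: "represents \<gamma> g"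
  shows "\<exists>z. reach z (g z) (geodesic_length Sg d \<gamma>)"
proof -
  obtain c l where c: "closed_geodesic (surface_interior Sg) d c l" "represents (\<lambda>t. c (l * t)) g"
    using interior_geodesic_exists[OF g free] by blast
  have "\<exists>l c. closed_geodesic_in_class Sg (surface_interior Sg) d \<gamma> c l"
    unfolding closed_geodesic_in_class_def using c represents_imp_homotopic[OF c(2) \<gamma> g(1)] by blast
  then obtain c' where c': "closed_geodesic_in_class Sg (surface_interior Sg) d \<gamma> c' (geodesic_length Sg d \<gamma>)"
    unfolding geodesic_length_def using someI_ex[of "\<lambda>l. \<exists>c. closed_geodesic_in_class Sg (surface_interior Sg) d \<gamma> c l"] by blast
  have cl: "closed_geodesic (surface_interior Sg) d c' (geodesic_length Sg d \<gamma>)"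
    "homotopic_loops Sg \<gamma> (\<lambda>t. c' (geodesic_length Sg d \<gamma> * t))"
    using c' homotopic_loops_sym unfolding closed_geodesic_in_class_def by blast+
  show "\<exists>z. reach z (g z) (geodesic_length Sg d \<gamma>)"
    using closed_geodesic_reach[OF cl(1) represents_homotopic[OF \<gamma> g(1) cl(2)]] .
qed

text \<open>A closed geodesic exists in the class, so the chosen current comes from one, and
  \<open>intersection_bound\<close> holds for each of them.\<close>

lemma curve_current_bound:
  assumes L: "geodesic_current C p L" and b: "b \<in> Deck" "\<beta>' \<in> Deck"
    and free: "\<And>x. x \<in> C \<Longrightarrow> b (\<beta>' x) \<noteq> x" and \<gamma>: "represents \<gamma> (\<lambda>x. b (\<beta>' x))"
    and zw: "z \<in> C" "w \<in> C" "sameline z (b z)" "sameline w (\<beta>' w)"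
  shows "intersection_form C p L (curve_current C p Sg \<gamma>) \<le> 2 * emeasure L (meeting z w)"
proof -
  note g = deck_comp[OF b]
  obtain c l where c: "closed_geodesic Sg dist c l" "represents (\<lambda>t. c (l * t)) (\<lambda>x. b (\<beta>' x))"
    using closed_geodesic_exists[OF g free] by blast
  have "\<exists>\<nu> c l. closed_geodesic_in_class Sg Sg dist \<gamma> c l \<and> \<nu> = closed_geodesic_current C p c l"
    unfolding closed_geodesic_in_class_def using c represents_imp_homotopic[OF c(2) \<gamma> g] by blast
  then obtain c' l' where c': "closed_geodesic_in_class Sg Sg dist \<gamma> c' l'"
    "curve_current C p Sg \<gamma> = closed_geodesic_current C p c' l'"
    unfolding curve_current_def
    using someI_ex[of "\<lambda>\<nu>. \<exists>c l. closed_geodesic_in_class Sg Sg dist \<gamma> c l \<and> \<nu> = closed_geodesic_current C p c l"] by blast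
  have cl: "closed_geodesic Sg dist c' l'" "homotopic_loops Sg \<gamma> (\<lambda>t. c' (l' * t))"
    using c'(1) homotopic_loops_sym unfolding closed_geodesic_in_class_def by blast+
  show ?thesis unfolding c'(2)
    using intersection_bound[OF L cl(1) represents_homotopic[OF \<gamma> g cl(2)] b zw] by simp
qed

end

theorem proposition2p2:
  fixes \<Sigma> :: "'a::metric_space set"
    and X :: "'a \<Rightarrow> 'a \<Rightarrow> real"
    and C :: "complex set"
    and p :: "complex \<Rightarrow> 'a"
  assumes "hyperbolic_surface \<Sigma>"
    and "compact \<Sigma>"
    and "surface_boundary \<Sigma> \<noteq> {}"
    and "universal_cover C p \<Sigma>"
    and "hyperbolic_structure (surface_interior \<Sigma>) X"
  shows "\<not> (\<exists>L. geodesic_current C p L \<and>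
           (\<forall>\<gamma>. essential_loop \<Sigma> \<gamma> \<longrightarrow>
              intersection_form C p L (curve_current C p \<Sigma> \<gamma>) = ennreal (geodesic_length \<Sigma> X \<gamma>)))"
proof
  interpret surface_cover \<Sigma> C p using assms by unfold_locales
  have "interior_structure \<Sigma> C p X"
    by (intro interior_structure.intro hyperbolic_metric.intro hyperbolic_metric_axioms.intro surface_cover_axioms)
       (use assms(5) in \<open>simp_all add: hyperbolic_structure_def\<close>)
  then interpret interior_structure \<Sigma> C p X .
  assume "\<exists>L. geodesic_current C p L \<and>
           (\<forall>\<gamma>. essential_loop \<Sigma> \<gamma> \<longrightarrow>
              intersection_form C p L (curve_current C p \<Sigma> \<gamma>) = ennreal (geodesic_length \<Sigma> X \<gamma>))"
  then obtain L where L: "geodesic_current C p L"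
    "\<And>\<gamma>. essential_loop \<Sigma> \<gamma> \<Longrightarrow> intersection_form C p L (curve_current C p \<Sigma> \<gamma>) = ennreal (geodesic_length \<Sigma> X \<gamma>)"
    by blast
  obtain z w \<beta>' and b :: "nat \<Rightarrow> complex \<Rightarrow> complex" where zw: "z \<in> C" "w \<in> C" "\<beta>' \<in> Deck" "\<And>n. b n \<in> Deck"
    "\<And>n. sameline z (b n z)" "sameline w (\<beta>' w)"
    and noline: "\<And>n N N'. n \<ge> 1 \<Longrightarrow> bline N N' \<Longrightarrow> \<exists>x\<in>C. \<not> (hV (N (b n (\<beta>' x))) = 0 \<longleftrightarrow> hV (N x) = 0)"
    and far: "\<And>R. \<exists>n0. \<forall>n\<ge>n0. \<forall>u\<in>C. hdist u (b n (\<beta>' u)) > R"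
    using figure_eight_family[OF assms(3)] by metis
  \<comment> \<open>The common bound for all intersection numbers; it is finite because
    \<open>meeting z w\<close> is compact.\<close>
  define m where "m = enn2real (2 * emeasure L (meeting z w))"
  have "emeasure L (meeting z w) < \<infinity>" using L(1) meeting_compact[OF zw(1,2)] unfolding geodesic_current_def by blast
  then have m: "ennreal m = 2 * emeasure L (meeting z w)" "m \<ge> 0"
    by (auto simp: m_def ennreal_mult_less_top)
  obtain B where B: "\<And>g z. g \<in> Deck \<Longrightarrow> free_of_boundary g \<Longrightarrow> reach z (g z) m \<Longrightarrow> hdist z (g z) \<le> B"
    using displacement_bound[of m] by blast
  \<comment> \<open>Displacement beyond \<open>B\<close> will contradict the length bound; the
    maximum with 0 also excludes fixed points.\<close>
  obtain n0 where n0: "\<And>n u. n \<ge> n0 \<Longrightarrow> u \<in> C \<Longrightarrow> hdist u (b n (\<beta>' u)) > max B 0" using far by metis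
  define n where "n = max 1 n0"
  define g where "g x = b n (\<beta>' x)" for x
  have g: "g \<in> Deck" unfolding g_def using deck_comp[OF zw(4,3)] .
  have disp: "hdist u (g u) > max B 0" if "u \<in> C" for u unfolding g_def by (rule n0) (use that in \<open>auto simp: n_def\<close>)
  have gf: "g u \<noteq> u" if "u \<in> C" for u using disp[OF that] C_uhpD[OF that] by auto
  have inv: "\<exists>x\<in>C. \<not> (hV (N (g x)) = 0 \<longleftrightarrow> hV (N x) = 0)" if "bline N N'" for N N'
    unfolding g_def by (rule noline[OF _ that]) (simp add: n_def)
  then have fb: "free_of_boundary g" unfolding free_of_boundary_def by blast
  obtain \<gamma> where \<gamma>: "represents \<gamma> g" "path \<gamma>" "path_image \<gamma> \<subseteq> \<Sigma>" "pathfinish \<gamma> = pathstart \<gamma>"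
    using represents_exists[OF g zw(1)] by blast
  have "essential_loop \<Sigma> \<gamma>" by (rule essential_if_no_invariant_line[OF g \<gamma> gf inv])
  then have "ennreal (geodesic_length \<Sigma> X \<gamma>) = intersection_form C p L (curve_current C p \<Sigma> \<gamma>)" using L(2) by simp
  also have "\<dots> \<le> ennreal m"
    unfolding m by (rule curve_current_bound[OF L(1) zw(4,3) _ _ zw(1,2,5,6)])
      (use gf \<gamma>(1) in \<open>simp_all add: g_def[abs_def]\<close>)
  finally have len: "geodesic_length \<Sigma> X \<gamma> \<le> m" using m(2) by simp
  obtain u where u: "reach u (g u) (geodesic_length \<Sigma> X \<gamma>)" using geodesic_length_reach[OF g fb gf \<gamma>(1)] by blast
  have "hdist u (g u) \<le> B" by (rule B[OF g fb reach_mono[OF u len]])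
  then show False using disp[OF D_C[OF reach_D(1)[OF u]]] by simp
qed

end
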